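(* Let $\bar\tau_0,\bar c,\eta$ be positive constants and let $$\mathcal D_\eta=\Big\{(\tau_0,u_0):\ (\tau_0-\bar\tau_0,u_0)\in\big(C^1(\mathbb R)\cap W^{1,1}(\mathbb R)\big)^2,\ \ \tfrac1{\bar c}\le\tau_0(x)\le\bar c,\ \ \int_{\mathbb R}\big(|\varpi_{-,0}'(x)|+|\varpi_{+,0}'(x)|\big)\,dx\le\eta\Big\},$$ where $\varpi_{\pm,0}=u_0\pm\frac{2}{\gamma-1}\tau_0^{-(\gamma-1)/2}$. Let $(\tau,u)$ and $(\hat\tau,\hat u)$ be two solutions of the compressible Euler equations (E) with initial data $(\tau_0,u_0)$ and $(\hat\tau_0,\hat u_0)$ in $\mathcal D_\eta$, let $t^*$ and $\hat t^*$ be the corresponding times at which their first singularities form, and set $t_d=\min\{t^*,\hat t^*\}$. If $\eta$ is sufficiently small, then there is a positive constant $\widehat C$ depending only on $\bar c$ and $t_d$ such that, for any time $t\le t_d$, the geodesic distances $d_*^{(i)}$ and $d_*^{(ii)}$ satisfy $$d_*^{(\iota)}\big((\tau,u)(t),(\hat\tau,\hat u)(t)\big)\le\widehat C\,d_*^{(\iota)}\big((\tau_0,u_0),(\hat\tau_0,\hat u_0)\big),\qquad \iota=i,ii.$$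
   Context: Fix $\gamma>1$, $c(\tau)=\tau^{-(\gamma+1)/2}$. (E): $\tau_t-u_x=0$, $u_t+\big(\tfrac1\gamma\tau^{-\gamma}\big)_x=0$, $\tau>0$, $x\in\mathbb R$, with initial data $(\tau_0,u_0)$ at $t=0$. $R=u_x+c(\tau)\tau_x$, $S=u_x-c(\tau)\tau_x$. First singularity time: first time one of $R,S$ blows up. Characteristic coordinates: with $\frac{d}{ds}x_\pm(s;x,t)=\pm c(\tau(x_\pm,s))$, $x_\pm(t;x,t)=x$, put $X=x_-(0;x,t)$, $Y=-x_+(0;x,t)$, $\alpha=2\arctan R$, $\beta=2\arctan S\in[-\pi,\pi)$, $p=\sqrt{1+R^2}/X_x$, $q=\sqrt{1+S^2}/(-Y_x)$. In these coordinates, with $c=c(\tau),c'=c'(\tau)$, (S): $\alpha_Y=\frac{c'}{2c^2}q\sin\frac\alpha2\sin\frac{\alpha-\beta}2$, $\beta_X=\frac{c'}{2c^2}p\sin\frac\beta2\sin\frac{\beta-\alpha}2$, $p_Y=\frac{c'}{4c^2}pq\cos\frac\alpha2\sin\frac{\beta-\alpha}2$, $q_X=\frac{c'}{4c^2}pq\cos\frac\beta2\sin\frac{\alpha-\beta}2$, $\tau_X=\frac1{2c}p\sin\frac\alpha2$, $\tau_Y=\frac1{2c}q\sin\frac\beta2$, $u_X=\frac12p\sin\frac\alpha2$, $u_Y=-\frac12q\sin\frac\beta2$, $t_X=\frac1{2c}p\cos\frac\alpha2$, $t_Y=\frac1{2c}q\cos\frac\beta2$, $x_X=\frac12p\cos\frac\alpha2$,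 $x_Y=-\frac12q\cos\frac\beta2$. If $(\tau,u,\alpha,\beta,p,q,x,t)(X,Y)$ solves (S) then so does its relabeling: $X=\phi(\widetilde X)$, $Y=\psi(\widetilde Y)$ with $\phi',\psi'>0$, $(\tau,u,\alpha,\beta,x,t)$ composed with $(\phi,\psi)$, $\tilde p=p\,\phi'$, $\tilde q=q\,\psi'$; relabelings represent the same $(\tau,u)(x,t)$. Generic singularities: a solution $(\tau,u)$ has only generic singularities for $t\in[0,t^*]$ if its graph is $\{(t,x,\tau,u)(X,Y)\}$ with smooth $(\tau,u,\alpha,\beta,p,q,x,t)(X,Y)$ solving (S) on the image $\Omega_{t^*}$ of $\mathbb R\times[0,t^*]$ and: $\alpha=-\pi,\alpha_X=0\Rightarrow\alpha_Y\ne0,\alpha_{XX}\ne0$; $\beta=-\pi,\beta_Y=0\Rightarrow\beta_X\ne0,\beta_{YY}\ne0$. Piecewise regular path: a path of solutions $\Upsilon^t:\vartheta\mapsto(\tau^\vartheta,u^\vartheta)$, $\vartheta\in[0,1]$, is piecewise regular for $t\in[0,T]$ if (i) for each $\vartheta$ the solution $(\tau^\vartheta,u^\vartheta)$ is smooth for $t\in[0,T)$; (ii) for all but finitely many $\vartheta$ it has only generic singularities, if they exist, on $t=T$. Length: represent the path by solutions $(\tau^\vartheta,u^\vartheta,\alpha^\vartheta,\beta^\vartheta,p^\vartheta,q^\vartheta,x^\vartheta,t^\vartheta)(X,Y)$ of (S), and let $(\Xi,\mathcal U,\mathcal A,\mathcal B,\mathcal P,\mathcal Q,\mathcal X,\mathcal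 T)$ be their $\vartheta$-derivatives at fixed $(X,Y)$. Put (superscripts $\vartheta$ omitted) $\widetilde{\mathcal J}_1^-=p(\mathcal X+c\mathcal T)$, $\widetilde{\mathcal J}_1^+=q(\mathcal X-c\mathcal T)$; $\widetilde{\mathcal J}_2^-=p\,\Xi$, $\widetilde{\mathcal J}_2^+=q\,\Xi$; $\widetilde{\mathcal J}_3^-=p\,\mathcal U$, $\widetilde{\mathcal J}_3^+=q\,\mathcal U$; $\widetilde{\mathcal J}_4^-=\mathcal P\sin\frac\alpha2+\frac12p\cos\frac\alpha2\,\mathcal A$, $\widetilde{\mathcal J}_4^+=\mathcal Q\sin\frac\beta2+\frac12q\cos\frac\beta2\,\mathcal B$; $\widetilde{\mathcal J}_5^-=\frac12p\mathcal A-\frac{c'}{2c}\mathcal Tp\sin^2\frac\alpha2$, $\widetilde{\mathcal J}_5^+=\frac12q\mathcal B-\frac{c'}{2c}\mathcal Tq\sin^2\frac\beta2$; $\widetilde{\mathcal J}_6^-=\mathcal P+\frac{c'}{4c}p\mathcal T\sin\alpha$, $\widetilde{\mathcal J}_6^+=\mathcal Q+\frac{c'}{4c}q\mathcal T\sin\beta$. Weights: $\mathcal W^-(x,t)=\eta+\int_{-\infty}^x\frac{S^2}{\sqrt{1+S^2}}(y,t)\,dy$, $\mathcal W^+(x,t)=\eta+\int_x^\infty\frac{R^2}{\sqrt{1+R^2}}(y,t)\,dy$, evaluated at $(x,t)=(x,t)^\vartheta(X,Y)$. With $\Gamma_t^\vartheta=\{(X,Y):t^\vartheta(X,Y)=t\}$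 and $N_i=4$, $N_{ii}=6$, $$\|\Upsilon^t\|^{(\iota)}=\inf\int_0^1\sum_{\ell=1}^{N_\iota}\int_{\Gamma_t^\vartheta}\Big(|\widetilde{\mathcal J}_\ell^{-,\vartheta}|\mathcal W^{-,\vartheta}\,dX+|\widetilde{\mathcal J}_\ell^{+,\vartheta}|\mathcal W^{+,\vartheta}\,dY\Big)d\vartheta,$$ the infimum being over all piecewise smooth relabelings of the $X$-$Y$ coordinates, and $dX,dY$ being taken as positive measures along $\Gamma_t^\vartheta$ (which is a graph over $X$ and over $Y$). Distance: let $\mathcal D$ be an open dense subset of $(C^3(\mathbb R)\cap W^{1,1}(\mathbb R))^2$ such that for data with $(\tau_0-\bar\tau_0,u_0)\in\mathcal D$ the solution is smooth on $[0,t^* )$ and has only generic singularities at $t=t^*$ (such a set exists), and $\mathcal D^\infty=C_0^\infty\cap\mathcal D$. For two solutions with initial data in $\mathcal D^\infty\cap\mathcal D_\eta$ (i.e. in $\mathcal D_\eta$ with $(\tau_0-\bar\tau_0,u_0)\in\mathcal D^\infty$) and $t\le t_d$, $d_*^{(\iota)}((\tau,u),(\hat\tau,\hat u))$ is the infimum of $\|\Upsilon^t\|^{(\iota)}$ over piecewise regular paths for $t\in[0,t_d]$ with $\Upsilon^t(0)=(\tau,u)$, $\Upsilon^t(1)=(\hat\tau,\hat u)$ and $\int_{\mathbb R}(|R^\vartheta|+|S^\vartheta|)\,dx\le\eta$ for all $\vartheta\in[0,1]$. ($\eta$ is small, ensuring positive upper and lower bounds for $\tau^\vartheta$.) For general data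 in $\mathcal D_\eta$, $d_*^{(\iota)}((\tau,u),(\hat\tau,\hat u))=\lim_{n\to\infty}d_*^{(\iota)}((\tau^{(n)},u^{(n)}),(\hat\tau^{(n)},\hat u^{(n)}))$ for arbitrary sequences of solutions with initial data in $\mathcal D^\infty\cap\mathcal D_\eta$ converging to the given initial data in $\|\cdot\|_{C^1}+\|\cdot\|_{W^{1,1}}$. *)

theory Defs
  imports "HOL-Analysis.Analysis"
begin

text \<open>\<^term>\<open>Ck_on k f A\<close>: \<open>f\<close> is \<open>k\<close> times continuously differentiable on \<open>A\<close>. It is used for open
  \<open>A\<close> and for strips \<open>\<real> \<times> [0,T)\<close>, where derivatives at the boundary are one-sided.\<close>

primrec Ck_on :: "nat \<Rightarrow> ('a::euclidean_space \<Rightarrow> real) \<Rightarrow> 'a set \<Rightarrow> bool" where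
  "Ck_on 0 f A \<longleftrightarrow> continuous_on A f"
| "Ck_on (Suc k) f A \<longleftrightarrow>
     (\<exists>g. (\<forall>z\<in>A. (f has_derivative (\<lambda>h. g z \<bullet> h)) (at z within A)) \<and>
          (\<forall>b\<in>Basis. Ck_on k (\<lambda>z. g z \<bullet> b) A))"

text \<open>\<open>C\<^sup>k(\<real>) \<inter> W\<^sup>1\<^sup>,\<^sup>1(\<real>)\<close> for \<open>k \<ge> 1\<close>, as a normed space: the derivatives up to order \<open>k\<close> are
  bounded. The weak derivative of a \<open>C\<^sup>1\<close> function is its classical derivative.\<close>

definition Ck_W11 :: "nat \<Rightarrow> (real \<Rightarrow> real) set" where
  "Ck_W11 k = {f. Ck_on k f UNIV \<and> (\<forall>j\<le>k. bounded (range ((deriv ^^ j) f))) \<and>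
                  integrable lborel f \<and> integrable lborel (deriv f)}"

definition Ck_W11_norm :: "nat \<Rightarrow> (real \<Rightarrow> real) \<Rightarrow> real" where
  "Ck_W11_norm k f = (\<Sum>j\<le>k. SUP x. \<bar>(deriv ^^ j) f x\<bar>)
     + (LINT x|lborel. \<bar>f x\<bar>) + (LINT x|lborel. \<bar>deriv f x\<bar>)"

type_synonym data = "(real \<Rightarrow> real) \<times> (real \<Rightarrow> real)"

definition data_dist :: "nat \<Rightarrow> data \<Rightarrow> data \<Rightarrow> real" where
  "data_dist k v w = Ck_W11_norm k (\<lambda>x. fst v x - fst w x) + Ck_W11_norm k (\<lambda>x. snd v x - snd w x)"

definition Cc_smooth :: "(real \<Rightarrow> real) set" where
  "Cc_smooth = {f. (\<forall>k. Ck_on k f UNIV) \<and> (\<exists>r. \<forall>x. r < \<bar>x\<bar> \<longrightarrow> f x = 0)}"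

definition wave_speed :: "real \<Rightarrow> real \<Rightarrow> real" where
  "wave_speed \<gamma> \<tau> = \<tau> powr (- (\<gamma> + 1) / 2)"

text \<open>Specific volume \<open>\<tau>\<close> and velocity \<open>u\<close>, as functions of \<open>(x, t)\<close>.\<close>

record flow =
  vol :: "real \<times> real \<Rightarrow> real"
  vel :: "real \<times> real \<Rightarrow> real"

definition initial :: "flow \<Rightarrow> data" where
  "initial s = ((\<lambda>x. vol s (x, 0)), (\<lambda>x. vel s (x, 0)))"

definition perturbation :: "real \<Rightarrow> data \<Rightarrow> data" where
  "perturbation \<tau>bar v = ((\<lambda>x. fst v x - \<tau>bar), snd v)"

definition R_var :: "real \<Rightarrow> flow \<Rightarrow> real \<Rightarrow> real \<Rightarrow> real" where
  "R_var \<gamma> s x t = deriv (\<lambda>y. vel s (y, t)) x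
     + wave_speed \<gamma> (vol s (x, t)) * deriv (\<lambda>y. vol s (y, t)) x"

definition S_var :: "real \<Rightarrow> flow \<Rightarrow> real \<Rightarrow> real \<Rightarrow> real" where
  "S_var \<gamma> s x t = deriv (\<lambda>y. vel s (y, t)) x
     - wave_speed \<gamma> (vol s (x, t)) * deriv (\<lambda>y. vol s (y, t)) x"

text \<open>A solution of class \<open>C\<^sup>k\<close> on \<open>\<real> \<times> [0,T)\<close> without singularity before time \<open>T\<close>.\<close>

definition euler_solution :: "real \<Rightarrow> real \<Rightarrow> nat \<Rightarrow> real \<Rightarrow> flow \<Rightarrow> bool" where
  "euler_solution \<gamma> \<tau>bar k T s \<longleftrightarrow>
     perturbation \<tau>bar (initial s) \<in> Ck_W11 k \<times> Ck_W11 k \<and>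
     Ck_on k (vol s) (UNIV \<times> {0..<T}) \<and> Ck_on k (vel s) (UNIV \<times> {0..<T}) \<and>
     (\<forall>x. \<forall>t\<in>{0..<T}. 0 < vol s (x, t)) \<and>
     (\<forall>x. \<forall>t\<in>{0<..<T}.
        deriv (\<lambda>t'. vol s (x, t')) t - deriv (\<lambda>y. vel s (y, t)) x = 0 \<and>
        deriv (\<lambda>t'. vel s (x, t')) t + deriv (\<lambda>y. (1 / \<gamma>) * vol s (y, t) powr (- \<gamma>)) x = 0) \<and>
     (\<forall>T'\<in>{0..<T}. \<exists>M. \<forall>x. \<forall>t\<in>{0..T'}. \<bar>R_var \<gamma> s x t\<bar> \<le> M \<and> \<bar>S_var \<gamma> s x t\<bar> \<le> M)"

text \<open>\<open>ts\<close> is the first singularity time of \<open>s\<close> (\<open>\<infinity>\<close> if there is no singularity).\<close>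

definition first_singularity :: "real \<Rightarrow> real \<Rightarrow> flow \<Rightarrow> ereal \<Rightarrow> bool" where
  "first_singularity \<gamma> \<tau>bar s ts \<longleftrightarrow>
     0 < ts \<and>
     (\<forall>T. 0 < T \<and> ereal T \<le> ts \<longrightarrow> euler_solution \<gamma> \<tau>bar 1 T s) \<and>
     (\<forall>T. ereal T = ts \<longrightarrow>
        \<not> (\<exists>M. \<forall>x. \<forall>t\<in>{0..<T}. \<bar>R_var \<gamma> s x t\<bar> \<le> M \<and> \<bar>S_var \<gamma> s x t\<bar> \<le> M))"

definition riemann_minus :: "real \<Rightarrow> data \<Rightarrow> real \<Rightarrow> real" where
  "riemann_minus \<gamma> v x = snd v x - 2 / (\<gamma> - 1) * fst v x powr (- (\<gamma> - 1) / 2)"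

definition riemann_plus :: "real \<Rightarrow> data \<Rightarrow> real \<Rightarrow> real" where
  "riemann_plus \<gamma> v x = snd v x + 2 / (\<gamma> - 1) * fst v x powr (- (\<gamma> - 1) / 2)"

definition D_eta :: "real \<Rightarrow> real \<Rightarrow> real \<Rightarrow> real \<Rightarrow> data set" where
  "D_eta \<gamma> \<tau>bar cbar \<eta> =
     {v. perturbation \<tau>bar v \<in> Ck_W11 1 \<times> Ck_W11 1 \<and>
         (\<forall>x. 1 / cbar \<le> fst v x \<and> fst v x \<le> cbar) \<and>
         (\<integral>\<^sup>+x. ennreal (\<bar>deriv (riemann_minus \<gamma> v) x\<bar> + \<bar>deriv (riemann_plus \<gamma> v) x\<bar>) \<partial>lborel)
           \<le> ennreal \<eta>}"

text \<open>The fields are functions of \<open>(X, Y)\<close>.\<close>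

record chart =
  ch_tau :: "real \<times> real \<Rightarrow> real"
  ch_u :: "real \<times> real \<Rightarrow> real"
  ch_alpha :: "real \<times> real \<Rightarrow> real"
  ch_beta :: "real \<times> real \<Rightarrow> real"
  ch_p :: "real \<times> real \<Rightarrow> real"
  ch_q :: "real \<times> real \<Rightarrow> real"
  ch_x :: "real \<times> real \<Rightarrow> real"
  ch_t :: "real \<times> real \<Rightarrow> real"

definition chart_fields :: "(chart \<Rightarrow> real \<times> real \<Rightarrow> real) set" where
  "chart_fields = {ch_tau, ch_u, ch_alpha, ch_beta, ch_p, ch_q, ch_x, ch_t}"

definition DX :: "(real \<times> real \<Rightarrow> real) \<Rightarrow> real \<times> real \<Rightarrow> real" where
  "DX f z = deriv (\<lambda>X. f (X, snd z)) (fst z)"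

definition DY :: "(real \<times> real \<Rightarrow> real) \<Rightarrow> real \<times> real \<Rightarrow> real" where
  "DY f z = deriv (\<lambda>Y. f (fst z, Y)) (snd z)"

definition semilinear_at :: "real \<Rightarrow> chart \<Rightarrow> real \<times> real \<Rightarrow> bool" where
  "semilinear_at \<gamma> Z z \<longleftrightarrow>
     (let c = wave_speed \<gamma> (ch_tau Z z); c' = deriv (wave_speed \<gamma>) (ch_tau Z z);
          \<alpha> = ch_alpha Z z; \<beta> = ch_beta Z z; p = ch_p Z z; q = ch_q Z z
      in DY (ch_alpha Z) z = c' / (2 * c\<^sup>2) * q * sin (\<alpha> / 2) * sin ((\<alpha> - \<beta>) / 2) \<and>
         DX (ch_beta Z) z = c' / (2 * c\<^sup>2) * p * sin (\<beta> / 2) * sin ((\<beta> - \<alpha>) / 2) \<and>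
         DY (ch_p Z) z = c' / (4 * c\<^sup>2) * p * q * cos (\<alpha> / 2) * sin ((\<beta> - \<alpha>) / 2) \<and>
         DX (ch_q Z) z = c' / (4 * c\<^sup>2) * p * q * cos (\<beta> / 2) * sin ((\<alpha> - \<beta>) / 2) \<and>
         DX (ch_tau Z) z = 1 / (2 * c) * p * sin (\<alpha> / 2) \<and>
         DY (ch_tau Z) z = 1 / (2 * c) * q * sin (\<beta> / 2) \<and>
         DX (ch_u Z) z = 1 / 2 * p * sin (\<alpha> / 2) \<and>
         DY (ch_u Z) z = - 1 / 2 * q * sin (\<beta> / 2) \<and>
         DX (ch_t Z) z = 1 / (2 * c) * p * cos (\<alpha> / 2) \<and>
         DY (ch_t Z) z = 1 / (2 * c) * q * cos (\<beta> / 2) \<and>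
         DX (ch_x Z) z = 1 / 2 * p * cos (\<alpha> / 2) \<and>
         DY (ch_x Z) z = - 1 / 2 * q * cos (\<beta> / 2))"

text \<open>\<open>Z\<close> represents the flow \<open>s\<close> on \<open>\<real> \<times> [0,T]\<close>, and \<open>\<Omega>\<close> is the image of \<open>\<real> \<times> [0,T]\<close> in the
  \<open>(X,Y)\<close> plane. The open set \<open>U \<supseteq> \<Omega>\<close> provides two-sided derivatives on the boundary of \<open>\<Omega>\<close>.
  Since \<open>(X,Y) \<mapsto> (x,t)\<close> is a homeomorphism and \<open>x\<^sub>X = c t\<^sub>X\<close>, \<open>x\<^sub>Y = - c t\<^sub>Y\<close>, the coordinate \<open>X\<close> is
  constant on backward and \<open>Y\<close> on forward characteristics, so \<open>(X,Y)\<close> is a relabeling of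
  \<open>(x\<^sub>-(0;x,t), - x\<^sub>+(0;x,t))\<close>; moreover \<open>dx = p cos(\<alpha>/2) dX = - q cos(\<beta>/2) dY\<close> along \<open>t = const\<close>,
  which gives \<open>p = sqrt(1+R\<^sup>2) / X\<^sub>x\<close> and \<open>q = sqrt(1+S\<^sup>2) / (- Y\<^sub>x)\<close>.
  At \<open>t = T\<close> the chart itself supplies the values of the solution (its extension by continuity).\<close>

definition char_chart ::
  "real \<Rightarrow> flow \<Rightarrow> real \<Rightarrow> (real \<times> real) set \<Rightarrow> (real \<times> real) set \<Rightarrow> chart \<Rightarrow> bool" where
  "char_chart \<gamma> s T U \<Omega> Z \<longleftrightarrow>
     open U \<and> \<Omega> \<subseteq> U \<and>
     (\<forall>f\<in>chart_fields. Ck_on 2 (f Z) U) \<and>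
     (\<forall>z\<in>U. semilinear_at \<gamma> Z z) \<and>
     (\<exists>g. homeomorphism \<Omega> (UNIV \<times> {0..T}) (\<lambda>z. (ch_x Z z, ch_t Z z)) g) \<and>
     (\<forall>z\<in>\<Omega>. 0 < ch_p Z z \<and> 0 < ch_q Z z \<and>
        ch_alpha Z z \<in> {-pi..<pi} \<and> ch_beta Z z \<in> {-pi..<pi} \<and>
        (ch_t Z z < T \<longrightarrow>
           ch_tau Z z = vol s (ch_x Z z, ch_t Z z) \<and>
           ch_u Z z = vel s (ch_x Z z, ch_t Z z) \<and>
           ch_alpha Z z = 2 * arctan (R_var \<gamma> s (ch_x Z z) (ch_t Z z)) \<and>
           ch_beta Z z = 2 * arctan (S_var \<gamma> s (ch_x Z z) (ch_t Z z))))"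

definition only_generic :: "real \<Rightarrow> flow \<Rightarrow> real \<Rightarrow> bool" where
  "only_generic \<gamma> s T \<longleftrightarrow>
     (\<exists>U \<Omega> Z. char_chart \<gamma> s T U \<Omega> Z \<and>
        (\<forall>z\<in>\<Omega>.
           (ch_alpha Z z = - pi \<and> DX (ch_alpha Z) z = 0 \<longrightarrow>
              DY (ch_alpha Z) z \<noteq> 0 \<and> DX (DX (ch_alpha Z)) z \<noteq> 0) \<and>
           (ch_beta Z z = - pi \<and> DY (ch_beta Z) z = 0 \<longrightarrow>
              DX (ch_beta Z) z \<noteq> 0 \<and> DY (DY (ch_beta Z)) z \<noteq> 0)))"

text \<open>The admissible choices of the generic set of perturbations. Solutions with \<open>C\<^sup>3\<close> data are of
  class \<open>C\<^sup>3\<close>, which is the meaning of \<open>smooth\<close> here; the chart is then of class \<open>C\<^sup>2\<close>.\<close>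

definition generic_data_set :: "real \<Rightarrow> real \<Rightarrow> data set \<Rightarrow> bool" where
  "generic_data_set \<gamma> \<tau>bar D \<longleftrightarrow>
     D \<subseteq> Ck_W11 3 \<times> Ck_W11 3 \<and>
     (\<forall>v\<in>D. \<exists>e>0. \<forall>w\<in>Ck_W11 3 \<times> Ck_W11 3. data_dist 3 w v < e \<longrightarrow> w \<in> D) \<and>
     (\<forall>v\<in>Ck_W11 3 \<times> Ck_W11 3. \<forall>e>0. \<exists>w\<in>D. data_dist 3 w v < e) \<and>
     (\<forall>s T. perturbation \<tau>bar (initial s) \<in> D \<and> first_singularity \<gamma> \<tau>bar s (ereal T) \<longrightarrow>
        euler_solution \<gamma> \<tau>bar 3 T s \<and> only_generic \<gamma> s T)"

definition D_infty :: "data set \<Rightarrow> data set" where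
  "D_infty D = D \<inter> (Cc_smooth \<times> Cc_smooth)"

text \<open>Continuity in \<open>\<theta>\<close> excludes jumps between solutions, which the length would not see.\<close>

definition piecewise_regular :: "real \<Rightarrow> real \<Rightarrow> real \<Rightarrow> (real \<Rightarrow> flow) \<Rightarrow> bool" where
  "piecewise_regular \<gamma> \<tau>bar T \<Upsilon> \<longleftrightarrow>
     continuous_on ({0..1} \<times> UNIV \<times> {0..<T}) (\<lambda>(\<theta>, z). vol (\<Upsilon> \<theta>) z) \<and>
     continuous_on ({0..1} \<times> UNIV \<times> {0..<T}) (\<lambda>(\<theta>, z). vel (\<Upsilon> \<theta>) z) \<and>
     continuous_on ({0..1} \<times> UNIV \<times> {0..<T}) (\<lambda>(\<theta>, x, t). R_var \<gamma> (\<Upsilon> \<theta>) x t) \<and>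
     continuous_on ({0..1} \<times> UNIV \<times> {0..<T}) (\<lambda>(\<theta>, x, t). S_var \<gamma> (\<Upsilon> \<theta>) x t) \<and>
     (\<forall>\<theta>\<in>{0..1}. euler_solution \<gamma> \<tau>bar 3 T (\<Upsilon> \<theta>)) \<and>
     finite {\<theta>\<in>{0..1}. \<not> only_generic \<gamma> (\<Upsilon> \<theta>) T}"

text \<open>The charts \<open>Z \<theta>\<close> (with images \<open>\<Omega> \<theta>\<close>) represent the path and depend smoothly on \<open>\<theta>\<close> at fixed
  \<open>(X,Y)\<close>, apart from finitely many \<open>\<theta>\<close>.\<close>

definition represents ::
  "real \<Rightarrow> real \<Rightarrow> (real \<Rightarrow> flow) \<Rightarrow> (real \<Rightarrow> (real \<times> real) set) \<Rightarrow> (real \<Rightarrow> chart) \<Rightarrow> bool" where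
  "represents \<gamma> T \<Upsilon> \<Omega> Z \<longleftrightarrow>
     (\<exists>F V. finite F \<and> open V \<and>
        (\<forall>f\<in>chart_fields. Ck_on 2 (\<lambda>(\<theta>, z). f (Z \<theta>) z) V) \<and>
        (\<forall>\<theta>\<in>{0<..<1} - F. char_chart \<gamma> (\<Upsilon> \<theta>) T {z. (\<theta>, z) \<in> V} (\<Omega> \<theta>) (Z \<theta>)))"

text \<open>A relabeling \<open>X = \<phi> \<theta> X'\<close> of one coordinate, piecewise of class \<open>C\<^sup>2\<close> in \<open>(\<theta>, X')\<close>: for \<open>\<theta>\<close>
  outside a finite set \<open>F\<close>, it is smooth on the closed cells \<open>[a,b]\<close> cut out by the finite set \<open>G\<close>
  of breakpoints, which do not move with \<open>\<theta>\<close>.\<close>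

definition pw_relabeling :: "(real \<Rightarrow> real \<Rightarrow> real) \<Rightarrow> bool" where
  "pw_relabeling \<phi> \<longleftrightarrow>
     (\<forall>\<theta>\<in>{0..1}. strict_mono (\<phi> \<theta>) \<and> continuous_on UNIV (\<phi> \<theta>) \<and> surj (\<phi> \<theta>)) \<and>
     (\<exists>F G. finite F \<and> finite G \<and>
        (\<forall>a b. a < b \<and> {a<..<b} \<inter> G = {} \<longrightarrow>
           (\<exists>h. Ck_on 2 (\<lambda>(\<theta>, X). h \<theta> X) (({0<..<1} - F) \<times> UNIV) \<and>
                (\<forall>\<theta>\<in>{0<..<1} - F. \<forall>X\<in>{a..b}. \<phi> \<theta> X = h \<theta> X \<and> 0 < deriv (h \<theta>) X))))"

definition relabel :: "(real \<Rightarrow> real) \<Rightarrow> (real \<Rightarrow> real) \<Rightarrow> chart \<Rightarrow> chart" where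
  "relabel \<phi> \<psi> Z = \<lparr>
     ch_tau = (\<lambda>(X, Y). ch_tau Z (\<phi> X, \<psi> Y)),
     ch_u = (\<lambda>(X, Y). ch_u Z (\<phi> X, \<psi> Y)),
     ch_alpha = (\<lambda>(X, Y). ch_alpha Z (\<phi> X, \<psi> Y)),
     ch_beta = (\<lambda>(X, Y). ch_beta Z (\<phi> X, \<psi> Y)),
     ch_p = (\<lambda>(X, Y). ch_p Z (\<phi> X, \<psi> Y) * deriv \<phi> X),
     ch_q = (\<lambda>(X, Y). ch_q Z (\<phi> X, \<psi> Y) * deriv \<psi> Y),
     ch_x = (\<lambda>(X, Y). ch_x Z (\<phi> X, \<psi> Y)),
     ch_t = (\<lambda>(X, Y). ch_t Z (\<phi> X, \<psi> Y))\<rparr>"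

definition relabel_domain ::
  "(real \<Rightarrow> real) \<Rightarrow> (real \<Rightarrow> real) \<Rightarrow> (real \<times> real) set \<Rightarrow> (real \<times> real) set" where
  "relabel_domain \<phi> \<psi> \<Omega> = {(X, Y). (\<phi> X, \<psi> Y) \<in> \<Omega>}"

definition D\<theta> ::
  "(chart \<Rightarrow> real \<times> real \<Rightarrow> real) \<Rightarrow> (real \<Rightarrow> chart) \<Rightarrow> real \<Rightarrow> real \<times> real \<Rightarrow> real" where
  "D\<theta> f Z \<theta> z = deriv (\<lambda>\<theta>'. f (Z \<theta>') z) \<theta>"

definition J_minus :: "real \<Rightarrow> nat \<Rightarrow> (real \<Rightarrow> chart) \<Rightarrow> real \<Rightarrow> real \<times> real \<Rightarrow> real" where
  "J_minus \<gamma> l Z \<theta> z =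
     (let c = wave_speed \<gamma> (ch_tau (Z \<theta>) z); c' = deriv (wave_speed \<gamma>) (ch_tau (Z \<theta>) z);
          \<alpha> = ch_alpha (Z \<theta>) z; p = ch_p (Z \<theta>) z;
          \<Xi> = D\<theta> ch_tau Z \<theta> z; \<U> = D\<theta> ch_u Z \<theta> z; \<A> = D\<theta> ch_alpha Z \<theta> z;
          \<P> = D\<theta> ch_p Z \<theta> z; \<X> = D\<theta> ch_x Z \<theta> z; \<T> = D\<theta> ch_t Z \<theta> z
      in if l = 1 then p * (\<X> + c * \<T>)
         else if l = 2 then p * \<Xi>
         else if l = 3 then p * \<U>
         else if l = 4 then \<P> * sin (\<alpha> / 2) + 1 / 2 * p * cos (\<alpha> / 2) * \<A>
         else if l = 5 then 1 / 2 * p * \<A> - c' / (2 * c) * \<T> * p * (sin (\<alpha> / 2))\<^sup>2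
         else if l = 6 then \<P> + c' / (4 * c) * p * \<T> * sin \<alpha>
         else 0)"

definition J_plus :: "real \<Rightarrow> nat \<Rightarrow> (real \<Rightarrow> chart) \<Rightarrow> real \<Rightarrow> real \<times> real \<Rightarrow> real" where
  "J_plus \<gamma> l Z \<theta> z =
     (let c = wave_speed \<gamma> (ch_tau (Z \<theta>) z); c' = deriv (wave_speed \<gamma>) (ch_tau (Z \<theta>) z);
          \<beta> = ch_beta (Z \<theta>) z; q = ch_q (Z \<theta>) z;
          \<Xi> = D\<theta> ch_tau Z \<theta> z; \<U> = D\<theta> ch_u Z \<theta> z; \<B> = D\<theta> ch_beta Z \<theta> z;
          \<Q> = D\<theta> ch_q Z \<theta> z; \<X> = D\<theta> ch_x Z \<theta> z; \<T> = D\<theta> ch_t Z \<theta> z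
      in if l = 1 then q * (\<X> - c * \<T>)
         else if l = 2 then q * \<Xi>
         else if l = 3 then q * \<U>
         else if l = 4 then \<Q> * sin (\<beta> / 2) + 1 / 2 * q * cos (\<beta> / 2) * \<B>
         else if l = 5 then 1 / 2 * q * \<B> - c' / (2 * c) * \<T> * q * (sin (\<beta> / 2))\<^sup>2
         else if l = 6 then \<Q> + c' / (4 * c) * q * \<T> * sin \<beta>
         else 0)"

text \<open>\<open>R = tan(\<alpha>/2)\<close> and \<open>S = tan(\<beta>/2)\<close> as functions of \<open>(x,t)\<close>, including \<open>t = T\<close>, where they may be
  infinite at some \<open>x\<close>.\<close>

definition chart_point :: "(real \<times> real) set \<Rightarrow> chart \<Rightarrow> real \<times> real \<Rightarrow> real \<times> real" where
  "chart_point \<Omega> Z = the_inv_into \<Omega> (\<lambda>z. (ch_x Z z, ch_t Z z))"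

definition chart_R :: "(real \<times> real) set \<Rightarrow> chart \<Rightarrow> real \<times> real \<Rightarrow> real" where
  "chart_R \<Omega> Z w = tan (ch_alpha Z (chart_point \<Omega> Z w) / 2)"

definition chart_S :: "(real \<times> real) set \<Rightarrow> chart \<Rightarrow> real \<times> real \<Rightarrow> real" where
  "chart_S \<Omega> Z w = tan (ch_beta Z (chart_point \<Omega> Z w) / 2)"

definition W_minus :: "real \<Rightarrow> (real \<times> real) set \<Rightarrow> chart \<Rightarrow> real \<Rightarrow> real \<Rightarrow> real" where
  "W_minus \<eta> \<Omega> Z x t = \<eta> +
     (LINT y:{..x}|lborel. (chart_S \<Omega> Z (y, t))\<^sup>2 / sqrt (1 + (chart_S \<Omega> Z (y, t))\<^sup>2))"

definition W_plus :: "real \<Rightarrow> (real \<times> real) set \<Rightarrow> chart \<Rightarrow> real \<Rightarrow> real \<Rightarrow> real" where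
  "W_plus \<eta> \<Omega> Z x t = \<eta> +
     (LINT y:{x..}|lborel. (chart_R \<Omega> Z (y, t))\<^sup>2 / sqrt (1 + (chart_R \<Omega> Z (y, t))\<^sup>2))"

definition level_curve :: "(real \<times> real) set \<Rightarrow> chart \<Rightarrow> real \<Rightarrow> (real \<times> real) set" where
  "level_curve \<Omega> Z t = {z\<in>\<Omega>. ch_t Z z = t}"

text \<open>Integrals with respect to the positive measures \<open>dX\<close> and \<open>dY\<close> over a curve that is a graph over
  \<open>X\<close> and over \<open>Y\<close>.\<close>

definition int_dX :: "(real \<times> real) set \<Rightarrow> (real \<times> real \<Rightarrow> ennreal) \<Rightarrow> ennreal" where
  "int_dX \<Gamma> f = (\<integral>\<^sup>+X\<in>fst ` \<Gamma>. f (X, THE Y. (X, Y) \<in> \<Gamma>) \<partial>lborel)"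

definition int_dY :: "(real \<times> real) set \<Rightarrow> (real \<times> real \<Rightarrow> ennreal) \<Rightarrow> ennreal" where
  "int_dY \<Gamma> f = (\<integral>\<^sup>+Y\<in>snd ` \<Gamma>. f (THE X. (X, Y) \<in> \<Gamma>, Y) \<partial>lborel)"

datatype metric_type = Metric_i | Metric_ii

fun num_terms :: "metric_type \<Rightarrow> nat" where
  "num_terms Metric_i = 4"
| "num_terms Metric_ii = 6"

definition tangent_norm ::
  "real \<Rightarrow> real \<Rightarrow> metric_type \<Rightarrow> (real \<Rightarrow> (real \<times> real) set) \<Rightarrow> (real \<Rightarrow> chart) \<Rightarrow> real \<Rightarrow> real \<Rightarrow> ennreal"
where
  "tangent_norm \<gamma> \<eta> \<iota> \<Omega> Z t \<theta> =
     (\<Sum>l = 1..num_terms \<iota>.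
        int_dX (level_curve (\<Omega> \<theta>) (Z \<theta>) t)
          (\<lambda>z. ennreal (\<bar>J_minus \<gamma> l Z \<theta> z\<bar> * W_minus \<eta> (\<Omega> \<theta>) (Z \<theta>) (ch_x (Z \<theta>) z) (ch_t (Z \<theta>) z)))
      + int_dY (level_curve (\<Omega> \<theta>) (Z \<theta>) t)
          (\<lambda>z. ennreal (\<bar>J_plus \<gamma> l Z \<theta> z\<bar> * W_plus \<eta> (\<Omega> \<theta>) (Z \<theta>) (ch_x (Z \<theta>) z) (ch_t (Z \<theta>) z))))"

definition path_length ::
  "real \<Rightarrow> real \<Rightarrow> metric_type \<Rightarrow> real \<Rightarrow> (real \<Rightarrow> flow) \<Rightarrow> real \<Rightarrow> ennreal" where
  "path_length \<gamma> \<eta> \<iota> T \<Upsilon> t =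
     Inf {\<integral>\<^sup>+\<theta>\<in>{0..1}. tangent_norm \<gamma> \<eta> \<iota>
             (\<lambda>\<theta>. relabel_domain (\<phi> \<theta>) (\<psi> \<theta>) (\<Omega> \<theta>)) (\<lambda>\<theta>. relabel (\<phi> \<theta>) (\<psi> \<theta>) (Z \<theta>)) t \<theta> \<partial>lborel
          | \<Omega> Z \<phi> \<psi>. represents \<gamma> T \<Upsilon> \<Omega> Z \<and> pw_relabeling \<phi> \<and> pw_relabeling \<psi>}"

definition same_flow :: "real \<Rightarrow> flow \<Rightarrow> flow \<Rightarrow> bool" where
  "same_flow T s s' \<longleftrightarrow>
     (\<forall>x. \<forall>t\<in>{0..<T}. vol s (x, t) = vol s' (x, t) \<and> vel s (x, t) = vel s' (x, t))"

text \<open>The distance at time \<open>t \<le> T\<close> between solutions with data in \<open>D\<^sup>\<infinity> \<inter> D\<^sub>\<eta>\<close>, \<open>T\<close> being the smaller of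
  their first singularity times (\<open>\<infinity>\<close> if there is no admissible path).\<close>

definition path_distance ::
  "real \<Rightarrow> real \<Rightarrow> real \<Rightarrow> metric_type \<Rightarrow> real \<Rightarrow> real \<Rightarrow> flow \<Rightarrow> flow \<Rightarrow> ennreal" where
  "path_distance \<gamma> \<tau>bar \<eta> \<iota> T t s s' =
     Inf {path_length \<gamma> \<eta> \<iota> T \<Upsilon> t | \<Upsilon>.
            piecewise_regular \<gamma> \<tau>bar T \<Upsilon> \<and> same_flow T (\<Upsilon> 0) s \<and> same_flow T (\<Upsilon> 1) s' \<and>
            (\<forall>\<theta>\<in>{0..1}. \<forall>r\<in>{0..<T}.
               (\<integral>\<^sup>+x. ennreal (\<bar>R_var \<gamma> (\<Upsilon> \<theta>) x r\<bar> + \<bar>S_var \<gamma> (\<Upsilon> \<theta>) x r\<bar>) \<partial>lborel) \<le> ennreal \<eta>)}"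

definition common_time :: "real \<Rightarrow> real \<Rightarrow> flow \<Rightarrow> flow \<Rightarrow> real \<Rightarrow> bool" where
  "common_time \<gamma> \<tau>bar s s' T \<longleftrightarrow>
     (\<exists>ts ts'. first_singularity \<gamma> \<tau>bar s ts \<and> first_singularity \<gamma> \<tau>bar s' ts' \<and> ereal T = min ts ts')"

definition smooth_class :: "real \<Rightarrow> real \<Rightarrow> real \<Rightarrow> real \<Rightarrow> data set \<Rightarrow> flow \<Rightarrow> bool" where
  "smooth_class \<gamma> \<tau>bar cbar \<eta> D s \<longleftrightarrow>
     initial s \<in> D_eta \<gamma> \<tau>bar cbar \<eta> \<and> perturbation \<tau>bar (initial s) \<in> D_infty D"

text \<open>The condition \<open>t \<le> T n\<close> makes the distance of the
  \<open>n\<close>-th approximations at time \<open>t\<close> meaningful.\<close>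

definition approximates ::
  "real \<Rightarrow> real \<Rightarrow> real \<Rightarrow> real \<Rightarrow> data set \<Rightarrow> real \<Rightarrow> flow \<Rightarrow> flow \<Rightarrow>
   (nat \<Rightarrow> flow) \<Rightarrow> (nat \<Rightarrow> flow) \<Rightarrow> (nat \<Rightarrow> real) \<Rightarrow> bool" where
  "approximates \<gamma> \<tau>bar cbar \<eta> D t s s' \<sigma> \<sigma>' T \<longleftrightarrow>
     (\<forall>n. smooth_class \<gamma> \<tau>bar cbar \<eta> D (\<sigma> n) \<and> smooth_class \<gamma> \<tau>bar cbar \<eta> D (\<sigma>' n) \<and>
          common_time \<gamma> \<tau>bar (\<sigma> n) (\<sigma>' n) (T n) \<and> t \<le> T n) \<and>
     (\<lambda>n. data_dist 1 (initial (\<sigma> n)) (initial s)) \<longlonglongrightarrow> 0 \<and>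
     (\<lambda>n. data_dist 1 (initial (\<sigma>' n)) (initial s')) \<longlonglongrightarrow> 0"

text \<open>\<open>d\<close> is the value of the geodesic distance at time \<open>t\<close>. Outside \<open>D\<^sup>\<infinity> \<inter> D\<^sub>\<eta>\<close> it is a limit that
  does not depend on the approximating sequences; the relation determines \<open>d\<close> uniquely, since at
  least one such sequence is required to exist.\<close>

definition geodesic_distance ::
  "real \<Rightarrow> real \<Rightarrow> real \<Rightarrow> real \<Rightarrow> data set \<Rightarrow> metric_type \<Rightarrow> real \<Rightarrow> flow \<Rightarrow> flow \<Rightarrow> ennreal \<Rightarrow> bool" where
  "geodesic_distance \<gamma> \<tau>bar cbar \<eta> D \<iota> t s s' d \<longleftrightarrow>
     (if smooth_class \<gamma> \<tau>bar cbar \<eta> D s \<and> smooth_class \<gamma> \<tau>bar cbar \<eta> D s'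
      then \<exists>T. common_time \<gamma> \<tau>bar s s' T \<and> t \<le> T \<and> d = path_distance \<gamma> \<tau>bar \<eta> \<iota> T t s s'
      else (\<exists>\<sigma> \<sigma>' T. approximates \<gamma> \<tau>bar cbar \<eta> D t s s' \<sigma> \<sigma>' T) \<and>
           (\<forall>\<sigma> \<sigma>' T. approximates \<gamma> \<tau>bar cbar \<eta> D t s s' \<sigma> \<sigma>' T \<longrightarrow>
              (\<lambda>n. path_distance \<gamma> \<tau>bar \<eta> \<iota> (T n) t (\<sigma> n) (\<sigma>' n)) \<longlonglongrightarrow> d))"

end

theory Submission
  imports Defs
begin

text \<open>
  In characteristic coordinates the system is semilinear, \<open>p sin(\<alpha>/2)\<close> depends on \<open>X\<close> only and
  \<open>q sin(\<beta>/2)\<close> on \<open>Y\<close> only. Differentiating in \<open>\<theta>\<close> shows that the densities satisfy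
  \<open>|\<partial>\<^sub>Y J\<^sub>l\<^sup>-|, |\<partial>\<^sub>X J\<^sub>l\<^sup>+| \<le> K (q \<Sum>|J\<^sub>k\<^sup>-| + p \<Sum>|J\<^sub>k\<^sup>+|)\<close>, where \<open>k\<close> runs over the four or six terms
  of the metric, and that no boundedness of \<open>R\<close>, \<open>S\<close> enters. Hence, for a function \<open>V\<close> with
  \<open>V\<^sub>X \<ge> L p\<close>, \<open>V\<^sub>Y \<ge> L q\<close> and \<open>L\<close> large, the form
  \<open>exp(-V) (\<Sum>|J\<^sub>k\<^sup>-| dX + \<Sum>|J\<^sub>k\<^sup>+| dY)\<close> has a flux through \<open>t = const\<close> that does not increase in time.
  Since \<open>p \<le> p |sin(\<alpha>/2)| + p cos(\<alpha>/2)\<close> and \<open>p cos(\<alpha>/2) = 2 c t\<^sub>X\<close>, one may take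
  \<open>V = L (b(X) + a(Y)) + 2 m L t\<close> with \<open>b' = p |sin(\<alpha>/2)|\<close>, \<open>a' = q |sin(\<beta>/2)|\<close> and \<open>c \<le> m\<close>; the total
  variation of the Riemann invariants bounds \<open>a\<close>, \<open>b\<close>, hence \<open>V\<close>. The weights \<open>\<W>\<^sup>\<plusminus>\<close> lie in \<open>[\<eta>, 2\<eta>]\<close>, so
  that they are comparable with \<open>exp(-V)\<close>. This bounds the length of every path at time \<open>t\<close> by a
  multiple of its length at time \<open>0\<close> in the same coordinates, and the infima and limits that define the
  distance inherit the bound.
\<close>

section \<open>The wave speed\<close>

text \<open>Three obstacles shape the argument. At the final time \<open>R\<close> and
  \<open>S\<close> may be infinite and the map from labels to \<open>(x,t)\<close> may degenerate;
  hence all estimates are made in the chart, whose fields stay of class C2 there, and the geometry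
  of the labels is reduced to order and continuity. This reduction also survives relabelings, which
  are only piecewise smooth. At their breakpoints \<open>p\<close>, \<open>q\<close> and the
  densities carry arbitrary values of \<open>deriv\<close>, so increments are taken along lines
  avoiding finitely many labels; each density still crosses the breakpoints of the other coordinate
  continuously. Finally the constant may depend only on \<gamma>, \<open>cbar\<close> and the time,
  so bounds on \<tau> must be recovered for every member of a path from its small total variation
  and from the value at infinity. Both metrics follow from one argument because the first four
  densities form a closed subsystem.\<close>

definition wave_speed1 :: "real \<Rightarrow> real \<Rightarrow> real" where
  "wave_speed1 \<gamma> \<tau> = - (\<gamma> + 1) / 2 * \<tau> powr (- (\<gamma> + 1) / 2 - 1)"

definition wave_speed2 :: "real \<Rightarrow> real \<Rightarrow> real" where
  "wave_speed2 \<gamma> \<tau> = - (\<gamma> + 1) / 2 * ((- (\<gamma> + 1) / 2 - 1) * \<tau> powr (- (\<gamma> + 1) / 2 - 2))"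

lemma wave_speed_pos: "0 < \<tau> \<Longrightarrow> 0 < wave_speed \<gamma> \<tau>"
  by (simp add: wave_speed_def)

lemma DERIV_wave_speed:
  assumes "0 < \<tau>"
  shows "(wave_speed \<gamma> has_real_derivative wave_speed1 \<gamma> \<tau>) (at \<tau>)"
  unfolding wave_speed_def[abs_def] wave_speed1_def
  using assms by (auto intro!: derivative_eq_intros)

lemma deriv_wave_speed: "0 < \<tau> \<Longrightarrow> deriv (wave_speed \<gamma>) \<tau> = wave_speed1 \<gamma> \<tau>"
  using DERIV_wave_speed DERIV_imp_deriv by blast

lemma DERIV_wave_speed1:
  assumes "0 < \<tau>"
  shows "(wave_speed1 \<gamma> has_real_derivative wave_speed2 \<gamma> \<tau>) (at \<tau>)"
  unfolding wave_speed1_def[abs_def] wave_speed2_def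
  using assms by (auto intro!: derivative_eq_intros simp: field_simps)

lemmas DERIV_wave_speed_chain [derivative_intros] =
  DERIV_wave_speed[THEN DERIV_chain2] DERIV_wave_speed1[THEN DERIV_chain2]

lemma continuous_on_wave_speed [continuous_intros]:
  assumes "continuous_on A f" "\<And>z. z \<in> A \<Longrightarrow> 0 < f z"
  shows "continuous_on A (\<lambda>z. wave_speed \<gamma> (f z))"
    and "continuous_on A (\<lambda>z. wave_speed1 \<gamma> (f z))"
    and "continuous_on A (\<lambda>z. wave_speed2 \<gamma> (f z))"
  unfolding wave_speed_def wave_speed1_def wave_speed2_def
  using assms by (force intro!: continuous_intros)+

text \<open>The coefficient of the equations for \<open>p\<close> and \<open>q\<close>, and half of
  that for \<alpha> and \<beta>. It also governs the variation of \<open>1 / (2 * c)\<close>, whose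
  derivative in \<tau> is \<open>- 2 * kap\<close>.\<close>

definition kap :: "real \<Rightarrow> real \<Rightarrow> real" where
  "kap \<gamma> \<tau> = wave_speed1 \<gamma> \<tau> / (4 * (wave_speed \<gamma> \<tau>)\<^sup>2)"

definition kap1 :: "real \<Rightarrow> real \<Rightarrow> real" where
  "kap1 \<gamma> \<tau> = wave_speed2 \<gamma> \<tau> / (4 * (wave_speed \<gamma> \<tau>)\<^sup>2)
     - (wave_speed1 \<gamma> \<tau>)\<^sup>2 / (2 * (wave_speed \<gamma> \<tau>) ^ 3)"

text \<open>The coefficient \<open>c' / (4 * c)\<close> of the sixth density; the fifth contains
  twice this value. It equals \<open>c * kap\<close>.\<close>

definition mu :: "real \<Rightarrow> real \<Rightarrow> real" where
  "mu \<gamma> \<tau> = wave_speed1 \<gamma> \<tau> / (4 * wave_speed \<gamma> \<tau>)"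

definition mu1 :: "real \<Rightarrow> real \<Rightarrow> real" where
  "mu1 \<gamma> \<tau> = wave_speed2 \<gamma> \<tau> / (4 * wave_speed \<gamma> \<tau>)
     - (wave_speed1 \<gamma> \<tau>)\<^sup>2 / (4 * (wave_speed \<gamma> \<tau>)\<^sup>2)"

lemma DERIV_kap:
  assumes "0 < \<tau>"
  shows "(kap \<gamma> has_real_derivative kap1 \<gamma> \<tau>) (at \<tau>)"
  unfolding kap_def[abs_def] kap1_def
  using assms wave_speed_pos[OF assms, of \<gamma>]
  by (auto intro!: derivative_eq_intros simp: field_simps power2_eq_square power3_eq_cube power4_eq_xxxx)

lemma DERIV_mu:
  assumes "0 < \<tau>"
  shows "(mu \<gamma> has_real_derivative mu1 \<gamma> \<tau>) (at \<tau>)"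
  unfolding mu_def[abs_def] mu1_def
  using assms wave_speed_pos[OF assms, of \<gamma>]
  by (auto intro!: derivative_eq_intros simp: field_simps power2_eq_square)

lemmas DERIV_kap_mu_chain [derivative_intros] =
  DERIV_kap[THEN DERIV_chain2] DERIV_mu[THEN DERIV_chain2]

lemma continuous_on_kap_mu [continuous_intros]:
  assumes "continuous_on A f" "\<And>z. z \<in> A \<Longrightarrow> 0 < f z"
  shows "continuous_on A (\<lambda>z. kap \<gamma> (f z))" and "continuous_on A (\<lambda>z. kap1 \<gamma> (f z))"
    and "continuous_on A (\<lambda>z. mu \<gamma> (f z))" and "continuous_on A (\<lambda>z. mu1 \<gamma> (f z))"
  unfolding kap_def kap1_def mu_def mu1_def
  using assms wave_speed_pos[OF assms(2), of _ \<gamma>]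
  by (force intro!: continuous_intros)+

text \<open>One number for all functions of \<tau> that enter the linearised system. The condition
  \<open>1 \<le> m\<close> makes higher powers of \<open>m\<close> dominate lower ones, so that a
  single power bounds all terms.\<close>

definition coeff_bound :: "real \<Rightarrow> real \<Rightarrow> real \<Rightarrow> bool" where
  "coeff_bound \<gamma> m \<tau> \<longleftrightarrow> 0 < \<tau> \<and> 1 \<le> m \<and>
     wave_speed \<gamma> \<tau> \<le> m \<and> \<bar>1 / (2 * wave_speed \<gamma> \<tau>)\<bar> \<le> m \<and>
     \<bar>kap \<gamma> \<tau>\<bar> \<le> m \<and> \<bar>kap1 \<gamma> \<tau>\<bar> \<le> m \<and> \<bar>mu \<gamma> \<tau>\<bar> \<le> m \<and> \<bar>mu1 \<gamma> \<tau>\<bar> \<le> m"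

lemma coeff_bound_exists:
  assumes "0 < l"
  shows "\<exists>m. \<forall>\<tau>\<in>{l..h}. coeff_bound \<gamma> m \<tau>"
proof -
  have bd: "\<exists>m. \<forall>\<tau>\<in>{l..h}. \<bar>f \<tau>\<bar> \<le> m" if "continuous_on {l..h} f" for f :: "real \<Rightarrow> real"
  proof -
    have "bounded (f ` {l..h})"
      by (intro compact_imp_bounded compact_continuous_image that) simp
    then show ?thesis by (auto simp: bounded_iff)
  qed
  have pos: "\<And>z. z \<in> {l..h} \<Longrightarrow> 0 < z" using assms by auto
  have ne: "\<And>z. z \<in> {l..h} \<Longrightarrow> wave_speed \<gamma> z \<noteq> 0"
    using wave_speed_pos[OF pos] by (metis less_irrefl)
  note cid = continuous_on_id[of "{l..h}"]
  obtain m1 where 1: "\<forall>\<tau>\<in>{l..h}. \<bar>wave_speed \<gamma> \<tau>\<bar> \<le> m1"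
    using bd[OF continuous_on_wave_speed(1)[OF cid pos, of \<gamma>]] by blast
  have "continuous_on {l..h} (\<lambda>\<tau>. 1 / (2 * wave_speed \<gamma> \<tau>))"
    using ne by (intro continuous_intros continuous_on_wave_speed(1)[OF cid pos]) auto
  then obtain m2 where 2: "\<forall>\<tau>\<in>{l..h}. \<bar>1 / (2 * wave_speed \<gamma> \<tau>)\<bar> \<le> m2"
    using bd by blast
  obtain m3 where 3: "\<forall>\<tau>\<in>{l..h}. \<bar>kap \<gamma> \<tau>\<bar> \<le> m3"
    using bd[OF continuous_on_kap_mu(1)[OF cid pos, of \<gamma>]] by blast
  obtain m4 where 4: "\<forall>\<tau>\<in>{l..h}. \<bar>kap1 \<gamma> \<tau>\<bar> \<le> m4"
    using bd[OF continuous_on_kap_mu(2)[OF cid pos, of \<gamma>]] by blast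
  obtain m5 where 5: "\<forall>\<tau>\<in>{l..h}. \<bar>mu \<gamma> \<tau>\<bar> \<le> m5"
    using bd[OF continuous_on_kap_mu(3)[OF cid pos, of \<gamma>]] by blast
  obtain m6 where 6: "\<forall>\<tau>\<in>{l..h}. \<bar>mu1 \<gamma> \<tau>\<bar> \<le> m6"
    using bd[OF continuous_on_kap_mu(4)[OF cid pos, of \<gamma>]] by blast
  define m where "m = Max {1, m1, m2, m3, m4, m5, m6}"
  have "1 \<le> m" "m1 \<le> m" "m2 \<le> m" "m3 \<le> m" "m4 \<le> m" "m5 \<le> m" "m6 \<le> m"
    unfolding m_def by (rule Max_ge; simp)+
  note m = this
  have "coeff_bound \<gamma> m \<tau>" if t: "\<tau> \<in> {l..h}" for \<tau>
    unfolding coeff_bound_def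
    using order_trans[OF bspec[OF 1 t] m(2)] order_trans[OF bspec[OF 2 t] m(3)]
      order_trans[OF bspec[OF 3 t] m(4)] order_trans[OF bspec[OF 4 t] m(5)]
      order_trans[OF bspec[OF 5 t] m(6)] order_trans[OF bspec[OF 6 t] m(7)] m(1) pos[OF t]
    by (simp only: abs_le_iff)
  then show ?thesis by (intro exI[of _ m] ballI)
qed

section \<open>Differentiation along a family of characteristics\<close>

text \<open>Writing \<open>F\<close> as its value at \<open>a\<close> plus the integral of
  \<open>H\<close> and differentiating under the integral sign exchanges the two derivatives without
  second-order regularity of \<open>F\<close>. This matters because the relabelled \<open>p\<close>
  contains a derivative of the relabeling. With \<open>H\<close> the right-hand side of the system,
  the result is the linearised system.\<close>

lemma mixed_derivative:
  fixes F F1 H H1 :: "real \<Rightarrow> real \<Rightarrow> real"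
  assumes "open S" "(\<theta>0, y0) \<in> S"
    and Fy: "\<And>\<theta> y. (\<theta>, y) \<in> S \<Longrightarrow> (F \<theta> has_real_derivative H \<theta> y) (at y)"
    and F\<theta>: "\<And>\<theta> y. (\<theta>, y) \<in> S \<Longrightarrow> ((\<lambda>\<theta>. F \<theta> y) has_real_derivative F1 \<theta> y) (at \<theta>)"
    and H\<theta>: "\<And>\<theta> y. (\<theta>, y) \<in> S \<Longrightarrow> ((\<lambda>\<theta>. H \<theta> y) has_real_derivative H1 \<theta> y) (at \<theta>)"
    and cH: "continuous_on S (\<lambda>(\<theta>, y). H \<theta> y)"
    and cH1: "continuous_on S (\<lambda>(\<theta>, y). H1 \<theta> y)"
  shows "(F1 \<theta>0 has_real_derivative H1 \<theta>0 y0) (at y0)"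
proof -
  obtain A B where AB: "open A" "open B" "\<theta>0 \<in> A" "y0 \<in> B" "A \<times> B \<subseteq> S"
    using assms(1,2) by (metis mem_Sigma_iff open_prod_elim)
  obtain d where d: "0 < d" "cball \<theta>0 d \<subseteq> A" using AB open_contains_cball by blast
  obtain e where e: "0 < e" "cball y0 e \<subseteq> B" using AB open_contains_cball by blast
  define U where "U = ball \<theta>0 d"
  define a where "a = y0 - e"
  define b where "b = y0 + e"
  have U: "open U" "convex U" "\<theta>0 \<in> U" using d by (auto simp: U_def)
  have ab: "{a..b} \<subseteq> B" using e(2) unfolding cball_eq_atLeastAtMost a_def b_def .
  have sub: "U \<times> {a..b} \<subseteq> S" using AB(5) ab d(2) by (force simp: U_def)
  have FT: "(H \<theta> has_integral F \<theta> y - F \<theta> a) {a..y}" if "\<theta> \<in> U" "y \<in> {a..b}" for \<theta> y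
  proof (rule fundamental_theorem_of_calculus)
    show "(F \<theta> has_vector_derivative H \<theta> x) (at x within {a..y})" if "x \<in> {a..y}" for x
    proof -
      have "(\<theta>, x) \<in> S" using \<open>\<theta> \<in> U\<close> \<open>y \<in> {a..b}\<close> that sub by auto
      from has_field_derivative_at_within[OF Fy[OF this]] show ?thesis
        by (simp add: has_real_derivative_iff_has_vector_derivative)
    qed
  qed (use that in auto)
  have eq: "F1 \<theta>0 y = F1 \<theta>0 a + integral {a..y} (H1 \<theta>0)" if y: "y \<in> {a..b}" for y
  proof -
    have "((\<lambda>\<theta>. integral (cbox a y) (H \<theta>)) has_real_derivative integral (cbox a y) (H1 \<theta>0)) (at \<theta>0 within U)"
    proof (rule leibniz_rule_field_derivative)
      show "((\<lambda>\<theta>. H \<theta> s) has_real_derivative H1 \<theta> s) (at \<theta> within U)"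
        if "\<theta> \<in> U" "s \<in> cbox a y" for \<theta> s
        using that y sub by (intro has_field_derivative_at_within[OF H\<theta>]) auto
      show "H \<theta> integrable_on cbox a y" if "\<theta> \<in> U" for \<theta>
        using FT[OF that y] by (auto simp: has_integral_integrable)
      show "continuous_on (U \<times> cbox a y) (\<lambda>(\<theta>, s). H1 \<theta> s)"
        by (rule continuous_on_subset[OF cH1]) (use sub y in auto)
    qed (use U in auto)
    then have 1: "((\<lambda>\<theta>. integral {a..y} (H \<theta>)) has_real_derivative integral {a..y} (H1 \<theta>0)) (at \<theta>0)"
      by (simp only: at_within_open[OF U(3,1)] cbox_interval)
    have "((\<lambda>\<theta>. F \<theta> y - F \<theta> a) has_real_derivative F1 \<theta>0 y - F1 \<theta>0 a) (at \<theta>0)"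
      using U y sub by (intro DERIV_diff F\<theta>) (auto simp: a_def)
    then have "((\<lambda>\<theta>. integral {a..y} (H \<theta>)) has_real_derivative F1 \<theta>0 y - F1 \<theta>0 a) (at \<theta>0)"
      by (rule has_field_derivative_transform_within_open[OF _ U(1,3)])
         (rule integral_unique[OF FT[OF _ y], symmetric])
    then show ?thesis using 1 DERIV_unique by fastforce
  qed
  have cont: "continuous_on {a..b} (H1 \<theta>0)"
  proof -
    have "continuous_on {a..b} (\<lambda>y. case (\<theta>0, y) of (\<theta>, y) \<Rightarrow> H1 \<theta> y)"
      by (rule continuous_on_compose2[OF cH1]) (use sub U in \<open>auto intro: continuous_on_Pair continuous_on_const continuous_on_id\<close>)
    then show ?thesis by simp
  qed
  have "((\<lambda>y. integral {a..y} (H1 \<theta>0)) has_real_derivative H1 \<theta>0 y0) (at y0 within {a..b})"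
    by (rule integral_has_real_derivative[OF cont]) (use e in \<open>auto simp: a_def b_def\<close>)
  moreover have "at y0 within {a..b} = at y0"
    by (rule at_within_interior) (use e in \<open>auto simp: a_def b_def\<close>)
  ultimately have "((\<lambda>y. integral {a..y} (H1 \<theta>0)) has_real_derivative H1 \<theta>0 y0) (at y0)"
    by simp
  then have "((\<lambda>y. F1 \<theta>0 a + integral {a..y} (H1 \<theta>0)) has_real_derivative H1 \<theta>0 y0) (at y0)"
    using DERIV_add[OF DERIV_const[of "F1 \<theta>0 a"]] by fastforce
  then show ?thesis
  proof (rule has_field_derivative_transform_within_open)
    show "y0 \<in> {a<..<b}" using e by (simp add: a_def b_def)
    show "F1 \<theta>0 a + integral {a..y} (H1 \<theta>0) = F1 \<theta>0 y" if "y \<in> {a<..<b}" for y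
      using eq[of y] that by simp
  qed simp
qed

text \<open>Common form of both families: \<open>J_plus\<close> arises by inserting \<beta> and
  \<open>q\<close> for \<alpha> and \<open>p\<close> and reversing the signs of the variations of
  \<open>u\<close> and \<open>x\<close>, up to a sign for some \<open>l\<close>.\<close>

definition J_val :: "real \<Rightarrow> nat \<Rightarrow> real \<Rightarrow> real \<Rightarrow> real \<Rightarrow> real \<Rightarrow> real \<Rightarrow> real \<Rightarrow> real \<Rightarrow> real \<Rightarrow> real \<Rightarrow> real" where
  "J_val \<gamma> l \<tau> \<alpha> p \<Xi> U A P X T =
     (if l = 1 then p * (X + wave_speed \<gamma> \<tau> * T)
      else if l = 2 then p * \<Xi>
      else if l = 3 then p * U
      else if l = 4 then P * sin (\<alpha> / 2) + 1 / 2 * p * cos (\<alpha> / 2) * A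
      else if l = 5 then 1 / 2 * p * A - 2 * mu \<gamma> \<tau> * T * p * (sin (\<alpha> / 2))\<^sup>2
      else if l = 6 then P + mu \<gamma> \<tau> * p * T * sin \<alpha>
      else 0)"

text \<open>The lines \<open>X = const\<close> of a family of charts, with \<open>y\<close> in the
  place of \<open>Y\<close>; primes are derivatives in \<theta>. Along such a line the system
  prescribes no derivative of \<beta> and \<open>q\<close>, and none is postulated here. The
  reflected lines \<open>Y = const\<close> satisfy the same axioms.\<close>

locale char_line =
  fixes \<gamma> :: real and S :: "(real \<times> real) set"
    and tau u al be p q x t :: "real \<Rightarrow> real \<Rightarrow> real"
    and tau' u' al' be' p' q' x' t' :: "real \<Rightarrow> real \<Rightarrow> real"
  assumes open_S: "open S"
    and tau_pos: "\<And>\<theta> y. (\<theta>, y) \<in> S \<Longrightarrow> 0 < tau \<theta> y"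
    and DERIV_\<theta> [derivative_intros]: "\<And>\<theta> y. (\<theta>, y) \<in> S \<Longrightarrow> ((\<lambda>\<theta>. tau \<theta> y) has_real_derivative tau' \<theta> y) (at \<theta>)"
      "\<And>\<theta> y. (\<theta>, y) \<in> S \<Longrightarrow> ((\<lambda>\<theta>. u \<theta> y) has_real_derivative u' \<theta> y) (at \<theta>)"
      "\<And>\<theta> y. (\<theta>, y) \<in> S \<Longrightarrow> ((\<lambda>\<theta>. al \<theta> y) has_real_derivative al' \<theta> y) (at \<theta>)"
      "\<And>\<theta> y. (\<theta>, y) \<in> S \<Longrightarrow> ((\<lambda>\<theta>. be \<theta> y) has_real_derivative be' \<theta> y) (at \<theta>)"
      "\<And>\<theta> y. (\<theta>, y) \<in> S \<Longrightarrow> ((\<lambda>\<theta>. p \<theta> y) has_real_derivative p' \<theta> y) (at \<theta>)"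
      "\<And>\<theta> y. (\<theta>, y) \<in> S \<Longrightarrow> ((\<lambda>\<theta>. q \<theta> y) has_real_derivative q' \<theta> y) (at \<theta>)"
      "\<And>\<theta> y. (\<theta>, y) \<in> S \<Longrightarrow> ((\<lambda>\<theta>. x \<theta> y) has_real_derivative x' \<theta> y) (at \<theta>)"
      "\<And>\<theta> y. (\<theta>, y) \<in> S \<Longrightarrow> ((\<lambda>\<theta>. t \<theta> y) has_real_derivative t' \<theta> y) (at \<theta>)"
    and cont: "continuous_on S (\<lambda>(\<theta>, y). tau \<theta> y)" "continuous_on S (\<lambda>(\<theta>, y). al \<theta> y)"
      "continuous_on S (\<lambda>(\<theta>, y). be \<theta> y)" "continuous_on S (\<lambda>(\<theta>, y). p \<theta> y)"
      "continuous_on S (\<lambda>(\<theta>, y). q \<theta> y)"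
    and cont': "continuous_on S (\<lambda>(\<theta>, y). tau' \<theta> y)" "continuous_on S (\<lambda>(\<theta>, y). al' \<theta> y)"
      "continuous_on S (\<lambda>(\<theta>, y). be' \<theta> y)" "continuous_on S (\<lambda>(\<theta>, y). p' \<theta> y)"
      "continuous_on S (\<lambda>(\<theta>, y). q' \<theta> y)"
    and DERIV_al: "\<And>\<theta> y. (\<theta>, y) \<in> S \<Longrightarrow> (al \<theta> has_real_derivative
       2 * kap \<gamma> (tau \<theta> y) * q \<theta> y * sin (al \<theta> y / 2) * sin ((al \<theta> y - be \<theta> y) / 2)) (at y)"
    and DERIV_p: "\<And>\<theta> y. (\<theta>, y) \<in> S \<Longrightarrow> (p \<theta> has_real_derivative
       kap \<gamma> (tau \<theta> y) * p \<theta> y * q \<theta> y * cos (al \<theta> y / 2) * sin ((be \<theta> y - al \<theta> y) / 2)) (at y)"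
    and DERIV_tau: "\<And>\<theta> y. (\<theta>, y) \<in> S \<Longrightarrow> (tau \<theta> has_real_derivative
       1 / (2 * wave_speed \<gamma> (tau \<theta> y)) * q \<theta> y * sin (be \<theta> y / 2)) (at y)"
    and DERIV_u: "\<And>\<theta> y. (\<theta>, y) \<in> S \<Longrightarrow> (u \<theta> has_real_derivative
       - 1 / 2 * q \<theta> y * sin (be \<theta> y / 2)) (at y)"
    and DERIV_t: "\<And>\<theta> y. (\<theta>, y) \<in> S \<Longrightarrow> (t \<theta> has_real_derivative
       1 / (2 * wave_speed \<gamma> (tau \<theta> y)) * q \<theta> y * cos (be \<theta> y / 2)) (at y)"
    and DERIV_x: "\<And>\<theta> y. (\<theta>, y) \<in> S \<Longrightarrow> (x \<theta> has_real_derivative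
       - 1 / 2 * q \<theta> y * cos (be \<theta> y / 2)) (at y)"
begin

lemma cs_nz: "(\<theta>, y) \<in> S \<Longrightarrow> wave_speed \<gamma> (tau \<theta> y) \<noteq> 0"
  using wave_speed_pos tau_pos by (metis less_irrefl)

lemmas cont_split = cont[unfolded case_prod_beta'] cont'[unfolded case_prod_beta']

lemma tau_pos': "z \<in> S \<Longrightarrow> 0 < tau (fst z) (snd z)"
  using tau_pos[of "fst z" "snd z"] by simp

lemma cs_nz': "z \<in> S \<Longrightarrow> wave_speed \<gamma> (tau (fst z) (snd z)) \<noteq> 0"
  using cs_nz[of "fst z" "snd z"] by simp

abbreviation J1 :: "nat \<Rightarrow> real \<Rightarrow> real \<Rightarrow> real" where
  "J1 l \<theta> y \<equiv> J_val \<gamma> l (tau \<theta> y) (al \<theta> y) (p \<theta> y) (tau' \<theta> y) (u' \<theta> y) (al' \<theta> y) (p' \<theta> y)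
     (x' \<theta> y) (t' \<theta> y)"

abbreviation J2 :: "nat \<Rightarrow> real \<Rightarrow> real \<Rightarrow> real" where
  "J2 l \<theta> y \<equiv> J_val \<gamma> l (tau \<theta> y) (be \<theta> y) (q \<theta> y) (tau' \<theta> y) (- u' \<theta> y) (be' \<theta> y) (q' \<theta> y)
     (- x' \<theta> y) (t' \<theta> y)"

context
  fixes \<theta> y assumes in_S: "(\<theta>, y) \<in> S"
begin

text \<open>Differentiating the right-hand side of the equation for \<alpha> in \<theta> gives the
  linearised equation through \<open>mixed_derivative\<close>. The other five equations are
  linearised in the same way.\<close>

lemma DERIV_al': "(al' \<theta> has_real_derivative
    2 * kap1 \<gamma> (tau \<theta> y) * tau' \<theta> y * q \<theta> y * sin (al \<theta> y / 2) * sin ((al \<theta> y - be \<theta> y) / 2)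
    + 2 * kap \<gamma> (tau \<theta> y) * q' \<theta> y * sin (al \<theta> y / 2) * sin ((al \<theta> y - be \<theta> y) / 2)
    + kap \<gamma> (tau \<theta> y) * q \<theta> y * cos (al \<theta> y / 2) * al' \<theta> y * sin ((al \<theta> y - be \<theta> y) / 2)
    + kap \<gamma> (tau \<theta> y) * q \<theta> y * sin (al \<theta> y / 2) * cos ((al \<theta> y - be \<theta> y) / 2) * (al' \<theta> y - be' \<theta> y))
    (at y)"
  (is "(_ has_real_derivative ?H1 \<theta> y) _")
proof (rule mixed_derivative[where ?H1.0 = ?H1, OF open_S in_S DERIV_al DERIV_\<theta>(3)], assumption, assumption, goal_cases)
  case (1 \<theta> y)
  note nz = cs_nz[OF 1]
  show ?case
    by (rule derivative_eq_intros 1 refl tau_pos[OF 1] nz | simp add: nz)+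
       (simp add: algebra_simps add_divide_distrib diff_divide_distrib)
qed (unfold case_prod_beta', (intro continuous_intros cont_split tau_pos'; simp add: cs_nz')+)

lemma DERIV_p': "(p' \<theta> has_real_derivative
    kap1 \<gamma> (tau \<theta> y) * tau' \<theta> y * p \<theta> y * q \<theta> y * cos (al \<theta> y / 2) * sin ((be \<theta> y - al \<theta> y) / 2)
    + kap \<gamma> (tau \<theta> y) * p' \<theta> y * q \<theta> y * cos (al \<theta> y / 2) * sin ((be \<theta> y - al \<theta> y) / 2)
    + kap \<gamma> (tau \<theta> y) * p \<theta> y * q' \<theta> y * cos (al \<theta> y / 2) * sin ((be \<theta> y - al \<theta> y) / 2)
    - 1 / 2 * kap \<gamma> (tau \<theta> y) * p \<theta> y * q \<theta> y * sin (al \<theta> y / 2) * al' \<theta> y * sin ((be \<theta> y - al \<theta> y) / 2)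
    + 1 / 2 * kap \<gamma> (tau \<theta> y) * p \<theta> y * q \<theta> y * cos (al \<theta> y / 2) * cos ((be \<theta> y - al \<theta> y) / 2) * (be' \<theta> y - al' \<theta> y))
    (at y)"
  (is "(_ has_real_derivative ?H1 \<theta> y) _")
proof (rule mixed_derivative[where ?H1.0 = ?H1, OF open_S in_S DERIV_p DERIV_\<theta>(5)], assumption, assumption, goal_cases)
  case (1 \<theta> y)
  note nz = cs_nz[OF 1]
  show ?case
    by (rule derivative_eq_intros 1 refl tau_pos[OF 1] nz | simp add: nz)+
       (simp add: algebra_simps add_divide_distrib diff_divide_distrib)
qed (unfold case_prod_beta', (intro continuous_intros cont_split tau_pos'; simp add: cs_nz')+)

text \<open>The bracket is the variation of \<open>q sin(\<beta>/2)\<close>, that is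
  \<open>J2 4\<close>; the last term is the variation of the factor
  \<open>1 / (2 * c)\<close>.\<close>

lemma DERIV_tau': "(tau' \<theta> has_real_derivative
    1 / (2 * wave_speed \<gamma> (tau \<theta> y)) * (q' \<theta> y * sin (be \<theta> y / 2) + 1 / 2 * q \<theta> y * cos (be \<theta> y / 2) * be' \<theta> y)
    - 2 * kap \<gamma> (tau \<theta> y) * tau' \<theta> y * q \<theta> y * sin (be \<theta> y / 2)) (at y)"
  (is "(_ has_real_derivative ?H1 \<theta> y) _")
proof (rule mixed_derivative[where ?H1.0 = ?H1, OF open_S in_S DERIV_tau DERIV_\<theta>(1)], assumption, assumption, goal_cases)
  case (1 \<theta> y)
  note nz = cs_nz[OF 1]
  show ?case
    by (rule derivative_eq_intros 1 refl tau_pos[OF 1] nz | simp add: nz)+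
       (simp add: nz kap_def divide_simps power2_eq_square, simp add: algebra_simps)
qed (unfold case_prod_beta', (intro continuous_intros cont_split tau_pos'; simp add: cs_nz')+)

lemma DERIV_t': "(t' \<theta> has_real_derivative
    1 / (2 * wave_speed \<gamma> (tau \<theta> y)) * (q' \<theta> y * cos (be \<theta> y / 2) - 1 / 2 * q \<theta> y * sin (be \<theta> y / 2) * be' \<theta> y)
    - 2 * kap \<gamma> (tau \<theta> y) * tau' \<theta> y * q \<theta> y * cos (be \<theta> y / 2)) (at y)"
  (is "(_ has_real_derivative ?H1 \<theta> y) _")
proof (rule mixed_derivative[where ?H1.0 = ?H1, OF open_S in_S DERIV_t DERIV_\<theta>(8)], assumption, assumption, goal_cases)
  case (1 \<theta> y)
  note nz = cs_nz[OF 1]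
  show ?case
    by (rule derivative_eq_intros 1 refl tau_pos[OF 1] nz | simp add: nz)+
       (simp add: nz kap_def divide_simps power2_eq_square, simp add: algebra_simps)
qed (unfold case_prod_beta', (intro continuous_intros cont_split tau_pos'; simp add: cs_nz')+)

lemma DERIV_u': "(u' \<theta> has_real_derivative
    - 1 / 2 * (q' \<theta> y * sin (be \<theta> y / 2) + 1 / 2 * q \<theta> y * cos (be \<theta> y / 2) * be' \<theta> y)) (at y)"
  (is "(_ has_real_derivative ?H1 \<theta> y) _")
proof (rule mixed_derivative[where ?H1.0 = ?H1, OF open_S in_S DERIV_u DERIV_\<theta>(2)], assumption, assumption, goal_cases)
  case (1 \<theta> y)
  note nz = cs_nz[OF 1]
  show ?case
    by (rule derivative_eq_intros 1 refl tau_pos[OF 1] nz | simp add: nz)+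
       (simp add: algebra_simps add_divide_distrib diff_divide_distrib)
qed (unfold case_prod_beta', (intro continuous_intros cont_split tau_pos'; simp add: cs_nz')+)

lemma DERIV_x': "(x' \<theta> has_real_derivative
    - 1 / 2 * (q' \<theta> y * cos (be \<theta> y / 2) - 1 / 2 * q \<theta> y * sin (be \<theta> y / 2) * be' \<theta> y)) (at y)"
  (is "(_ has_real_derivative ?H1 \<theta> y) _")
proof (rule mixed_derivative[where ?H1.0 = ?H1, OF open_S in_S DERIV_x DERIV_\<theta>(7)], assumption, assumption, goal_cases)
  case (1 \<theta> y)
  note nz = cs_nz[OF 1]
  show ?case
    by (rule derivative_eq_intros 1 refl tau_pos[OF 1] nz | simp add: nz)+
       (simp add: algebra_simps add_divide_distrib diff_divide_distrib)
qed (unfold case_prod_beta', (intro continuous_intros cont_split tau_pos'; simp add: cs_nz')+)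

text \<open>Along the line \<open>x\<close> and \<open>t\<close> satisfy
  \<open>x_Y = - c t_Y\<close>, so the terms with \<open>q'\<close> and \<open>be'\<close> cancel in
  the variation of \<open>x + c t\<close>. What is left comes from the variation of
  \<open>c\<close>, from its change along the line and from the derivative of
  \<open>p\<close>.\<close>

lemma DERIV_J1_1: "(J1 1 \<theta> has_real_derivative
   (kap \<gamma> (tau \<theta> y) * cos (al \<theta> y / 2) * sin ((be \<theta> y - al \<theta> y) / 2)) * (q \<theta> y * J1 1 \<theta> y)
   + (2 * mu \<gamma> (tau \<theta> y) * sin (be \<theta> y / 2)) * (p \<theta> y * q \<theta> y * t' \<theta> y)
   - (2 * mu \<gamma> (tau \<theta> y) * cos (be \<theta> y / 2)) * (p \<theta> y * q \<theta> y * tau' \<theta> y)) (at y)"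
  unfolding J_val_def[abs_def] using cs_nz[OF in_S]
  apply simp
  by ((rule derivative_eq_intros DERIV_p[OF in_S] DERIV_x' DERIV_t' DERIV_tau[OF in_S] refl tau_pos[OF in_S] | simp)+,
     simp add: kap_def mu_def divide_simps power2_eq_square, (simp add: algebra_simps)?)

text \<open>The variation of \<open>q sin(\<beta>/2)\<close> enters only as a whole, as
  \<open>J2 4\<close>, and never through \<open>q'\<close> and \<open>be'\<close> separately. This
  closes the system of the first four densities.\<close>

lemma DERIV_J1_2: "(J1 2 \<theta> has_real_derivative
   (kap \<gamma> (tau \<theta> y) * cos (al \<theta> y / 2) * sin ((be \<theta> y - al \<theta> y) / 2)) * (p \<theta> y * q \<theta> y * tau' \<theta> y)
   + (1 / (2 * wave_speed \<gamma> (tau \<theta> y))) * (p \<theta> y * J2 4 \<theta> y)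
   - (2 * kap \<gamma> (tau \<theta> y) * sin (be \<theta> y / 2)) * (p \<theta> y * q \<theta> y * tau' \<theta> y)) (at y)"
  unfolding J_val_def[abs_def] using cs_nz[OF in_S]
  apply simp
  by ((rule derivative_eq_intros DERIV_p[OF in_S] DERIV_tau' refl | simp)+,
     simp add: divide_simps, (simp add: algebra_simps)?)

lemma DERIV_J1_3: "(J1 3 \<theta> has_real_derivative
   (kap \<gamma> (tau \<theta> y) * cos (al \<theta> y / 2) * sin ((be \<theta> y - al \<theta> y) / 2)) * (q \<theta> y * J1 3 \<theta> y)
   - 1 / 2 * (p \<theta> y * J2 4 \<theta> y)) (at y)"
  unfolding J_val_def[abs_def]
  apply simp
  by ((rule derivative_eq_intros DERIV_p[OF in_S] DERIV_u' refl | simp)+,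
     (simp add: algebra_simps)?)

lemma sin_diff_swap: "sin ((a - b) / 2) = - sin ((b - a) / 2)" "cos ((a - b) / 2) = cos ((b - a) / 2)"
  for a b :: real
  by (metis minus_diff_eq minus_divide_left sin_minus, metis minus_diff_eq minus_divide_left cos_minus)

text \<open>\<open>J\<^sub>4 = 2 \<partial>\<^sub>\<theta> u\<^sub>X\<close> is constant because \<open>u\<^sub>X\<^sub>Y = 0\<close>.\<close>

lemma DERIV_J1_4: "(J1 4 \<theta> has_real_derivative 0) (at y)"
  unfolding J_val_def[abs_def]
  apply simp
  by ((rule derivative_eq_intros DERIV_al[OF in_S] DERIV_p[OF in_S] DERIV_al' DERIV_p' refl | simp)+,
     simp add: sin_diff_swap[of "al \<theta> y"] divide_simps, (simp add: algebra_simps)?)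

text \<open>The derivative is expanded into twelve monomials, each a bounded coefficient times a
  product with exactly one variation, so that it can be estimated term by term.\<close>

lemma DERIV_J1_5: "(J1 5 \<theta> has_real_derivative
   (1 / 2 * kap \<gamma> (tau \<theta> y) * cos (al \<theta> y / 2) * sin ((be \<theta> y - al \<theta> y) / 2)) * (p \<theta> y * q \<theta> y * al' \<theta> y)
   + (kap1 \<gamma> (tau \<theta> y) * sin (al \<theta> y / 2) * sin ((al \<theta> y - be \<theta> y) / 2)) * (p \<theta> y * q \<theta> y * tau' \<theta> y)
   + (kap \<gamma> (tau \<theta> y) * sin (al \<theta> y / 2) * sin ((al \<theta> y - be \<theta> y) / 2)) * (p \<theta> y * q' \<theta> y)
   + (1 / 2 * kap \<gamma> (tau \<theta> y) * cos (al \<theta> y / 2) * sin ((al \<theta> y - be \<theta> y) / 2)) * (p \<theta> y * q \<theta> y * al' \<theta> y)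
   + (1 / 2 * kap \<gamma> (tau \<theta> y) * sin (al \<theta> y / 2) * cos ((al \<theta> y - be \<theta> y) / 2)) * (p \<theta> y * q \<theta> y * al' \<theta> y)
   + (- (1 / 2) * kap \<gamma> (tau \<theta> y) * sin (al \<theta> y / 2) * cos ((al \<theta> y - be \<theta> y) / 2)) * (p \<theta> y * q \<theta> y * be' \<theta> y)
   + (- 2 * (mu1 \<gamma> (tau \<theta> y) * (1 / (2 * wave_speed \<gamma> (tau \<theta> y)))) * sin (be \<theta> y / 2) * (sin (al \<theta> y / 2))\<^sup>2) * (p \<theta> y * q \<theta> y * t' \<theta> y)
   + (- 2 * (mu \<gamma> (tau \<theta> y) * (1 / (2 * wave_speed \<gamma> (tau \<theta> y)))) * cos (be \<theta> y / 2) * (sin (al \<theta> y / 2))\<^sup>2) * (p \<theta> y * q' \<theta> y)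
   + (1 * (mu \<gamma> (tau \<theta> y) * (1 / (2 * wave_speed \<gamma> (tau \<theta> y)))) * sin (be \<theta> y / 2) * (sin (al \<theta> y / 2))\<^sup>2) * (p \<theta> y * q \<theta> y * be' \<theta> y)
   + (4 * (mu \<gamma> (tau \<theta> y) * kap \<gamma> (tau \<theta> y)) * cos (be \<theta> y / 2) * (sin (al \<theta> y / 2))\<^sup>2) * (p \<theta> y * q \<theta> y * tau' \<theta> y)
   + (- 2 * (mu \<gamma> (tau \<theta> y) * kap \<gamma> (tau \<theta> y)) * cos (al \<theta> y / 2) * sin ((be \<theta> y - al \<theta> y) / 2) * (sin (al \<theta> y / 2))\<^sup>2) * (p \<theta> y * q \<theta> y * t' \<theta> y)
   + (- 4 * (mu \<gamma> (tau \<theta> y) * kap \<gamma> (tau \<theta> y)) * cos (al \<theta> y / 2) * sin ((al \<theta> y - be \<theta> y) / 2) * (sin (al \<theta> y / 2))\<^sup>2) * (p \<theta> y * q \<theta> y * t' \<theta> y))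
   (at y)"
  unfolding J_val_def[abs_def] using cs_nz[OF in_S]
  apply simp
  by ((rule derivative_eq_intros DERIV_al[OF in_S] DERIV_p[OF in_S] DERIV_tau[OF in_S] DERIV_al' DERIV_p' DERIV_t' tau_pos[OF in_S] refl | simp)+,
     simp add: sin_diff_swap[of "al \<theta> y"] power2_eq_square divide_simps, (simp add: algebra_simps)?)

lemma DERIV_J1_6: "(J1 6 \<theta> has_real_derivative
   (kap1 \<gamma> (tau \<theta> y) * cos (al \<theta> y / 2) * sin ((be \<theta> y - al \<theta> y) / 2)) * (p \<theta> y * q \<theta> y * tau' \<theta> y)
   + (kap \<gamma> (tau \<theta> y) * cos (al \<theta> y / 2) * sin ((be \<theta> y - al \<theta> y) / 2)) * (q \<theta> y * p' \<theta> y)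
   + (kap \<gamma> (tau \<theta> y) * cos (al \<theta> y / 2) * sin ((be \<theta> y - al \<theta> y) / 2)) * (p \<theta> y * q' \<theta> y)
   + (- (1 / 2) * kap \<gamma> (tau \<theta> y) * sin (al \<theta> y / 2) * sin ((be \<theta> y - al \<theta> y) / 2)) * (p \<theta> y * q \<theta> y * al' \<theta> y)
   + (1 / 2 * kap \<gamma> (tau \<theta> y) * cos (al \<theta> y / 2) * cos ((be \<theta> y - al \<theta> y) / 2)) * (p \<theta> y * q \<theta> y * be' \<theta> y)
   + (- (1 / 2) * kap \<gamma> (tau \<theta> y) * cos (al \<theta> y / 2) * cos ((be \<theta> y - al \<theta> y) / 2)) * (p \<theta> y * q \<theta> y * al' \<theta> y)
   + (1 * (mu1 \<gamma> (tau \<theta> y) * (1 / (2 * wave_speed \<gamma> (tau \<theta> y)))) * sin (be \<theta> y / 2) * sin (al \<theta> y)) * (p \<theta> y * q \<theta> y * t' \<theta> y)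
   + (1 * (mu \<gamma> (tau \<theta> y) * kap \<gamma> (tau \<theta> y)) * cos (al \<theta> y / 2) * sin ((be \<theta> y - al \<theta> y) / 2) * sin (al \<theta> y)) * (p \<theta> y * q \<theta> y * t' \<theta> y)
   + (1 * (mu \<gamma> (tau \<theta> y) * (1 / (2 * wave_speed \<gamma> (tau \<theta> y)))) * cos (be \<theta> y / 2) * sin (al \<theta> y)) * (p \<theta> y * q' \<theta> y)
   + (- (1 / 2) * (mu \<gamma> (tau \<theta> y) * (1 / (2 * wave_speed \<gamma> (tau \<theta> y)))) * sin (be \<theta> y / 2) * sin (al \<theta> y)) * (p \<theta> y * q \<theta> y * be' \<theta> y)
   + (- 2 * (mu \<gamma> (tau \<theta> y) * kap \<gamma> (tau \<theta> y)) * cos (be \<theta> y / 2) * sin (al \<theta> y)) * (p \<theta> y * q \<theta> y * tau' \<theta> y)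
   + (2 * (mu \<gamma> (tau \<theta> y) * kap \<gamma> (tau \<theta> y)) * cos (al \<theta> y) * sin (al \<theta> y / 2) * sin ((al \<theta> y - be \<theta> y) / 2)) * (p \<theta> y * q \<theta> y * t' \<theta> y))
   (at y)"
  unfolding J_val_def[abs_def] using cs_nz[OF in_S]
  apply simp
  by ((rule derivative_eq_intros DERIV_al[OF in_S] DERIV_p[OF in_S] DERIV_tau[OF in_S] DERIV_p' DERIV_t' tau_pos[OF in_S] refl | simp)+,
     simp add: sin_diff_swap[of "al \<theta> y"] divide_simps, (simp add: algebra_simps)?)

text \<open>The products of a variation with \<open>p\<close> or \<open>q\<close> that occur in the
  derivatives are linear combinations of \<open>q * J1\<close> and \<open>p * J2\<close> with
  bounded coefficients. For \<open>l \<le> 4\<close> only densities of index at most four are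
  involved, hence the two admissible values of \<open>N\<close>.\<close>

lemma DERIV_J1_bound:
  assumes m: "coeff_bound \<gamma> m (tau \<theta> y)" and pq: "0 < p \<theta> y" "0 < q \<theta> y"
    and N: "N = 4 \<or> N = 6" and l: "l \<in> {1..N}"
  shows "\<exists>D. (J1 l \<theta> has_real_derivative D) (at y) \<and>
    \<bar>D\<bar> \<le> 500 * m ^ 4 * (q \<theta> y * (\<Sum>k = 1..N. \<bar>J1 k \<theta> y\<bar>) + p \<theta> y * (\<Sum>k = 1..N. \<bar>J2 k \<theta> y\<bar>))"
proof -
  define E where "E = q \<theta> y * (\<Sum>k = 1..N. \<bar>J1 k \<theta> y\<bar>) + p \<theta> y * (\<Sum>k = 1..N. \<bar>J2 k \<theta> y\<bar>)"
  define k k1 \<mu> \<mu>1 c where "k = kap \<gamma> (tau \<theta> y)" and "k1 = kap1 \<gamma> (tau \<theta> y)"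
    and "\<mu> = mu \<gamma> (tau \<theta> y)" and "\<mu>1 = mu1 \<gamma> (tau \<theta> y)" and "c = 1 / (2 * wave_speed \<gamma> (tau \<theta> y))"
  note defs = k_def k1_def \<mu>_def \<mu>1_def c_def
  have m1: "1 \<le> m" and bd: "\<bar>k\<bar> \<le> m" "\<bar>k1\<bar> \<le> m" "\<bar>\<mu>\<bar> \<le> m" "\<bar>\<mu>1\<bar> \<le> m" "\<bar>c\<bar> \<le> m"
    using m by (auto simp: coeff_bound_def defs)
  have "m * 1 \<le> m * m" using m1 by (intro mult_left_mono) auto
  then have m2: "m \<le> m\<^sup>2" "1 \<le> m\<^sup>2"
    using m1 unfolding power2_eq_square by linarith+
  have sums: "0 \<le> (\<Sum>k = 1..N. \<bar>J1 k \<theta> y\<bar>)" "0 \<le> (\<Sum>k = 1..N. \<bar>J2 k \<theta> y\<bar>)"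
    by (simp_all add: sum_nonneg)
  have E1: "\<bar>q \<theta> y * J1 i \<theta> y\<bar> \<le> E" and E2: "\<bar>p \<theta> y * J2 i \<theta> y\<bar> \<le> E" if "i \<in> {1..N}" for i
  proof -
    have "\<bar>J1 i \<theta> y\<bar> \<le> (\<Sum>k = 1..N. \<bar>J1 k \<theta> y\<bar>)" "\<bar>J2 i \<theta> y\<bar> \<le> (\<Sum>k = 1..N. \<bar>J2 k \<theta> y\<bar>)"
      using that by (auto intro: member_le_sum)
    then have "q \<theta> y * \<bar>J1 i \<theta> y\<bar> \<le> q \<theta> y * (\<Sum>k = 1..N. \<bar>J1 k \<theta> y\<bar>)"
      "p \<theta> y * \<bar>J2 i \<theta> y\<bar> \<le> p \<theta> y * (\<Sum>k = 1..N. \<bar>J2 k \<theta> y\<bar>)"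
      using pq by (auto intro: mult_left_mono)
    moreover have "0 \<le> q \<theta> y * (\<Sum>k = 1..N. \<bar>J1 k \<theta> y\<bar>)" "0 \<le> p \<theta> y * (\<Sum>k = 1..N. \<bar>J2 k \<theta> y\<bar>)"
      using pq sums by auto
    ultimately have "q \<theta> y * \<bar>J1 i \<theta> y\<bar> \<le> E" "p \<theta> y * \<bar>J2 i \<theta> y\<bar> \<le> E"
      unfolding E_def by linarith+
    then show "\<bar>q \<theta> y * J1 i \<theta> y\<bar> \<le> E" "\<bar>p \<theta> y * J2 i \<theta> y\<bar> \<le> E"
      using pq by (simp_all add: abs_mult)
  qed
  have E0: "0 \<le> E" using E1[OF l] by linarith
  define F where "F = 10 * m\<^sup>2 * E"
  have weak: "\<bar>z\<bar> \<le> F" if "\<bar>z\<bar> \<le> E" for z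
    using that mult_right_mono[OF m2(2) E0] E0 by (simp add: F_def)
  have in4: "{1, 2, 3, 4} \<subseteq> {1..N}" using N by auto
  have T: "\<bar>p \<theta> y * q \<theta> y * t' \<theta> y\<bar> \<le> 2 * m * E"
  proof -
    \<comment> \<open>The first densities of the two families contain \<open>x' + c t'\<close> and
      \<open>- x' + c t'\<close>, so their sum eliminates \<open>x'\<close> and isolates
      \<open>t'\<close>.\<close>
    have "p \<theta> y * q \<theta> y * t' \<theta> y = c * (q \<theta> y * J1 1 \<theta> y + p \<theta> y * J2 1 \<theta> y)"
      using cs_nz[OF in_S] by (simp add: J_val_def c_def field_simps)
    moreover have "\<bar>q \<theta> y * J1 1 \<theta> y + p \<theta> y * J2 1 \<theta> y\<bar> \<le> 2 * E"
      using E1[of 1] E2[of 1] in4 by (simp add: abs_if split: if_splits)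
    ultimately have "\<bar>p \<theta> y * q \<theta> y * t' \<theta> y\<bar> \<le> m * (2 * E)"
      using bd(5) m1 by (simp only: abs_mult) (intro mult_mono; simp)
    then show ?thesis by (simp only: mult_ac)
  qed
  have mE: "m * E \<le> m\<^sup>2 * E" "E \<le> m\<^sup>2 * E" using mult_right_mono[OF m2(1) E0] mult_right_mono[OF m2(2) E0] by auto
  have bT: "\<bar>p \<theta> y * q \<theta> y * t' \<theta> y\<bar> \<le> F"
    using T mE E0 by (simp add: F_def)
  have bX: "\<bar>p \<theta> y * q \<theta> y * tau' \<theta> y\<bar> \<le> F"
    using weak[OF E1[of 2]] in4 by (simp add: J_val_def mult_ac)
  have mT: "\<bar>\<mu> * s * (p \<theta> y * q \<theta> y * t' \<theta> y)\<bar> \<le> m * (2 * m * E)" if "\<bar>s\<bar> \<le> 1" for s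
  proof -
    have "\<bar>\<mu>\<bar> * \<bar>s\<bar> \<le> m * 1" using that bd(3) m1 by (intro mult_mono) auto
    then have "\<bar>\<mu> * s\<bar> * \<bar>p \<theta> y * q \<theta> y * t' \<theta> y\<bar> \<le> m * (2 * m * E)"
      using T m1 by (intro mult_mono) (auto simp: abs_mult)
    then show ?thesis by (simp add: abs_mult)
  qed
  have sin2: "\<bar>(sin a)\<^sup>2\<bar> \<le> 1" for a :: real
    by (simp add: abs_square_le_1)
  have b6: "\<bar>p \<theta> y * q \<theta> y * al' \<theta> y\<bar> \<le> 10 * m\<^sup>2 * E" "\<bar>p \<theta> y * q \<theta> y * be' \<theta> y\<bar> \<le> 10 * m\<^sup>2 * E"
    "\<bar>p \<theta> y * q' \<theta> y\<bar> \<le> 10 * m\<^sup>2 * E" "\<bar>q \<theta> y * p' \<theta> y\<bar> \<le> 10 * m\<^sup>2 * E" if "N = 6"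
  proof -
    have in6: "5 \<in> {1..N}" "6 \<in> {1..N}" using that by auto
    \<comment> \<open>The fifth and sixth densities are solved for the variations of the angles and
      of \<open>p\<close>, \<open>q\<close>; their correction terms contain only the product with
      \<open>t'\<close>, which is already bounded.\<close>
    have "p \<theta> y * q \<theta> y * al' \<theta> y = 2 * (q \<theta> y * J1 5 \<theta> y) + 4 * (\<mu> * (sin (al \<theta> y / 2))\<^sup>2 * (p \<theta> y * q \<theta> y * t' \<theta> y))"
      "p \<theta> y * q \<theta> y * be' \<theta> y = 2 * (p \<theta> y * J2 5 \<theta> y) + 4 * (\<mu> * (sin (be \<theta> y / 2))\<^sup>2 * (p \<theta> y * q \<theta> y * t' \<theta> y))"
      by (simp_all add: J_val_def \<mu>_def algebra_simps)
    moreover have "p \<theta> y * q' \<theta> y = p \<theta> y * J2 6 \<theta> y - \<mu> * sin (be \<theta> y) * (p \<theta> y * q \<theta> y * t' \<theta> y)"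
      "q \<theta> y * p' \<theta> y = q \<theta> y * J1 6 \<theta> y - \<mu> * sin (al \<theta> y) * (p \<theta> y * q \<theta> y * t' \<theta> y)"
      by (simp_all add: J_val_def \<mu>_def algebra_simps)
    ultimately show "\<bar>p \<theta> y * q \<theta> y * al' \<theta> y\<bar> \<le> 10 * m\<^sup>2 * E" "\<bar>p \<theta> y * q \<theta> y * be' \<theta> y\<bar> \<le> 10 * m\<^sup>2 * E"
      "\<bar>p \<theta> y * q' \<theta> y\<bar> \<le> 10 * m\<^sup>2 * E" "\<bar>q \<theta> y * p' \<theta> y\<bar> \<le> 10 * m\<^sup>2 * E"
      using E1[OF in6(1)] E2[OF in6(1)] E1[OF in6(2)] E2[OF in6(2)] mE
        mT[OF sin2[of "al \<theta> y / 2"]] mT[OF sin2[of "be \<theta> y / 2"]]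
        mT[OF abs_sin_le_one[of "al \<theta> y"]] mT[OF abs_sin_le_one[of "be \<theta> y"]]
      by (simp_all add: abs_le_iff power2_eq_square mult_ac)
  qed
  \<comment> \<open>Bound for one monomial: its numerical factor is at most 4, it contains at most
    two functions of \<tau>, each bounded by \<open>m\<close>, and the product with the variation is
    at most \<open>F\<close>.\<close>
  define G where "G = 4 * m\<^sup>2 * F"
  have G: "G = 40 * m ^ 4 * E" by (simp add: G_def F_def power2_eq_square power4_eq_xxxx)
  have tri: "\<bar>x + y\<bar> \<le> r + s" "\<bar>x - y\<bar> \<le> r + s" if "\<bar>x\<bar> \<le> r" "\<bar>y\<bar> \<le> s" for x y r s :: real
    using that by linarith+
  have trm: "\<bar>a * b\<bar> \<le> G" if "\<bar>a\<bar> \<le> 4 * m\<^sup>2" "\<bar>b\<bar> \<le> F" for a b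
    unfolding abs_mult G_def by (rule mult_mono) (use that in auto)
  have cf: "\<bar>a * b\<bar> \<le> 4 * m\<^sup>2" if "\<bar>a\<bar> \<le> 4 * m\<^sup>2" "\<bar>b\<bar> \<le> 1" for a b
    using mult_mono[OF that] by (simp add: abs_mult)
  have co: "\<bar>r * a\<bar> \<le> 4 * m\<^sup>2" if "\<bar>r\<bar> \<le> 4" "\<bar>a\<bar> \<le> m\<^sup>2" for r a
    unfolding abs_mult by (rule mult_mono) (use that in auto)
  have le: "\<bar>a\<bar> \<le> m\<^sup>2" if "\<bar>a\<bar> \<le> m" for a using that m2 by linarith
  have le2: "\<bar>a * b\<bar> \<le> m\<^sup>2" if "\<bar>a\<bar> \<le> m" "\<bar>b\<bar> \<le> m" for a b
    unfolding abs_mult power2_eq_square by (rule mult_mono) (use that in auto)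
  have ps: "\<bar>a\<bar> \<le> 4 * m\<^sup>2" if "\<bar>a\<bar> \<le> m" for a using le[OF that] m2 by linarith
  have cft: "\<bar>a * sin b\<bar> \<le> 4 * m\<^sup>2" "\<bar>a * cos b\<bar> \<le> 4 * m\<^sup>2" "\<bar>a * (sin b)\<^sup>2\<bar> \<le> 4 * m\<^sup>2"
    if "\<bar>a\<bar> \<le> 4 * m\<^sup>2" for a b
    by (rule cf[OF that abs_sin_le_one], rule cf[OF that abs_cos_le_one], rule cf[OF that sin2])
  \<comment> \<open>Twelve terms of size \<open>40 * m ^ 4 * E\<close> stay below
    \<open>500 * m ^ 4 * E\<close>. Derivatives with fewer terms are padded by
    \<open>0 \<le> G\<close>.\<close>
  have fin: "\<bar>D\<bar> \<le> 500 * m ^ 4 * E" if "\<bar>D\<bar> \<le> G + G + G + G + G + G + G + G + G + G + G + G" for D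
  proof -
    have "0 \<le> m ^ 4 * E" using E0 m1 by simp
    then show ?thesis using that unfolding G by linarith
  qed
  have G0: "0 \<le> G" unfolding G using E0 m1 by simp
  consider "l = 1" | "l = 2" | "l = 3" | "l = 4" | "l = 5" "N = 6" | "l = 6" "N = 6"
    using l N by force
  then have "\<exists>D. (J1 l \<theta> has_real_derivative D) (at y) \<and> \<bar>D\<bar> \<le> 500 * m ^ 4 * E"
  proof cases
    case 1
    have "\<bar>k * cos (al \<theta> y / 2) * sin ((be \<theta> y - al \<theta> y) / 2) * (q \<theta> y * J1 1 \<theta> y)
        + 2 * \<mu> * sin (be \<theta> y / 2) * (p \<theta> y * q \<theta> y * t' \<theta> y)
        - 2 * \<mu> * cos (be \<theta> y / 2) * (p \<theta> y * q \<theta> y * tau' \<theta> y)\<bar> \<le> G + G + G"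
      by (intro tri trm cft bT bX weak E1 ps[OF bd(1)] co le[OF bd(3)]) (use in4 in auto)
    note b = this
    show ?thesis unfolding 1
      by (intro exI conjI, rule DERIV_J1_1[folded defs], rule fin, rule order_trans[OF b]) (use G0 in linarith)
  next
    case 2
    have "\<bar>k * cos (al \<theta> y / 2) * sin ((be \<theta> y - al \<theta> y) / 2) * (p \<theta> y * q \<theta> y * tau' \<theta> y)
        + c * (p \<theta> y * J2 4 \<theta> y)
        - 2 * k * sin (be \<theta> y / 2) * (p \<theta> y * q \<theta> y * tau' \<theta> y)\<bar> \<le> G + G + G"
      by (intro tri trm cft bT bX weak E2 ps[OF bd(1)] ps[OF bd(5)] co le[OF bd(1)]) (use in4 in auto)
    note b = this
    show ?thesis unfolding 2
      by (intro exI conjI, rule DERIV_J1_2[folded defs], rule fin, rule order_trans[OF b]) (use G0 in linarith)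
  next
    case 3
    have "\<bar>1 / 2\<bar> \<le> 4 * m\<^sup>2" using m2 by simp
    then have "\<bar>k * cos (al \<theta> y / 2) * sin ((be \<theta> y - al \<theta> y) / 2) * (q \<theta> y * J1 3 \<theta> y)
        - 1 / 2 * (p \<theta> y * J2 4 \<theta> y)\<bar> \<le> G + G"
      by (intro tri trm cft weak E1 E2 ps[OF bd(1)]) (use in4 m1 in auto)
    note b = this
    show ?thesis unfolding 3
      by (intro exI conjI, rule DERIV_J1_3[folded defs], rule fin, rule order_trans[OF b]) (use G0 in linarith)
  next
    case 4
    then show ?thesis using DERIV_J1_4 E0 m1 by (intro exI[of _ 0]) simp
  next
    case 5
    have b: "\<bar>p \<theta> y * q \<theta> y * al' \<theta> y\<bar> \<le> F" "\<bar>p \<theta> y * q \<theta> y * be' \<theta> y\<bar> \<le> F"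
      "\<bar>p \<theta> y * q' \<theta> y\<bar> \<le> F" "\<bar>q \<theta> y * p' \<theta> y\<bar> \<le> F" using b6[OF 5(2)] unfolding F_def .
    show ?thesis unfolding 5(1)
      by (intro exI conjI, rule DERIV_J1_5[folded defs],
          intro fin tri trm cft bT bX b ps[OF bd(1)] ps[OF bd(2)] le[OF bd(1)] le2[OF bd(4,5)] le2[OF bd(3,5)] le2[OF bd(3,1)] co) auto
  next
    case 6
    have b: "\<bar>p \<theta> y * q \<theta> y * al' \<theta> y\<bar> \<le> F" "\<bar>p \<theta> y * q \<theta> y * be' \<theta> y\<bar> \<le> F"
      "\<bar>p \<theta> y * q' \<theta> y\<bar> \<le> F" "\<bar>q \<theta> y * p' \<theta> y\<bar> \<le> F" using b6[OF 6(2)] unfolding F_def .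
    show ?thesis unfolding 6(1)
      by (intro exI conjI, rule DERIV_J1_6[folded defs],
          intro fin tri trm cft bT bX b ps[OF bd(1)] ps[OF bd(2)] le[OF bd(1)] le2[OF bd(4,5)] le2[OF bd(3,5)] le2[OF bd(3,1)] co) auto
  qed
  then show ?thesis by (simp add: E_def)
qed

end

end

lemma continuous_on_compose_pair:
  assumes "continuous_on S (\<lambda>(x, y). f x y)" "continuous_on A g" "continuous_on A h"
    "\<And>z. z \<in> A \<Longrightarrow> (g z, h z) \<in> S"
  shows "continuous_on A (\<lambda>z. f (g z) (h z))"
proof -
  have "continuous_on A (\<lambda>z. case (g z, h z) of (x, y) \<Rightarrow> f x y)"
    by (rule continuous_on_compose2[OF assms(1)]) (use assms in \<open>auto intro: continuous_on_Pair\<close>)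
  then show ?thesis by simp
qed

section \<open>Strips labelled by characteristics\<close>

text \<open>All that is retained of characteristic coordinates: two labels that are continuous and
  monotone in position and time, and finite propagation speed \<open>cm\<close>. These properties
  persist under increasing homeomorphisms of the labels and up to the final time, where the labels
  may cease to be differentiable in \<open>x\<close>.\<close>

locale label_strip =
  fixes T cm :: real and Xf Yf :: "real \<Rightarrow> real \<Rightarrow> real"
  assumes T_pos: "0 < T" and cm_nonneg: "0 \<le> cm"
    and contX: "continuous_on (UNIV \<times> {0..T}) (\<lambda>(x, t). Xf x t)"
    and contY: "continuous_on (UNIV \<times> {0..T}) (\<lambda>(x, t). Yf x t)"
    and monoX: "\<And>x x' t. t \<in> {0..T} \<Longrightarrow> x < x' \<Longrightarrow> Xf x t < Xf x' t"
    and antiY: "\<And>x x' t. t \<in> {0..T} \<Longrightarrow> x < x' \<Longrightarrow> Yf x' t < Yf x t"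
    and timeX: "\<And>x s t. 0 \<le> s \<Longrightarrow> s < t \<Longrightarrow> t \<le> T \<Longrightarrow> Xf x s < Xf x t"
    and timeY: "\<And>x s t. 0 \<le> s \<Longrightarrow> s < t \<Longrightarrow> t \<le> T \<Longrightarrow> Yf x s < Yf x t"
    and coneX: "\<And>x s t. 0 \<le> s \<Longrightarrow> s \<le> t \<Longrightarrow> t \<le> T \<Longrightarrow> Xf x t \<le> Xf (x + cm * (t - s)) s"
    and coneY: "\<And>x s t. 0 \<le> s \<Longrightarrow> s \<le> t \<Longrightarrow> t \<le> T \<Longrightarrow> Yf x t \<le> Yf (x - cm * (t - s)) s"
begin

text \<open>The reflection \<open>x \<mapsto> - x\<close> exchanges the two labels, so every
  statement about \<open>dX\<close> has a counterpart about \<open>dY\<close>.\<close>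

lemma swap: "label_strip T cm (\<lambda>x t. Yf (- x) t) (\<lambda>x t. Xf (- x) t)"
proof
  show "continuous_on (UNIV \<times> {0..T}) (\<lambda>(x, t). Yf (- x) t)"
    unfolding case_prod_beta' by (rule continuous_on_compose_pair[OF contY]) (auto intro!: continuous_intros)
  show "continuous_on (UNIV \<times> {0..T}) (\<lambda>(x, t). Xf (- x) t)"
    unfolding case_prod_beta' by (rule continuous_on_compose_pair[OF contX]) (auto intro!: continuous_intros)
  show "Yf (- x) t \<le> Yf (- (x + cm * (t - s))) s" if "0 \<le> s" "s \<le> t" "t \<le> T" for x s t
    using coneY[OF that, of "- x"] by simp
  show "Xf (- x) t \<le> Xf (- (x - cm * (t - s))) s" if "0 \<le> s" "s \<le> t" "t \<le> T" for x s t
    using coneX[OF that, of "- x"] by simp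
qed (use T_pos cm_nonneg monoX antiY timeX timeY in auto)

text \<open>The labels occurring at time 0; by \<open>transport\<close> they are the labels of every
  other time as well. They need not fill the line, so functions along a level curve are cut off
  outside.\<close>

definition IX :: "real set" where "IX = range (\<lambda>x. Xf x 0)"
definition IY :: "real set" where "IY = range (\<lambda>x. Yf x 0)"

text \<open>The position at time \<open>t\<close> of the characteristic with label \<open>X\<close>.
  The level curve of time \<open>t\<close> is then the graph of \<open>yv t\<close>.\<close>

definition xi :: "real \<Rightarrow> real \<Rightarrow> real" where "xi t X = (THE x. Xf x t = X)"

definition yv :: "real \<Rightarrow> real \<Rightarrow> real" where "yv t X = Yf (xi t X) t"

definition strip_image :: "real \<Rightarrow> (real \<times> real) set" where
  "strip_image t = {(Xf x s, Yf x s) | x s. 0 \<le> s \<and> s \<le> t}"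

lemma monoX_iff: "t \<in> {0..T} \<Longrightarrow> Xf x t < Xf x' t \<longleftrightarrow> x < x'"
  using monoX by (metis less_asym linorder_less_linear)

lemma antiY_iff: "t \<in> {0..T} \<Longrightarrow> Yf x' t < Yf x t \<longleftrightarrow> x < x'"
  using antiY by (metis less_asym linorder_less_linear)

lemma inj_Xf: "t \<in> {0..T} \<Longrightarrow> Xf x t = Xf x' t \<longleftrightarrow> x = x'"
  using monoX by (metis less_irrefl linorder_less_linear)

lemma xi_Xf: "t \<in> {0..T} \<Longrightarrow> xi t (Xf x t) = x"
  unfolding xi_def by (rule the_equality) (auto simp: inj_Xf)

lemma cont_Xf: "t \<in> {0..T} \<Longrightarrow> continuous_on A (\<lambda>x. Xf x t)"
  by (rule continuous_on_compose_pair[OF contX]) auto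

text \<open>Monotonicity in time and the cone condition enclose the label between its values at two
  points of the other time level, and the intermediate value theorem finds it in between.
  Characteristics are thus followed, with speed at most \<open>cm\<close>, without solving a
  differential equation.\<close>

lemma transport:
  assumes "s \<in> {0..T}" "t \<in> {0..T}"
  shows "\<exists>x'. Xf x' s = Xf x t \<and> \<bar>x' - x\<bar> \<le> cm * \<bar>s - t\<bar>"
proof (cases "s \<le> t")
  case True
  have "Xf x s \<le> Xf x t" using timeX[of s t x] True assms by (cases "s = t") auto
  moreover have "Xf x t \<le> Xf (x + cm * (t - s)) s" using coneX True assms by simp
  ultimately obtain x' where "x \<le> x'" "x' \<le> x + cm * (t - s)" "Xf x' s = Xf x t"
    using IVT'[of "\<lambda>x. Xf x s" x "Xf x t" "x + cm * (t - s)"] cont_Xf[OF assms(1)] True cm_nonneg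
    by auto
  then show ?thesis using True by (intro exI[of _ x']) auto
next
  case False
  have "Xf x t \<le> Xf x s" using timeX[of t s x] False assms by auto
  moreover have "Xf (x - cm * (s - t)) s \<le> Xf x t"
    using coneX[of t s "x - cm * (s - t)"] False assms by simp
  ultimately obtain x' where "x - cm * (s - t) \<le> x'" "x' \<le> x" "Xf x' s = Xf x t"
    using IVT'[of "\<lambda>x. Xf x s" "x - cm * (s - t)" "Xf x t" x] cont_Xf[OF assms(1)] False cm_nonneg
    by auto
  then show ?thesis using False by (intro exI[of _ x']) auto
qed

lemma Xf_in_IX:
  assumes "t \<in> {0..T}"
  shows "Xf x t \<in> IX"
proof -
  obtain x' where "Xf x' 0 = Xf x t" using transport[of 0 t x] T_pos assms by auto
  then have "Xf x t = Xf x' 0" by simp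
  then show ?thesis by (simp add: IX_def)
qed

lemma Xf_xi:
  assumes "t \<in> {0..T}" "X \<in> IX"
  shows "Xf (xi t X) t = X"
proof -
  obtain x where x: "X = Xf x 0" using assms(2) by (auto simp: IX_def)
  obtain x' where x': "Xf x' t = X" using transport[of t 0 x] T_pos assms(1) x by auto
  then have "xi t X = x'" using xi_Xf[OF assms(1), of x'] by simp
  then show ?thesis using x' by simp
qed

lemma xi_lipschitz:
  assumes "X \<in> IX" "s \<in> {0..T}" "t \<in> {0..T}"
  shows "\<bar>xi s X - xi t X\<bar> \<le> cm * \<bar>s - t\<bar>"
proof -
  obtain x' where "Xf x' s = Xf (xi t X) t" "\<bar>x' - xi t X\<bar> \<le> cm * \<bar>s - t\<bar>"
    using transport[OF assms(2,3), of "xi t X"] by blast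
  then show ?thesis using assms Xf_xi xi_Xf by metis
qed

lemma cont_yv:
  assumes "X \<in> IX"
  shows "continuous_on {0..T} (\<lambda>t. yv t X)"
proof -
  have "cm-lipschitz_on {0..T} (\<lambda>t. xi t X)"
    using xi_lipschitz[OF assms] cm_nonneg by (auto simp: lipschitz_on_def dist_real_def)
  then have "continuous_on {0..T} (\<lambda>t. (xi t X, t))"
    by (intro continuous_on_Pair lipschitz_on_continuous_on continuous_on_id)
  then have "continuous_on {0..T} (\<lambda>t. case (xi t X, t) of (x, t) \<Rightarrow> Yf x t)"
    by (rule continuous_on_compose2[OF contY]) auto
  then show ?thesis by (simp add: yv_def)
qed

lemma yv_strict_mono:
  assumes "X \<in> IX" "0 \<le> s" "s < t" "t \<le> T"
  shows "yv s X < yv t X"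
proof -
  have s: "s \<in> {0..T}" and t: "t \<in> {0..T}" using assms by auto
  have "Xf (xi t X) s < Xf (xi s X) s"
    using timeX[OF assms(2-4), of "xi t X"] Xf_xi[OF s assms(1)] Xf_xi[OF t assms(1)] by simp
  then have "xi t X < xi s X" using monoX_iff[OF s] by simp
  then show ?thesis
    using antiY[OF s] timeY[OF assms(2-4), of "xi t X"] unfolding yv_def by fastforce
qed

lemma yv_antimono:
  assumes "t \<in> {0..T}" "X \<in> IX" "X' \<in> IX" "X < X'"
  shows "yv t X' < yv t X"
  using assms Xf_xi[OF assms(1)] monoX_iff[OF assms(1), of "xi t X" "xi t X'"] antiY[OF assms(1)]
  by (simp add: yv_def)

text \<open>For a fixed label \<open>X\<close> the other label increases continuously with time, so
  the slice is the interval swept between the times 0 and \<open>t\<close>. These slices are what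
  Fubini's theorem is applied to.\<close>

lemma strip_image_slice:
  assumes "X \<in> IX" "t \<in> {0..T}"
  shows "(X, Y) \<in> strip_image t \<longleftrightarrow> yv 0 X \<le> Y \<and> Y \<le> yv t X"
proof
  assume "(X, Y) \<in> strip_image t"
  then obtain x s where s: "X = Xf x s" "Y = Yf x s" "0 \<le> s" "s \<le> t" by (auto simp: strip_image_def)
  then have "Y = yv s X" using xi_Xf[of s x] assms by (simp add: yv_def)
  then show "yv 0 X \<le> Y \<and> Y \<le> yv t X"
    using s yv_strict_mono[OF assms(1)] assms(2)
    by (metis atLeastAtMost_iff less_eq_real_def order_trans)
next
  assume Y: "yv 0 X \<le> Y \<and> Y \<le> yv t X"
  obtain s where "0 \<le> s" "s \<le> t" "yv s X = Y"
    using IVT'[of "\<lambda>s. yv s X" 0 Y t] Y assms continuous_on_subset[OF cont_yv[OF assms(1)]] by auto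
  then show "(X, Y) \<in> strip_image t"
    using Xf_xi[OF _ assms(1), of s] assms(2) unfolding strip_image_def yv_def by force
qed

lemma strip_image_IX: "t \<in> {0..T} \<Longrightarrow> (X, Y) \<in> strip_image t \<Longrightarrow> X \<in> IX"
  using Xf_in_IX by (auto simp: strip_image_def)

lemma open_IX: "open IX"
proof (subst open_subopen, intro ballI)
  fix X assume "X \<in> IX"
  then obtain x where x: "X = Xf x 0" by (auto simp: IX_def)
  have 0: "(0::real) \<in> {0..T}" using T_pos by simp
  have "{Xf (x - 1) 0<..<Xf (x + 1) 0} \<subseteq> IX"
  proof
    fix Z assume "Z \<in> {Xf (x - 1) 0<..<Xf (x + 1) 0}"
    then have "\<exists>y. x - 1 \<le> y \<and> y \<le> x + 1 \<and> Xf y 0 = Z"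
      using cont_Xf[OF 0] by (intro IVT') auto
    then show "Z \<in> IX" by (auto simp: IX_def)
  qed
  moreover have "X \<in> {Xf (x - 1) 0<..<Xf (x + 1) 0}"
    using x monoX[OF 0, of "x - 1" x] monoX[OF 0, of x "x + 1"] by simp
  ultimately show "\<exists>V. open V \<and> X \<in> V \<and> V \<subseteq> IX"
    by (intro exI[of _ "{Xf (x - 1) 0<..<Xf (x + 1) 0}"]) simp
qed

section \<open>Truncated domains and the monotone flux\<close>

definition region :: "real \<Rightarrow> real \<Rightarrow> real \<Rightarrow> (real \<times> real) set" where
  "region t xa xb = {z \<in> strip_image t. fst z \<le> Xf xa 0 \<and> snd z \<le> Yf xb 0}"

text \<open>The region is bounded laterally by the characteristics issuing from \<open>xa\<close>
  and \<open>xb\<close>, hence is a domain of determinacy. Since both labels increase in time, its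
  points have positions in \<open>{xb..xa}\<close>, and it is a closed part of the image of a
  compact rectangle.\<close>

lemma compact_region:
  assumes t: "t \<in> {0..T}"
  shows "compact (region t xa xb)"
proof -
  define f where "f = (\<lambda>(x, s). (Xf x s, Yf x s))"
  define K where "K = {xb..xa} \<times> {0..t}"
  have K: "compact K" "K \<subseteq> UNIV \<times> {0..T}" using t by (auto simp: K_def compact_Times)
  have cf: "continuous_on K f"
    using continuous_on_subset[OF contX K(2)] continuous_on_subset[OF contY K(2)]
    by (auto simp: f_def case_prod_beta' intro!: continuous_on_Pair)
  have "closed {z::real \<times> real. fst z \<le> Xf xa 0 \<and> snd z \<le> Yf xb 0}"
    by (intro closed_Collect_conj closed_Collect_le continuous_intros)
  then have "compact ({z. fst z \<le> Xf xa 0 \<and> snd z \<le> Yf xb 0} \<inter> f ` K)"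
    using compact_continuous_image[OF cf K(1)] by (rule closed_Int_compact)
  moreover have "region t xa xb = {z. fst z \<le> Xf xa 0 \<and> snd z \<le> Yf xb 0} \<inter> f ` K"
  proof
    show "region t xa xb \<subseteq> {z. fst z \<le> Xf xa 0 \<and> snd z \<le> Yf xb 0} \<inter> f ` K"
    proof
      fix z assume z: "z \<in> region t xa xb"
      then obtain x s where xs: "z = (Xf x s, Yf x s)" "0 \<le> s" "s \<le> t"
        by (auto simp: region_def strip_image_def)
      have "Xf x 0 \<le> Xf x s" "Yf x 0 \<le> Yf x s"
        using xs t timeX[of 0 s x] timeY[of 0 s x] by (cases "s = 0"; force)+
      then have "Xf x 0 \<le> Xf xa 0" "Yf x 0 \<le> Yf xb 0" using z xs by (auto simp: region_def)
      then have x: "x \<le> xa" "xb \<le> x" using monoX_iff[of 0 xa x] antiY_iff[where t = 0 and x' = xb and x = x] T_pos by force+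
      show "z \<in> {z. fst z \<le> Xf xa 0 \<and> snd z \<le> Yf xb 0} \<inter> f ` K"
      proof -
        have "z = f (x, s)" "(x, s) \<in> K" using xs x by (auto simp: f_def K_def)
        then show ?thesis using z by (auto simp: region_def)
      qed
    qed
    show "{z. fst z \<le> Xf xa 0 \<and> snd z \<le> Yf xb 0} \<inter> f ` K \<subseteq> region t xa xb"
    proof
      fix z assume z: "z \<in> {z. fst z \<le> Xf xa 0 \<and> snd z \<le> Yf xb 0} \<inter> f ` K"
      then obtain x s where "z = (Xf x s, Yf x s)" "0 \<le> s" "s \<le> t" by (auto simp: f_def K_def)
      then have "z \<in> strip_image t" unfolding strip_image_def by blast
      then show "z \<in> region t xa xb" using z by (simp add: region_def)
    qed
  qed
  ultimately show ?thesis by simp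
qed

text \<open>The level curve is a monotone graph, which gives measurability even at the final
  time.\<close>

lemma measurable_yv:
  assumes t: "t \<in> {0..T}"
  shows "(\<lambda>X. if X \<in> IX then yv t X else 0) \<in> borel_measurable borel"
proof -
  have "mono_on IX (\<lambda>X. - yv t X)"
    using yv_antimono[OF t] by (force intro!: mono_onI simp: order_le_less)
  then have "(\<lambda>X. - yv t X) \<in> borel_measurable (restrict_space borel IX)"
    by (rule borel_measurable_mono_on_fnc)
  then have m: "yv t \<in> borel_measurable (restrict_space borel IX)"
    by simp
  have "(\<lambda>X. indicator IX X *\<^sub>R yv t X) \<in> borel_measurable borel"
    using m open_IX by (subst (asm) borel_measurable_restrict_space_iff) auto
  then show ?thesis by (rule measurable_cong[THEN iffD1, rotated]) (auto simp: indicator_def)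
qed

lemma finite_yv_preimage:
  assumes t: "t \<in> {0..T}" and "finite N"
  shows "finite {X \<in> IX. yv t X \<in> N}"
proof -
  have "inj_on (yv t) IX"
    using yv_antimono[OF t] by (intro inj_onI) (metis less_irrefl linorder_less_linear)
  then show ?thesis using finite_vimage_IntI[OF assms(2), of "yv t" IX] by (simp add: vimage_def Int_def conj_commute)
qed

lemma AE_yv_avoids:
  assumes t: "t \<in> {0..T}" and N: "finite N"
  shows "AE X in lborel. X \<notin> N \<and> (X \<in> IX \<longrightarrow> yv t X \<notin> N)"
proof -
  have "finite (N \<union> {X \<in> IX. yv t X \<in> N})" using finite_yv_preimage[OF t N] N by simp
  then have "AE X in lborel. X \<notin> N \<union> {X \<in> IX. yv t X \<in> N}"
    by (intro AE_not_in countable_imp_null_set_lborel countable_finite)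
  then show ?thesis by eventually_elim auto
qed

lemma measurable_graph:
  assumes t: "t \<in> {0..T}" and e: "e \<in> borel_measurable (borel :: (real \<times> real) measure)"
  shows "(\<lambda>X. if X \<in> IX then e (X, yv t X) else c) \<in> borel_measurable borel"
proof -
  have "IX \<in> sets borel" using open_IX by simp
  moreover have "(\<lambda>X. (X, if X \<in> IX then yv t X else 0)) \<in> borel_measurable borel"
    by (intro borel_measurable_Pair measurable_yv[OF t]) simp
  then have "(\<lambda>X. e (X, if X \<in> IX then yv t X else 0)) \<in> borel_measurable borel"
    by (rule measurable_compose[OF _ e])
  ultimately have "(\<lambda>X. if X \<in> IX then e (X, if X \<in> IX then yv t X else 0) else c) \<in> borel_measurable borel"
    by (intro measurable_If_set) auto
  then show ?thesis by (rule measurable_cong[THEN iffD1, rotated]) auto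
qed

lemma measurable_graph_trunc:
  assumes t: "t \<in> {0..T}" and e: "e \<in> borel_measurable (borel :: (real \<times> real) measure)"
  shows "(\<lambda>X. if X \<in> IX \<and> X \<le> a \<and> yv t X \<le> b then e (X, yv t X) else 0 :: real) \<in> borel_measurable borel"
proof -
  have "closed {z::real \<times> real. fst z \<le> a \<and> snd z \<le> b}"
    by (intro closed_Collect_conj closed_Collect_le continuous_intros)
  then have "(\<lambda>z. if z \<in> {z. fst z \<le> a \<and> snd z \<le> b} then e z else 0) \<in> borel_measurable borel"
    using e by (intro measurable_If_set) auto
  from measurable_graph[OF t this, of 0] show ?thesis
    by (rule measurable_cong[THEN iffD1, rotated]) auto
qed

text \<open>The finite set \<open>N\<close> contains the labels at which the integrands may jump.\<close>

lemma region_slices: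
  fixes e g :: "real \<times> real \<Rightarrow> real"
  assumes t: "t \<in> {0..T}" and N: "finite N" and b: "Yf xb 0 \<notin> N"
    and meas: "e \<in> borel_measurable borel" "g \<in> borel_measurable borel"
    and bd: "\<And>z. z \<in> region t xa xb \<Longrightarrow> \<bar>e z\<bar> \<le> B" "\<And>z. z \<in> region t xa xb \<Longrightarrow> \<bar>g z\<bar> \<le> B"
    and B0: "0 \<le> B" and nonneg: "\<And>z. 0 \<le> e z"
    and inc: "\<And>X Y1 Y2. X \<in> IX - N \<Longrightarrow> Y1 \<le> Y2 \<Longrightarrow> Y1 \<notin> N \<Longrightarrow> Y2 \<notin> N \<Longrightarrow> yv 0 X \<le> Y1 \<Longrightarrow> Y2 \<le> yv t X \<Longrightarrow>
       e (X, Y2) - e (X, Y1) \<le> (LINT Y:{Y1..Y2}|lborel. g (X, Y))"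
  shows "\<exists>r0 r1. (\<integral>\<^sup>+X. ennreal (if X \<in> IX \<and> X \<le> Xf xa 0 \<and> yv t X \<le> Yf xb 0 then e (X, yv t X) else 0) \<partial>lborel) = ennreal r1
    \<and> ennreal r0 \<le> (\<integral>\<^sup>+X. ennreal (if X \<in> IX then e (X, yv 0 X) else 0) \<partial>lborel)
    \<and> 0 \<le> r0 \<and> 0 \<le> r1 \<and> r1 \<le> r0 + (LINT z:region t xa xb|lborel. g z)"
proof -
  define D where "D = region t xa xb"
  define a where "a = Xf xa 0"
  define b where "b = Yf xb 0"
  have 0: "(0::real) \<in> {0..T}" using T_pos by simp
  have D: "compact D" unfolding D_def by (rule compact_region[OF t])
  then obtain L where "\<And>z. z \<in> D \<Longrightarrow> norm z \<le> L"
    using compact_imp_bounded bounded_iff by metis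
  then have L: "X \<in> {- L..L}" if "(X, Y) \<in> D" for X Y
    using norm_fst_le[of X Y] that by force
  have Dmem: "(X, Y) \<in> D \<longleftrightarrow> X \<in> IX \<and> X \<le> a \<and> yv 0 X \<le> Y \<and> Y \<le> min (yv t X) b" for X Y
    using strip_image_slice[OF _ t] strip_image_IX[OF t] by (auto simp: D_def region_def a_def b_def)
  have yle: "yv 0 X \<le> yv t X" if "X \<in> IX" for X
    using yv_strict_mono[OF that, of 0 t] t by (cases "t = 0") auto
  define f1 where "f1 X = (if X \<in> IX \<and> X \<le> a \<and> yv t X \<le> b then e (X, yv t X) else 0)" for X
  define f0 where "f0 X = (if X \<in> IX \<and> X \<le> a \<and> yv 0 X \<le> b then e (X, yv 0 X) else 0)" for X
  have fb: "\<bar>f1 X\<bar> \<le> B * indicator {- L..L} X" "\<bar>f0 X\<bar> \<le> B * indicator {- L..L} X" for X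
  proof -
    have "(X, yv t X) \<in> D" if "X \<in> IX" "X \<le> a" "yv t X \<le> b" using that yle[of X] Dmem by auto
    moreover have "(X, yv 0 X) \<in> D" if "X \<in> IX" "X \<le> a" "yv 0 X \<le> b" using that yle[of X] Dmem by auto
    moreover have "\<bar>e z\<bar> \<le> B" if "z \<in> D" for z using bd(1)[of z] that by (simp add: D_def)
    moreover have "0 \<le> B * indicator {- L..L} X"
    proof (cases "X \<in> {- L..L}")
      case True
      then show ?thesis using B0 by simp
    qed simp
    ultimately show "\<bar>f1 X\<bar> \<le> B * indicator {- L..L} X" "\<bar>f0 X\<bar> \<le> B * indicator {- L..L} X"
      using L unfolding f1_def f0_def by (auto simp: indicator_def)
  qed
  have m: "f1 \<in> borel_measurable borel" "f0 \<in> borel_measurable borel"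
    unfolding f1_def[abs_def] f0_def[abs_def] by (rule measurable_graph_trunc[OF t meas(1)] measurable_graph_trunc[OF 0 meas(1)])+
  have "integrable lborel (\<lambda>X. B * indicator {- L..L} X :: real)"
    by (intro integrable_mult_right integrable_real_indicator) (auto simp: emeasure_lborel_Icc_eq)
  note dom = Bochner_Integration.integrable_bound[OF this]
  have "integrable lborel f" if "f \<in> borel_measurable borel" "\<And>X. \<bar>f X\<bar> \<le> B * indicator {- L..L} X" for f :: "real \<Rightarrow> real"
  proof (rule dom)
    show "AE X in lborel. norm (f X) \<le> norm (B * indicator {- L..L} X :: real)"
      unfolding real_norm_def by (intro AE_I2 order_trans[OF that(2) abs_ge_self])
  qed (use that in simp)
  then have int: "integrable lborel f1" "integrable lborel f0"
    using fb m by blast+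
  define F where "F = (\<lambda>z. indicator D z *\<^sub>R g z)"
  have Db: "D \<in> sets borel" using D by (rule borel_compact)
  have F: "integrable lborel F"
  proof (rule Bochner_Integration.integrable_bound)
    show "integrable lborel (\<lambda>z. B * indicator D z :: real)"
      using Db emeasure_compact_finite[OF D] by (intro integrable_mult_right) (simp add: less_top[symmetric])
    show "F \<in> borel_measurable lborel" using Db meas(2) by (simp add: F_def)
    show "AE z in lborel. norm (F z) \<le> norm (B * indicator D z :: real)"
      using bd(2) by (intro AE_I2) (force simp: F_def D_def indicator_def)
  qed
  define G where "G X = (LINT Y|lborel. F (X, Y))" for X
  have G: "integrable lborel G" "(LINT X|lborel. G X) = (LINT z|lborel. F z)"
    using lborel_pair.integrable_fst'[of F] lborel_pair.integral_fst'[of F] F unfolding G_def lborel_prod by auto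
  have "AE X in lborel. f1 X \<le> f0 X + G X"
    using AE_yv_avoids[OF 0 N] AE_yv_avoids[OF t N]
  proof eventually_elim
    case (elim X)
    show ?case
    proof (cases "X \<in> IX \<and> X \<le> a \<and> yv 0 X \<le> b")
      case True
      \<comment> \<open>A slice ends either on the level \<open>t\<close> or at the truncation
        \<open>Y = b\<close>. In the second case \<open>f1 X\<close> is zero and the nonnegative
        value of \<open>e\<close> at the top is discarded.\<close>
      define top where "top = min (yv t X) b"
      have "G X = (LINT Y:{yv 0 X..top}|lborel. g (X, Y))"
        using True Dmem unfolding G_def F_def set_lebesgue_integral_def top_def
        by (intro Bochner_Integration.integral_cong) (auto simp: indicator_def)
      moreover have "e (X, top) - e (X, yv 0 X) \<le> (LINT Y:{yv 0 X..top}|lborel. g (X, Y))"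
        using True elim yle[of X] \<open>Yf xb 0 \<notin> N\<close> by (intro inc) (auto simp: top_def b_def min_def)
      moreover have "f1 X \<le> e (X, top)"
        using nonneg True by (auto simp: f1_def top_def)
      ultimately show ?thesis using True by (simp add: f0_def)
    next
      case False
      then have "indicator D (X, Y) = (0::real)" for Y
        using Dmem[of X Y] by (cases "X \<in> IX") (auto simp: indicator_def)
      then have "G X = 0" by (simp add: G_def F_def)
      moreover have "f1 X = 0" using False yle[of X] by (auto simp: f1_def)
      moreover have "f0 X = 0" using False by (auto simp: f0_def)
      ultimately show ?thesis by simp
    qed
  qed
  then have "(LINT X|lborel. f1 X) \<le> (LINT X|lborel. f0 X + G X)"
    using int G by (intro integral_mono_AE) auto
  then have "(LINT X|lborel. f1 X) \<le> (LINT X|lborel. f0 X) + (LINT z:D|lborel. g z)"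
    using int G by (simp add: F_def set_lebesgue_integral_def)
  moreover have "(\<integral>\<^sup>+X. ennreal (f1 X) \<partial>lborel) = ennreal (LINT X|lborel. f1 X)"
    by (rule nn_integral_eq_integral[OF int(1)]) (auto simp: f1_def nonneg)
  moreover have "ennreal (LINT X|lborel. f0 X) \<le> (\<integral>\<^sup>+X. ennreal (if X \<in> IX then e (X, yv 0 X) else 0) \<partial>lborel)"
  proof -
    have "ennreal (LINT X|lborel. f0 X) = (\<integral>\<^sup>+X. ennreal (f0 X) \<partial>lborel)"
      by (rule nn_integral_eq_integral[OF int(2), symmetric]) (auto simp: f0_def nonneg)
    also have "\<dots> \<le> (\<integral>\<^sup>+X. ennreal (if X \<in> IX then e (X, yv 0 X) else 0) \<partial>lborel)"
      by (intro nn_integral_mono ennreal_leI) (auto simp: f0_def nonneg)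
    finally show ?thesis .
  qed
  moreover have "0 \<le> (LINT X|lborel. f1 X)" "0 \<le> (LINT X|lborel. f0 X)"
    using nonneg by (auto simp: f1_def f0_def intro!: integral_nonneg_AE)
  ultimately show ?thesis
    by (intro exI[of _ "LINT X|lborel. f0 X"] exI[of _ "LINT X|lborel. f1 X"]) (simp add: f1_def a_def b_def D_def)
qed

text \<open>The label \<open>X\<close> at which the line \<open>Y = const\<close> meets a time
  level, obtained as \<open>yv\<close> of the reflected strip.\<close>

definition xv :: "real \<Rightarrow> real \<Rightarrow> real" where
  "xv = label_strip.yv (\<lambda>x t. Yf (- x) t) (\<lambda>x t. Xf (- x) t)"

lemma swap_simps:
  "label_strip.yv (\<lambda>x t. Yf (- x) t) (\<lambda>x t. Xf (- x) t) = xv"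
  "label_strip.IX (\<lambda>x t. Yf (- x) t) = IY"
  "label_strip.strip_image (\<lambda>x t. Yf (- x) t) (\<lambda>x t. Xf (- x) t) t = prod.swap ` strip_image t"
  "label_strip.region (\<lambda>x t. Yf (- x) t) (\<lambda>x t. Xf (- x) t) t (- xb) (- xa) = prod.swap ` region t xa xb"
proof -
  interpret S: label_strip T cm "\<lambda>x t. Yf (- x) t" "\<lambda>x t. Xf (- x) t" by (rule swap)
  show "S.yv = xv" by (simp add: xv_def)
  have "range (\<lambda>x. Yf (- x) 0) = range (\<lambda>x. Yf x 0)"
  proof (intro equalityI subsetI)
    show "y \<in> range (\<lambda>x. Yf (- x) 0)" if "y \<in> range (\<lambda>x. Yf x 0)" for y
    proof -
      obtain x where "y = Yf (- (- x)) 0" using \<open>y \<in> range (\<lambda>x. Yf x 0)\<close> by auto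
      then show ?thesis by (rule image_eqI) simp
    qed
  qed auto
  then show "S.IX = IY" by (simp add: S.IX_def IY_def)
  show si: "S.strip_image t = prod.swap ` strip_image t"
  proof -
    have "(Y, X) \<in> S.strip_image t \<longleftrightarrow> (X, Y) \<in> strip_image t" for X Y
    proof
      assume "(Y, X) \<in> S.strip_image t"
      then obtain x s where "Y = Yf (- x) s" "X = Xf (- x) s" "0 \<le> s" "s \<le> t" by (auto simp: S.strip_image_def)
      then show "(X, Y) \<in> strip_image t" unfolding strip_image_def by blast
    next
      assume "(X, Y) \<in> strip_image t"
      then obtain x s where "Y = Yf (- (- x)) s" "X = Xf (- (- x)) s" "0 \<le> s" "s \<le> t" by (auto simp: strip_image_def)
      then show "(Y, X) \<in> S.strip_image t" unfolding S.strip_image_def by blast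
    qed
    then show ?thesis by (force simp: image_iff)
  qed
  show "S.region t (- xb) (- xa) = prod.swap ` region t xa xb"
    unfolding S.region_def region_def si by auto
qed

lemma graph_point: "t \<in> {0..T} \<Longrightarrow> X \<in> IX \<Longrightarrow> \<exists>x. Xf x t = X \<and> Yf x t = yv t X"
  using Xf_xi unfolding yv_def by blast

lemma graph_point': "t \<in> {0..T} \<Longrightarrow> Y \<in> IY \<Longrightarrow> \<exists>x. Yf x t = Y \<and> Xf x t = xv t Y"
  using label_strip.graph_point[OF swap, of t Y] unfolding swap_simps by blast

text \<open>Green's theorem for the form \<open>e1 dX + e2 dY\<close>, as an inequality. Across the
  lateral sides of a truncated region, which are characteristics, the flux is outgoing and
  nonnegative, so it may be dropped. The truncations exhaust the strip by monotone convergence,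
  which also covers infinite fluxes.\<close>

theorem monotone_flux:
  fixes e1 e2 g1 g2 :: "real \<times> real \<Rightarrow> real"
  assumes t: "t \<in> {0..T}" and N: "finite N"
    and meas: "e1 \<in> borel_measurable borel" "e2 \<in> borel_measurable borel"
      "g1 \<in> borel_measurable borel" "g2 \<in> borel_measurable borel"
    and nonneg: "\<And>z. 0 \<le> e1 z" "\<And>z. 0 \<le> e2 z"
    and bd: "\<And>xa xb. \<exists>B. \<forall>z\<in>region t xa xb. \<bar>e1 z\<bar> \<le> B \<and> \<bar>e2 z\<bar> \<le> B \<and> \<bar>g1 z\<bar> \<le> B \<and> \<bar>g2 z\<bar> \<le> B"
    and inc1: "\<And>X Y1 Y2. X \<in> IX - N \<Longrightarrow> Y1 \<le> Y2 \<Longrightarrow> Y1 \<notin> N \<Longrightarrow> Y2 \<notin> N \<Longrightarrow> yv 0 X \<le> Y1 \<Longrightarrow> Y2 \<le> yv t X \<Longrightarrow>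
       e1 (X, Y2) - e1 (X, Y1) \<le> (LINT Y:{Y1..Y2}|lborel. g1 (X, Y))"
    and inc2: "\<And>Y X1 X2. Y \<in> IY - N \<Longrightarrow> X1 \<le> X2 \<Longrightarrow> X1 \<notin> N \<Longrightarrow> X2 \<notin> N \<Longrightarrow> xv 0 Y \<le> X1 \<Longrightarrow> X2 \<le> xv t Y \<Longrightarrow>
       e2 (X2, Y) - e2 (X1, Y) \<le> (LINT X:{X1..X2}|lborel. g2 (X, Y))"
    and sum: "\<And>z. z \<in> strip_image t \<Longrightarrow> g1 z + g2 z \<le> 0"
  shows "(\<integral>\<^sup>+X. ennreal (if X \<in> IX then e1 (X, yv t X) else 0) \<partial>lborel)
      + (\<integral>\<^sup>+Y. ennreal (if Y \<in> IY then e2 (xv t Y, Y) else 0) \<partial>lborel)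
    \<le> (\<integral>\<^sup>+X. ennreal (if X \<in> IX then e1 (X, yv 0 X) else 0) \<partial>lborel)
      + (\<integral>\<^sup>+Y. ennreal (if Y \<in> IY then e2 (xv 0 Y, Y) else 0) \<partial>lborel)"
    (is "?L \<le> ?R")
proof -
  interpret S: label_strip T cm "\<lambda>x t. Yf (- x) t" "\<lambda>x t. Xf (- x) t" by (rule swap)
  have 0: "(0::real) \<in> {0..T}" using T_pos by simp
  define P1 where "P1 xa xb X = ennreal (if X \<in> IX \<and> X \<le> Xf xa 0 \<and> yv t X \<le> Yf xb 0 then e1 (X, yv t X) else 0)" for xa xb X
  define P2 where "P2 xa xb Y = ennreal (if Y \<in> IY \<and> Y \<le> Yf xb 0 \<and> xv t Y \<le> Xf xa 0 then e2 (xv t Y, Y) else 0)" for xa xb Y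
  have sw: "(\<lambda>z. f (prod.swap z)) \<in> borel_measurable borel"
    if "f \<in> borel_measurable borel" for f :: "real \<times> real \<Rightarrow> real"
  proof -
    have "prod.swap \<in> borel_measurable (borel :: (real \<times> real) measure)"
      by (intro borel_measurable_continuous_onI continuous_on_swap)
    from measurable_compose[OF this that] show ?thesis .
  qed
  have trunc: "integral\<^sup>N lborel (P1 xa xb) + integral\<^sup>N lborel (P2 xa xb) \<le> ?R"
    if "Xf xa 0 \<notin> N" "Yf xb 0 \<notin> N" for xa xb
  proof -
    define D where "D = region t xa xb"
    obtain B where B: "\<And>z. z \<in> D \<Longrightarrow> \<bar>e1 z\<bar> \<le> B \<and> \<bar>e2 z\<bar> \<le> B \<and> \<bar>g1 z\<bar> \<le> B \<and> \<bar>g2 z\<bar> \<le> B"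
      using bd[of xa xb] unfolding D_def by blast
    have B': "\<bar>e1 z\<bar> \<le> \<bar>B\<bar> \<and> \<bar>e2 z\<bar> \<le> \<bar>B\<bar> \<and> \<bar>g1 z\<bar> \<le> \<bar>B\<bar> \<and> \<bar>g2 z\<bar> \<le> \<bar>B\<bar>" if "z \<in> D" for z
      using B[OF that] by linarith
    have D: "compact D" unfolding D_def by (rule compact_region[OF t])
    have "\<exists>r0 r1. integral\<^sup>N lborel (P1 xa xb) = ennreal r1
      \<and> ennreal r0 \<le> (\<integral>\<^sup>+X. ennreal (if X \<in> IX then e1 (X, yv 0 X) else 0) \<partial>lborel)
      \<and> 0 \<le> r0 \<and> 0 \<le> r1 \<and> r1 \<le> r0 + (LINT z:D|lborel. g1 z)"
      unfolding P1_def D_def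
      by (rule region_slices[OF t N that(2) meas(1,3), where B = "\<bar>B\<bar>"]) (use B' nonneg inc1 in \<open>auto simp: D_def\<close>)
    then obtain r0 r1 where r: "integral\<^sup>N lborel (P1 xa xb) = ennreal r1"
      "ennreal r0 \<le> (\<integral>\<^sup>+X. ennreal (if X \<in> IX then e1 (X, yv 0 X) else 0) \<partial>lborel)"
      "0 \<le> r0" "0 \<le> r1" "r1 \<le> r0 + (LINT z:D|lborel. g1 z)" by blast
    have "\<exists>r0 r1. integral\<^sup>N lborel (P2 xa xb) = ennreal r1
      \<and> ennreal r0 \<le> (\<integral>\<^sup>+Y. ennreal (if Y \<in> IY then e2 (xv 0 Y, Y) else 0) \<partial>lborel)
      \<and> 0 \<le> r0 \<and> 0 \<le> r1 \<and> r1 \<le> r0 + (LINT z:prod.swap ` D|lborel. g2 (prod.swap z))"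
      unfolding P2_def D_def
      by (rule S.region_slices[OF t N, of "- xa" "\<lambda>z. e2 (prod.swap z)" "\<lambda>z. g2 (prod.swap z)" "- xb" "\<bar>B\<bar>",
            unfolded swap_simps swap_simp minus_minus])
         (use that(1) sw[OF meas(2)] sw[OF meas(4)] B' nonneg inc2 in \<open>auto simp: D_def\<close>)
    then obtain s0 s1 where s: "integral\<^sup>N lborel (P2 xa xb) = ennreal s1"
      "ennreal s0 \<le> (\<integral>\<^sup>+Y. ennreal (if Y \<in> IY then e2 (xv 0 Y, Y) else 0) \<partial>lborel)"
      "0 \<le> s0" "0 \<le> s1" "s1 \<le> s0 + (LINT z:prod.swap ` D|lborel. g2 (prod.swap z))" by blast
    have int: "set_integrable lborel D g" if "g \<in> borel_measurable borel" "\<And>z. z \<in> D \<Longrightarrow> \<bar>g z\<bar> \<le> \<bar>B\<bar>" for g :: "real \<times> real \<Rightarrow> real"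
      unfolding set_integrable_def
    proof (rule Bochner_Integration.integrable_bound)
      show "integrable lborel (\<lambda>z. \<bar>B\<bar> * indicator D z :: real)"
        using borel_compact[OF D] emeasure_compact_finite[OF D]
        by (intro integrable_mult_right) (simp add: less_top[symmetric])
      show "(\<lambda>z. indicator D z *\<^sub>R g z) \<in> borel_measurable lborel" using borel_compact[OF D] that(1) by simp
      show "AE z in lborel. norm (indicator D z *\<^sub>R g z) \<le> norm (\<bar>B\<bar> * indicator D z :: real)"
        using that(2) by (intro AE_I2) (force simp: indicator_def)
    qed
    have "(LINT z:prod.swap ` D|lborel. g2 (prod.swap z)) = (LINT z|lborel. (case z of (x, y) \<Rightarrow> indicator D (y, x) *\<^sub>R g2 (y, x)))"
      unfolding set_lebesgue_integral_def
    proof (rule Bochner_Integration.integral_cong)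
      fix z :: "real \<times> real"
      have "z \<in> prod.swap ` D \<longleftrightarrow> (snd z, fst z) \<in> D" by (cases z) force
      then show "indicator (prod.swap ` D) z *\<^sub>R g2 (prod.swap z) = (case z of (x, y) \<Rightarrow> indicator D (y, x) *\<^sub>R g2 (y, x))"
        by (cases z) (simp add: indicator_def)
    qed simp
    also have "\<dots> = (LINT z:D|lborel. g2 z)"
    proof -
      have "(\<lambda>z. indicator D z *\<^sub>R g2 z) \<in> borel_measurable borel" using borel_compact[OF D] meas(4) by simp
      then show ?thesis
        using lborel_pair.integral_product_swap[of "\<lambda>z. indicator D z *\<^sub>R g2 z"]
        by (simp add: lborel_prod set_lebesgue_integral_def)
    qed
    finally have "(LINT z:D|lborel. g1 z) + (LINT z:prod.swap ` D|lborel. g2 (prod.swap z)) = (LINT z:D|lborel. g1 z + g2 z)"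
      using int[OF meas(3)] int[OF meas(4)] B' by (subst set_integral_add) auto
    also have "\<dots> \<le> 0"
    proof -
      have "0 \<le> (LINT z|lborel. - (indicator D z *\<^sub>R (g1 z + g2 z)))"
        by (intro integral_nonneg_AE AE_I2) (use sum in \<open>auto simp: indicator_def D_def region_def\<close>)
      then show ?thesis by (simp add: set_lebesgue_integral_def)
    qed
    \<comment> \<open>Neither area integral has a sign, only their sum has; so the two balances are
      added as inequalities between real numbers before returning to \<open>ennreal\<close>.\<close>
    finally have "r1 + s1 \<le> r0 + s0" using r s by linarith
    then have "ennreal r1 + ennreal s1 \<le> ennreal r0 + ennreal s0"
      using r s by (simp flip: ennreal_plus)
    also have "\<dots> \<le> ?R" using r s by (intro add_mono)
    finally show ?thesis using r s by simp
  qed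
  \<comment> \<open>The truncating labels must avoid \<open>N\<close>; an interval of positions has
    infinitely many distinct labels, of which only finitely many are excluded.\<close>
  have fresh: "\<exists>x\<in>{y..y + 1}. f x \<notin> N" if "inj f" for f :: "real \<Rightarrow> real" and y :: real
  proof (rule ccontr)
    assume "\<not> ?thesis"
    then have "f ` {y..y + 1} \<subseteq> N" by auto
    then have "finite (f ` {y..y + 1})" using N finite_subset by blast
    then have "finite {y..y + 1}" using that finite_imageD inj_on_subset by blast
    then show False by (simp add: infinite_Icc)
  qed
  have inj: "inj (\<lambda>x. Xf x 0)" "inj (\<lambda>x. Yf x 0)"
    using inj_Xf[OF 0] antiY[OF 0] by (auto simp: inj_def) (metis less_irrefl linorder_less_linear)
  have "\<forall>n::nat. \<exists>x. x \<in> {real n..real n + 1} \<and> Xf x 0 \<notin> N" using fresh[OF inj(1)] by blast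
  from choice[OF this] obtain xa where xa: "\<And>n::nat. xa n \<in> {real n..real n + 1}" "\<And>n. Xf (xa n) 0 \<notin> N"
    by blast
  have "\<forall>n::nat. \<exists>x. x \<in> {- real n - 1..- real n - 1 + 1} \<and> Yf x 0 \<notin> N" using fresh[OF inj(2)] by blast
  from choice[OF this] obtain xb where xb: "\<And>n::nat. xb n \<in> {- real n - 1..- real n}" "\<And>n. Yf (xb n) 0 \<notin> N"
    by auto
  have mono: "Xf x 0 \<le> Xf x' 0" "Yf x' 0 \<le> Yf x 0" if "x \<le> x'" for x x'
    using that monoX[OF 0, of x x'] antiY[OF 0, of x x'] by (cases "x = x'"; force)+
  have incr: "xa m \<le> xa n" "xb n \<le> xb m" if "m \<le> n" for m n
    using that xa(1)[of m] xa(1)[of n] xb(1)[of m] xb(1)[of n] by (cases "m = n"; force)+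
  have bdX: "\<exists>n. x \<le> xa n" "\<exists>n. xb n \<le> x" for x
  proof -
    obtain n m where "x \<le> real n" "- x \<le> real m" using real_arch_simple by metis
    then have "x \<le> xa n" "xb m \<le> x" using xa(1)[of n] xb(1)[of m] by auto
    then show "\<exists>n. x \<le> xa n" "\<exists>n. xb n \<le> x" by blast+
  qed
  define Q1 where "Q1 n = P1 (xa n) (xb n)" for n
  define Q2 where "Q2 n = P2 (xa n) (xb n)" for n
  have ge: "Xf (xa m) 0 \<le> Xf (xa n) 0" "Yf (xb m) 0 \<le> Yf (xb n) 0" if "m \<le> n" for m n
    using mono incr[OF that] by auto
  have Q1: "incseq Q1" "\<And>n. Q1 n \<in> borel_measurable lborel"
  proof -
    show "incseq Q1"
      unfolding incseq_def le_fun_def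
    proof (intro allI impI)
      fix m n X assume "m \<le> (n::nat)"
      then show "Q1 m X \<le> Q1 n X"
        using ge[of m n] unfolding Q1_def P1_def by (auto intro: ennreal_leI nonneg)
    qed
    show "Q1 n \<in> borel_measurable lborel" for n
      using measurable_compose[OF measurable_graph_trunc[OF t meas(1)] measurable_ennreal]
      unfolding Q1_def P1_def[abs_def] by simp
  qed
  have Q2: "incseq Q2" "\<And>n. Q2 n \<in> borel_measurable lborel"
  proof -
    show "incseq Q2"
      unfolding incseq_def le_fun_def
    proof (intro allI impI)
      fix m n Y assume "m \<le> (n::nat)"
      then show "Q2 m Y \<le> Q2 n Y"
        using ge[of m n] unfolding Q2_def P2_def by (auto intro: ennreal_leI nonneg)
    qed
    show "Q2 n \<in> borel_measurable lborel" for n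
      using measurable_compose[OF S.measurable_graph_trunc[OF t sw[OF meas(2)], unfolded swap_simps swap_simp] measurable_ennreal]
      unfolding Q2_def P2_def[abs_def] by simp
  qed
  have sup1: "(SUP n. Q1 n X) = ennreal (if X \<in> IX then e1 (X, yv t X) else 0)" for X
  proof (cases "X \<in> IX")
    case True
    obtain x0 where x0: "X = Xf x0 0" using True by (auto simp: IX_def)
    obtain x where x: "Yf x t = yv t X" using graph_point[OF t True] by blast
    \<comment> \<open>By finite speed, the label \<open>Y\<close> seen at \<open>(x,t)\<close> is at
      most the one at position \<open>x - cm * t\<close> at time 0. A truncation starting further
      left therefore contains the point.\<close>
    obtain n1 n2 where n: "x0 \<le> xa n1" "xb n2 \<le> x - cm * t" using bdX by metis
    define n where "n = max n1 n2"
    have "X \<le> Xf (xa n) 0" using mono(1)[OF n(1)] ge(1)[of n1 n] x0 by (simp add: n_def)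
    moreover have "yv t X \<le> Yf (xb n) 0"
      using coneY[of 0 t x] t x mono(2)[OF n(2)] ge(2)[of n2 n] by (simp add: n_def)
    ultimately have "Q1 n X = ennreal (e1 (X, yv t X))" using True by (simp add: Q1_def P1_def)
    then show ?thesis using True nonneg
      by (intro antisym SUP_least) (auto simp: Q1_def P1_def intro: SUP_upper2[of n])
  qed (simp add: Q1_def P1_def)
  have sup2: "(SUP n. Q2 n Y) = ennreal (if Y \<in> IY then e2 (xv t Y, Y) else 0)" for Y
  proof (cases "Y \<in> IY")
    case True
    obtain x0 where x0: "Y = Yf x0 0" using True by (auto simp: IY_def)
    obtain x where x: "Xf x t = xv t Y" using graph_point'[OF t True] by blast
    obtain n1 n2 where n: "x + cm * t \<le> xa n1" "xb n2 \<le> x0" using bdX by metis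
    define n where "n = max n1 n2"
    have "xv t Y \<le> Xf (xa n) 0"
      using coneX[of 0 t x] t x mono(1)[OF n(1)] ge(1)[of n1 n] by (simp add: n_def)
    moreover have "Y \<le> Yf (xb n) 0" using mono(2)[OF n(2)] ge(2)[of n2 n] x0 by (simp add: n_def)
    ultimately have "Q2 n Y = ennreal (e2 (xv t Y, Y))" using True by (simp add: Q2_def P2_def)
    then show ?thesis using True nonneg
      by (intro antisym SUP_least) (auto simp: Q2_def P2_def intro: SUP_upper2[of n])
  qed (simp add: Q2_def P2_def)
  have "?L = (SUP n. integral\<^sup>N lborel (Q1 n)) + (SUP n. integral\<^sup>N lborel (Q2 n))"
    using nn_integral_monotone_convergence_SUP[OF Q1] nn_integral_monotone_convergence_SUP[OF Q2]
    by (simp add: sup1 sup2)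
  also have "\<dots> = (SUP n. integral\<^sup>N lborel (Q1 n) + integral\<^sup>N lborel (Q2 n))"
    using Q1(1) Q2(1)
    by (intro ennreal_SUP_add[symmetric]) (auto simp: incseq_def le_fun_def intro!: nn_integral_mono)
  also have "\<dots> \<le> ?R"
    unfolding Q1_def Q2_def by (intro SUP_least trunc xa xb)
  finally show ?thesis .
qed

end

section \<open>Characteristic coordinates label the strip\<close>

lemma DERIV_along_line:
  assumes "(f has_derivative (\<lambda>h. a * fst h + b * snd h)) (at (g t, k t))"
    and "(g has_real_derivative g') (at t)" "(k has_real_derivative k') (at t)"
  shows "((\<lambda>t. f (g t, k t)) has_real_derivative a * g' + b * k') (at t)"
proof -
  have "((\<lambda>t. (g t, k t)) has_derivative (\<lambda>h. (g' * h, k' * h))) (at t)"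
    using assms(2,3) by (auto simp: has_field_derivative_def intro!: has_derivative_Pair)
  from has_derivative_compose[OF this assms(1)] show ?thesis
    by (auto simp: has_field_derivative_def algebra_simps elim!: has_derivative_eq_rhs)
qed

text \<open>The analytic content of one chart, with \<open>G\<close> the inverse of the map to
  \<open>(x,t)\<close>. The cosines are nonnegative on the closed strip and positive before time
  \<open>T\<close>. The variation is recorded at the interior time \<open>T / 2\<close>, where the
  potentials are built.\<close>

locale char_geometry =
  fixes \<gamma> T m \<eta> :: real and U \<Omega> :: "(real \<times> real) set" and G :: "real \<times> real \<Rightarrow> real \<times> real"
    and tau al be p q xc tc :: "real \<times> real \<Rightarrow> real"
  assumes T_pos: "0 < T"
    and open_U: "open U" and \<Omega>_U: "\<Omega> \<subseteq> U"
    and D_x: "\<And>z. z \<in> U \<Longrightarrow> (xc has_derivative (\<lambda>h. (1 / 2 * p z * cos (al z / 2)) * fst h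
        + (- 1 / 2 * q z * cos (be z / 2)) * snd h)) (at z)"
    and D_t: "\<And>z. z \<in> U \<Longrightarrow> (tc has_derivative (\<lambda>h. (1 / (2 * wave_speed \<gamma> (tau z)) * p z * cos (al z / 2)) * fst h
        + (1 / (2 * wave_speed \<gamma> (tau z)) * q z * cos (be z / 2)) * snd h)) (at z)"
    and D_al: "\<And>X Y. (X, Y) \<in> U \<Longrightarrow> ((\<lambda>Y. al (X, Y)) has_real_derivative
        2 * kap \<gamma> (tau (X, Y)) * q (X, Y) * sin (al (X, Y) / 2) * sin ((al (X, Y) - be (X, Y)) / 2)) (at Y)"
    and D_be: "\<And>X Y. (X, Y) \<in> U \<Longrightarrow> ((\<lambda>X. be (X, Y)) has_real_derivative
        2 * kap \<gamma> (tau (X, Y)) * p (X, Y) * sin (be (X, Y) / 2) * sin ((be (X, Y) - al (X, Y)) / 2)) (at X)"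
    and D_p: "\<And>X Y. (X, Y) \<in> U \<Longrightarrow> ((\<lambda>Y. p (X, Y)) has_real_derivative
        kap \<gamma> (tau (X, Y)) * p (X, Y) * q (X, Y) * cos (al (X, Y) / 2) * sin ((be (X, Y) - al (X, Y)) / 2)) (at Y)"
    and D_q: "\<And>X Y. (X, Y) \<in> U \<Longrightarrow> ((\<lambda>X. q (X, Y)) has_real_derivative
        kap \<gamma> (tau (X, Y)) * q (X, Y) * p (X, Y) * cos (be (X, Y) / 2) * sin ((al (X, Y) - be (X, Y)) / 2)) (at X)"
    and cont_al: "continuous_on U al" and cont_be: "continuous_on U be"
    and cont_G: "continuous_on (UNIV \<times> {0..T}) G"
    and G_in: "\<And>w. w \<in> UNIV \<times> {0..T} \<Longrightarrow> G w \<in> \<Omega>"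
    and x_G: "\<And>w. w \<in> UNIV \<times> {0..T} \<Longrightarrow> xc (G w) = fst w"
    and t_G: "\<And>w. w \<in> UNIV \<times> {0..T} \<Longrightarrow> tc (G w) = snd w"
    and G_xt: "\<And>z. z \<in> \<Omega> \<Longrightarrow> G (xc z, tc z) = z" and t_range: "\<And>z. z \<in> \<Omega> \<Longrightarrow> tc z \<in> {0..T}"
    and pq_pos: "\<And>z. z \<in> \<Omega> \<Longrightarrow> 0 < p z" "\<And>z. z \<in> \<Omega> \<Longrightarrow> 0 < q z"
    and cos_nonneg: "\<And>z. z \<in> \<Omega> \<Longrightarrow> 0 \<le> cos (al z / 2)" "\<And>z. z \<in> \<Omega> \<Longrightarrow> 0 \<le> cos (be z / 2)"
    and cos_pos: "\<And>z. z \<in> \<Omega> \<Longrightarrow> tc z < T \<Longrightarrow> 0 < cos (al z / 2)" "\<And>z. z \<in> \<Omega> \<Longrightarrow> tc z < T \<Longrightarrow> 0 < cos (be z / 2)"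
    and coeff: "\<And>z. z \<in> \<Omega> \<Longrightarrow> coeff_bound \<gamma> m (tau z)"
    and \<eta>_nonneg: "0 \<le> \<eta>"
    and tv_al: "(\<integral>\<^sup>+y. ennreal \<bar>tan (al (G (y, T / 2)) / 2)\<bar> \<partial>lborel) \<le> ennreal \<eta>"
    and tv_be: "(\<integral>\<^sup>+y. ennreal \<bar>tan (be (G (y, T / 2)) / 2)\<bar> \<partial>lborel) \<le> ennreal \<eta>"
begin

definition Xf :: "real \<Rightarrow> real \<Rightarrow> real" where "Xf x t = fst (G (x, t))"
definition Yf :: "real \<Rightarrow> real \<Rightarrow> real" where "Yf x t = snd (G (x, t))"

lemma open_swap: "open (prod.swap ` U)"
proof -
  have "prod.swap ` U = prod.swap -` U" by force
  moreover have "open (prod.swap -` U)"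
    by (rule open_vimage[OF open_U]) (intro continuous_on_swap)
  ultimately show ?thesis by simp
qed

text \<open>Exchanging \<open>X\<close>, \<alpha>, \<open>p\<close> with \<open>Y\<close>, \<beta>,
  \<open>q\<close> and reversing the sign of \<open>x\<close> leaves the system invariant. Results
  for \<open>X\<close> thereby hold for \<open>Y\<close>.\<close>

lemma swap_geometry: "char_geometry \<gamma> T m \<eta> (prod.swap ` U) (prod.swap ` \<Omega>) (\<lambda>w. prod.swap (G (- fst w, snd w)))
    (\<lambda>z. tau (prod.swap z)) (\<lambda>z. be (prod.swap z)) (\<lambda>z. al (prod.swap z)) (\<lambda>z. q (prod.swap z)) (\<lambda>z. p (prod.swap z))
    (\<lambda>z. - xc (prod.swap z)) (\<lambda>z. tc (prod.swap z))"
proof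
  have sw: "(prod.swap has_derivative prod.swap) (at z)" for z :: "real \<times> real"
  proof -
    have "bounded_linear (\<lambda>z::real \<times> real. (snd z, fst z))"
      by (intro bounded_linear_Pair bounded_linear_fst bounded_linear_snd)
    moreover have "prod.swap = (\<lambda>z::real \<times> real. (snd z, fst z))" by (simp add: fun_eq_iff)
    ultimately show ?thesis by (simp add: bounded_linear_imp_has_derivative)
  qed
  show "open (prod.swap ` U)" by (rule open_swap)
  show "prod.swap ` \<Omega> \<subseteq> prod.swap ` U" using \<Omega>_U by auto
  fix z assume z: "z \<in> prod.swap ` U"
  then have z': "prod.swap z \<in> U" by auto
  show "((\<lambda>z. - xc (prod.swap z)) has_derivative (\<lambda>h. 1 / 2 * q (prod.swap z) * cos (be (prod.swap z) / 2) * fst h +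
      - 1 / 2 * p (prod.swap z) * cos (al (prod.swap z) / 2) * snd h)) (at z)"
    using has_derivative_minus[OF has_derivative_compose[OF sw D_x[OF z']]]
    by (rule has_derivative_eq_rhs) (auto simp: algebra_simps)
  show "((\<lambda>z. tc (prod.swap z)) has_derivative (\<lambda>h. 1 / (2 * wave_speed \<gamma> (tau (prod.swap z))) * q (prod.swap z) * cos (be (prod.swap z) / 2) * fst h +
      1 / (2 * wave_speed \<gamma> (tau (prod.swap z))) * p (prod.swap z) * cos (al (prod.swap z) / 2) * snd h)) (at z)"
    using has_derivative_compose[OF sw D_t[OF z']]
    by (rule has_derivative_eq_rhs) (auto simp: algebra_simps)
next
  have U: "(Y, X) \<in> U" if "(X, Y) \<in> prod.swap ` U" for X Y using that by auto
  fix X Y assume XY: "(X, Y) \<in> prod.swap ` U"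
  note U = U[OF XY]
  show "((\<lambda>Y. be (prod.swap (X, Y))) has_real_derivative 2 * kap \<gamma> (tau (prod.swap (X, Y))) * p (prod.swap (X, Y)) *
       sin (be (prod.swap (X, Y)) / 2) * sin ((be (prod.swap (X, Y)) - al (prod.swap (X, Y))) / 2)) (at Y)"
    using D_be[OF U] by simp
  show "((\<lambda>X. al (prod.swap (X, Y))) has_real_derivative 2 * kap \<gamma> (tau (prod.swap (X, Y))) * q (prod.swap (X, Y)) *
       sin (al (prod.swap (X, Y)) / 2) * sin ((al (prod.swap (X, Y)) - be (prod.swap (X, Y))) / 2)) (at X)"
    using D_al[OF U] by simp
  show "((\<lambda>Y. q (prod.swap (X, Y))) has_real_derivative kap \<gamma> (tau (prod.swap (X, Y))) * q (prod.swap (X, Y)) * p (prod.swap (X, Y)) *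
       cos (be (prod.swap (X, Y)) / 2) * sin ((al (prod.swap (X, Y)) - be (prod.swap (X, Y))) / 2)) (at Y)"
    using D_q[OF U] by simp
  show "((\<lambda>X. p (prod.swap (X, Y))) has_real_derivative kap \<gamma> (tau (prod.swap (X, Y))) * p (prod.swap (X, Y)) * q (prod.swap (X, Y)) *
       cos (al (prod.swap (X, Y)) / 2) * sin ((be (prod.swap (X, Y)) - al (prod.swap (X, Y))) / 2)) (at X)"
    using D_p[OF U] by simp
next
  have "continuous_on (prod.swap ` U) prod.swap" by (rule continuous_on_swap)
  then show "continuous_on (prod.swap ` U) (\<lambda>z. be (prod.swap z))" "continuous_on (prod.swap ` U) (\<lambda>z. al (prod.swap z))"
    by (auto intro!: continuous_on_compose2[OF cont_be] continuous_on_compose2[OF cont_al])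
  show "continuous_on (UNIV \<times> {0..T}) (\<lambda>w. prod.swap (G (- fst w, snd w)))"
    by (intro continuous_on_compose2[OF continuous_on_swap] continuous_on_compose2[OF cont_G] continuous_intros) auto
next
  have refl: "(\<integral>\<^sup>+y. f (- y) \<partial>lborel) = (\<integral>\<^sup>+y. f y \<partial>lborel)" if "f \<in> borel_measurable borel" for f :: "real \<Rightarrow> ennreal"
    using nn_integral_real_affine[OF that, of "- 1" 0] by simp
  have meas: "(\<lambda>y. ennreal \<bar>tan (f (G (y, T / 2)) / 2)\<bar>) \<in> borel_measurable borel" if "continuous_on U f" for f
  proof -
    have "continuous_on UNIV (\<lambda>y. f (G (y, T / 2)))"
      using \<Omega>_U G_in T_pos
      by (intro continuous_on_compose2[OF that] continuous_on_compose2[OF cont_G] continuous_intros) auto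
    then have "(\<lambda>y. f (G (y, T / 2))) \<in> borel_measurable borel" by (rule borel_measurable_continuous_onI)
    then show ?thesis unfolding tan_def by measurable
  qed
  show "(\<integral>\<^sup>+y. ennreal \<bar>tan (be (prod.swap (prod.swap (G (- fst (y, T / 2), snd (y, T / 2))))) / 2)\<bar> \<partial>lborel) \<le> ennreal \<eta>"
    using refl[OF meas[OF cont_be]] tv_be by simp
  show "(\<integral>\<^sup>+y. ennreal \<bar>tan (al (prod.swap (prod.swap (G (- fst (y, T / 2), snd (y, T / 2))))) / 2)\<bar> \<partial>lborel) \<le> ennreal \<eta>"
    using refl[OF meas[OF cont_al]] tv_al by simp
qed (use T_pos \<eta>_nonneg G_in x_G t_G G_xt t_range pq_pos cos_nonneg cos_pos coeff in auto)

text \<open>Before the final time \<open>p\<close>, \<open>q\<close> and the cosines are positive,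
  so the derivative of the map to \<open>(x,t)\<close> is an invertible matrix. As its inverse map
  \<open>G\<close> is already known to be continuous, \<open>G\<close> is differentiable with the
  inverse matrix.\<close>

lemma D_G:
  assumes "0 < t" "t < T"
  shows "(G has_derivative (\<lambda>h. let z = G (x, t) in
      ((fst h + wave_speed \<gamma> (tau z) * snd h) / (p z * cos (al z / 2)),
       (wave_speed \<gamma> (tau z) * snd h - fst h) / (q z * cos (be z / 2))))) (at (x, t))"
proof -
  define z where "z = G (x, t)"
  have w: "(x, t) \<in> UNIV \<times> {0..T}" using assms by auto
  have z: "z \<in> \<Omega>" "z \<in> U" "tc z = t" using G_in[OF w] t_G[OF w] \<Omega>_U by (auto simp: z_def)
  define P Q c where "P = p z * cos (al z / 2)" and "Q = q z * cos (be z / 2)" and "c = wave_speed \<gamma> (tau z)"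
  have pos: "0 < P" "0 < Q" "0 < c"
    using pq_pos cos_pos z assms coeff[OF z(1)] wave_speed_pos by (auto simp: P_def Q_def c_def coeff_bound_def)
  have D: "((\<lambda>z. (xc z, tc z)) has_derivative (\<lambda>h. (1 / 2 * P * fst h + (- 1 / 2 * Q) * snd h, 1 / (2 * c) * P * fst h + 1 / (2 * c) * Q * snd h))) (at (G (x, t)))"
    using has_derivative_Pair[OF D_x[OF z(2)] D_t[OF z(2)]]
    by (auto simp: P_def Q_def c_def z_def mult_ac elim!: has_derivative_eq_rhs)
  have op: "open (UNIV \<times> {0<..<T} :: (real \<times> real) set)" by (intro open_Times) auto
  have "(G has_derivative (\<lambda>h. ((fst h + c * snd h) / P, (c * snd h - fst h) / Q))) (at (x, t))"
  proof (rule has_derivative_inverse_basic[where y = "(x, t)" and g = G, OF D _ _ _ op])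
    show "bounded_linear (\<lambda>h. ((fst h + c * snd h) / P, (c * snd h - fst h) / Q))"
      unfolding linear_conv_bounded_linear[symmetric]
      by (rule linearI) (auto simp: algebra_simps add_divide_distrib diff_divide_distrib)
    show "(\<lambda>h. ((fst h + c * snd h) / P, (c * snd h - fst h) / Q)) \<circ> (\<lambda>h. (1 / 2 * P * fst h + (- 1 / 2 * Q) * snd h, 1 / (2 * c) * P * fst h + 1 / (2 * c) * Q * snd h)) = id"
      using pos by (auto simp: fun_eq_iff field_simps)
    show "continuous (at (x, t)) G"
      using continuous_on_interior[OF cont_G] assms by (simp add: interior_Times)
    show "(xc (G w), tc (G w)) = w" if "w \<in> UNIV \<times> {0<..<T}" for w
      using that x_G[of w] t_G[of w] by (cases w) auto
  qed (use assms in auto)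
  then show ?thesis by (simp add: z_def P_def Q_def c_def Let_def)
qed

context
  fixes x t :: real
  assumes t: "0 < t" "t < T"
begin

text \<open>Along a level of \<open>t\<close> one has \<open>dx = PX dX = - QY dY\<close>.\<close>

definition "PX = p (G (x, t)) * cos (al (G (x, t)) / 2)"
definition "QY = q (G (x, t)) * cos (be (G (x, t)) / 2)"
definition "cG = wave_speed \<gamma> (tau (G (x, t)))"

lemma PQ_pos: "0 < PX" "0 < QY" "0 < cG" "cG \<le> m"
proof -
  have "(x, t) \<in> UNIV \<times> {0..T}" using t by auto
  then have z: "G (x, t) \<in> \<Omega>" "tc (G (x, t)) = t" using G_in t_G by auto
  then show "0 < PX" "0 < QY" "0 < cG" "cG \<le> m"
    using pq_pos cos_pos t coeff[OF z(1)] wave_speed_pos by (auto simp: PX_def QY_def cG_def coeff_bound_def)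
qed

lemma D_Xf: "((\<lambda>w. Xf (fst w) (snd w)) has_derivative (\<lambda>h. (1 / PX) * fst h + (cG / PX) * snd h)) (at (x, t))"
  using has_derivative_fst[OF D_G[OF t, of x]]
  by (auto simp: Xf_def PX_def cG_def Let_def add_divide_distrib elim!: has_derivative_eq_rhs)

lemma D_Yf: "((\<lambda>w. Yf (fst w) (snd w)) has_derivative (\<lambda>h. (- 1 / QY) * fst h + (cG / QY) * snd h)) (at (x, t))"
  using has_derivative_snd[OF D_G[OF t, of x]]
  by (auto simp: Yf_def QY_def cG_def Let_def diff_divide_distrib elim!: has_derivative_eq_rhs)

end

lemma swap_Xf: "char_geometry.Xf (\<lambda>w. prod.swap (G (- fst w, snd w))) = (\<lambda>x t. Yf (- x) t)"
  "char_geometry.Yf (\<lambda>w. prod.swap (G (- fst w, snd w))) = (\<lambda>x t. Xf (- x) t)"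
  using char_geometry.Xf_def[OF swap_geometry] char_geometry.Yf_def[OF swap_geometry]
  by (auto simp: fun_eq_iff Xf_def Yf_def)

lemma cont_Xf_strip: "continuous_on (UNIV \<times> {0..T}) (\<lambda>(x, t). Xf x t)"
  unfolding Xf_def case_prod_beta' prod.collapse by (intro continuous_on_fst cont_G)

lemma cont_Yf_strip: "continuous_on (UNIV \<times> {0..T}) (\<lambda>(x, t). Yf x t)"
  unfolding Yf_def case_prod_beta' prod.collapse by (intro continuous_on_snd cont_G)

lemma D_Xf_path:
  assumes "0 < k s" "k s < T" "(g has_real_derivative g') (at s)" "(k has_real_derivative k') (at s)"
  shows "((\<lambda>s. Xf (g s) (k s)) has_real_derivative (g' + cG (g s) (k s) * k') / PX (g s) (k s)) (at s)"
  using DERIV_along_line[OF D_Xf[OF assms(1,2)] assms(3,4)] by (simp add: add_divide_distrib)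

lemma D_Yf_path:
  assumes "0 < k s" "k s < T" "(g has_real_derivative g') (at s)" "(k has_real_derivative k') (at s)"
  shows "((\<lambda>s. Yf (g s) (k s)) has_real_derivative (cG (g s) (k s) * k' - g') / QY (g s) (k s)) (at s)"
  using DERIV_along_line[OF D_Yf[OF assms(1,2)] assms(3,4)] by (simp add: diff_divide_distrib)

lemma timeX:
  assumes "0 \<le> s" "s < t" "t \<le> T"
  shows "Xf x s < Xf x t"
proof (rule DERIV_pos_imp_increasing_open[OF assms(2)])
  fix r assume r: "s < r" "r < t"
  show "\<exists>y. ((\<lambda>t. Xf x t) has_real_derivative y) (at r) \<and> 0 < y"
    using D_Xf_path[of "\<lambda>r. r" r "\<lambda>_. x" 0 1] PQ_pos[of r x] r assms by auto
next
  show "continuous_on {s..t} (Xf x)"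
    by (rule continuous_on_compose_pair[OF cont_Xf_strip]) (use assms in \<open>auto intro!: continuous_intros\<close>)
qed

text \<open>A line moving to the left with speed \<open>m\<close> is at least as fast as the
  characteristics on which \<open>X\<close> is constant, so \<open>X\<close> does not increase along
  it.\<close>

lemma coneX:
  assumes "0 \<le> s" "s \<le> t" "t \<le> T"
  shows "Xf x t \<le> Xf (x + m * (t - s)) s"
proof -
  have "- Xf (x + m * (t - s)) s \<le> - Xf (x + m * (t - t)) t"
  proof (rule DERIV_nonneg_imp_increasing_open[OF assms(2)])
    fix r assume r: "s < r" "r < t"
    have "((\<lambda>r. Xf (x + m * (t - r)) r) has_real_derivative (- m + cG (x + m * (t - r)) r * 1) / PX (x + m * (t - r)) r) (at r)"
      using r assms by (intro D_Xf_path) (auto intro!: derivative_eq_intros)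
    then have "((\<lambda>r. - Xf (x + m * (t - r)) r) has_real_derivative - ((- m + cG (x + m * (t - r)) r * 1) / PX (x + m * (t - r)) r)) (at r)"
      by (rule DERIV_minus)
    moreover have "0 \<le> - ((- m + cG (x + m * (t - r)) r * 1) / PX (x + m * (t - r)) r)"
      using PQ_pos[of r "x + m * (t - r)"] r assms by (simp add: divide_simps)
    ultimately show "\<exists>y. ((\<lambda>r. - Xf (x + m * (t - r)) r) has_real_derivative y) (at r) \<and> 0 \<le> y" by blast
  next
    show "continuous_on {s..t} (\<lambda>r. - Xf (x + m * (t - r)) r)"
      by (intro continuous_on_minus continuous_on_compose_pair[OF cont_Xf_strip]) (use assms in \<open>auto intro!: continuous_intros\<close>)
  qed
  then show ?thesis by simp
qed

lemma monoX_interior: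
  assumes "0 < t" "t < T" "x < x'"
  shows "Xf x t < Xf x' t" "Yf x' t < Yf x t"
proof -
  show "Xf x t < Xf x' t"
  proof (rule DERIV_pos_imp_increasing[OF assms(3)])
    show "\<exists>d. ((\<lambda>x. Xf x t) has_real_derivative d) (at y) \<and> 0 < d" for y
      using D_Xf_path[of "\<lambda>_. t" y "\<lambda>y. y" 1 0] PQ_pos[of t y] assms by auto
  qed
  have "- Yf x t < - Yf x' t"
  proof (rule DERIV_pos_imp_increasing[OF assms(3)])
    fix y
    have "((\<lambda>x. - Yf x t) has_real_derivative 1 / QY y t) (at y)"
      using DERIV_minus[OF D_Yf_path[of "\<lambda>_. t" y "\<lambda>y. y" 1 0]] assms by auto
    then show "\<exists>d. ((\<lambda>x. - Yf x t) has_real_derivative d) (at y) \<and> 0 < d"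
      using PQ_pos[of t y] assms by auto
  qed
  then show "Yf x' t < Yf x t" by simp
qed

text \<open>On the boundary levels \<open>t = 0\<close> and \<open>t = T\<close> no derivative of
  \<open>G\<close> is at hand; the inequality is carried there from the interior by continuity, at
  the price of strictness.\<close>

lemma monoX_closed:
  assumes "t \<in> {0..T}" "x \<le> x'"
  shows "Xf x t \<le> Xf x' t" "Yf x' t \<le> Yf x t"
proof -
  have cX: "continuous_on {0..T} (\<lambda>t. Xf y t)" and cY: "continuous_on {0..T} (\<lambda>t. Yf y t)" for y
    by (rule continuous_on_compose_pair[OF cont_Xf_strip] continuous_on_compose_pair[OF cont_Yf_strip];
        auto intro!: continuous_intros)+
  have lim: "0 \<le> f t" if c: "continuous_on {0..T} f" and f: "\<And>s. 0 < s \<Longrightarrow> s < T \<Longrightarrow> 0 \<le> f s" for f :: "real \<Rightarrow> real"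
  proof -
    have "t \<in> closure {0<..<T}" using assms(1) T_pos by simp
    moreover have "continuous_on (closure {0<..<T}) f" using c T_pos by simp
    ultimately show ?thesis
      using continuous_ge_on_closure[of "{0<..<T}" f t 0] f by auto
  qed
  have "0 \<le> Xf x' t - Xf x t"
    by (rule lim[of "\<lambda>t. Xf x' t - Xf x t"]) (use cX monoX_interior(1)[of _ x x'] assms(2) in \<open>auto intro!: continuous_intros simp: order_le_less\<close>)
  then show "Xf x t \<le> Xf x' t" by simp
  have "0 \<le> Yf x t - Yf x' t"
    by (rule lim[of "\<lambda>t. Yf x t - Yf x' t"]) (use cY monoX_interior(2)[of _ x x'] assms(2) in \<open>auto intro!: continuous_intros simp: order_le_less\<close>)
  then show "Yf x' t \<le> Yf x t" by simp
qed

text \<open>Strict monotonicity persists at \<open>t = T\<close>, where the Jacobian may vanish: a horizontal segment with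
  constant \<open>X\<close> would be a vertical segment in \<open>\<Omega>\<close> on which \<open>t\<close>, hence also \<open>x\<close>, is constant.\<close>

lemma strict_monoX:
  assumes t: "t \<in> {0..T}" and "x < x'"
  shows "Xf x t < Xf x' t"
proof (rule ccontr)
  assume "\<not> ?thesis"
  then have eq: "Xf x t = Xf x' t" using monoX_closed(1)[OF t less_imp_le[OF assms(2)]] by linarith
  have const: "Xf y t = Xf x t" if "y \<in> {x..x'}" for y
    using monoX_closed(1)[OF t, of x y] monoX_closed(1)[OF t, of y x'] that eq by simp
  have w: "(y, t) \<in> UNIV \<times> {0..T}" for y using t by simp
  have G: "G (y, t) = (Xf y t, Yf y t)" for y by (simp add: Xf_def Yf_def)
  have "Yf x t \<noteq> Yf x' t"
  proof
    assume "Yf x t = Yf x' t"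
    then have "G (x, t) = G (x', t)" using eq G by simp
    then show False using x_G[OF w, of x] x_G[OF w, of x'] assms(2) by simp
  qed
  then have less: "Yf x' t < Yf x t" using monoX_closed(2)[OF t less_imp_le[OF assms(2)]] by linarith
  have ex: "\<exists>y. (Xf x t, Y) = G (y, t)" if YI: "Y \<in> {Yf x' t..Yf x t}" for Y
  proof -
    have "continuous_on {x..x'} (\<lambda>y. Yf y t)"
      by (rule continuous_on_compose_pair[OF cont_Yf_strip]) (use t in \<open>auto intro!: continuous_intros\<close>)
    then obtain y where "x \<le> y" "y \<le> x'" "Yf y t = Y"
      using IVT2'[of "\<lambda>y. Yf y t" x' Y x] YI assms(2) by auto
    then have "(Xf x t, Y) = G (y, t)" using const[of y] G[of y] by simp
    then show ?thesis ..
  qed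
  define X0 where "X0 = Xf x t"
  have in\<Omega>: "(X0, Y) \<in> \<Omega>" "tc (X0, Y) = t" if "Y \<in> {Yf x' t..Yf x t}" for Y
    using ex[OF that] G_in[OF w] t_G[OF w] by (auto simp: X0_def)
  have dt: "((\<lambda>Y. tc (X0, Y)) has_real_derivative 1 / (2 * wave_speed \<gamma> (tau (X0, Y))) * q (X0, Y) * cos (be (X0, Y) / 2)) (at Y)"
    and dx: "((\<lambda>Y. xc (X0, Y)) has_real_derivative - 1 / 2 * q (X0, Y) * cos (be (X0, Y) / 2)) (at Y)"
    if "Y \<in> {Yf x' t..Yf x t}" for Y
  proof -
    have U: "(X0, Y) \<in> U" using in\<Omega>[OF that] \<Omega>_U by auto
    show "((\<lambda>Y. tc (X0, Y)) has_real_derivative 1 / (2 * wave_speed \<gamma> (tau (X0, Y))) * q (X0, Y) * cos (be (X0, Y) / 2)) (at Y)"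
      using DERIV_along_line[OF D_t[OF U] DERIV_const DERIV_ident] by simp
    show "((\<lambda>Y. xc (X0, Y)) has_real_derivative - 1 / 2 * q (X0, Y) * cos (be (X0, Y) / 2)) (at Y)"
      using DERIV_along_line[OF D_x[OF U] DERIV_const DERIV_ident] by simp
  qed
  have "xc (X0, Yf x t) = xc (X0, Yf x' t)"
  proof (rule DERIV_isconst_end[OF less])
    show "continuous_on {Yf x' t..Yf x t} (\<lambda>Y. xc (X0, Y))"
      using dx by (meson DERIV_isCont continuous_at_imp_continuous_on)
    fix Y assume Y: "Yf x' t < Y" "Y < Yf x t"
    then have YI: "Y \<in> {Yf x' t..Yf x t}" by auto
    have "((\<lambda>Y. tc (X0, Y)) has_real_derivative 0) (at Y)"
    proof (rule has_field_derivative_transform_within_open[OF DERIV_const[of t], where S = "{Yf x' t<..<Yf x t}"])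
      show "t = tc (X0, Y')" if "Y' \<in> {Yf x' t<..<Yf x t}" for Y' using in\<Omega>(2)[of Y'] that by simp
    qed (use Y in auto)
    from DERIV_unique[OF this dt[OF YI]] have "q (X0, Y) * cos (be (X0, Y) / 2) = 0"
      using coeff[OF in\<Omega>(1)[OF YI]] wave_speed_pos[of "tau (X0, Y)" \<gamma>] by (auto simp: coeff_bound_def)
    then have "- 1 / 2 * q (X0, Y) * cos (be (X0, Y) / 2) = 0" by simp
    then show "((\<lambda>Y. xc (X0, Y)) has_real_derivative 0) (at Y)" using dx[OF YI] by metis
  qed
  moreover have "(X0, Yf x t) = G (x, t)" "(X0, Yf x' t) = G (x', t)" using G eq by (auto simp: X0_def)
  ultimately show False using x_G[OF w, of x] x_G[OF w, of x'] assms(2) by simp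
qed

end

text \<open>The upper bound \<open>m\<close> of the wave speed serves as the cone speed; the facts
  about \<open>Yf\<close> come from the reflected geometry.\<close>

sublocale char_geometry \<subseteq> label_strip T m Xf Yf
proof -
  interpret S: char_geometry \<gamma> T m \<eta> "prod.swap ` U" "prod.swap ` \<Omega>" "\<lambda>w. prod.swap (G (- fst w, snd w))"
    "\<lambda>z. tau (prod.swap z)" "\<lambda>z. be (prod.swap z)" "\<lambda>z. al (prod.swap z)" "\<lambda>z. q (prod.swap z)" "\<lambda>z. p (prod.swap z)"
    "\<lambda>z. - xc (prod.swap z)" "\<lambda>z. tc (prod.swap z)" by (rule swap_geometry)
  show "label_strip T m Xf Yf"
  proof
    show "0 < T" by (rule T_pos)
    have "(0, 0) \<in> UNIV \<times> {0..T}" using T_pos by simp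
    from coeff[OF G_in[OF this]] show "0 \<le> m" by (simp add: coeff_bound_def)
    show "Yf x' t < Yf x t" if "t \<in> {0..T}" "x < x'" for x x' t
      using S.strict_monoX[of t "- x'" "- x"] that unfolding swap_Xf by simp
    show "Yf x s < Yf x t" if "0 \<le> s" "s < t" "t \<le> T" for x s t
      using S.timeX[OF that, of "- x"] unfolding swap_Xf by simp
    show "Yf x t \<le> Yf (x - m * (t - s)) s" if "0 \<le> s" "s \<le> t" "t \<le> T" for x s t
      using S.coneX[OF that, of "- x"] unfolding swap_Xf by simp
  qed (use cont_Xf_strip cont_Yf_strip strict_monoX timeX coneX in auto)
qed

context char_geometry
begin

lemma G_eq: "G (x, t) = (Xf x t, Yf x t)"
  by (simp add: Xf_def Yf_def)

lemma \<Omega>_eq: "\<Omega> = strip_image T"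
proof (intro equalityI subsetI)
  fix z assume "z \<in> \<Omega>"
  then have "z = (Xf (xc z) (tc z), Yf (xc z) (tc z))" "0 \<le> tc z" "tc z \<le> T"
    using G_xt[of z] t_range[of z] by (simp_all flip: G_eq)
  then show "z \<in> strip_image T" unfolding strip_image_def by blast
next
  fix z assume "z \<in> strip_image T"
  then obtain x s where "z = G (x, s)" "0 \<le> s" "s \<le> T" by (auto simp: strip_image_def G_eq)
  then show "z \<in> \<Omega>" using G_in[of "(x, s)"] by simp
qed

lemma slice: "X \<in> IX \<Longrightarrow> (X, Y) \<in> \<Omega> \<longleftrightarrow> yv 0 X \<le> Y \<and> Y \<le> yv T X"
  unfolding \<Omega>_eq using T_pos by (intro strip_image_slice) auto

lemma \<Omega>_IX: "(X, Y) \<in> \<Omega> \<Longrightarrow> X \<in> IX"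
  unfolding \<Omega>_eq using T_pos by (intro strip_image_IX[of T]) auto

lemma p_sin_const:
  assumes "(X, Y) \<in> \<Omega>" "(X, Y') \<in> \<Omega>"
  shows "p (X, Y) * sin (al (X, Y) / 2) = p (X, Y') * sin (al (X, Y') / 2)"
proof -
  have X: "X \<in> IX" using \<Omega>_IX assms(1) by blast
  define I where "I = {yv 0 X..yv T X}"
  have "((\<lambda>Y. p (X, Y) * sin (al (X, Y) / 2)) has_real_derivative 0) (at Y within I)" if "Y \<in> I" for Y
  proof -
    have "(X, Y) \<in> U" using slice[OF X] that \<Omega>_U by (auto simp: I_def)
    note D_p[OF this] D_al[OF this]
    then have "((\<lambda>Y. p (X, Y) * sin (al (X, Y) / 2)) has_real_derivative
      kap \<gamma> (tau (X, Y)) * p (X, Y) * q (X, Y) * cos (al (X, Y) / 2) * sin ((be (X, Y) - al (X, Y)) / 2) * sin (al (X, Y) / 2)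
      + (cos (al (X, Y) / 2) * (2 * kap \<gamma> (tau (X, Y)) * q (X, Y) * sin (al (X, Y) / 2) * sin ((al (X, Y) - be (X, Y)) / 2) / 2)) * p (X, Y)) (at Y)"
      by (auto intro!: derivative_eq_intros)
    moreover have "sin ((al (X, Y) - be (X, Y)) / 2) = - sin ((be (X, Y) - al (X, Y)) / 2)"
      by (metis minus_diff_eq minus_divide_left sin_minus)
    ultimately show ?thesis by (auto simp: algebra_simps intro: has_field_derivative_subset)
  qed
  then obtain c where "\<And>Y. Y \<in> I \<Longrightarrow> p (X, Y) * sin (al (X, Y) / 2) = c"
    using has_field_derivative_zero_constant[of I "\<lambda>Y. p (X, Y) * sin (al (X, Y) / 2)"] by (auto simp: I_def)
  then show ?thesis using assms slice[OF X] by (simp add: I_def)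
qed

text \<open>An antiderivative of \<open>p |sin(\<alpha>/2)|\<close>, which depends on \<open>X\<close> only, is the total variation of
  \<open>R dx\<close> at time \<open>T/2\<close> up to the characteristic through \<open>X\<close>.\<close>

lemma variation_potential:
  "\<exists>b. (\<forall>X. \<bar>b X\<bar> \<le> \<eta>) \<and>
     (\<forall>X Y. (X, Y) \<in> \<Omega> \<longrightarrow> (b has_real_derivative p (X, Y) * \<bar>sin (al (X, Y) / 2)\<bar>) (at X))"
proof -
  \<comment> \<open>An interior time, where \<open>G\<close> is differentiable and the tangents are
    finite.\<close>
  define s where "s = T / 2"
  have s: "0 < s" "s < T" "s \<in> {0..T}" using T_pos by (auto simp: s_def)
  define r where "r y = \<bar>tan (al (G (y, s)) / 2)\<bar>" for y
  have w: "(y, s) \<in> UNIV \<times> {0..T}" for y using s by simp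
  have cr: "continuous_on UNIV r"
  proof -
    have "continuous_on UNIV (\<lambda>y. al (G (y, s)))"
      using \<Omega>_U G_in w
      by (intro continuous_on_compose2[OF cont_al] continuous_on_compose2[OF cont_G] continuous_intros) auto
    moreover have "cos (al (G (y, s)) / 2) \<noteq> 0" for y
      using cos_pos(1)[OF G_in[OF w]] t_G[OF w] s by (metis less_irrefl snd_conv)
    ultimately show ?thesis unfolding r_def by (intro continuous_intros) auto
  qed
  obtain F where F: "\<And>y. (F has_real_derivative r y) (at y)"
    using einterval_antiderivative[of "-\<infinity>" "\<infinity>" r] cr
    by (auto simp: has_real_derivative_iff_has_vector_derivative continuous_on_eq_continuous_at)
  have Fle: "F a \<le> F b" "F b - F a \<le> \<eta>" if "a \<le> b" for a b
  proof -
    have "(\<integral>\<^sup>+y. ennreal (r y) * indicator {a..b} y \<partial>lborel) = ennreal (F b - F a)"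
      by (rule nn_integral_FTC_Icc) (use cr F that in \<open>auto simp: r_def intro: borel_measurable_continuous_onI\<close>)
    moreover have "(\<integral>\<^sup>+y. ennreal (r y) * indicator {a..b} y \<partial>lborel) \<le> (\<integral>\<^sup>+y. ennreal (r y) \<partial>lborel)"
      by (intro nn_integral_mono) (auto simp: indicator_def)
    ultimately have "ennreal (F b - F a) \<le> ennreal \<eta>" using tv_al unfolding r_def s_def by simp
    then show "F b - F a \<le> \<eta>" using \<eta>_nonneg by (simp add: ennreal_le_iff)
    show "F a \<le> F b" using F by (intro DERIV_nonneg_imp_nondecreasing[OF that]) (metis abs_ge_zero r_def)
  qed
  define b where "b X = F (xi s X) - F 0" for X
  have "\<bar>b X\<bar> \<le> \<eta>" for X
    using Fle[of 0 "xi s X"] Fle[of "xi s X" 0] by (cases "0 \<le> xi s X") (auto simp: b_def)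
  moreover have "(b has_real_derivative p (X, Y) * \<bar>sin (al (X, Y) / 2)\<bar>) (at X)" if XY: "(X, Y) \<in> \<Omega>" for X Y
  proof -
    have X: "X \<in> IX" using \<Omega>_IX XY by blast
    define x0 where "x0 = xi s X"
    have Xx: "Xf x0 s = X" using Xf_xi[OF s(3) X] by (simp add: x0_def)
    have DX: "((\<lambda>x. Xf x s) has_real_derivative 1 / PX x0 s) (at x0)"
      using D_Xf_path[of "\<lambda>_. s" x0 "\<lambda>y. y" 1 0] s by simp
    have "isCont (\<lambda>x. Xf x s) y" for y
      using cont_Xf[OF s(3), of UNIV] by (simp add: continuous_on_eq_continuous_at)
    then have "isCont (xi s) (Xf x0 s)"
      by (intro isCont_inverse_function[of 1 x0 "xi s" "\<lambda>x. Xf x s"]) (auto simp: xi_Xf[OF s(3)])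
    then have cont: "isCont (xi s) X" by (simp add: Xx)
    obtain e where e: "0 < e" "ball X e \<subseteq> IX" using open_IX X open_contains_ball by blast
    have "(xi s has_real_derivative inverse (1 / PX x0 s)) (at X)"
    proof (rule DERIV_inverse_function[where f = "\<lambda>x. Xf x s" and a = "X - e" and b = "X + e"])
      show "Xf (xi s y) s = y" if "X - e < y" "y < X + e" for y
        using that e(2) by (intro Xf_xi[OF s(3)]) (auto simp: ball_def dist_real_def)
    qed (use DX cont e PQ_pos(1)[OF s(1,2), of x0] in \<open>auto simp: x0_def\<close>)
    then have "(b has_real_derivative r x0 * PX x0 s) (at X)"
      unfolding b_def x0_def using DERIV_chain2[OF F, of "xi s"] by (auto intro!: derivative_eq_intros)
    \<comment> \<open>Since \<open>dx = PX dX\<close>, the measure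
      \<open>|tan(\<alpha>/2)| dx\<close> becomes \<open>p |sin(\<alpha>/2)| dX\<close> at time
      \<open>s\<close>. The density does not vary along the line, so it may be evaluated at any
      other point of it.\<close>
    moreover have "r x0 * PX x0 s = p (X, Y) * \<bar>sin (al (X, Y) / 2)\<bar>"
    proof -
      define Y0 where "Y0 = Yf x0 s"
      have G0: "G (x0, s) = (X, Y0)" by (simp add: G_eq Xx Y0_def)
      have in0: "(X, Y0) \<in> \<Omega>" "tc (X, Y0) = s" using G_in[OF w] t_G[OF w] G0 by (metis, metis snd_conv)
      have "0 < cos (al (X, Y0) / 2)" using cos_pos(1)[OF in0(1)] in0(2) s by simp
      then have "r x0 * PX x0 s = \<bar>p (X, Y0) * sin (al (X, Y0) / 2)\<bar>"
        using pq_pos(1)[OF in0(1)] PX_def[OF s(1,2)] by (simp add: r_def G0 tan_def abs_mult)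
      also have "\<dots> = p (X, Y) * \<bar>sin (al (X, Y) / 2)\<bar>"
        using p_sin_const[OF in0(1) XY] pq_pos(1)[OF XY] by (simp add: abs_mult)
      finally show ?thesis .
    qed
    ultimately show ?thesis by simp
  qed
  ultimately show ?thesis by blast
qed

end

section \<open>Smooth families of charts in relabelled coordinates\<close>

text \<open>On one cell the relabelings coincide with families \<open>h\<close>, \<open>k\<close>
  that are smooth on the whole line. Working with these extensions gives two-sided derivatives up to
  and across the edges of the cell.\<close>

locale smooth_cell =
  fixes \<gamma> :: real and V :: "(real \<times> real \<times> real) set" and A :: "real set" and Z :: "real \<Rightarrow> chart"
    and grad :: "(chart \<Rightarrow> real \<times> real \<Rightarrow> real) \<Rightarrow> real \<times> real \<times> real \<Rightarrow> real \<times> real \<times> real"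
    and h k ht hx hxt kt kx kxt :: "real \<Rightarrow> real \<Rightarrow> real"
  assumes open_V: "open V" and open_A: "open A"
    and D_field: "\<And>f z. f \<in> chart_fields \<Longrightarrow> z \<in> V \<Longrightarrow>
      ((\<lambda>(\<theta>, z). f (Z \<theta>) z) has_derivative (\<lambda>d. grad f z \<bullet> d)) (at z)"
    and cont_grad: "\<And>f. f \<in> chart_fields \<Longrightarrow> continuous_on V (grad f)"
    and system: "\<And>\<theta> z. \<theta> \<in> A \<Longrightarrow> (\<theta>, z) \<in> V \<Longrightarrow> semilinear_at \<gamma> (Z \<theta>) z"
    and D_h: "\<And>\<theta> X. \<theta> \<in> A \<Longrightarrow> ((\<lambda>\<theta>. h \<theta> X) has_real_derivative ht \<theta> X) (at \<theta>)"
      "\<And>\<theta> X. \<theta> \<in> A \<Longrightarrow> (h \<theta> has_real_derivative hx \<theta> X) (at X)"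
      "\<And>\<theta> X. \<theta> \<in> A \<Longrightarrow> ((\<lambda>\<theta>. hx \<theta> X) has_real_derivative hxt \<theta> X) (at \<theta>)"
    and D_k: "\<And>\<theta> X. \<theta> \<in> A \<Longrightarrow> ((\<lambda>\<theta>. k \<theta> X) has_real_derivative kt \<theta> X) (at \<theta>)"
      "\<And>\<theta> X. \<theta> \<in> A \<Longrightarrow> (k \<theta> has_real_derivative kx \<theta> X) (at X)"
      "\<And>\<theta> X. \<theta> \<in> A \<Longrightarrow> ((\<lambda>\<theta>. kx \<theta> X) has_real_derivative kxt \<theta> X) (at \<theta>)"
    and cont_h: "continuous_on (A \<times> UNIV) (\<lambda>(\<theta>, X). h \<theta> X)" "continuous_on (A \<times> UNIV) (\<lambda>(\<theta>, X). ht \<theta> X)"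
      "continuous_on (A \<times> UNIV) (\<lambda>(\<theta>, X). hx \<theta> X)" "continuous_on (A \<times> UNIV) (\<lambda>(\<theta>, X). hxt \<theta> X)"
    and cont_k: "continuous_on (A \<times> UNIV) (\<lambda>(\<theta>, X). k \<theta> X)" "continuous_on (A \<times> UNIV) (\<lambda>(\<theta>, X). kt \<theta> X)"
      "continuous_on (A \<times> UNIV) (\<lambda>(\<theta>, X). kx \<theta> X)" "continuous_on (A \<times> UNIV) (\<lambda>(\<theta>, X). kxt \<theta> X)"
begin

definition "emb w = (case w of (\<theta>, X, Y) \<Rightarrow> (\<theta>, h \<theta> X, k \<theta> Y))"

definition "val f \<theta> X Y = f (Z \<theta>) (h \<theta> X, k \<theta> Y)"

text \<open>The derivative in \<theta> at fixed new labels. The components \<open>ht\<close>,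
  \<open>kt\<close> record that the old labels move with \<theta>.\<close>

definition "dot f \<theta> X Y = grad f (\<theta>, h \<theta> X, k \<theta> Y) \<bullet> (1, ht \<theta> X, kt \<theta> Y)"

text \<open>Positivity of \<tau> is part of the domain because the wave speed is differentiated
  there.\<close>

definition "W = {w \<in> A \<times> UNIV. emb w \<in> V \<and> 0 < (case emb w of (\<theta>, z) \<Rightarrow> ch_tau (Z \<theta>) z)}"

definition "pc \<theta> X Y = val ch_p \<theta> X Y * hx \<theta> X"
definition "pd \<theta> X Y = dot ch_p \<theta> X Y * hx \<theta> X + val ch_p \<theta> X Y * hxt \<theta> X"
definition "qc \<theta> X Y = val ch_q \<theta> X Y * kx \<theta> Y"
definition "qd \<theta> X Y = dot ch_q \<theta> X Y * kx \<theta> Y + val ch_q \<theta> X Y * kxt \<theta> Y"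

definition "Jc1 l \<theta> X Y = J_val \<gamma> l (val ch_tau \<theta> X Y) (val ch_alpha \<theta> X Y) (pc \<theta> X Y) (dot ch_tau \<theta> X Y)
  (dot ch_u \<theta> X Y) (dot ch_alpha \<theta> X Y) (pd \<theta> X Y) (dot ch_x \<theta> X Y) (dot ch_t \<theta> X Y)"

definition "Jc2 l \<theta> X Y = J_val \<gamma> l (val ch_tau \<theta> X Y) (val ch_beta \<theta> X Y) (qc \<theta> X Y) (dot ch_tau \<theta> X Y)
  (- dot ch_u \<theta> X Y) (dot ch_beta \<theta> X Y) (qd \<theta> X Y) (- dot ch_x \<theta> X Y) (dot ch_t \<theta> X Y)"

lemma W_iff: "(\<theta>, X, Y) \<in> W \<longleftrightarrow> \<theta> \<in> A \<and> (\<theta>, h \<theta> X, k \<theta> Y) \<in> V \<and> 0 < val ch_tau \<theta> X Y"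
  by (simp add: W_def emb_def val_def)

lemma chart_fields_mem [simp]: "ch_tau \<in> chart_fields" "ch_u \<in> chart_fields" "ch_alpha \<in> chart_fields" "ch_beta \<in> chart_fields"
  "ch_p \<in> chart_fields" "ch_q \<in> chart_fields" "ch_x \<in> chart_fields" "ch_t \<in> chart_fields"
  by (auto simp: chart_fields_def)

lemma cont_lift:
  assumes "continuous_on (A \<times> UNIV) (\<lambda>(\<theta>, X). f \<theta> X)" "S \<subseteq> A \<times> UNIV"
  shows "continuous_on S (\<lambda>w. f (fst w) (fst (snd w)))" "continuous_on S (\<lambda>w. f (fst w) (snd (snd w)))"
  by (rule continuous_on_compose_pair[OF assms(1)]; use assms(2) in \<open>auto intro!: continuous_intros\<close>)+

lemma cont_emb: "continuous_on (A \<times> UNIV) emb"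
  unfolding emb_def case_prod_beta'
  by (intro continuous_on_Pair continuous_on_fst continuous_on_id cont_lift[OF cont_h(1)] cont_lift[OF cont_k(1)] order_refl)

lemma cont_field: "f \<in> chart_fields \<Longrightarrow> continuous_on V (\<lambda>(\<theta>, z). f (Z \<theta>) z)"
  using D_field by (intro continuous_at_imp_continuous_on ballI has_derivative_continuous)

lemma open_W: "open W"
proof -
  have oA: "open (A \<times> (UNIV :: (real \<times> real) set))" using open_A by (intro open_Times) auto
  define V' where "V' = V \<inter> (\<lambda>(\<theta>, z). ch_tau (Z \<theta>) z) -` {0<..}"
  have "open V'"
    unfolding V'_def using cont_field[of ch_tau] open_V by (intro continuous_open_preimage) auto
  then have "open ((A \<times> UNIV) \<inter> emb -` V')" using cont_emb oA by (intro continuous_open_preimage)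
  moreover have "W = (A \<times> UNIV) \<inter> emb -` V'" by (auto simp: W_def V'_def)
  ultimately show ?thesis by simp
qed

lemma W_A: "W \<subseteq> A \<times> UNIV" by (auto simp: W_def)

lemma cont_val:
  assumes "f \<in> chart_fields"
  shows "continuous_on W (\<lambda>(\<theta>, X, Y). val f \<theta> X Y)"
proof -
  have "continuous_on W (\<lambda>w. (\<lambda>(\<theta>, z). f (Z \<theta>) z) (emb w))"
    by (rule continuous_on_compose2[OF cont_field[OF assms] continuous_on_subset[OF cont_emb W_A]]) (auto simp: W_def)
  then show ?thesis by (simp add: val_def emb_def case_prod_beta')
qed

lemma cont_dot:
  assumes "f \<in> chart_fields"
  shows "continuous_on W (\<lambda>(\<theta>, X, Y). dot f \<theta> X Y)"
proof -
  have "continuous_on W (\<lambda>w. grad f (emb w))"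
    by (rule continuous_on_compose2[OF cont_grad[OF assms] continuous_on_subset[OF cont_emb W_A]]) (auto simp: W_def)
  moreover have "continuous_on W (\<lambda>w. (1::real, ht (fst w) (fst (snd w)), kt (fst w) (snd (snd w))))"
    by (intro continuous_on_Pair continuous_on_const cont_lift[OF cont_h(2) W_A] cont_lift[OF cont_k(2) W_A])
  ultimately have "continuous_on W (\<lambda>w. grad f (emb w) \<bullet> (1, ht (fst w) (fst (snd w)), kt (fst w) (snd (snd w))))"
    by (intro continuous_on_inner)
  then show ?thesis by (simp add: dot_def emb_def case_prod_beta')
qed

lemma cont_pq:
  "continuous_on W (\<lambda>(\<theta>, X, Y). pc \<theta> X Y)" "continuous_on W (\<lambda>(\<theta>, X, Y). pd \<theta> X Y)"
  "continuous_on W (\<lambda>(\<theta>, X, Y). qc \<theta> X Y)" "continuous_on W (\<lambda>(\<theta>, X, Y). qd \<theta> X Y)"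
  unfolding pc_def pd_def qc_def qd_def case_prod_beta'
  by (intro continuous_intros cont_val[unfolded case_prod_beta'] cont_dot[unfolded case_prod_beta']
        cont_lift[OF cont_h(3) W_A] cont_lift[OF cont_h(4) W_A] cont_lift[OF cont_k(3) W_A] cont_lift[OF cont_k(4) W_A]; simp)+

lemma cont_J_val:
  fixes S :: "'c::t2_space set"
  assumes "continuous_on S \<tau>" "continuous_on S a" "continuous_on S p" "continuous_on S \<Xi>" "continuous_on S U"
    "continuous_on S B" "continuous_on S P" "continuous_on S X" "continuous_on S Y"
    "\<And>z. z \<in> S \<Longrightarrow> 0 < \<tau> z"
  shows "continuous_on S (\<lambda>z. J_val \<gamma> l (\<tau> z) (a z) (p z) (\<Xi> z) (U z) (B z) (P z) (X z) (Y z))"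
proof -
  have trig: "continuous_on S (\<lambda>z. sin (a z / 2))" "continuous_on S (\<lambda>z. cos (a z / 2))" "continuous_on S (\<lambda>z. sin (a z))"
    using assms(2) by (auto intro!: continuous_on_sin continuous_on_cos continuous_intros)
  note c = continuous_on_divide continuous_on_mult continuous_on_add continuous_on_diff continuous_on_power continuous_on_const
    continuous_on_wave_speed(1) continuous_on_kap_mu(3)
  consider "l = 1" | "l = 2" | "l = 3" | "l = 4" | "l = 5" | "l = 6" | "l \<notin> {1..6}" by force
  then show ?thesis
    by cases (simp_all only: J_val_def if_True if_False, auto intro!: c trig assms)
qed

lemma cont_J: "continuous_on W (\<lambda>(\<theta>, X, Y). Jc1 l \<theta> X Y)" "continuous_on W (\<lambda>(\<theta>, X, Y). Jc2 l \<theta> X Y)"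
proof -
  have pos: "\<And>z. z \<in> W \<Longrightarrow> 0 < val ch_tau (fst z) (fst (snd z)) (snd (snd z))"
    by (auto simp: W_iff)
  note c = cont_val[unfolded case_prod_beta'] cont_dot[unfolded case_prod_beta'] cont_pq[unfolded case_prod_beta']
  show "continuous_on W (\<lambda>(\<theta>, X, Y). Jc1 l \<theta> X Y)"
    unfolding Jc1_def case_prod_beta' by (rule cont_J_val) (simp_all add: c pos)
  show "continuous_on W (\<lambda>(\<theta>, X, Y). Jc2 l \<theta> X Y)"
    unfolding Jc2_def case_prod_beta' by (rule cont_J_val) (simp_all add: c pos continuous_on_minus)
qed

lemma D_val_\<theta>:
  assumes "(\<theta>, X, Y) \<in> W" "f \<in> chart_fields"
  shows "((\<lambda>\<theta>. val f \<theta> X Y) has_real_derivative dot f \<theta> X Y) (at \<theta>)"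
proof -
  have w: "\<theta> \<in> A" "(\<theta>, h \<theta> X, k \<theta> Y) \<in> V" using assms by (auto simp: W_iff)
  have "((\<lambda>\<theta>. (\<theta>, h \<theta> X, k \<theta> Y)) has_derivative (\<lambda>d. (d, ht \<theta> X * d, kt \<theta> Y * d))) (at \<theta>)"
    using D_h(1)[OF w(1), of X] D_k(1)[OF w(1), of Y]
    by (auto simp: has_field_derivative_def intro!: has_derivative_Pair)
  from has_derivative_compose[OF this D_field[OF assms(2) w(2)]]
  show ?thesis
    by (auto simp: has_field_derivative_def val_def dot_def inner_prod_def algebra_simps elim!: has_derivative_eq_rhs)
qed

lemma D_val_X:
  assumes "(\<theta>, X, Y) \<in> W" "f \<in> chart_fields"
  shows "((\<lambda>X. val f \<theta> X Y) has_real_derivative DX (f (Z \<theta>)) (h \<theta> X, k \<theta> Y) * hx \<theta> X) (at X)"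
    and "((\<lambda>Y. val f \<theta> X Y) has_real_derivative DY (f (Z \<theta>)) (h \<theta> X, k \<theta> Y) * kx \<theta> Y) (at Y)"
proof -
  have w: "\<theta> \<in> A" "(\<theta>, h \<theta> X, k \<theta> Y) \<in> V" using assms by (auto simp: W_iff)
  define a b where "a = h \<theta> X" and "b = k \<theta> Y"
  have "((\<lambda>x. (\<theta>, x, b)) has_derivative (\<lambda>d. (0, d, 0))) (at a)"
    by (auto intro!: derivative_eq_intros)
  from has_derivative_compose[OF this] D_field[OF assms(2) w(2)]
  have 1: "((\<lambda>x. f (Z \<theta>) (x, b)) has_real_derivative fst (snd (grad f (\<theta>, a, b)))) (at a)"
    by (force simp: has_field_derivative_def a_def b_def inner_prod_def algebra_simps elim!: has_derivative_eq_rhs)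
  have "((\<lambda>y. (\<theta>, a, y)) has_derivative (\<lambda>d. (0, 0, d))) (at b)"
    by (auto intro!: derivative_eq_intros)
  from has_derivative_compose[OF this] D_field[OF assms(2) w(2)]
  have 2: "((\<lambda>y. f (Z \<theta>) (a, y)) has_real_derivative snd (snd (grad f (\<theta>, a, b)))) (at b)"
    by (force simp: has_field_derivative_def a_def b_def inner_prod_def algebra_simps elim!: has_derivative_eq_rhs)
  have d: "DX (f (Z \<theta>)) (a, b) = fst (snd (grad f (\<theta>, a, b)))" "DY (f (Z \<theta>)) (a, b) = snd (snd (grad f (\<theta>, a, b)))"
    using DERIV_imp_deriv[OF 1] DERIV_imp_deriv[OF 2] by (simp_all add: DX_def DY_def)
  show "((\<lambda>X. val f \<theta> X Y) has_real_derivative DX (f (Z \<theta>)) (h \<theta> X, k \<theta> Y) * hx \<theta> X) (at X)"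
    using DERIV_chain2[OF 1[unfolded a_def] D_h(2)[OF w(1), of X]] d by (simp add: val_def a_def b_def)
  show "((\<lambda>Y. val f \<theta> X Y) has_real_derivative DY (f (Z \<theta>)) (h \<theta> X, k \<theta> Y) * kx \<theta> Y) (at Y)"
    using DERIV_chain2[OF 2[unfolded b_def] D_k(2)[OF w(1), of Y]] d by (simp add: val_def a_def b_def)
qed

lemma D_pq_\<theta>:
  assumes "(\<theta>, X, Y) \<in> W"
  shows "((\<lambda>\<theta>. pc \<theta> X Y) has_real_derivative pd \<theta> X Y) (at \<theta>)" "((\<lambda>\<theta>. qc \<theta> X Y) has_real_derivative qd \<theta> X Y) (at \<theta>)"
  unfolding pc_def pd_def qc_def qd_def
  using DERIV_mult[OF D_val_\<theta>[OF assms, of ch_p] D_h(3)[of \<theta> X]] DERIV_mult[OF D_val_\<theta>[OF assms, of ch_q] D_k(3)[of \<theta> Y]] assms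
  by (simp_all add: W_iff mult_ac add_ac)

lemma coeff_eq:
  assumes "0 < \<tau>"
  shows "deriv (wave_speed \<gamma>) \<tau> / (2 * (wave_speed \<gamma> \<tau>)\<^sup>2) = 2 * kap \<gamma> \<tau>"
    "deriv (wave_speed \<gamma>) \<tau> / (4 * (wave_speed \<gamma> \<tau>)\<^sup>2) = kap \<gamma> \<tau>"
  using deriv_wave_speed[OF assms, of \<gamma>] by (simp_all add: kap_def)

lemma slice_open: "open {(\<theta>, Y). (\<theta>, X, Y) \<in> W}" "open {(\<theta>, X). (\<theta>, X, Y) \<in> W}"
proof -
  have "open ((\<lambda>w. (fst w, X, snd w)) -` W)" "open ((\<lambda>w. (fst w, snd w, Y)) -` W)"
    using open_W by (intro open_vimage continuous_intros; simp)+
  then show "open {(\<theta>, Y). (\<theta>, X, Y) \<in> W}" "open {(\<theta>, X). (\<theta>, X, Y) \<in> W}"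
    by (simp_all add: vimage_def case_prod_beta')
qed

lemma cont_slice:
  assumes "continuous_on W (\<lambda>(\<theta>, X, Y). f \<theta> X Y)"
  shows "continuous_on {(\<theta>, Y). (\<theta>, X, Y) \<in> W} (\<lambda>(\<theta>, Y). f \<theta> X Y)" "continuous_on {(\<theta>, X). (\<theta>, X, Y) \<in> W} (\<lambda>(\<theta>, X). f \<theta> X Y)"
proof -
  have "continuous_on {(\<theta>, Y). (\<theta>, X, Y) \<in> W} (\<lambda>w. (\<lambda>(\<theta>, X, Y). f \<theta> X Y) (fst w, X, snd w))"
    by (rule continuous_on_compose2[OF assms]) (auto intro!: continuous_intros)
  then show "continuous_on {(\<theta>, Y). (\<theta>, X, Y) \<in> W} (\<lambda>(\<theta>, Y). f \<theta> X Y)" by (simp add: case_prod_beta')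
  have "continuous_on {(\<theta>, X). (\<theta>, X, Y) \<in> W} (\<lambda>w. (\<lambda>(\<theta>, X, Y). f \<theta> X Y) (fst w, snd w, Y))"
    by (rule continuous_on_compose2[OF assms]) (auto intro!: continuous_intros)
  then show "continuous_on {(\<theta>, X). (\<theta>, X, Y) \<in> W} (\<lambda>(\<theta>, X). f \<theta> X Y)" by (simp add: case_prod_beta')
qed

text \<open>Since \<open>p\<close> and \<open>q\<close> absorb the factors \<open>hx\<close> and
  \<open>kx\<close>, the relabelled fields solve the same system, and each line
  \<open>X = const\<close> is an instance of \<open>char_line\<close>.\<close>

lemma char_line_Y: "char_line \<gamma> {(\<theta>, Y). (\<theta>, X, Y) \<in> W} (\<lambda>\<theta> Y. val ch_tau \<theta> X Y) (\<lambda>\<theta> Y. val ch_u \<theta> X Y)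
  (\<lambda>\<theta> Y. val ch_alpha \<theta> X Y) (\<lambda>\<theta> Y. val ch_beta \<theta> X Y) (\<lambda>\<theta> Y. pc \<theta> X Y) (\<lambda>\<theta> Y. qc \<theta> X Y) (\<lambda>\<theta> Y. val ch_x \<theta> X Y) (\<lambda>\<theta> Y. val ch_t \<theta> X Y)
  (\<lambda>\<theta> Y. dot ch_tau \<theta> X Y) (\<lambda>\<theta> Y. dot ch_u \<theta> X Y) (\<lambda>\<theta> Y. dot ch_alpha \<theta> X Y) (\<lambda>\<theta> Y. dot ch_beta \<theta> X Y) (\<lambda>\<theta> Y. pd \<theta> X Y) (\<lambda>\<theta> Y. qd \<theta> X Y)
  (\<lambda>\<theta> Y. dot ch_x \<theta> X Y) (\<lambda>\<theta> Y. dot ch_t \<theta> X Y)"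
proof
  fix \<theta> Y assume "(\<theta>, Y) \<in> {(\<theta>, Y). (\<theta>, X, Y) \<in> W}"
  then have w: "(\<theta>, X, Y) \<in> W" by simp
  then have A: "\<theta> \<in> A" "(\<theta>, h \<theta> X, k \<theta> Y) \<in> V" and pos: "0 < val ch_tau \<theta> X Y" by (auto simp: W_iff)
  show "0 < val ch_tau \<theta> X Y" by (rule pos)
  note sys = system[OF A, unfolded semilinear_at_def Let_def, folded val_def, unfolded coeff_eq[OF pos]]
  note D = D_val_X(2)[OF w]
  show "((\<lambda>Y. val ch_alpha \<theta> X Y) has_real_derivative 2 * kap \<gamma> (val ch_tau \<theta> X Y) * qc \<theta> X Y * sin (val ch_alpha \<theta> X Y / 2) *
      sin ((val ch_alpha \<theta> X Y - val ch_beta \<theta> X Y) / 2)) (at Y)"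
    using D[of ch_alpha] sys by (simp add: qc_def mult_ac)
  show "((\<lambda>Y. pc \<theta> X Y) has_real_derivative kap \<gamma> (val ch_tau \<theta> X Y) * pc \<theta> X Y * qc \<theta> X Y * cos (val ch_alpha \<theta> X Y / 2) *
      sin ((val ch_beta \<theta> X Y - val ch_alpha \<theta> X Y) / 2)) (at Y)"
    using DERIV_cmult_right[OF D[of ch_p], of "hx \<theta> X"] sys by (simp add: pc_def qc_def mult_ac)
  show "((\<lambda>Y. val ch_tau \<theta> X Y) has_real_derivative 1 / (2 * wave_speed \<gamma> (val ch_tau \<theta> X Y)) * qc \<theta> X Y * sin (val ch_beta \<theta> X Y / 2)) (at Y)"
    using D[of ch_tau] sys by (simp add: qc_def mult_ac)
  show "((\<lambda>Y. val ch_u \<theta> X Y) has_real_derivative - 1 / 2 * qc \<theta> X Y * sin (val ch_beta \<theta> X Y / 2)) (at Y)"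
    using D[of ch_u] sys by (simp add: qc_def mult_ac)
  show "((\<lambda>Y. val ch_t \<theta> X Y) has_real_derivative 1 / (2 * wave_speed \<gamma> (val ch_tau \<theta> X Y)) * qc \<theta> X Y * cos (val ch_beta \<theta> X Y / 2)) (at Y)"
    using D[of ch_t] sys by (simp add: qc_def mult_ac)
  show "((\<lambda>Y. val ch_x \<theta> X Y) has_real_derivative - 1 / 2 * qc \<theta> X Y * cos (val ch_beta \<theta> X Y / 2)) (at Y)"
    using D[of ch_x] sys by (simp add: qc_def mult_ac)
qed (auto intro!: slice_open cont_slice(1) cont_val cont_dot cont_pq D_val_\<theta> D_pq_\<theta>)

text \<open>Along \<open>Y = const\<close> the equations of \<open>u\<close> and \<open>x\<close>
  have the opposite sign; replacing \<open>u\<close>, \<open>x\<close> by \<open>- u\<close>,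
  \<open>- x\<close> restores the form required by \<open>char_line\<close>.\<close>

lemma char_line_X: "char_line \<gamma> {(\<theta>, X). (\<theta>, X, Y) \<in> W} (\<lambda>\<theta> X. val ch_tau \<theta> X Y) (\<lambda>\<theta> X. - val ch_u \<theta> X Y)
  (\<lambda>\<theta> X. val ch_beta \<theta> X Y) (\<lambda>\<theta> X. val ch_alpha \<theta> X Y) (\<lambda>\<theta> X. qc \<theta> X Y) (\<lambda>\<theta> X. pc \<theta> X Y) (\<lambda>\<theta> X. - val ch_x \<theta> X Y) (\<lambda>\<theta> X. val ch_t \<theta> X Y)
  (\<lambda>\<theta> X. dot ch_tau \<theta> X Y) (\<lambda>\<theta> X. - dot ch_u \<theta> X Y) (\<lambda>\<theta> X. dot ch_beta \<theta> X Y) (\<lambda>\<theta> X. dot ch_alpha \<theta> X Y) (\<lambda>\<theta> X. qd \<theta> X Y) (\<lambda>\<theta> X. pd \<theta> X Y)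
  (\<lambda>\<theta> X. - dot ch_x \<theta> X Y) (\<lambda>\<theta> X. dot ch_t \<theta> X Y)"
proof
  fix \<theta> X assume "(\<theta>, X) \<in> {(\<theta>, X). (\<theta>, X, Y) \<in> W}"
  then have w: "(\<theta>, X, Y) \<in> W" by simp
  then have A: "\<theta> \<in> A" "(\<theta>, h \<theta> X, k \<theta> Y) \<in> V" and pos: "0 < val ch_tau \<theta> X Y" by (auto simp: W_iff)
  show "0 < val ch_tau \<theta> X Y" by (rule pos)
  note sys = system[OF A, unfolded semilinear_at_def Let_def, folded val_def, unfolded coeff_eq[OF pos]]
  note D = D_val_X(1)[OF w]
  show "((\<lambda>X. val ch_beta \<theta> X Y) has_real_derivative 2 * kap \<gamma> (val ch_tau \<theta> X Y) * pc \<theta> X Y * sin (val ch_beta \<theta> X Y / 2) *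
      sin ((val ch_beta \<theta> X Y - val ch_alpha \<theta> X Y) / 2)) (at X)"
    using D[of ch_beta] sys by (simp add: pc_def mult_ac)
  show "((\<lambda>X. qc \<theta> X Y) has_real_derivative kap \<gamma> (val ch_tau \<theta> X Y) * qc \<theta> X Y * pc \<theta> X Y * cos (val ch_beta \<theta> X Y / 2) *
      sin ((val ch_alpha \<theta> X Y - val ch_beta \<theta> X Y) / 2)) (at X)"
    using DERIV_cmult_right[OF D[of ch_q], of "kx \<theta> Y"] sys by (simp add: pc_def qc_def mult_ac)
  show "((\<lambda>X. val ch_tau \<theta> X Y) has_real_derivative 1 / (2 * wave_speed \<gamma> (val ch_tau \<theta> X Y)) * pc \<theta> X Y * sin (val ch_alpha \<theta> X Y / 2)) (at X)"
    using D[of ch_tau] sys by (simp add: pc_def mult_ac)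
  show "((\<lambda>X. - val ch_u \<theta> X Y) has_real_derivative - 1 / 2 * pc \<theta> X Y * sin (val ch_alpha \<theta> X Y / 2)) (at X)"
    using DERIV_minus[OF D[of ch_u]] sys by (simp add: pc_def mult_ac)
  show "((\<lambda>X. val ch_t \<theta> X Y) has_real_derivative 1 / (2 * wave_speed \<gamma> (val ch_tau \<theta> X Y)) * pc \<theta> X Y * cos (val ch_alpha \<theta> X Y / 2)) (at X)"
    using D[of ch_t] sys by (simp add: pc_def mult_ac)
  show "((\<lambda>X. - val ch_x \<theta> X Y) has_real_derivative - 1 / 2 * pc \<theta> X Y * cos (val ch_alpha \<theta> X Y / 2)) (at X)"
    using DERIV_minus[OF D[of ch_x]] sys by (simp add: pc_def mult_ac)
qed (auto intro!: slice_open cont_slice(2) cont_val cont_dot cont_pq D_val_\<theta> D_pq_\<theta> DERIV_minus)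

lemma J_bounds:
  assumes w: "(\<theta>, X, Y) \<in> W" and m: "coeff_bound \<gamma> m (val ch_tau \<theta> X Y)"
    and pq: "0 < pc \<theta> X Y" "0 < qc \<theta> X Y" and N: "N = 4 \<or> N = 6" and l: "l \<in> {1..N}"
  shows "\<exists>D. ((\<lambda>Y. Jc1 l \<theta> X Y) has_real_derivative D) (at Y) \<and>
      \<bar>D\<bar> \<le> 500 * m ^ 4 * (qc \<theta> X Y * (\<Sum>k = 1..N. \<bar>Jc1 k \<theta> X Y\<bar>) + pc \<theta> X Y * (\<Sum>k = 1..N. \<bar>Jc2 k \<theta> X Y\<bar>))"
    and "\<exists>D. ((\<lambda>X. Jc2 l \<theta> X Y) has_real_derivative D) (at X) \<and>
      \<bar>D\<bar> \<le> 500 * m ^ 4 * (qc \<theta> X Y * (\<Sum>k = 1..N. \<bar>Jc1 k \<theta> X Y\<bar>) + pc \<theta> X Y * (\<Sum>k = 1..N. \<bar>Jc2 k \<theta> X Y\<bar>))"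
  using char_line.DERIV_J1_bound[OF char_line_Y, of \<theta> Y X m N l] char_line.DERIV_J1_bound[OF char_line_X, of \<theta> X Y m N l] assms
  by (simp_all add: Jc1_def[abs_def] Jc2_def[abs_def] add.commute)

end

section \<open>Piecewise smooth relabelings and weighted increments\<close>

definition C2_family :: "real set \<Rightarrow> (real \<Rightarrow> real \<Rightarrow> real) \<Rightarrow> (real \<Rightarrow> real \<Rightarrow> real) \<Rightarrow> (real \<Rightarrow> real \<Rightarrow> real) \<Rightarrow> (real \<Rightarrow> real \<Rightarrow> real) \<Rightarrow> bool" where
  "C2_family A h ht hx hxt \<longleftrightarrow>
     (\<forall>\<theta>\<in>A. \<forall>X. ((\<lambda>\<theta>. h \<theta> X) has_real_derivative ht \<theta> X) (at \<theta>) \<and> (h \<theta> has_real_derivative hx \<theta> X) (at X) \<and>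
        ((\<lambda>\<theta>. hx \<theta> X) has_real_derivative hxt \<theta> X) (at \<theta>)) \<and>
     continuous_on (A \<times> UNIV) (\<lambda>(\<theta>, X). h \<theta> X) \<and> continuous_on (A \<times> UNIV) (\<lambda>(\<theta>, X). ht \<theta> X) \<and>
     continuous_on (A \<times> UNIV) (\<lambda>(\<theta>, X). hx \<theta> X) \<and> continuous_on (A \<times> UNIV) (\<lambda>(\<theta>, X). hxt \<theta> X)"

text \<open>The relabeling agrees with its smooth extension on the closed cell, so both one-sided
  derivatives exist at the breakpoints, and the set \<open>N\<close> of breakpoints is the same for
  all parameters in \<open>A\<close>.\<close>

definition smooth_cells :: "real set \<Rightarrow> real set \<Rightarrow> (real \<Rightarrow> real \<Rightarrow> real) \<Rightarrow> bool" where
  "smooth_cells A N \<phi> \<longleftrightarrow> (\<forall>a b. a < b \<and> {a<..<b} \<inter> N = {} \<longrightarrow>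
     (\<exists>h ht hx hxt. C2_family A h ht hx hxt \<and> (\<forall>\<theta>\<in>A. \<forall>X\<in>{a..b}. \<phi> \<theta> X = h \<theta> X \<and> 0 < hx \<theta> X)))"

lemma Ck_on_continuous: "Ck_on k f A \<Longrightarrow> continuous_on A f"
proof (cases k)
  case (Suc j)
  assume "Ck_on k f A"
  then obtain g where "\<And>z. z \<in> A \<Longrightarrow> (f has_derivative (\<lambda>h. g z \<bullet> h)) (at z within A)"
    using Suc by auto
  then show ?thesis by (meson continuous_on_eq_continuous_within has_derivative_continuous)
qed simp

lemma Ck_on_open_gradient:
  assumes "Ck_on (Suc k) f A" "open A"
  shows "\<exists>g. (\<forall>z\<in>A. (f has_derivative (\<lambda>h. g z \<bullet> h)) (at z)) \<and> continuous_on A g \<and> (\<forall>b\<in>Basis. Ck_on k (\<lambda>z. g z \<bullet> b) A)"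
proof -
  obtain g where g: "\<And>z. z \<in> A \<Longrightarrow> (f has_derivative (\<lambda>h. g z \<bullet> h)) (at z within A)"
    "\<And>b. b \<in> Basis \<Longrightarrow> Ck_on k (\<lambda>z. g z \<bullet> b) A"
    using assms(1) by auto
  have "continuous_on A (\<lambda>z. \<Sum>b\<in>Basis. (g z \<bullet> b) *\<^sub>R b)"
    by (intro continuous_on_sum continuous_on_scaleR continuous_on_const Ck_on_continuous[OF g(2)])
  then have "continuous_on A g" by (simp add: euclidean_representation)
  moreover have "(f has_derivative (\<lambda>h. g z \<bullet> h)) (at z)" if "z \<in> A" for z
    using g(1)[OF that] at_within_open[OF that assms(2)] by simp
  ultimately show ?thesis using g(2) by blast
qed

lemma Ck_on_2_family:
  assumes "Ck_on 2 (\<lambda>(\<theta>, X). h \<theta> X) (A \<times> UNIV)" "open A"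
  shows "\<exists>ht hx hxt. C2_family A h ht hx hxt"
proof -
  have op: "open (A \<times> (UNIV :: real set))" using assms(2) by (intro open_Times) auto
  have ptw: "((\<lambda>\<theta>. f (\<theta>, X)) has_real_derivative G \<bullet> (1, 0)) (at \<theta>)" "((\<lambda>X. f (\<theta>, X)) has_real_derivative G \<bullet> (0, 1)) (at X)"
    if "(f has_derivative (\<lambda>d. G \<bullet> d)) (at (\<theta>, X))" for f :: "real \<times> real \<Rightarrow> real" and G and \<theta> X :: real
  proof -
    have D: "(f has_derivative (\<lambda>d. fst G * fst d + snd G * snd d)) (at (\<theta>, X))"
      using that by (simp add: inner_prod_def)
    show "((\<lambda>\<theta>. f (\<theta>, X)) has_real_derivative G \<bullet> (1, 0)) (at \<theta>)"
      using DERIV_along_line[of f _ _ "\<lambda>t. t" \<theta> "\<lambda>_. X", OF D DERIV_ident DERIV_const] by (simp add: inner_prod_def)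
    show "((\<lambda>X. f (\<theta>, X)) has_real_derivative G \<bullet> (0, 1)) (at X)"
      using DERIV_along_line[of f _ _ "\<lambda>_. \<theta>" X "\<lambda>t. t", OF D DERIV_const DERIV_ident] by (simp add: inner_prod_def)
  qed
  have "Ck_on (Suc 1) (\<lambda>(\<theta>, X). h \<theta> X) (A \<times> UNIV)" using assms(1) by (simp add: numeral_2_eq_2)
  from Ck_on_open_gradient[OF this op] obtain g where g: "\<And>z. z \<in> A \<times> UNIV \<Longrightarrow> ((\<lambda>(\<theta>, X). h \<theta> X) has_derivative (\<lambda>d. g z \<bullet> d)) (at z)"
    "continuous_on (A \<times> UNIV) g" "\<And>b. b \<in> Basis \<Longrightarrow> Ck_on 1 (\<lambda>z. g z \<bullet> b) (A \<times> UNIV)"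
    by blast
  have "(0, 1) \<in> (Basis :: (real \<times> real) set)" by (simp add: Basis_prod_def)
  then have "Ck_on (Suc 0) (\<lambda>z. g z \<bullet> (0, 1)) (A \<times> UNIV)" using g(3) by simp
  from Ck_on_open_gradient[OF this op] obtain g' where g': "\<And>z. z \<in> A \<times> UNIV \<Longrightarrow> ((\<lambda>z. g z \<bullet> (0, 1)) has_derivative (\<lambda>d. g' z \<bullet> d)) (at z)"
    "continuous_on (A \<times> UNIV) g'"
    by blast
  have "C2_family A h (\<lambda>\<theta> X. g (\<theta>, X) \<bullet> (1, 0)) (\<lambda>\<theta> X. g (\<theta>, X) \<bullet> (0, 1)) (\<lambda>\<theta> X. g' (\<theta>, X) \<bullet> (1, 0))"
    unfolding C2_family_def
  proof (intro conjI ballI allI)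
    fix \<theta> X :: real assume "\<theta> \<in> A"
    then have w: "(\<theta>, X) \<in> A \<times> UNIV" by simp
    show "((\<lambda>\<theta>. h \<theta> X) has_real_derivative g (\<theta>, X) \<bullet> (1, 0)) (at \<theta>)" "(h \<theta> has_real_derivative g (\<theta>, X) \<bullet> (0, 1)) (at X)"
      using ptw[OF g(1)[OF w]] by simp_all
    show "((\<lambda>\<theta>. g (\<theta>, X) \<bullet> (0, 1)) has_real_derivative g' (\<theta>, X) \<bullet> (1, 0)) (at \<theta>)"
      using ptw(1)[OF g'(1)[OF w]] by simp
  qed (use Ck_on_continuous[OF assms(1)] g(2) g'(2) in \<open>auto simp: case_prod_beta' intro!: continuous_intros\<close>)
  then show ?thesis by blast
qed

lemma C2_family_mono:
  assumes "C2_family A h ht hx hxt" "B \<subseteq> A"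
  shows "C2_family B h ht hx hxt"
proof -
  have "continuous_on (B \<times> UNIV) f" if "continuous_on (A \<times> UNIV) f" for f :: "real \<times> real \<Rightarrow> real"
    by (rule continuous_on_subset[OF that]) (use assms(2) in auto)
  then show ?thesis using assms unfolding C2_family_def by blast
qed

lemma pw_relabeling_cells:
  assumes "pw_relabeling \<phi>"
  shows "\<exists>F N. finite F \<and> finite N \<and> (\<forall>A. open A \<longrightarrow> A \<subseteq> {0<..<1} - F \<longrightarrow> smooth_cells A N \<phi>)"
proof -
  define ok where "ok F h a b \<longleftrightarrow> Ck_on 2 (\<lambda>(\<theta>, X). h \<theta> X) (({0<..<1} - F) \<times> UNIV) \<and>
      (\<forall>\<theta>\<in>{0<..<1} - F. \<forall>X\<in>{a..b}. \<phi> \<theta> X = h \<theta> X \<and> 0 < deriv (h \<theta>) X)" for F h and a b :: real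
  have "\<exists>F G. finite F \<and> finite G \<and> (\<forall>a b. a < b \<and> {a<..<b} \<inter> G = {} \<longrightarrow> (\<exists>h. ok F h a b))"
    using assms unfolding pw_relabeling_def ok_def by (rule conjunct2)
  then obtain F N where FN: "finite F" "finite N"
    and c: "\<forall>a b. a < b \<and> {a<..<b} \<inter> N = {} \<longrightarrow> (\<exists>h. ok F h a b)" by (elim exE conjE) (rule that)
  have op: "open ({0<..<1} - F)" using FN(1) by (simp add: finite_imp_closed open_Diff)
  have "smooth_cells A N \<phi>" if A: "A \<subseteq> {0<..<1} - F" for A
    unfolding smooth_cells_def
  proof (intro allI impI, elim conjE)
    fix a b :: real assume "a < b" "{a<..<b} \<inter> N = {}"
    with c obtain h where "ok F h a b" by meson
    then have h: "Ck_on 2 (\<lambda>(\<theta>, X). h \<theta> X) (({0<..<1} - F) \<times> UNIV)"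
      "\<forall>\<theta>\<in>{0<..<1} - F. \<forall>X\<in>{a..b}. \<phi> \<theta> X = h \<theta> X \<and> 0 < deriv (h \<theta>) X"
      unfolding ok_def by simp_all
    obtain ht hx hxt where C2: "C2_family ({0<..<1} - F) h ht hx hxt" using Ck_on_2_family[OF h(1) op] by blast
    show "\<exists>h ht hx hxt. C2_family A h ht hx hxt \<and> (\<forall>\<theta>\<in>A. \<forall>X\<in>{a..b}. \<phi> \<theta> X = h \<theta> X \<and> 0 < hx \<theta> X)"
    proof (intro exI conjI ballI)
      show "C2_family A h ht hx hxt" by (rule C2_family_mono[OF C2 A])
      fix \<theta> X assume "\<theta> \<in> A" "X \<in> {a..b}"
      then have \<theta>: "\<theta> \<in> {0<..<1} - F" using A by blast
      have "(h \<theta> has_real_derivative hx \<theta> X) (at X)" using C2 \<theta> by (simp add: C2_family_def)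
      then have "deriv (h \<theta>) X = hx \<theta> X" by (rule DERIV_imp_deriv)
      moreover have "\<phi> \<theta> X = h \<theta> X \<and> 0 < deriv (h \<theta>) X" using bspec[OF bspec[OF h(2) \<theta>] \<open>X \<in> {a..b}\<close>] .
      ultimately show "\<phi> \<theta> X = h \<theta> X" "0 < hx \<theta> X" by simp_all
    qed
  qed
  then show ?thesis using FN by blast
qed

lemma cells_around:
  fixes N :: "real set"
  assumes "finite N"
  shows "\<exists>d>0. {x - d<..<x} \<inter> N = {} \<and> {x<..<x + d} \<inter> N = {} \<and> (x \<notin> N \<longrightarrow> {x - d<..<x + d} \<inter> N = {})"
proof -
  obtain d where "0 < d" "\<And>y. y \<in> N \<Longrightarrow> y \<noteq> x \<Longrightarrow> d \<le> dist x y"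
    using finite_set_avoid[OF assms, of x] by blast
  note d = this
  have n: "y \<notin> N" if "\<bar>y - x\<bar> < d" "y \<noteq> x" for y
    using d(2)[of y] that by (auto simp: dist_real_def abs_minus_commute)
  have 1: "{x - d<..<x} \<inter> N = {}" using n by (auto simp: disjoint_iff abs_less_iff)
  have 2: "{x<..<x + d} \<inter> N = {}" using n by (auto simp: disjoint_iff abs_less_iff)
  have 3: "{x - d<..<x + d} \<inter> N = {}" if "x \<notin> N"
  proof -
    have "y \<notin> N" if "y \<in> {x - d<..<x + d}" for y
      using n[of y] that \<open>x \<notin> N\<close> by (cases "y = x") (auto simp: abs_less_iff)
    then show ?thesis by blast
  qed
  show ?thesis using d(1) 1 2 3 by blast
qed

text \<open>\<open>r\<close> bounds the growth of \<open>|J|\<close> and \<open>v\<close> is the rate gained from the weight \<open>exp(-V)\<close>; the proof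
  smooths \<open>|J|\<close> to \<open>sqrt(J\<^sup>2 + \<epsilon>\<^sup>2)\<close>.\<close>

lemma weighted_abs_increment:
  fixes J V D V' r v g :: "real \<Rightarrow> real"
  assumes ab: "a \<le> b" and S: "finite S"
    and contJ: "continuous_on {a..b} J" and contV: "continuous_on {a..b} V"
    and DJ: "\<And>y. y \<in> {a<..<b} - S \<Longrightarrow> (J has_real_derivative D y) (at y)" "\<And>y. y \<in> {a<..<b} - S \<Longrightarrow> \<bar>D y\<bar> \<le> r y"
    and DV: "\<And>y. y \<in> {a<..<b} - S \<Longrightarrow> (V has_real_derivative V' y) (at y)" "\<And>y. y \<in> {a<..<b} - S \<Longrightarrow> v y \<le> V' y"
      "\<And>y. y \<in> {a<..<b} - S \<Longrightarrow> 0 \<le> v y"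
    and g: "\<And>y. y \<in> {a<..<b} - S \<Longrightarrow> g y = exp (- V y) * (r y - v y * \<bar>J y\<bar>)" "set_integrable lborel {a..b} g"
  shows "\<bar>J b\<bar> * exp (- V b) - \<bar>J a\<bar> * exp (- V a) \<le> (LINT y:{a..b}|lborel. g y)"
proof -
  have gi: "(g has_integral (LINT y:{a..b}|lborel. g y)) {a..b}"
    using set_borel_integral_eq_integral[OF g(2)] by (simp add: has_integral_integral)
  have eps: "sqrt ((J b)\<^sup>2 + e\<^sup>2) * exp (- V b) - sqrt ((J a)\<^sup>2 + e\<^sup>2) * exp (- V a) \<le> (LINT y:{a..b}|lborel. g y)"
    if e: "0 < e" for e
  proof -
    define f where "f y = sqrt ((J y)\<^sup>2 + e\<^sup>2) * exp (- V y)" for y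
    define f' where "f' y = J y * D y / sqrt ((J y)\<^sup>2 + e\<^sup>2) * exp (- V y) - sqrt ((J y)\<^sup>2 + e\<^sup>2) * exp (- V y) * V' y" for y
    have pos: "0 < (J y)\<^sup>2 + e\<^sup>2" for y using e by (simp add: add_nonneg_pos)
    have D: "(f has_real_derivative f' y) (at y)" if "y \<in> {a<..<b} - S" for y
    proof -
      note [derivative_intros] = DJ(1)[OF that] DV(1)[OF that]
      show ?thesis unfolding f_def f'_def using pos[of y]
        by (auto intro!: derivative_eq_intros simp: field_simps)
    qed
    have "(f' has_integral f b - f a) {a..b}"
    proof (rule fundamental_theorem_of_calculus_interior_strong[OF S ab])
      show "(f has_vector_derivative f' y) (at y)" if "y \<in> {a<..<b} - S" for y
        using D[OF that] by (simp add: has_real_derivative_iff_has_vector_derivative)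
      show "continuous_on {a..b} f" unfolding f_def by (intro continuous_intros contJ contV)
    qed
    \<comment> \<open>Overwriting the derivative by \<open>g\<close> at finitely many points does
      not change the integral and makes the comparison with \<open>g\<close> hold at every
      point.\<close>
    then have fi: "((\<lambda>y. if y \<in> S \<union> {a, b} then g y else f' y) has_integral f b - f a) {a..b}"
      by (rule has_integral_spike_finite[rotated 2, of _ _ _ "S \<union> {a, b}"]) (use S in auto)
    have "f b - f a \<le> (LINT y:{a..b}|lborel. g y)"
    proof (rule has_integral_le[OF fi gi])
      fix y assume y: "y \<in> {a..b}"
      show "(if y \<in> S \<union> {a, b} then g y else f' y) \<le> g y"
      proof (cases "y \<in> S \<union> {a, b}")
        case False
        then have y': "y \<in> {a<..<b} - S" using y by auto
        define s where "s = sqrt ((J y)\<^sup>2 + e\<^sup>2)"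
        have s: "0 < s" "\<bar>J y\<bar> \<le> s" using pos[of y] by (auto simp: s_def intro: real_le_rsqrt)
        have "J y * D y / s \<le> r y"
        proof -
          have "J y * D y \<le> \<bar>J y\<bar> * \<bar>D y\<bar>" by (metis abs_ge_self abs_mult)
          also have "\<dots> \<le> s * r y" using s DJ(2)[OF y'] by (intro mult_mono) auto
          finally show ?thesis using s by (simp add: field_simps)
        qed
        moreover have "v y * \<bar>J y\<bar> \<le> V' y * s"
          using s DV(2,3)[OF y'] by (intro mult_mono) auto
        ultimately have "exp (- V y) * (J y * D y / s - V' y * s) \<le> exp (- V y) * (r y - v y * \<bar>J y\<bar>)"
          by (intro mult_left_mono) auto
        then show ?thesis using False g(1)[OF y'] by (simp add: f'_def s_def algebra_simps)
      qed simp
    qed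
    then show ?thesis by (simp add: f_def)
  qed
  have "((\<lambda>e. sqrt ((J b)\<^sup>2 + e\<^sup>2) * exp (- V b) - sqrt ((J a)\<^sup>2 + e\<^sup>2) * exp (- V a)) \<longlongrightarrow>
      sqrt ((J b)\<^sup>2 + 0\<^sup>2) * exp (- V b) - sqrt ((J a)\<^sup>2 + 0\<^sup>2) * exp (- V a)) (at_right 0)"
    by (intro tendsto_intros)
  then have "((\<lambda>e. sqrt ((J b)\<^sup>2 + e\<^sup>2) * exp (- V b) - sqrt ((J a)\<^sup>2 + e\<^sup>2) * exp (- V a)) \<longlongrightarrow>
      \<bar>J b\<bar> * exp (- V b) - \<bar>J a\<bar> * exp (- V a)) (at_right 0)" by simp
  then show ?thesis
    by (rule tendsto_upperbound[OF _ eventually_at_rightI[of 0 1]]) (auto intro: eps)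
qed

lemma locally_bounded_on_compact:
  fixes f :: "'a::metric_space \<Rightarrow> real"
  assumes "compact K" "\<And>z. z \<in> K \<Longrightarrow> \<exists>d B. 0 < d \<and> (\<forall>w\<in>ball z d \<inter> S. \<bar>f w\<bar> \<le> B)"
  shows "\<exists>B. \<forall>w\<in>K \<inter> S. \<bar>f w\<bar> \<le> B"
proof -
  obtain d B where dB: "\<And>z. z \<in> K \<Longrightarrow> 0 < d z" "\<And>z w. z \<in> K \<Longrightarrow> w \<in> ball z (d z) \<inter> S \<Longrightarrow> \<bar>f w\<bar> \<le> B z"
    using assms(2) by metis
  obtain C where C: "C \<subseteq> K" "finite C" "K \<subseteq> (\<Union>z\<in>C. ball z (d z))"
  proof (rule compactE_image[OF assms(1), of K "\<lambda>z. ball z (d z)"])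
    show "K \<subseteq> (\<Union>z\<in>K. ball z (d z))" using dB(1) by force
  qed auto
  show ?thesis
  proof (intro exI ballI)
    fix w assume w: "w \<in> K \<inter> S"
    then obtain z where z: "z \<in> C" "w \<in> ball z (d z)" using C by auto
    then have "\<bar>f w\<bar> \<le> \<bar>B z\<bar>" using dB(2)[of z w] C w by force
    also have "\<dots> \<le> (\<Sum>z\<in>C. \<bar>B z\<bar>)" using C z by (intro member_le_sum) auto
    finally show "\<bar>f w\<bar> \<le> (\<Sum>z\<in>C. \<bar>B z\<bar>)" .
  qed
qed

section \<open>Densities in relabelled coordinates at one parameter\<close>

locale relabelled_path = char_geometry \<gamma> T m \<eta> "{z. (\<theta>, z) \<in> V}" \<Omega> G "ch_tau (Z \<theta>)" "ch_alpha (Z \<theta>)" "ch_beta (Z \<theta>)"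
    "ch_p (Z \<theta>)" "ch_q (Z \<theta>)" "ch_x (Z \<theta>)" "ch_t (Z \<theta>)"
  for \<gamma> T m \<eta> \<theta> :: real and V :: "(real \<times> real \<times> real) set" and \<Omega> G and Z :: "real \<Rightarrow> chart" +
  fixes A N M :: "real set" and \<phi> \<psi> :: "real \<Rightarrow> real \<Rightarrow> real"
    and grad :: "(chart \<Rightarrow> real \<times> real \<Rightarrow> real) \<Rightarrow> real \<times> real \<times> real \<Rightarrow> real \<times> real \<times> real"
  assumes open_V: "open V" and open_A: "open A" and \<theta>_A: "\<theta> \<in> A" and fin: "finite N" "finite M"
    and D_field: "\<And>f z. f \<in> chart_fields \<Longrightarrow> z \<in> V \<Longrightarrow>
      ((\<lambda>(\<theta>, z). f (Z \<theta>) z) has_derivative (\<lambda>d. grad f z \<bullet> d)) (at z)"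
    and cont_grad: "\<And>f. f \<in> chart_fields \<Longrightarrow> continuous_on V (grad f)"
    and system: "\<And>\<theta> z. \<theta> \<in> A \<Longrightarrow> (\<theta>, z) \<in> V \<Longrightarrow> semilinear_at \<gamma> (Z \<theta>) z"
    and cells: "smooth_cells A N \<phi>" "smooth_cells A M \<psi>"
    and \<phi>: "strict_mono (\<phi> \<theta>)" "continuous_on UNIV (\<phi> \<theta>)" "surj (\<phi> \<theta>)"
    and \<psi>: "strict_mono (\<psi> \<theta>)" "continuous_on UNIV (\<psi> \<theta>)" "surj (\<psi> \<theta>)"
begin

definition "Zr = (\<lambda>\<theta>. relabel (\<phi> \<theta>) (\<psi> \<theta>) (Z \<theta>))"
definition "\<Omega>r = relabel_domain (\<phi> \<theta>) (\<psi> \<theta>) \<Omega>"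
definition "Ur = {(X, Y). (\<theta>, \<phi> \<theta> X, \<psi> \<theta> Y) \<in> V \<and> 0 < ch_tau (Z \<theta>) (\<phi> \<theta> X, \<psi> \<theta> Y)}"
definition "Jm l z = J_minus \<gamma> l Zr \<theta> z"
text \<open>The reflection \<open>X \<leftrightarrow> Y\<close>, \<open>x \<mapsto> - x\<close>, \<open>u \<mapsto> - u\<close> turns \<open>J\<^sub>l\<^sup>+\<close> into \<open>J\<^sub>l\<^sup>-\<close> up to the sign for \<open>l = 1, 3\<close>.\<close>

definition "Jp l z = (if l = 1 \<or> l = 3 then - J_plus \<gamma> l Zr \<theta> z else J_plus \<gamma> l Zr \<theta> z)"
definition "pr z = ch_p (Zr \<theta>) z"
definition "qr z = ch_q (Zr \<theta>) z"

lemma \<Omega>r_iff: "(X, Y) \<in> \<Omega>r \<longleftrightarrow> (\<phi> \<theta> X, \<psi> \<theta> Y) \<in> \<Omega>"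
  by (simp add: \<Omega>r_def relabel_domain_def)

lemma \<Omega>r_Ur: "\<Omega>r \<subseteq> Ur"
  using \<Omega>_U coeff by (auto simp: \<Omega>r_iff Ur_def coeff_bound_def)

text \<open>On a closed cell the densities have representatives that are continuous past the edges
  and satisfy the differential inequalities. For \<open>pr\<close> and \<open>Jm\<close>, which
  contain the derivative of \<phi> but not that of \<psi>, agreement needs \<open>X\<close> inside
  the cell and allows \<open>Y\<close> on its edge; for \<open>qr\<close> and \<open>Jp\<close> the
  roles are exchanged.\<close>

definition "rep a b a' b' W0 P Q J1 J2 \<longleftrightarrow> open W0 \<and> (\<forall>X Y. (X, Y) \<in> Ur \<longrightarrow> X \<in> {a..b} \<longrightarrow> Y \<in> {a'..b'} \<longrightarrow> (X, Y) \<in> W0) \<and>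
   continuous_on W0 P \<and> continuous_on W0 Q \<and> (\<forall>l. continuous_on W0 (J1 l)) \<and> (\<forall>l. continuous_on W0 (J2 l)) \<and>
   (\<forall>X Y. (X, Y) \<in> Ur \<longrightarrow> X \<in> {a..b} \<longrightarrow> Y \<in> {a'..b'} \<longrightarrow>
      (a < X \<and> X < b \<longrightarrow> pr (X, Y) = P (X, Y) \<and> (\<forall>l. Jm l (X, Y) = J1 l (X, Y))) \<and>
      (a' < Y \<and> Y < b' \<longrightarrow> qr (X, Y) = Q (X, Y) \<and> (\<forall>l. Jp l (X, Y) = J2 l (X, Y)))) \<and>
   (\<forall>X Y. (X, Y) \<in> \<Omega>r \<longrightarrow> X \<in> {a..b} \<longrightarrow> Y \<in> {a'..b'} \<longrightarrow> 0 < P (X, Y) \<and> 0 < Q (X, Y) \<and>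
     (\<forall>l n. (n = 4 \<or> n = 6) \<longrightarrow> l \<in> {1..n} \<longrightarrow>
       (\<exists>D. ((\<lambda>Y. J1 l (X, Y)) has_real_derivative D) (at Y) \<and>
          \<bar>D\<bar> \<le> 500 * m ^ 4 * (Q (X, Y) * (\<Sum>k = 1..n. \<bar>J1 k (X, Y)\<bar>) + P (X, Y) * (\<Sum>k = 1..n. \<bar>J2 k (X, Y)\<bar>))) \<and>
       (\<exists>D. ((\<lambda>X. J2 l (X, Y)) has_real_derivative D) (at X) \<and>
          \<bar>D\<bar> \<le> 500 * m ^ 4 * (Q (X, Y) * (\<Sum>k = 1..n. \<bar>J1 k (X, Y)\<bar>) + P (X, Y) * (\<Sum>k = 1..n. \<bar>J2 k (X, Y)\<bar>)))))"

text \<open>Breakpoints do not move with \<theta>. At fixed labels in a closed cell the derivatives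
  in \<theta> of the composed fields can therefore be computed with the smooth extensions, even on
  the edges.\<close>

lemma cell_rep:
  assumes ab: "a < b" "{a<..<b} \<inter> N = {}" and ab': "a' < b'" "{a'<..<b'} \<inter> M = {}"
  shows "\<exists>W0 P Q J1 J2. rep a b a' b' W0 P Q J1 J2"
proof -
  obtain h ht hx hxt where h: "C2_family A h ht hx hxt" "\<And>\<theta> X. \<theta> \<in> A \<Longrightarrow> X \<in> {a..b} \<Longrightarrow> \<phi> \<theta> X = h \<theta> X \<and> 0 < hx \<theta> X"
    using cells(1) ab unfolding smooth_cells_def by meson
  obtain k kt kx kxt where k: "C2_family A k kt kx kxt" "\<And>\<theta> X. \<theta> \<in> A \<Longrightarrow> X \<in> {a'..b'} \<Longrightarrow> \<psi> \<theta> X = k \<theta> X \<and> 0 < kx \<theta> X"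
    using cells(2) ab' unfolding smooth_cells_def by meson
  interpret C: smooth_cell \<gamma> V A Z grad h k ht hx hxt kt kx kxt
    by unfold_locales (use open_V open_A D_field cont_grad system h(1) k(1) in \<open>auto simp: C2_family_def\<close>)
  define W0 where "W0 = {(X, Y). (\<theta>, X, Y) \<in> C.W}"
  have W0: "open W0"
  proof -
    have "open ((\<lambda>z. (\<theta>, z)) -` C.W)" using C.open_W by (intro open_vimage) (auto intro!: continuous_intros)
    then show ?thesis by (simp add: W0_def vimage_def case_prod_beta')
  qed
  have cont: "continuous_on W0 (\<lambda>(X, Y). f \<theta> X Y)" if "continuous_on C.W (\<lambda>(\<theta>, X, Y). f \<theta> X Y)" for f :: "real \<Rightarrow> real \<Rightarrow> real \<Rightarrow> real"
  proof -
    have "continuous_on W0 (\<lambda>z. (\<lambda>(\<theta>, X, Y). f \<theta> X Y) (\<theta>, z))"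
      by (rule continuous_on_compose2[OF that]) (auto simp: W0_def intro!: continuous_intros)
    then show ?thesis by (simp add: case_prod_beta')
  qed
  have inW: "(\<theta>, X, Y) \<in> C.W" if "(X, Y) \<in> Ur" "X \<in> {a..b}" "Y \<in> {a'..b'}" for X Y
    using that h(2)[OF \<theta>_A that(2)] k(2)[OF \<theta>_A that(3)] \<theta>_A by (simp add: C.W_iff Ur_def C.val_def)
  have val: "f (Z t) (\<phi> t X, \<psi> t Y) = C.val f t X Y" if "t \<in> A" "X \<in> {a..b}" "Y \<in> {a'..b'}" for f t X Y
    using h(2)[OF that(1,2)] k(2)[OF that(1,3)] by (simp add: C.val_def)
  have dot: "deriv (\<lambda>t. f (Z t) (\<phi> t X, \<psi> t Y)) \<theta> = C.dot f \<theta> X Y"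
    if w: "(X, Y) \<in> Ur" "X \<in> {a..b}" "Y \<in> {a'..b'}" and f: "f \<in> chart_fields" for f X Y
  proof (rule DERIV_imp_deriv)
    show "((\<lambda>t. f (Z t) (\<phi> t X, \<psi> t Y)) has_real_derivative C.dot f \<theta> X Y) (at \<theta>)"
      by (rule has_field_derivative_transform_within_open[OF C.D_val_\<theta>[OF inW[OF w] f] open_A \<theta>_A])
         (rule val[symmetric]; use w in simp)
  qed
  have der\<phi>: "deriv (\<phi> t) X = hx t X" if "t \<in> A" "a < X" "X < b" for t X
  proof (rule DERIV_imp_deriv)
    have "(h t has_real_derivative hx t X) (at X)" using h(1) that(1) by (simp add: C2_family_def)
    then show "(\<phi> t has_real_derivative hx t X) (at X)"
      by (rule has_field_derivative_transform_within_open[where S = "{a<..<b}"]) (use that h(2)[OF that(1)] in auto)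
  qed
  have der\<psi>: "deriv (\<psi> t) X = kx t X" if "t \<in> A" "a' < X" "X < b'" for t X
  proof (rule DERIV_imp_deriv)
    have "(k t has_real_derivative kx t X) (at X)" using k(1) that(1) by (simp add: C2_family_def)
    then show "(\<psi> t has_real_derivative kx t X) (at X)"
      by (rule has_field_derivative_transform_within_open[where S = "{a'<..<b'}"]) (use that k(2)[OF that(1)] in auto)
  qed
  have eq1: "pr (X, Y) = C.pc \<theta> X Y" "Jm l (X, Y) = C.Jc1 l \<theta> X Y"
    if w: "(X, Y) \<in> Ur" "X \<in> {a..b}" "Y \<in> {a'..b'}" and X: "a < X" "X < b" for X Y l
  proof -
    have p: "ch_p (Zr t) (X, Y) = C.pc t X Y" if "t \<in> A" for t
      using val[OF that w(2,3), of ch_p] der\<phi>[OF that X] by (simp add: Zr_def relabel_def C.pc_def)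
    then show "pr (X, Y) = C.pc \<theta> X Y" using \<theta>_A by (simp add: pr_def)
    have P: "deriv (\<lambda>t. ch_p (Zr t) (X, Y)) \<theta> = C.pd \<theta> X Y"
    proof (rule DERIV_imp_deriv)
      show "((\<lambda>t. ch_p (Zr t) (X, Y)) has_real_derivative C.pd \<theta> X Y) (at \<theta>)"
        by (rule has_field_derivative_transform_within_open[OF C.D_pq_\<theta>(1)[OF inW[OF w]] open_A \<theta>_A]) (rule p[symmetric])
    qed
    have pos: "0 < C.val ch_tau \<theta> X Y" using inW[OF w] by (simp add: C.W_iff)
    show "Jm l (X, Y) = C.Jc1 l \<theta> X Y"
      unfolding Jm_def J_minus_def D\<theta>_def P C.Jc1_def J_val_def Let_def p[OF \<theta>_A]
      using dot[OF w] val[OF \<theta>_A w(2,3), of ch_tau] val[OF \<theta>_A w(2,3), of ch_alpha] deriv_wave_speed[OF pos, of \<gamma>]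
      by (simp add: Zr_def relabel_def mu_def)
  qed
  have eq2: "qr (X, Y) = C.qc \<theta> X Y" "Jp l (X, Y) = C.Jc2 l \<theta> X Y"
    if w: "(X, Y) \<in> Ur" "X \<in> {a..b}" "Y \<in> {a'..b'}" and Y: "a' < Y" "Y < b'" for X Y l
  proof -
    have q: "ch_q (Zr t) (X, Y) = C.qc t X Y" if "t \<in> A" for t
      using val[OF that w(2,3), of ch_q] der\<psi>[OF that Y] by (simp add: Zr_def relabel_def C.qc_def)
    then show "qr (X, Y) = C.qc \<theta> X Y" using \<theta>_A by (simp add: qr_def)
    have Q: "deriv (\<lambda>t. ch_q (Zr t) (X, Y)) \<theta> = C.qd \<theta> X Y"
    proof (rule DERIV_imp_deriv)
      show "((\<lambda>t. ch_q (Zr t) (X, Y)) has_real_derivative C.qd \<theta> X Y) (at \<theta>)"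
        by (rule has_field_derivative_transform_within_open[OF C.D_pq_\<theta>(2)[OF inW[OF w]] open_A \<theta>_A]) (rule q[symmetric])
    qed
    have pos: "0 < C.val ch_tau \<theta> X Y" using inW[OF w] by (simp add: C.W_iff)
    have neg: "q * (- x + c * t) = - (q * (x - c * t))" for q x c t :: real by (simp add: algebra_simps)
    show "Jp l (X, Y) = C.Jc2 l \<theta> X Y"
      unfolding Jp_def J_plus_def D\<theta>_def Q C.Jc2_def J_val_def Let_def q[OF \<theta>_A] neg
      using dot[OF w] val[OF \<theta>_A w(2,3), of ch_tau] val[OF \<theta>_A w(2,3), of ch_beta] deriv_wave_speed[OF pos, of \<gamma>]
      by (simp add: Zr_def relabel_def mu_def)
  qed
  have bounds: "0 < C.pc \<theta> X Y \<and> 0 < C.qc \<theta> X Y \<and> coeff_bound \<gamma> m (C.val ch_tau \<theta> X Y)"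
    if w: "(X, Y) \<in> \<Omega>r" "X \<in> {a..b}" "Y \<in> {a'..b'}" for X Y
  proof -
    have \<Omega>: "(\<phi> \<theta> X, \<psi> \<theta> Y) \<in> \<Omega>" using w by (simp add: \<Omega>r_iff)
    note v = val[OF \<theta>_A w(2,3), symmetric]
    show ?thesis using pq_pos[OF \<Omega>] coeff[OF \<Omega>] h(2)[OF \<theta>_A w(2)] k(2)[OF \<theta>_A w(3)]
      by (simp add: C.pc_def C.qc_def v)
  qed
  have "rep a b a' b' W0 (\<lambda>(X, Y). C.pc \<theta> X Y) (\<lambda>(X, Y). C.qc \<theta> X Y) (\<lambda>l (X, Y). C.Jc1 l \<theta> X Y) (\<lambda>l (X, Y). C.Jc2 l \<theta> X Y)"
    unfolding rep_def
  proof (intro conjI allI impI, goal_cases)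
    case (13 X Y l n)
    have "(\<theta>, X, Y) \<in> C.W" using 13 \<Omega>r_Ur by (intro inW) auto
    from C.J_bounds(1)[OF this, of m n l] show ?case using bounds[of X Y] 13 by simp
  next
    case (14 X Y l n)
    have "(\<theta>, X, Y) \<in> C.W" using 14 \<Omega>r_Ur by (intro inW) auto
    from C.J_bounds(2)[OF this, of m n l] show ?case using bounds[of X Y] 14 by simp
  next
    case 1 show ?case by (rule W0)
  next
    case (2 X Y) then show ?case using inW by (simp add: W0_def)
  next
    case 3 show ?case by (rule cont[OF C.cont_pq(1)])
  next
    case 4 show ?case by (rule cont[OF C.cont_pq(3)])
  next
    case (5 l) show ?case by (rule cont[OF C.cont_J(1)])
  next
    case (6 l) show ?case by (rule cont[OF C.cont_J(2)])
  next
    case (7 X Y) then show ?case using eq1(1) by simp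
  next
    case (8 X Y l) then show ?case using eq1(2) by simp
  next
    case (9 X Y) then show ?case using eq2(1) by simp
  next
    case (10 X Y l) then show ?case using eq2(2) by simp
  next
    case (11 X Y) then show ?case using bounds[of X Y] by simp
  next
    case (12 X Y) then show ?case using bounds[of X Y] by simp
  qed
  then show ?thesis by blast
qed

end

lemma isCont_by_sides:
  fixes f g1 g2 :: "real \<Rightarrow> real"
  assumes "0 < e" "isCont g1 y" "isCont g2 y"
    and "\<And>z. y - e < z \<Longrightarrow> z \<le> y \<Longrightarrow> f z = g1 z" "\<And>z. y \<le> z \<Longrightarrow> z < y + e \<Longrightarrow> f z = g2 z"
  shows "isCont f y"
  unfolding isCont_def filterlim_at_split
proof
  have "(g1 \<longlongrightarrow> f y) (at_left y)"
    using assms(1,2) assms(4)[of y] by (simp add: isCont_def filterlim_at_split)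
  then show "(f \<longlongrightarrow> f y) (at_left y)"
    by (rule Lim_transform_eventually)
       (use eventually_at_left_real[of "y - e" y] assms(1) assms(4) in \<open>auto elim: eventually_mono\<close>)
  have "(g2 \<longlongrightarrow> f y) (at_right y)"
    using assms(1,3) assms(5)[of y] by (simp add: isCont_def filterlim_at_split)
  then show "(f \<longlongrightarrow> f y) (at_right y)"
    by (rule Lim_transform_eventually)
       (use eventually_at_right_real[of y "y + e"] assms(1) assms(5) in \<open>auto elim: eventually_mono\<close>)
qed

context relabelled_path
begin

lemma repD:
  assumes "rep a b a' b' W0 P Q J1 J2"
  shows "open W0" "continuous_on W0 P" "continuous_on W0 Q" "continuous_on W0 (J1 l)" "continuous_on W0 (J2 l)"
    and "(X, Y) \<in> Ur \<Longrightarrow> X \<in> {a..b} \<Longrightarrow> Y \<in> {a'..b'} \<Longrightarrow> (X, Y) \<in> W0"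
    and "(X, Y) \<in> Ur \<Longrightarrow> a < X \<Longrightarrow> X < b \<Longrightarrow> Y \<in> {a'..b'} \<Longrightarrow> pr (X, Y) = P (X, Y)"
    and "(X, Y) \<in> Ur \<Longrightarrow> a < X \<Longrightarrow> X < b \<Longrightarrow> Y \<in> {a'..b'} \<Longrightarrow> Jm l (X, Y) = J1 l (X, Y)"
    and "(X, Y) \<in> Ur \<Longrightarrow> X \<in> {a..b} \<Longrightarrow> a' < Y \<Longrightarrow> Y < b' \<Longrightarrow> qr (X, Y) = Q (X, Y)"
    and "(X, Y) \<in> Ur \<Longrightarrow> X \<in> {a..b} \<Longrightarrow> a' < Y \<Longrightarrow> Y < b' \<Longrightarrow> Jp l (X, Y) = J2 l (X, Y)"
    and "(X, Y) \<in> \<Omega>r \<Longrightarrow> X \<in> {a..b} \<Longrightarrow> Y \<in> {a'..b'} \<Longrightarrow> 0 < P (X, Y)"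
    and "(X, Y) \<in> \<Omega>r \<Longrightarrow> X \<in> {a..b} \<Longrightarrow> Y \<in> {a'..b'} \<Longrightarrow> 0 < Q (X, Y)"
    and "(X, Y) \<in> \<Omega>r \<Longrightarrow> X \<in> {a..b} \<Longrightarrow> Y \<in> {a'..b'} \<Longrightarrow> n = 4 \<or> n = 6 \<Longrightarrow> l \<in> {1..n} \<Longrightarrow>
       \<exists>D. ((\<lambda>Y. J1 l (X, Y)) has_real_derivative D) (at Y) \<and>
          \<bar>D\<bar> \<le> 500 * m ^ 4 * (Q (X, Y) * (\<Sum>k = 1..n. \<bar>J1 k (X, Y)\<bar>) + P (X, Y) * (\<Sum>k = 1..n. \<bar>J2 k (X, Y)\<bar>))"
    and "(X, Y) \<in> \<Omega>r \<Longrightarrow> X \<in> {a..b} \<Longrightarrow> Y \<in> {a'..b'} \<Longrightarrow> n = 4 \<or> n = 6 \<Longrightarrow> l \<in> {1..n} \<Longrightarrow>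
       \<exists>D. ((\<lambda>X. J2 l (X, Y)) has_real_derivative D) (at X) \<and>
          \<bar>D\<bar> \<le> 500 * m ^ 4 * (Q (X, Y) * (\<Sum>k = 1..n. \<bar>J1 k (X, Y)\<bar>) + P (X, Y) * (\<Sum>k = 1..n. \<bar>J2 k (X, Y)\<bar>))"
proof -
  note R = assms[unfolded rep_def]
  note R1 = R[THEN conjunct1]
  note R2 = R[THEN conjunct2, THEN conjunct1, rule_format]
  note R3 = R[THEN conjunct2, THEN conjunct2]
  note R7 = R3[THEN conjunct2, THEN conjunct2, THEN conjunct2, THEN conjunct2]
  note E = R7[THEN conjunct1, rule_format]
  note O = R7[THEN conjunct2, rule_format]
  show "open W0" by (rule R1)
  show "continuous_on W0 P" "continuous_on W0 Q" "continuous_on W0 (J1 l)" "continuous_on W0 (J2 l)"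
    using R3 by simp_all
  show "(X, Y) \<in> W0" if "(X, Y) \<in> Ur" "X \<in> {a..b}" "Y \<in> {a'..b'}" by (rule R2[OF that])
  show "pr (X, Y) = P (X, Y)" "Jm l (X, Y) = J1 l (X, Y)" if "(X, Y) \<in> Ur" "a < X" "X < b" "Y \<in> {a'..b'}"
    using E[OF that(1) _ that(4)] that(2,3) by simp_all
  show "qr (X, Y) = Q (X, Y)" "Jp l (X, Y) = J2 l (X, Y)" if "(X, Y) \<in> Ur" "X \<in> {a..b}" "a' < Y" "Y < b'"
    using E[OF that(1,2)] that(3,4) by simp_all
  assume "(X, Y) \<in> \<Omega>r" "X \<in> {a..b}" "Y \<in> {a'..b'}"
  note O = O[OF this]
  show "0 < P (X, Y)" "0 < Q (X, Y)" using O by blast+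
  assume "n = 4 \<or> n = 6" "l \<in> {1..n}"
  note O = O[THEN conjunct2, THEN conjunct2, rule_format, OF this]
  show "\<exists>D. ((\<lambda>Y. J1 l (X, Y)) has_real_derivative D) (at Y) \<and>
          \<bar>D\<bar> \<le> 500 * m ^ 4 * (Q (X, Y) * (\<Sum>k = 1..n. \<bar>J1 k (X, Y)\<bar>) + P (X, Y) * (\<Sum>k = 1..n. \<bar>J2 k (X, Y)\<bar>))"
    by (rule O[THEN conjunct1])
  show "\<exists>D. ((\<lambda>X. J2 l (X, Y)) has_real_derivative D) (at X) \<and>
          \<bar>D\<bar> \<le> 500 * m ^ 4 * (Q (X, Y) * (\<Sum>k = 1..n. \<bar>J1 k (X, Y)\<bar>) + P (X, Y) * (\<Sum>k = 1..n. \<bar>J2 k (X, Y)\<bar>))"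
    by (rule O[THEN conjunct2])
qed

definition "good = {(X, Y). (X, Y) \<in> Ur \<and> X \<notin> N \<and> Y \<notin> M}"

lemma open_Ur: "open Ur"
proof -
  define V' where "V' = V \<inter> (\<lambda>(\<theta>, z). ch_tau (Z \<theta>) z) -` {0<..}"
  have "continuous_on V (\<lambda>(\<theta>, z). ch_tau (Z \<theta>) z)"
    using D_field[of ch_tau] by (intro continuous_at_imp_continuous_on ballI has_derivative_continuous) (auto simp: chart_fields_def)
  then have "open V'" unfolding V'_def using open_V by (intro continuous_open_preimage) auto
  moreover have "continuous_on UNIV (\<lambda>z. (\<theta>, \<phi> \<theta> (fst z), \<psi> \<theta> (snd z)))"
    by (intro continuous_on_Pair continuous_on_const continuous_on_compose2[OF \<phi>(2)] continuous_on_compose2[OF \<psi>(2)] continuous_intros) auto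
  ultimately have "open ((\<lambda>z. (\<theta>, \<phi> \<theta> (fst z), \<psi> \<theta> (snd z))) -` V')" by (intro open_vimage)
  moreover have "(\<lambda>z. (\<theta>, \<phi> \<theta> (fst z), \<psi> \<theta> (snd z))) -` V' = Ur" by (auto simp: V'_def Ur_def)
  ultimately show ?thesis by simp
qed

lemma open_good: "open good"
proof -
  have "good = Ur \<inter> ((- N) \<times> (- M))" by (auto simp: good_def)
  then show ?thesis using open_Ur fin by (auto intro!: open_Int open_Times finite_imp_closed)
qed

lemma isCont_line:
  fixes f :: "real \<times> real \<Rightarrow> real"
  assumes "open W" "continuous_on W f" "(X, Y) \<in> W"
  shows "isCont (\<lambda>Y. f (X, Y)) Y" "isCont (\<lambda>X. f (X, Y)) X"
proof -
  have "isCont f (X, Y)" using assms by (simp add: continuous_on_eq_continuous_at)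
  then show "isCont (\<lambda>Y. f (X, Y)) Y" "isCont (\<lambda>X. f (X, Y)) X"
    by (auto intro!: isCont_o2[where g = f] continuous_intros)
qed

lemma Ur_lines:
  assumes "(X, Y) \<in> Ur"
  shows "\<exists>e>0. \<forall>Y'. \<bar>Y' - Y\<bar> < e \<longrightarrow> (X, Y') \<in> Ur" "\<exists>e>0. \<forall>X'. \<bar>X' - X\<bar> < e \<longrightarrow> (X', Y) \<in> Ur"
proof -
  obtain e where e: "0 < e" "ball (X, Y) e \<subseteq> Ur" using open_Ur assms open_contains_ball by blast
  have "(X, Y') \<in> Ur" if "\<bar>Y' - Y\<bar> < e" for Y' using e(2) that by (auto simp: dist_Pair_Pair dist_real_def abs_minus_commute)
  then show "\<exists>e>0. \<forall>Y'. \<bar>Y' - Y\<bar> < e \<longrightarrow> (X, Y') \<in> Ur" using e(1) by blast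
  have "(X', Y) \<in> Ur" if "\<bar>X' - X\<bar> < e" for X' using e(2) that by (auto simp: dist_Pair_Pair dist_real_def abs_minus_commute)
  then show "\<exists>e>0. \<forall>X'. \<bar>X' - X\<bar> < e \<longrightarrow> (X', Y) \<in> Ur" using e(1) by blast
qed

text \<open>At a breakpoint of \<psi> the cells on both sides provide continuous representatives
  that agree with \<open>Jm\<close> on the closed half-lines, because \<open>Jm\<close> involves
  \<psi> but not its derivative in \<open>Y\<close>. Hence breakpoints of \<psi> cause no jump of
  \<open>Jm\<close> along \<open>X = const\<close>.\<close>

lemma isCont_Jm:
  assumes U: "(X, Y) \<in> Ur" and X: "X \<notin> N"
  shows "isCont (\<lambda>Y. Jm l (X, Y)) Y"
proof -
  obtain d where d: "0 < d" "{X - d<..<X + d} \<inter> N = {}" using cells_around[OF fin(1), of X] X by blast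
  obtain e where e: "0 < e" "{Y - e<..<Y} \<inter> M = {}" "{Y<..<Y + e} \<inter> M = {}" using cells_around[OF fin(2), of Y] by blast
  obtain r where r: "0 < r" "\<And>Y'. \<bar>Y' - Y\<bar> < r \<Longrightarrow> (X, Y') \<in> Ur" using Ur_lines(1)[OF U] by blast
  obtain W0 P Q J1 J2 where R: "rep (X - d) (X + d) (Y - e) Y W0 P Q J1 J2"
    using cell_rep[of "X - d" "X + d" "Y - e" Y] d e by auto
  obtain W0' P' Q' J1' J2' where R': "rep (X - d) (X + d) Y (Y + e) W0' P' Q' J1' J2'"
    using cell_rep[of "X - d" "X + d" Y "Y + e"] d e by auto
  show ?thesis
  proof (rule isCont_by_sides[where e = "min e r"])
    show "isCont (\<lambda>Y. J1 l (X, Y)) Y" "isCont (\<lambda>Y. J1' l (X, Y)) Y"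
      using isCont_line(1)[OF repD(1,4)[OF R] repD(6)[OF R U]] isCont_line(1)[OF repD(1,4)[OF R'] repD(6)[OF R' U]] d e by auto
    show "Jm l (X, z) = J1 l (X, z)" if "Y - min e r < z" "z \<le> Y" for z
    proof -
      have "(X, z) \<in> Ur" using r(2)[of z] that by simp
      then show ?thesis using that d(1) r(1) by (intro repD(8)[OF R]) auto
    qed
    show "Jm l (X, z) = J1' l (X, z)" if "Y \<le> z" "z < Y + min e r" for z
    proof -
      have "(X, z) \<in> Ur" using r(2)[of z] that by simp
      then show ?thesis using that d(1) r(1) by (intro repD(8)[OF R']) auto
    qed
  qed (use e r in auto)
qed

lemma isCont_Jp:
  assumes U: "(X, Y) \<in> Ur" and Y: "Y \<notin> M"
  shows "isCont (\<lambda>X. Jp l (X, Y)) X"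
proof -
  obtain d where d: "0 < d" "{Y - d<..<Y + d} \<inter> M = {}" using cells_around[OF fin(2), of Y] Y by blast
  obtain e where e: "0 < e" "{X - e<..<X} \<inter> N = {}" "{X<..<X + e} \<inter> N = {}" using cells_around[OF fin(1), of X] by blast
  obtain r where r: "0 < r" "\<And>X'. \<bar>X' - X\<bar> < r \<Longrightarrow> (X', Y) \<in> Ur" using Ur_lines(2)[OF U] by blast
  obtain W0 P Q J1 J2 where R: "rep (X - e) X (Y - d) (Y + d) W0 P Q J1 J2"
    using cell_rep[of "X - e" X "Y - d" "Y + d"] d e by auto
  obtain W0' P' Q' J1' J2' where R': "rep X (X + e) (Y - d) (Y + d) W0' P' Q' J1' J2'"
    using cell_rep[of X "X + e" "Y - d" "Y + d"] d e by auto
  show ?thesis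
  proof (rule isCont_by_sides[where e = "min e r"])
    show "isCont (\<lambda>X. J2 l (X, Y)) X" "isCont (\<lambda>X. J2' l (X, Y)) X"
      using isCont_line(2)[OF repD(1,5)[OF R] repD(6)[OF R U]] isCont_line(2)[OF repD(1,5)[OF R'] repD(6)[OF R' U]] d e by auto
    show "Jp l (z, Y) = J2 l (z, Y)" if "X - min e r < z" "z \<le> X" for z
    proof -
      have "(z, Y) \<in> Ur" using r(2)[of z] that by simp
      then show ?thesis using that d(1) r(1) by (intro repD(10)[OF R]) auto
    qed
    show "Jp l (z, Y) = J2' l (z, Y)" if "X \<le> z" "z < X + min e r" for z
    proof -
      have "(z, Y) \<in> Ur" using r(2)[of z] that by simp
      then show ?thesis using that d(1) r(1) by (intro repD(10)[OF R']) auto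
    qed
  qed (use e r in auto)
qed

lemma good_rep:
  assumes "(X, Y) \<in> good"
  shows "\<exists>d>0. \<exists>W0 P Q J1 J2. rep (X - d) (X + d) (Y - d) (Y + d) W0 P Q J1 J2"
proof -
  obtain d where d: "0 < d" "{X - d<..<X + d} \<inter> N = {}" using cells_around[OF fin(1), of X] assms by (auto simp: good_def)
  obtain e where e: "0 < e" "{Y - e<..<Y + e} \<inter> M = {}" using cells_around[OF fin(2), of Y] assms by (auto simp: good_def)
  define r where "r = min d e"
  have "{X - r<..<X + r} \<subseteq> {X - d<..<X + d}" "{Y - r<..<Y + r} \<subseteq> {Y - e<..<Y + e}" "0 < r"
    using d(1) e(1) by (auto simp: r_def)
  then have "{X - r<..<X + r} \<inter> N = {}" "{Y - r<..<Y + r} \<inter> M = {}" "0 < r"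
    using d(2) e(2) by blast+
  then show ?thesis using cell_rep[of "X - r" "X + r" "Y - r" "Y + r"] by (intro exI[of _ r]) auto
qed

lemma continuous_on_good:
  "continuous_on good pr" "continuous_on good qr" "continuous_on good (Jm l)" "continuous_on good (Jp l)"
proof -
  have "isCont pr z \<and> isCont qr z \<and> isCont (Jm l) z \<and> isCont (Jp l) z" if z: "z \<in> good" for z
  proof -
    obtain X Y where XY: "z = (X, Y)" by (cases z)
    obtain d W0 P Q J1 J2 where d: "0 < d" and R: "rep (X - d) (X + d) (Y - d) (Y + d) W0 P Q J1 J2"
      using good_rep z XY by blast
    define B where "B = Ur \<inter> ({X - d<..<X + d} \<times> {Y - d<..<Y + d})"
    have B: "open B" "z \<in> B" using z d open_Ur by (auto simp: B_def XY good_def intro!: open_Int open_Times)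
    have W: "open W0" "z \<in> W0" using repD(1)[OF R] repD(6)[OF R, of X Y] z d by (auto simp: XY good_def)
    have tr: "isCont f z" if "continuous_on W0 g" "\<And>w. w \<in> B \<Longrightarrow> f w = g w" for f g :: "real \<times> real \<Rightarrow> real"
    proof -
      have "isCont g z" using that(1) W by (simp add: continuous_on_eq_continuous_at)
      moreover have "eventually (\<lambda>w. f w = g w) (nhds z)"
        using B that(2) by (auto simp: eventually_nhds)
      ultimately show ?thesis by (simp add: isCont_cong)
    qed
    show ?thesis
    proof (intro conjI)
      show "isCont pr z" by (rule tr[OF repD(2)[OF R]]) (auto simp: B_def intro!: repD(7)[OF R])
      show "isCont qr z" by (rule tr[OF repD(3)[OF R]]) (auto simp: B_def intro!: repD(9)[OF R])
      show "isCont (Jm l) z" by (rule tr[OF repD(4)[OF R]]) (auto simp: B_def intro!: repD(8)[OF R])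
      show "isCont (Jp l) z" by (rule tr[OF repD(5)[OF R]]) (auto simp: B_def intro!: repD(10)[OF R])
    qed
  qed
  then show "continuous_on good pr" "continuous_on good qr" "continuous_on good (Jm l)" "continuous_on good (Jp l)"
    by (auto intro: continuous_at_imp_continuous_on)
qed

lemma good_derivatives:
  assumes \<Omega>: "(X, Y) \<in> \<Omega>r" and g: "X \<notin> N" "Y \<notin> M" and n: "n = 4 \<or> n = 6" and l: "l \<in> {1..n}"
  shows "0 < pr (X, Y)" "0 < qr (X, Y)"
    and "\<exists>D. ((\<lambda>Y. Jm l (X, Y)) has_real_derivative D) (at Y) \<and>
      \<bar>D\<bar> \<le> 500 * m ^ 4 * (qr (X, Y) * (\<Sum>k = 1..n. \<bar>Jm k (X, Y)\<bar>) + pr (X, Y) * (\<Sum>k = 1..n. \<bar>Jp k (X, Y)\<bar>))"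
    and "\<exists>D. ((\<lambda>X. Jp l (X, Y)) has_real_derivative D) (at X) \<and>
      \<bar>D\<bar> \<le> 500 * m ^ 4 * (qr (X, Y) * (\<Sum>k = 1..n. \<bar>Jm k (X, Y)\<bar>) + pr (X, Y) * (\<Sum>k = 1..n. \<bar>Jp k (X, Y)\<bar>))"
proof -
  have U: "(X, Y) \<in> Ur" using \<Omega> \<Omega>r_Ur by auto
  obtain d W0 P Q J1 J2 where d: "0 < d" and R: "rep (X - d) (X + d) (Y - d) (Y + d) W0 P Q J1 J2"
    using good_rep[of X Y] U g by (auto simp: good_def)
  have eq: "pr (X', Y') = P (X', Y')" "qr (X', Y') = Q (X', Y')" "Jm k (X', Y') = J1 k (X', Y')" "Jp k (X', Y') = J2 k (X', Y')"
    if "(X', Y') \<in> Ur" "\<bar>X' - X\<bar> < d" "\<bar>Y' - Y\<bar> < d" for X' Y' k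
    using that by (auto simp: abs_less_iff intro!: repD(7-10)[OF R])
  have at: "X \<in> {X - d..X + d}" "Y \<in> {Y - d..Y + d}" using d by auto
  have pq: "0 < P (X, Y)" "0 < Q (X, Y)" by (rule repD(11,12)[OF R \<Omega> at])+
  then show "0 < pr (X, Y)" "0 < qr (X, Y)" using eq[OF U] d by simp_all
  obtain D1 where D1: "((\<lambda>Y. J1 l (X, Y)) has_real_derivative D1) (at Y)"
    "\<bar>D1\<bar> \<le> 500 * m ^ 4 * (Q (X, Y) * (\<Sum>k = 1..n. \<bar>J1 k (X, Y)\<bar>) + P (X, Y) * (\<Sum>k = 1..n. \<bar>J2 k (X, Y)\<bar>))"
    using repD(13)[OF R \<Omega> at n l] by blast
  obtain D2 where D2: "((\<lambda>X. J2 l (X, Y)) has_real_derivative D2) (at X)"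
    "\<bar>D2\<bar> \<le> 500 * m ^ 4 * (Q (X, Y) * (\<Sum>k = 1..n. \<bar>J1 k (X, Y)\<bar>) + P (X, Y) * (\<Sum>k = 1..n. \<bar>J2 k (X, Y)\<bar>))"
    using repD(14)[OF R \<Omega> at n l] by blast
  obtain r where r: "0 < r" "\<And>Y'. \<bar>Y' - Y\<bar> < r \<Longrightarrow> (X, Y') \<in> Ur" using Ur_lines(1)[OF U] by blast
  obtain r' where r': "0 < r'" "\<And>X'. \<bar>X' - X\<bar> < r' \<Longrightarrow> (X', Y) \<in> Ur" using Ur_lines(2)[OF U] by blast
  have "((\<lambda>Y. Jm l (X, Y)) has_real_derivative D1) (at Y)"
  proof (rule has_field_derivative_transform_within_open[OF D1(1), of "ball Y (min d r)"])
    show "J1 l (X, Y') = Jm l (X, Y')" if "Y' \<in> ball Y (min d r)" for Y'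
      using eq(3)[of X Y' l] r(2)[of Y'] that d by (simp add: dist_real_def abs_minus_commute)
  qed (use d r in auto)
  then show "\<exists>D. ((\<lambda>Y. Jm l (X, Y)) has_real_derivative D) (at Y) \<and>
      \<bar>D\<bar> \<le> 500 * m ^ 4 * (qr (X, Y) * (\<Sum>k = 1..n. \<bar>Jm k (X, Y)\<bar>) + pr (X, Y) * (\<Sum>k = 1..n. \<bar>Jp k (X, Y)\<bar>))"
    using D1(2) eq[OF U] d by (intro exI[of _ D1]) simp
  have "((\<lambda>X. Jp l (X, Y)) has_real_derivative D2) (at X)"
  proof (rule has_field_derivative_transform_within_open[OF D2(1), of "ball X (min d r')"])
    show "J2 l (X', Y) = Jp l (X', Y)" if "X' \<in> ball X (min d r')" for X'
      using eq(4)[of X' Y l] r'(2)[of X'] that d by (simp add: dist_real_def abs_minus_commute)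
  qed (use d r' in auto)
  then show "\<exists>D. ((\<lambda>X. Jp l (X, Y)) has_real_derivative D) (at X) \<and>
      \<bar>D\<bar> \<le> 500 * m ^ 4 * (qr (X, Y) * (\<Sum>k = 1..n. \<bar>Jm k (X, Y)\<bar>) + pr (X, Y) * (\<Sum>k = 1..n. \<bar>Jp k (X, Y)\<bar>))"
    using D2(2) eq[OF U] d by (intro exI[of _ D2]) simp
qed

definition "size_at n z = \<bar>pr z\<bar> + \<bar>qr z\<bar> + (\<Sum>k = 1..n. \<bar>Jm k z\<bar>) + (\<Sum>k = 1..n. \<bar>Jp k z\<bar>)"

lemma size_at_nonneg: "0 \<le> size_at n z"
  by (simp add: size_at_def sum_nonneg)

text \<open>Near any point of \<open>Ur\<close>, breakpoint or not, the good points lie inside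
  finitely many cells having that point in their closure, and on each of them the continuous
  representatives are bounded nearby.\<close>

lemma size_locally_bounded:
  assumes U: "z \<in> Ur"
  shows "\<exists>d B. 0 < d \<and> (\<forall>w\<in>ball z d \<inter> good. \<bar>size_at n w\<bar> \<le> B)"
proof -
  obtain X Y where z: "z = (X, Y)" by (cases z)
  obtain d where d: "0 < d" "{X - d<..<X} \<inter> N = {}" "{X<..<X + d} \<inter> N = {}" "X \<notin> N \<Longrightarrow> {X - d<..<X + d} \<inter> N = {}"
    using cells_around[OF fin(1), of X] by blast
  obtain e where e: "0 < e" "{Y - e<..<Y} \<inter> M = {}" "{Y<..<Y + e} \<inter> M = {}" "Y \<notin> M \<Longrightarrow> {Y - e<..<Y + e} \<inter> M = {}"
    using cells_around[OF fin(2), of Y] by blast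
  \<comment> \<open>Good points with the same label \<open>X\<close> lie on the common edge of the
    first two intervals; the third one catches them. If \<open>X\<close> is a breakpoint there are
    no such points.\<close>
  define CX where "CX = {(X - d, X), (X, X + d), if X \<in> N then (X - d, X) else (X - d, X + d)}"
  define CY where "CY = {(Y - e, Y), (Y, Y + e), if Y \<in> M then (Y - e, Y) else (Y - e, Y + e)}"
  have CX: "a < b \<and> {a<..<b} \<inter> N = {} \<and> X \<in> {a..b}" if "(a, b) \<in> CX" for a b
    using that d unfolding CX_def by (auto split: if_splits)
  have CY: "a < b \<and> {a<..<b} \<inter> M = {} \<and> Y \<in> {a..b}" if "(a, b) \<in> CY" for a b
    using that e unfolding CY_def by (auto split: if_splits)
  have inCX: "\<exists>(a, b)\<in>CX. a < X' \<and> X' < b" if "X' \<notin> N" "\<bar>X' - X\<bar> < d" for X'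
    using that d(1) unfolding CX_def by (cases X' X rule: linorder_cases) auto
  have inCY: "\<exists>(a, b)\<in>CY. a < Y' \<and> Y' < b" if "Y' \<notin> M" "\<bar>Y' - Y\<bar> < e" for Y'
    using that e(1) unfolding CY_def by (cases Y' Y rule: linorder_cases) auto
  have cell: "\<exists>r B. 0 < r \<and> (\<forall>X' Y'. (X', Y') \<in> ball z r \<inter> good \<longrightarrow> a < X' \<longrightarrow> X' < b \<longrightarrow> a' < Y' \<longrightarrow> Y' < b' \<longrightarrow> size_at n (X', Y') \<le> B)"
    if ab: "(a, b) \<in> CX" "(a', b') \<in> CY" for a b a' b'
  proof -
    obtain W0 P Q J1 J2 where R: "rep a b a' b' W0 P Q J1 J2"
      using cell_rep[of a b a' b'] CX[OF ab(1)] CY[OF ab(2)] by blast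
    define f where "f w = \<bar>P w\<bar> + \<bar>Q w\<bar> + (\<Sum>k = 1..n. \<bar>J1 k w\<bar>) + (\<Sum>k = 1..n. \<bar>J2 k w\<bar>)" for w
    have "z \<in> W0" "open W0" using repD(1)[OF R] repD(6)[OF R, of X Y] U CX[OF ab(1)] CY[OF ab(2)] by (auto simp: z)
    moreover have "continuous_on W0 f" unfolding f_def by (intro continuous_intros repD(2-5)[OF R])
    ultimately have "isCont f z" by (simp add: continuous_on_eq_continuous_at)
    then obtain r where r: "0 < r" "\<And>w. dist w z < r \<Longrightarrow> dist (f w) (f z) < 1"
      unfolding continuous_at_eps_delta by (meson zero_less_one)
    have "size_at n (X', Y') \<le> f z + 1" if w: "(X', Y') \<in> ball z r \<inter> good" "a < X'" "X' < b" "a' < Y'" "Y' < b'" for X' Y'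
    proof -
      have "(X', Y') \<in> Ur" using w by (auto simp: good_def)
      then have "size_at n (X', Y') = f (X', Y')"
        using w(2-5) repD(7-10)[OF R, of X' Y'] by (simp add: size_at_def f_def)
      then show ?thesis using r(2)[of "(X', Y')"] w(1) by (simp add: dist_real_def dist_commute)
    qed
    then show ?thesis using r(1) by blast
  qed
  define ok where "ok c rB \<longleftrightarrow> 0 < fst rB \<and> (\<forall>X' Y'. (X', Y') \<in> ball z (fst rB) \<inter> good \<longrightarrow> fst (fst c) < X' \<longrightarrow> X' < snd (fst c) \<longrightarrow>
      fst (snd c) < Y' \<longrightarrow> Y' < snd (snd c) \<longrightarrow> size_at n (X', Y') \<le> snd rB)" for c and rB :: "real \<times> real"
  have "\<exists>rB. ok c rB" if c: "c \<in> CX \<times> CY" for c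
  proof -
    have "(fst (fst c), snd (fst c)) \<in> CX" "(fst (snd c), snd (snd c)) \<in> CY" using c by auto
    from cell[OF this] obtain r B where "0 < r" "\<forall>X' Y'. (X', Y') \<in> ball z r \<inter> good \<longrightarrow> fst (fst c) < X' \<longrightarrow> X' < snd (fst c) \<longrightarrow>
      fst (snd c) < Y' \<longrightarrow> Y' < snd (snd c) \<longrightarrow> size_at n (X', Y') \<le> B" by (elim exE conjE)
    then have "ok c (r, B)" by (simp add: ok_def)
    then show ?thesis by (rule exI)
  qed
  then have "\<forall>c\<in>CX \<times> CY. \<exists>rB. ok c rB" by (intro ballI)
  from bchoice[OF this] obtain rB where ok: "\<forall>c\<in>CX \<times> CY. ok c (rB c)" by (elim exE)
  have rB: "0 < fst (rB c)" if "c \<in> CX \<times> CY" for c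
    using bspec[OF ok that] by (simp add: ok_def)
  have rB': "size_at n (X', Y') \<le> snd (rB c)"
    if "c \<in> CX \<times> CY" "(X', Y') \<in> ball z (fst (rB c)) \<inter> good" "fst (fst c) < X'" "X' < snd (fst c)" "fst (snd c) < Y'" "Y' < snd (snd c)" for c X' Y'
    using bspec[OF ok that(1)] that(2-) unfolding ok_def by simp
  have finC: "finite (CX \<times> CY)" by (simp add: CX_def CY_def)
  define r where "r = Min (insert (min d e) ((\<lambda>c. fst (rB c)) ` (CX \<times> CY)))"
  define B where "B = (\<Sum>c\<in>CX \<times> CY. \<bar>snd (rB c)\<bar>)"
  have r: "0 < r" "r \<le> min d e" "\<And>c. c \<in> CX \<times> CY \<Longrightarrow> r \<le> fst (rB c)"
  proof -
    have "finite (insert (min d e) ((\<lambda>c. fst (rB c)) ` (CX \<times> CY)))" using finC by simp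
    note f = this
    show "0 < r" unfolding r_def using f rB d(1) e(1) by (subst Min_gr_iff) auto
    show "r \<le> min d e" unfolding r_def by (rule Min_le[OF f]) simp
    show "r \<le> fst (rB c)" if "c \<in> CX \<times> CY" for c unfolding r_def by (rule Min_le[OF f]) (use that in blast)
  qed
  have "\<bar>size_at n w\<bar> \<le> B" if w: "w \<in> ball z r \<inter> good" for w
  proof -
    obtain X' Y' where w': "w = (X', Y')" by (cases w)
    have "dist X X' \<le> dist z w" "dist Y Y' \<le> dist z w" unfolding z w' by (metis dist_fst_le fst_conv, metis dist_snd_le snd_conv)
    then have "\<bar>X' - X\<bar> < d" "\<bar>Y' - Y\<bar> < e" using w r(2) by (auto simp: dist_real_def abs_minus_commute)
    moreover have "X' \<notin> N" "Y' \<notin> M" using w by (auto simp: good_def w')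
    ultimately obtain a b a' b' where c: "(a, b) \<in> CX" "a < X'" "X' < b" "(a', b') \<in> CY" "a' < Y'" "Y' < b'"
      using inCX[of X'] inCY[of Y'] by blast
    define c where "c = ((a, b), (a', b'))"
    have cC: "c \<in> CX \<times> CY" using c by (simp add: c_def)
    have "w \<in> ball z (fst (rB c)) \<inter> good" using w r(3)[OF cC] by auto
    then have "size_at n w \<le> snd (rB c)" using rB'[OF cC, of X' Y'] c by (simp add: w' c_def)
    also have "\<dots> \<le> \<bar>snd (rB c)\<bar>" by simp
    also have "\<dots> \<le> B" unfolding B_def using finC cC by (intro member_le_sum) auto
    finally show ?thesis using size_at_nonneg[of n w] by simp
  qed
  then show ?thesis using r(1) by blast
qed

end

lemma strict_mono_surj_inv:
  fixes \<phi> :: "real \<Rightarrow> real"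
  assumes "strict_mono \<phi>" "continuous_on UNIV \<phi>" "surj \<phi>"
  shows "\<And>x. inv \<phi> (\<phi> x) = x" "\<And>x. \<phi> (inv \<phi> x) = x" "\<And>x y. inv \<phi> x < inv \<phi> y \<longleftrightarrow> x < y"
    "\<And>x y. inv \<phi> x \<le> inv \<phi> y \<longleftrightarrow> x \<le> y" "continuous_on UNIV (inv \<phi>)"
proof -
  have inj: "inj \<phi>" using assms(1) by (rule strict_mono_imp_inj_on)
  show l: "inv \<phi> (\<phi> x) = x" for x using inj by simp
  show r: "\<phi> (inv \<phi> x) = x" for x using assms(3) by (rule surj_f_inv_f)
  show "inv \<phi> x < inv \<phi> y \<longleftrightarrow> x < y" for x y
    using strict_mono_less[OF assms(1), of "inv \<phi> x" "inv \<phi> y"] r by simp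
  show "inv \<phi> x \<le> inv \<phi> y \<longleftrightarrow> x \<le> y" for x y
    using strict_mono_less_eq[OF assms(1), of "inv \<phi> x" "inv \<phi> y"] r by simp
  have "isCont (inv \<phi>) (\<phi> x)" for x
    by (rule isCont_inverse_function[of 1]) (use l assms(2) in \<open>auto simp: continuous_on_eq_continuous_at\<close>)
  then have "isCont (inv \<phi>) x" for x using r[of x] by metis
  then show "continuous_on UNIV (inv \<phi>)" by (simp add: continuous_on_eq_continuous_at)
qed

lemma (in label_strip) relabel_strip:
  assumes \<phi>: "strict_mono \<phi>" "continuous_on UNIV \<phi>" "surj \<phi>" and \<psi>: "strict_mono \<psi>" "continuous_on UNIV \<psi>" "surj \<psi>"
  shows "label_strip T cm (\<lambda>x t. inv \<phi> (Xf x t)) (\<lambda>x t. inv \<psi> (Yf x t))"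
proof
  note i = strict_mono_surj_inv[OF \<phi>] and j = strict_mono_surj_inv[OF \<psi>]
  show "continuous_on (UNIV \<times> {0..T}) (\<lambda>(x, t). inv \<phi> (Xf x t))"
    using continuous_on_compose2[OF i(5) contX] by (simp add: case_prod_beta')
  show "continuous_on (UNIV \<times> {0..T}) (\<lambda>(x, t). inv \<psi> (Yf x t))"
    using continuous_on_compose2[OF j(5) contY] by (simp add: case_prod_beta')
  show "inv \<phi> (Xf x t) < inv \<phi> (Xf x' t)" if "t \<in> {0..T}" "x < x'" for x x' t using monoX[OF that] i(3) by simp
  show "inv \<psi> (Yf x' t) < inv \<psi> (Yf x t)" if "t \<in> {0..T}" "x < x'" for x x' t using antiY[OF that] j(3) by simp
  show "inv \<phi> (Xf x s) < inv \<phi> (Xf x t)" if "0 \<le> s" "s < t" "t \<le> T" for x s t using timeX[OF that] i(3) by simp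
  show "inv \<psi> (Yf x s) < inv \<psi> (Yf x t)" if "0 \<le> s" "s < t" "t \<le> T" for x s t using timeY[OF that] j(3) by simp
  show "inv \<phi> (Xf x t) \<le> inv \<phi> (Xf (x + cm * (t - s)) s)" if "0 \<le> s" "s \<le> t" "t \<le> T" for x s t using coneX[OF that] i(4) by simp
  show "inv \<psi> (Yf x t) \<le> inv \<psi> (Yf (x - cm * (t - s)) s)" if "0 \<le> s" "s \<le> t" "t \<le> T" for x s t using coneY[OF that] j(4) by simp
qed (use T_pos cm_nonneg in auto)

lemma smooth_cells_derivative:
  assumes "smooth_cells A N \<phi>" "finite N" "\<theta> \<in> A" "X \<notin> N"
  shows "(\<phi> \<theta> has_real_derivative deriv (\<phi> \<theta>) X) (at X)" "0 < deriv (\<phi> \<theta>) X"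
proof -
  obtain d where d: "0 < d" "{X - d<..<X + d} \<inter> N = {}" using cells_around[OF assms(2), of X] assms(4) by blast
  then have "X - d < X + d" by simp
  then obtain h ht hx hxt where h: "C2_family A h ht hx hxt" "\<And>\<theta> X'. \<theta> \<in> A \<Longrightarrow> X' \<in> {X - d..X + d} \<Longrightarrow> \<phi> \<theta> X' = h \<theta> X' \<and> 0 < hx \<theta> X'"
    using assms(1) d(2) unfolding smooth_cells_def by meson
  have "(h \<theta> has_real_derivative hx \<theta> X) (at X)" using h(1) assms(3) by (simp add: C2_family_def)
  then have D: "(\<phi> \<theta> has_real_derivative hx \<theta> X) (at X)"
    by (rule has_field_derivative_transform_within_open[where S = "{X - d<..<X + d}"]) (use d h(2)[OF assms(3)] in auto)
  then show "(\<phi> \<theta> has_real_derivative deriv (\<phi> \<theta>) X) (at X)" "0 < deriv (\<phi> \<theta>) X"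
    using DERIV_imp_deriv[OF D] h(2)[OF assms(3), of X] d(1) by simp_all
qed

section \<open>The strip in relabelled coordinates\<close>

context relabelled_path
begin

definition "Xr x t = inv (\<phi> \<theta>) (Xf x t)"
definition "Yr x t = inv (\<psi> \<theta>) (Yf x t)"

lemmas \<phi>_inv = strict_mono_surj_inv[OF \<phi>] and \<psi>_inv = strict_mono_surj_inv[OF \<psi>]

sublocale R: label_strip T m Xr Yr
  using relabel_strip[OF \<phi> \<psi>] by (simp add: Xr_def[abs_def] Yr_def[abs_def])

lemma \<phi>_Xr: "\<phi> \<theta> (Xr x t) = Xf x t" "\<psi> \<theta> (Yr x t) = Yf x t"
  by (simp_all add: Xr_def Yr_def \<phi>_inv \<psi>_inv)

lemma RIX_iff: "X \<in> R.IX \<longleftrightarrow> \<phi> \<theta> X \<in> IX" "Y \<in> R.IY \<longleftrightarrow> \<psi> \<theta> Y \<in> IY"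
proof -
  have "X \<in> R.IX" if "\<phi> \<theta> X \<in> IX"
  proof -
    obtain x where "\<phi> \<theta> X = Xf x 0" using \<open>\<phi> \<theta> X \<in> IX\<close> by (auto simp: IX_def)
    then have "X = Xr x 0" using \<phi>_inv(1)[of X] by (simp add: Xr_def)
    then show ?thesis by (simp add: R.IX_def)
  qed
  then show "X \<in> R.IX \<longleftrightarrow> \<phi> \<theta> X \<in> IX" by (auto simp: R.IX_def IX_def \<phi>_Xr)
  have "Y \<in> R.IY" if "\<psi> \<theta> Y \<in> IY"
  proof -
    obtain x where "\<psi> \<theta> Y = Yf x 0" using \<open>\<psi> \<theta> Y \<in> IY\<close> by (auto simp: IY_def)
    then have "Y = Yr x 0" using \<psi>_inv(1)[of Y] by (simp add: Yr_def)
    then show ?thesis by (simp add: R.IY_def)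
  qed
  then show "Y \<in> R.IY \<longleftrightarrow> \<psi> \<theta> Y \<in> IY" by (auto simp: R.IY_def IY_def \<phi>_Xr)
qed

lemma graph_in_\<Omega>r: "t \<in> {0..T} \<Longrightarrow> (Xr x t, Yr x t) \<in> \<Omega>r"
  using G_in[of "(x, t)"] by (simp add: \<Omega>r_iff \<phi>_Xr flip: G_eq)

lemma \<Omega>r_eq: "\<Omega>r = R.strip_image T"
proof (intro equalityI subsetI)
  fix z assume z: "z \<in> \<Omega>r"
  obtain X Y where XY: "z = (X, Y)" by (cases z)
  have "(\<phi> \<theta> X, \<psi> \<theta> Y) \<in> \<Omega>" using z by (simp add: XY \<Omega>r_iff)
  then have "(\<phi> \<theta> X, \<psi> \<theta> Y) \<in> strip_image T" unfolding \<Omega>_eq .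
  then obtain x s where s: "\<phi> \<theta> X = Xf x s" "\<psi> \<theta> Y = Yf x s" "0 \<le> s" "s \<le> T" by (auto simp: strip_image_def)
  then have "X = Xr x s" "Y = Yr x s" using \<phi>_inv(1)[of X] \<psi>_inv(1)[of Y] by (simp_all add: Xr_def Yr_def)
  then show "z \<in> R.strip_image T" using s XY unfolding R.strip_image_def by blast
next
  fix z assume "z \<in> R.strip_image T"
  then show "z \<in> \<Omega>r" using graph_in_\<Omega>r by (auto simp: R.strip_image_def)
qed

lemma strip_image_\<Omega>r: "t \<le> T \<Longrightarrow> R.strip_image t \<subseteq> \<Omega>r"
  unfolding \<Omega>r_eq R.strip_image_def by force

lemma R_slice:
  assumes t: "t \<in> {0..T}"
  shows "X \<in> R.IX \<Longrightarrow> R.yv 0 X \<le> Y \<Longrightarrow> Y \<le> R.yv t X \<Longrightarrow> (X, Y) \<in> \<Omega>r"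
    and "Y \<in> R.IY \<Longrightarrow> R.xv 0 Y \<le> X \<Longrightarrow> X \<le> R.xv t Y \<Longrightarrow> (X, Y) \<in> \<Omega>r"
proof -
  show "X \<in> R.IX \<Longrightarrow> R.yv 0 X \<le> Y \<Longrightarrow> Y \<le> R.yv t X \<Longrightarrow> (X, Y) \<in> \<Omega>r"
    using R.strip_image_slice[OF _ t, of X Y] strip_image_\<Omega>r[of t] t by auto
  assume "Y \<in> R.IY" "R.xv 0 Y \<le> X" "X \<le> R.xv t Y"
  then have "(Y, X) \<in> prod.swap ` R.strip_image t"
    using label_strip.strip_image_slice[OF R.swap _ t, of Y X] unfolding R.swap_simps by simp
  then show "(X, Y) \<in> \<Omega>r" using strip_image_\<Omega>r[of t] t by auto
qed

lemma level_curve_eq: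
  assumes t: "t \<in> {0..T}"
  shows "level_curve \<Omega>r (Zr \<theta>) t = range (\<lambda>x. (Xr x t, Yr x t))"
proof (intro equalityI subsetI)
  have tz: "ch_t (Zr \<theta>) (X, Y) = ch_t (Z \<theta>) (\<phi> \<theta> X, \<psi> \<theta> Y)" for X Y by (simp add: Zr_def relabel_def)
  fix z assume z: "z \<in> level_curve \<Omega>r (Zr \<theta>) t"
  obtain X Y where XY: "z = (X, Y)" by (cases z)
  define w where "w = (\<phi> \<theta> X, \<psi> \<theta> Y)"
  have w: "w \<in> \<Omega>" "ch_t (Z \<theta>) w = t" using z by (auto simp: XY level_curve_def \<Omega>r_iff tz w_def)
  then have "w = (Xf (ch_x (Z \<theta>) w) t, Yf (ch_x (Z \<theta>) w) t)" using G_xt[OF w(1)] by (simp flip: G_eq)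
  then have "X = Xr (ch_x (Z \<theta>) w) t" "Y = Yr (ch_x (Z \<theta>) w) t"
    using \<phi>_inv(1)[of X] \<psi>_inv(1)[of Y] by (auto simp: w_def Xr_def Yr_def)
  then show "z \<in> range (\<lambda>x. (Xr x t, Yr x t))" using XY by blast
next
  fix z assume "z \<in> range (\<lambda>x. (Xr x t, Yr x t))"
  then obtain x where "z = (Xr x t, Yr x t)" by blast
  then show "z \<in> level_curve \<Omega>r (Zr \<theta>) t"
    using graph_in_\<Omega>r[OF t, of x] t_G[of "(x, t)"] t by (simp add: level_curve_def Zr_def relabel_def \<phi>_Xr flip: G_eq)
qed

end

text \<open>Each of the \<open>n\<close> densities in each of the two families grows at most at the
  rate \<open>500 * m ^ 4\<close> times the same sum. The constant \<open>L\<close> is this rate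
  counted \<open>2 * n\<close> times, so that the weight compensates the total growth. The functions
  \<open>a\<close> and \<open>b\<close> are the variation potentials of the two families.\<close>

locale weighted_path = relabelled_path +
  fixes L :: real and a b :: "real \<Rightarrow> real" and n :: nat
  assumes n: "n = 4 \<or> n = 6" and L: "L = 2 * real n * (500 * m ^ 4)"
    and b: "\<And>X. \<bar>b X\<bar> \<le> \<eta>" "\<And>X Y. (X, Y) \<in> \<Omega> \<Longrightarrow> (b has_real_derivative ch_p (Z \<theta>) (X, Y) * \<bar>sin (ch_alpha (Z \<theta>) (X, Y) / 2)\<bar>) (at X)"
    and a: "\<And>Y. \<bar>a Y\<bar> \<le> \<eta>" "\<And>X Y. (X, Y) \<in> \<Omega> \<Longrightarrow> (a has_real_derivative ch_q (Z \<theta>) (X, Y) * \<bar>sin (ch_beta (Z \<theta>) (X, Y) / 2)\<bar>) (at Y)"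
begin

text \<open>The exponent of the weight: its derivatives dominate \<open>L p\<close> and \<open>L q\<close>, while its size is controlled
  by the total variation and the time.\<close>

definition "V0 z = L * (b (\<phi> \<theta> (fst z)) + a (\<psi> \<theta> (snd z))) + 2 * m * L * ch_t (Z \<theta>) (\<phi> \<theta> (fst z), \<psi> \<theta> (snd z))"

lemma m_ge_1: "1 \<le> m"
  using coeff[OF G_in[of "(0, 0)"]] T_pos by (simp add: coeff_bound_def)

lemma L_nonneg: "0 \<le> L" using m_ge_1 by (simp add: L)

lemma V0_bounds:
  assumes "z \<in> \<Omega>r"
  shows "- (2 * L * \<eta>) \<le> V0 z" "V0 z \<le> 2 * L * \<eta> + 2 * m * L * ch_t (Zr \<theta>) z"
proof -
  define s where "s = b (\<phi> \<theta> (fst z)) + a (\<psi> \<theta> (snd z))"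
  have s: "- (2 * \<eta>) \<le> s" "s \<le> 2 * \<eta>" using b(1)[of "\<phi> \<theta> (fst z)"] a(1)[of "\<psi> \<theta> (snd z)"] by (auto simp: s_def)
  have Ls: "L * (- (2 * \<eta>)) \<le> L * s" "L * s \<le> L * (2 * \<eta>)"
    by (rule mult_left_mono[OF s(1) L_nonneg], rule mult_left_mono[OF s(2) L_nonneg])
  have t: "ch_t (Zr \<theta>) z = ch_t (Z \<theta>) (\<phi> \<theta> (fst z), \<psi> \<theta> (snd z))" by (cases z) (simp add: Zr_def relabel_def)
  have "(\<phi> \<theta> (fst z), \<psi> \<theta> (snd z)) \<in> \<Omega>" using assms by (cases z) (simp add: \<Omega>r_iff)
  then have "0 \<le> ch_t (Zr \<theta>) z" using t_range t by auto
  then have "0 \<le> 2 * m * L * ch_t (Zr \<theta>) z" using m_ge_1 L_nonneg by simp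
  then show "- (2 * L * \<eta>) \<le> V0 z" "V0 z \<le> 2 * L * \<eta> + 2 * m * L * ch_t (Zr \<theta>) z"
    using Ls unfolding V0_def s_def[symmetric] t by (auto simp: algebra_simps)
qed

lemma isCont_t: "(\<phi> \<theta> X, \<psi> \<theta> Y) \<in> {z. (\<theta>, z) \<in> V} \<Longrightarrow> isCont (ch_t (Z \<theta>)) (\<phi> \<theta> X, \<psi> \<theta> Y)"
  using D_t by (rule has_derivative_continuous)

lemma isCont_\<phi>: "isCont (\<phi> \<theta>) X" "isCont (\<psi> \<theta>) X"
  using \<phi>(2) \<psi>(2) by (simp_all add: continuous_on_eq_continuous_at)

text \<open>The potentials are only known to be differentiable at labels that occur in the strip,
  hence the restriction to \<open>R.IX\<close> and \<open>R.IY\<close>; a point at time 0 with the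
  given label supplies their continuity.\<close>

lemma isCont_V0:
  assumes "X \<in> R.IX" "Y \<in> R.IY" "(X, Y) \<in> Ur"
  shows "isCont V0 (X, Y)"
proof -
  have 0: "(0::real) \<in> {0..T}" using T_pos by simp
  obtain x where x: "\<phi> \<theta> X = Xf x 0" using assms(1) RIX_iff by (auto simp: IX_def)
  obtain y where y: "\<psi> \<theta> Y = Yf y 0" using assms(2) RIX_iff by (auto simp: IY_def)
  have "(\<phi> \<theta> X, Yf x 0) \<in> \<Omega>" "(Xf y 0, \<psi> \<theta> Y) \<in> \<Omega>" using G_in[of "(x, 0)"] G_in[of "(y, 0)"] 0 by (simp_all add: x y G_eq)
  then have "isCont b (\<phi> \<theta> X)" "isCont a (\<psi> \<theta> Y)" using b(2) a(2) DERIV_isCont by blast+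
  note ba = this
  have fs: "isCont (\<lambda>z. \<phi> \<theta> (fst z)) (X, Y)" "isCont (\<lambda>z. \<psi> \<theta> (snd z)) (X, Y)"
  proof -
    have "isCont (\<lambda>z. fst z) (X, Y)" "isCont (\<lambda>z. snd z) (X, Y)" by (intro continuous_intros)+
    from isCont_o2[OF this(1), where g = "\<phi> \<theta>"] isCont_o2[OF this(2), where g = "\<psi> \<theta>"] isCont_\<phi>
    show "isCont (\<lambda>z. \<phi> \<theta> (fst z)) (X, Y)" "isCont (\<lambda>z. \<psi> \<theta> (snd z)) (X, Y)" by simp_all
  qed
  have ab: "isCont (\<lambda>z. b (\<phi> \<theta> (fst z))) (X, Y)" "isCont (\<lambda>z. a (\<psi> \<theta> (snd z))) (X, Y)"
    using isCont_o2[OF fs(1), where g = b] isCont_o2[OF fs(2), where g = a] ba by simp_all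
  have "isCont (\<lambda>z. (\<phi> \<theta> (fst z), \<psi> \<theta> (snd z))) (X, Y)"
    by (rule isCont_Pair[OF fs])
  then have "isCont (\<lambda>z. ch_t (Z \<theta>) (\<phi> \<theta> (fst z), \<psi> \<theta> (snd z))) (X, Y)"
    using isCont_o2[where f = "\<lambda>z. (\<phi> \<theta> (fst z), \<psi> \<theta> (snd z))" and a = "(X, Y)" and g = "ch_t (Z \<theta>)"] isCont_t[of X Y] assms(3)
    by (simp add: Ur_def)
  then show ?thesis unfolding V0_def[abs_def] using ab
    by (intro continuous_add continuous_mult continuous_const)
qed

lemma \<Omega>r_RIX: "(X, Y) \<in> \<Omega>r \<Longrightarrow> X \<in> R.IX" "(X, Y) \<in> \<Omega>r \<Longrightarrow> Y \<in> R.IY"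
proof -
  assume \<Omega>: "(X, Y) \<in> \<Omega>r"
  show "X \<in> R.IX" using R.strip_image_IX[of T X Y] \<Omega> T_pos by (simp add: \<Omega>r_eq)
  have "(Y, X) \<in> prod.swap ` R.strip_image T" using \<Omega> by (force simp: \<Omega>r_eq)
  then show "Y \<in> R.IY"
    using label_strip.strip_image_IX[OF R.swap, of T Y X] T_pos unfolding R.swap_simps by simp
qed

lemma isCont_V0_line:
  assumes "(X, Y) \<in> \<Omega>r"
  shows "isCont (\<lambda>Y. V0 (X, Y)) Y" "isCont (\<lambda>X. V0 (X, Y)) X"
proof -
  have "isCont V0 (X, Y)" using isCont_V0[OF \<Omega>r_RIX[OF assms]] assms \<Omega>r_Ur by blast
  then show "isCont (\<lambda>Y. V0 (X, Y)) Y" "isCont (\<lambda>X. V0 (X, Y)) X"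
  proof -
    have "isCont (\<lambda>Y. (X, Y)) Y" "isCont (\<lambda>X. (X, Y)) X" by (intro continuous_intros)+
    from isCont_o2[OF this(1), where g = V0] isCont_o2[OF this(2), where g = V0] \<open>isCont V0 (X, Y)\<close>
    show "isCont (\<lambda>Y. V0 (X, Y)) Y" "isCont (\<lambda>X. V0 (X, Y)) X" by simp_all
  qed
qed

lemma sin_cos_ge: "0 \<le> cos x \<Longrightarrow> 1 \<le> \<bar>sin x\<bar> + cos x" for x :: real
proof -
  assume c: "0 \<le> cos x"
  have "\<bar>sin x\<bar> * \<bar>sin x\<bar> \<le> \<bar>sin x\<bar> * 1" by (rule mult_left_mono) auto
  then have "sin x * sin x \<le> \<bar>sin x\<bar>" by simp
  moreover have "cos x * cos x \<le> cos x * 1" using c by (intro mult_left_mono) auto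
  ultimately show ?thesis using sin_cos_squared_add3[of x] by linarith
qed

lemma D_V0:
  assumes \<Omega>: "(X, Y) \<in> \<Omega>r"
  shows "Y \<notin> M \<Longrightarrow> \<exists>D. ((\<lambda>Y. V0 (X, Y)) has_real_derivative D) (at Y) \<and> L * qr (X, Y) \<le> D"
    and "X \<notin> N \<Longrightarrow> \<exists>D. ((\<lambda>X. V0 (X, Y)) has_real_derivative D) (at X) \<and> L * pr (X, Y) \<le> D"
proof -
  define z where "z = (\<phi> \<theta> X, \<psi> \<theta> Y)"
  have z: "z \<in> \<Omega>" using \<Omega> by (simp add: z_def \<Omega>r_iff)
  then have U: "(\<phi> \<theta> X, \<psi> \<theta> Y) \<in> {z. (\<theta>, z) \<in> V}" using \<Omega>_U by (auto simp: z_def)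
  define c where "c = wave_speed \<gamma> (ch_tau (Z \<theta>) z)"
  have c: "0 < c" "c \<le> m" using coeff[OF z] wave_speed_pos by (auto simp: c_def coeff_bound_def)
  \<comment> \<open>The factor \<open>2 * m\<close> in \<open>V0\<close> turns the time term into
    \<open>L * (m / c) * r * cos x * d\<close>. As \<open>c \<le> m\<close>, this is at least
    \<open>L * r * cos x * d\<close>, which together with the sine term covers
    \<open>L * r * d\<close>.\<close>
  have key: "L * (r * d) \<le> L * (r * \<bar>sin x\<bar> * d) + 2 * m * L * (1 / (2 * c) * r * cos x * d)"
    if "0 < r" "0 < d" "0 \<le> cos x" for r d x :: real
  proof -
    have "1 \<le> m / c" using c by (simp add: divide_simps)
    then have "cos x \<le> m / c * cos x" using that(3) mult_right_mono[of 1 "m / c" "cos x"] by simp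
    then have "1 \<le> \<bar>sin x\<bar> + m / c * cos x" using sin_cos_ge[OF that(3)] by linarith
    then have "(L * r * d) * 1 \<le> (L * r * d) * (\<bar>sin x\<bar> + m / c * cos x)"
      using L_nonneg that by (intro mult_left_mono) auto
    then show ?thesis using c by (simp add: field_simps)
  qed
  show "\<exists>D. ((\<lambda>Y. V0 (X, Y)) has_real_derivative D) (at Y) \<and> L * qr (X, Y) \<le> D" if Y: "Y \<notin> M"
  proof -
    define d where "d = deriv (\<psi> \<theta>) Y"
    have d: "(\<psi> \<theta> has_real_derivative d) (at Y)" "0 < d"
      using smooth_cells_derivative[OF cells(2) fin(2) \<theta>_A Y] by (auto simp: d_def)
    define r s where "r = ch_q (Z \<theta>) z" and "s = ch_beta (Z \<theta>) z / 2"
    have "((\<lambda>Y. a (\<psi> \<theta> Y)) has_real_derivative r * \<bar>sin s\<bar> * d) (at Y)"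
      using DERIV_chain2[OF a(2) d(1)] z by (simp add: z_def r_def s_def)
    moreover have "((\<lambda>Y. ch_t (Z \<theta>) (\<phi> \<theta> X, \<psi> \<theta> Y)) has_real_derivative 1 / (2 * c) * r * cos s * d) (at Y)"
      using DERIV_along_line[OF D_t[OF U] DERIV_const d(1)] by (simp add: z_def r_def s_def c_def)
    ultimately have "((\<lambda>Y. V0 (X, Y)) has_real_derivative L * (r * \<bar>sin s\<bar> * d) + 2 * m * L * (1 / (2 * c) * r * cos s * d)) (at Y)"
      unfolding V0_def fst_conv snd_conv
      by (intro DERIV_add DERIV_cmult) (use DERIV_add[OF DERIV_const] in fastforce)+
    moreover have "qr (X, Y) = r * d" by (simp add: qr_def Zr_def relabel_def r_def z_def d_def)
    moreover have "0 < r" "0 \<le> cos s" using pq_pos(2)[OF z] cos_nonneg(2)[OF z] by (auto simp: r_def s_def)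
    ultimately show ?thesis using key d(2) by metis
  qed
  show "\<exists>D. ((\<lambda>X. V0 (X, Y)) has_real_derivative D) (at X) \<and> L * pr (X, Y) \<le> D" if X: "X \<notin> N"
  proof -
    define d where "d = deriv (\<phi> \<theta>) X"
    have d: "(\<phi> \<theta> has_real_derivative d) (at X)" "0 < d"
      using smooth_cells_derivative[OF cells(1) fin(1) \<theta>_A X] by (auto simp: d_def)
    define r s where "r = ch_p (Z \<theta>) z" and "s = ch_alpha (Z \<theta>) z / 2"
    have "((\<lambda>X. b (\<phi> \<theta> X)) has_real_derivative r * \<bar>sin s\<bar> * d) (at X)"
      using DERIV_chain2[OF b(2) d(1)] z by (simp add: z_def r_def s_def)
    moreover have "((\<lambda>X. ch_t (Z \<theta>) (\<phi> \<theta> X, \<psi> \<theta> Y)) has_real_derivative 1 / (2 * c) * r * cos s * d) (at X)"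
      using DERIV_along_line[OF D_t[OF U] d(1) DERIV_const] by (simp add: z_def r_def s_def c_def)
    ultimately have "((\<lambda>X. V0 (X, Y)) has_real_derivative L * (r * \<bar>sin s\<bar> * d) + 2 * m * L * (1 / (2 * c) * r * cos s * d)) (at X)"
      unfolding V0_def fst_conv snd_conv
      by (intro DERIV_add DERIV_cmult) (use DERIV_add[OF _ DERIV_const] in fastforce)+
    moreover have "pr (X, Y) = r * d" by (simp add: pr_def Zr_def relabel_def r_def z_def d_def)
    moreover have "0 < r" "0 \<le> cos s" using pq_pos(1)[OF z] cos_nonneg(1)[OF z] by (auto simp: r_def s_def)
    ultimately show ?thesis using key d(2) by metis
  qed
qed

end

section \<open>Growth of the tangent norm\<close>

text \<open>The integrands of the tangent norm are not known to be measurable, so \<open>nn_integral_cmult\<close> does not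
  apply to them.\<close>

lemma nn_integral_cmult_le:
  assumes "0 < c"
  shows "(\<integral>\<^sup>+x. ennreal c * f x \<partial>M) \<le> ennreal c * (\<integral>\<^sup>+x. f x \<partial>M)"
  unfolding nn_integral_def[of M "\<lambda>x. ennreal c * f x"]
proof (rule SUP_least, elim CollectE conjE)
  fix g assume g: "simple_function M g" "g \<le> (\<lambda>x. ennreal c * f x)"
  define k where "k x = ennreal (1 / c) * g x" for x
  have k: "simple_function M k" unfolding k_def using g(1) by simp
  have cc: "ennreal c * ennreal (1 / c) = 1" using assms by (simp flip: ennreal_mult' add: ennreal_1)
  have "k x \<le> f x" for x
  proof -
    have "k x \<le> ennreal (1 / c) * (ennreal c * f x)"
      unfolding k_def using g(2) by (intro mult_left_mono) (auto simp: le_fun_def)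
    also have "\<dots> = f x" using cc by (metis mult.assoc mult.commute mult_1)
    finally show ?thesis .
  qed
  then have "integral\<^sup>S M k \<le> (\<integral>\<^sup>+x. f x \<partial>M)"
    using k by (simp add: nn_integral_eq_simple_integral[symmetric] nn_integral_mono)
  then have "ennreal c * integral\<^sup>S M k \<le> ennreal c * (\<integral>\<^sup>+x. f x \<partial>M)" by (rule mult_left_mono) simp
  moreover have "ennreal c * integral\<^sup>S M k = integral\<^sup>S M g"
    unfolding k_def simple_integral_mult[OF g(1)] mult.assoc[symmetric] cc by simp
  ultimately show "integral\<^sup>S M g \<le> ennreal c * (\<integral>\<^sup>+x. f x \<partial>M)" by simp
qed

lemma sum_weighted_increment:
  fixes J :: "nat \<Rightarrow> real \<Rightarrow> real" and V r v :: "real \<Rightarrow> real" and g :: "nat \<Rightarrow> real \<Rightarrow> real"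
  assumes ab: "a \<le> b" and S: "finite S"
    and contJ: "\<And>l. l \<in> A \<Longrightarrow> continuous_on {a..b} (J l)" and contV: "continuous_on {a..b} V"
    and DJ: "\<And>y l. y \<in> {a<..<b} - S \<Longrightarrow> l \<in> A \<Longrightarrow> \<exists>D. (J l has_real_derivative D) (at y) \<and> \<bar>D\<bar> \<le> r y"
    and DV: "\<And>y. y \<in> {a<..<b} - S \<Longrightarrow> \<exists>D. (V has_real_derivative D) (at y) \<and> v y \<le> D"
    and v: "\<And>y. y \<in> {a<..<b} - S \<Longrightarrow> 0 \<le> v y"
    and g: "\<And>y l. y \<in> {a<..<b} - S \<Longrightarrow> l \<in> A \<Longrightarrow> g l y = exp (- V y) * (r y - v y * \<bar>J l y\<bar>)"
      "\<And>l. l \<in> A \<Longrightarrow> set_integrable lborel {a..b} (g l)"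
  shows "(\<Sum>l\<in>A. \<bar>J l b\<bar> * exp (- V b)) - (\<Sum>l\<in>A. \<bar>J l a\<bar> * exp (- V a)) \<le> (LINT y:{a..b}|lborel. \<Sum>l\<in>A. g l y)"
proof -
  have "\<forall>y. \<exists>D. y \<in> {a<..<b} - S \<longrightarrow> (V has_real_derivative D) (at y) \<and> v y \<le> D" using DV by blast
  from choice[OF this] obtain V' where V': "\<forall>y. y \<in> {a<..<b} - S \<longrightarrow> (V has_real_derivative V' y) (at y) \<and> v y \<le> V' y" ..
  have "\<bar>J l b\<bar> * exp (- V b) - \<bar>J l a\<bar> * exp (- V a) \<le> (LINT y:{a..b}|lborel. g l y)" if l: "l \<in> A" for l
  proof -
    have "\<forall>y. \<exists>D. y \<in> {a<..<b} - S \<longrightarrow> (J l has_real_derivative D) (at y) \<and> \<bar>D\<bar> \<le> r y" using DJ l by blast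
    from choice[OF this] obtain D where D: "\<forall>y. y \<in> {a<..<b} - S \<longrightarrow> (J l has_real_derivative D y) (at y) \<and> \<bar>D y\<bar> \<le> r y" ..
    show ?thesis
      by (rule weighted_abs_increment[OF ab S contJ[OF l] contV, where D = D and V' = V' and r = r and v = v])
         (use D V' v g l in blast)+
  qed
  then have "(\<Sum>l\<in>A. \<bar>J l b\<bar> * exp (- V b) - \<bar>J l a\<bar> * exp (- V a)) \<le> (\<Sum>l\<in>A. LINT y:{a..b}|lborel. g l y)"
    by (rule sum_mono)
  also have "\<dots> = (LINT y:{a..b}|lborel. \<Sum>l\<in>A. g l y)"
    unfolding set_lebesgue_integral_def scaleR_sum_right
    by (rule Bochner_Integration.integral_sum[symmetric]) (use g(2) in \<open>simp add: set_integrable_def\<close>)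
  finally show ?thesis by (simp add: sum_subtractf)
qed

lemma set_integrable_line:
  fixes f :: "real \<times> real \<Rightarrow> real" and h :: "real \<Rightarrow> real \<times> real"
  assumes f: "f \<in> borel_measurable borel" and h: "continuous_on UNIV h" and B: "\<And>y. y \<in> {a..b} \<Longrightarrow> \<bar>f (h y)\<bar> \<le> B"
  shows "set_integrable lborel {a..b} (\<lambda>y. f (h y))"
  unfolding set_integrable_def
proof (rule Bochner_Integration.integrable_bound)
  show "integrable lborel (\<lambda>y. B * indicator {a..b} y :: real)"
    by (intro integrable_mult_right integrable_real_indicator) (auto simp: emeasure_lborel_Icc_eq)
  have "(\<lambda>y. f (h y)) \<in> borel_measurable borel"
    using measurable_compose[OF borel_measurable_continuous_onI[OF h] f] .
  then show "(\<lambda>y. indicator {a..b} y *\<^sub>R f (h y)) \<in> borel_measurable lborel" by simp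
  show "AE y in lborel. norm (indicator {a..b} y *\<^sub>R f (h y)) \<le> norm (B * indicator {a..b} y :: real)"
    using B by (intro AE_I2) (force simp: indicator_def)
qed

lemma (in label_strip) int_dX_graph:
  assumes t: "t \<in> {0..T}" and \<Gamma>: "\<Gamma> = range (\<lambda>x. (Xf x t, Yf x t))"
  shows "int_dX \<Gamma> f = (\<integral>\<^sup>+X. (if X \<in> IX then f (X, yv t X) else 0) \<partial>lborel)"
proof -
  have mem: "(X, Y) \<in> \<Gamma> \<longleftrightarrow> X \<in> IX \<and> Y = yv t X" for X Y
  proof
    assume "(X, Y) \<in> \<Gamma>"
    then obtain x where "X = Xf x t" "Y = Yf x t" by (auto simp: \<Gamma>)
    then show "X \<in> IX \<and> Y = yv t X" using Xf_in_IX[OF t] xi_Xf[OF t] by (simp add: yv_def)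
  next
    assume "X \<in> IX \<and> Y = yv t X"
    then obtain x where "Xf x t = X" "Yf x t = Y" using graph_point[OF t] by blast
    then show "(X, Y) \<in> \<Gamma>" unfolding \<Gamma> by blast
  qed
  have "fst ` \<Gamma> = IX" using mem by force
  then show ?thesis unfolding int_dX_def by (intro nn_integral_cong) (auto simp: mem)
qed

lemma (in label_strip) int_dY_graph:
  assumes t: "t \<in> {0..T}" and \<Gamma>: "\<Gamma> = range (\<lambda>x. (Xf x t, Yf x t))"
  shows "int_dY \<Gamma> f = (\<integral>\<^sup>+Y. (if Y \<in> IY then f (xv t Y, Y) else 0) \<partial>lborel)"
proof -
  have "range (\<lambda>x. (Yf (- x) t, Xf (- x) t)) = prod.swap ` \<Gamma>"
  proof (intro equalityI subsetI)
    fix z assume "z \<in> prod.swap ` \<Gamma>"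
    then obtain x where "z = (Yf (- (- x)) t, Xf (- (- x)) t)" by (auto simp: \<Gamma>)
    then show "z \<in> range (\<lambda>x. (Yf (- x) t, Xf (- x) t))" by blast
  qed (auto simp: \<Gamma> image_iff)
  from label_strip.int_dX_graph[OF swap t this[symmetric], of "\<lambda>z. f (prod.swap z)"]
  have "int_dX (prod.swap ` \<Gamma>) (\<lambda>z. f (prod.swap z)) = (\<integral>\<^sup>+Y. (if Y \<in> IY then f (xv t Y, Y) else 0) \<partial>lborel)"
    unfolding swap_simps swap_simp .
  moreover have "fst ` prod.swap ` \<Gamma> = snd ` \<Gamma>" by force
  moreover have "(Y, X) \<in> prod.swap ` \<Gamma> \<longleftrightarrow> (X, Y) \<in> \<Gamma>" for X Y by force
  ultimately show ?thesis unfolding int_dX_def int_dY_def by simp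
qed

section \<open>The weighted flux\<close>

context weighted_path
begin

text \<open>An open set on which both the densities and \<open>V0\<close> are continuous. Cutting
  off outside it makes the weighted densities Borel functions on the plane, while almost every label
  of a level curve gives a point inside.\<close>

definition "O2 = {(X, Y). (X, Y) \<in> good \<and> X \<in> R.IX \<and> Y \<in> R.IY}"
definition "E1 z = (\<Sum>k = 1..n. \<bar>Jm k z\<bar>)"
definition "E2 z = (\<Sum>k = 1..n. \<bar>Jp k z\<bar>)"
definition "rate z = 500 * m ^ 4 * (qr z * E1 z + pr z * E2 z)"
definition "e1 l z = indicator O2 z *\<^sub>R (\<bar>Jm l z\<bar> * exp (- V0 z))"
definition "e2 l z = indicator O2 z *\<^sub>R (\<bar>Jp l z\<bar> * exp (- V0 z))"
definition "g1 l z = indicator O2 z *\<^sub>R (exp (- V0 z) * (rate z - L * qr z * \<bar>Jm l z\<bar>))"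
definition "g2 l z = indicator O2 z *\<^sub>R (exp (- V0 z) * (rate z - L * pr z * \<bar>Jp l z\<bar>))"

lemma open_O2: "open O2"
proof -
  have "open R.IY" using label_strip.open_IX[OF R.swap] unfolding R.swap_simps .
  moreover have "O2 = good \<inter> R.IX \<times> R.IY" by (auto simp: O2_def)
  ultimately show ?thesis using open_good R.open_IX by (auto intro!: open_Int open_Times)
qed

lemma measurable_e_g:
  "e1 l \<in> borel_measurable borel" "e2 l \<in> borel_measurable borel"
  "g1 l \<in> borel_measurable borel" "g2 l \<in> borel_measurable borel"
proof -
  have sub: "O2 \<subseteq> good" by (auto simp: O2_def)
  have V: "continuous_on O2 V0"
    using isCont_V0 by (auto intro!: continuous_at_imp_continuous_on simp: O2_def good_def)
  note c = continuous_on_subset[OF continuous_on_good(1) sub] continuous_on_subset[OF continuous_on_good(2) sub]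
    continuous_on_subset[OF continuous_on_good(3) sub] continuous_on_subset[OF continuous_on_good(4) sub]
  have O: "O2 \<in> sets borel" using open_O2 by simp
  show "e1 l \<in> borel_measurable borel" "e2 l \<in> borel_measurable borel"
    "g1 l \<in> borel_measurable borel" "g2 l \<in> borel_measurable borel"
    unfolding e1_def[abs_def] e2_def[abs_def] g1_def[abs_def] g2_def[abs_def] rate_def E1_def E2_def
    by (intro borel_measurable_continuous_on_indicator O continuous_on_mult continuous_on_exp continuous_on_minus continuous_on_diff
        continuous_on_add continuous_on_const continuous_on_rabs continuous_on_sum V c)+
qed

text \<open>The weight is at most \<open>exp (2 * L * \<eta>)\<close> on the strip, and the
  densities and rates are bounded off the breakpoints by \<open>size_locally_bounded\<close>;
  outside \<open>O2\<close> everything vanishes.\<close>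

lemma e_g_bounded:
  assumes K: "compact K" "K \<subseteq> \<Omega>r"
  shows "\<exists>B\<ge>0. \<forall>z\<in>K. \<forall>l\<in>{1..n}. \<bar>e1 l z\<bar> \<le> B \<and> \<bar>e2 l z\<bar> \<le> B \<and> \<bar>g1 l z\<bar> \<le> B \<and> \<bar>g2 l z\<bar> \<le> B"
proof -
  have "\<exists>B. \<forall>w\<in>K \<inter> good. \<bar>size_at n w\<bar> \<le> B"
    by (rule locally_bounded_on_compact[OF K(1)]) (use size_locally_bounded K(2) \<Omega>r_Ur in blast)
  then obtain B where B: "\<And>w. w \<in> K \<inter> good \<Longrightarrow> \<bar>size_at n w\<bar> \<le> B" by blast
  define c where "c = exp (2 * L * \<eta>)"
  define k where "k = 500 * m ^ 4"
  have k: "0 \<le> k" using m_ge_1 by (simp add: k_def)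
  define C where "C = c * \<bar>B\<bar> + c * (k * (\<bar>B\<bar> * \<bar>B\<bar> + \<bar>B\<bar> * \<bar>B\<bar>) + L * \<bar>B\<bar> * \<bar>B\<bar>)"
  have c0: "0 < c" by (simp add: c_def)
  have C: "0 \<le> C" "c * \<bar>B\<bar> \<le> C" "c * (k * (\<bar>B\<bar> * \<bar>B\<bar> + \<bar>B\<bar> * \<bar>B\<bar>) + L * \<bar>B\<bar> * \<bar>B\<bar>) \<le> C"
    using c0 k L_nonneg by (simp_all add: C_def)
  have "\<bar>e1 l z\<bar> \<le> C \<and> \<bar>e2 l z\<bar> \<le> C \<and> \<bar>g1 l z\<bar> \<le> C \<and> \<bar>g2 l z\<bar> \<le> C" if z: "z \<in> K" and l: "l \<in> {1..n}" for z l
  proof (cases "z \<in> O2")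
    case True
    then have zg: "z \<in> K \<inter> good" using z by (auto simp: O2_def)
    have S: "size_at n z \<le> \<bar>B\<bar>" using B[OF zg] by linarith
    have nn: "0 \<le> E1 z" "0 \<le> E2 z" by (simp_all add: E1_def E2_def sum_nonneg)
    have b: "\<bar>pr z\<bar> \<le> \<bar>B\<bar>" "\<bar>qr z\<bar> \<le> \<bar>B\<bar>" "\<bar>E1 z\<bar> \<le> \<bar>B\<bar>" "\<bar>E2 z\<bar> \<le> \<bar>B\<bar>"
      using S nn unfolding size_at_def E1_def[symmetric] E2_def[symmetric] by linarith+
    have "\<bar>Jm l z\<bar> \<le> E1 z" "\<bar>Jp l z\<bar> \<le> E2 z" unfolding E1_def E2_def using l by (auto intro: member_le_sum)
    then have j: "\<bar>Jm l z\<bar> \<le> \<bar>B\<bar>" "\<bar>Jp l z\<bar> \<le> \<bar>B\<bar>" using b nn by linarith+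
    have ex: "exp (- V0 z) \<le> c" using V0_bounds(1)[of z] K(2) z by (auto simp: c_def)
    have pr: "\<bar>x * y\<bar> \<le> \<bar>B\<bar> * \<bar>B\<bar>" if "\<bar>x\<bar> \<le> \<bar>B\<bar>" "\<bar>y\<bar> \<le> \<bar>B\<bar>" for x y
      unfolding abs_mult by (rule mult_mono) (use that in auto)
    have "\<bar>qr z * E1 z + pr z * E2 z\<bar> \<le> \<bar>B\<bar> * \<bar>B\<bar> + \<bar>B\<bar> * \<bar>B\<bar>"
      using pr[OF b(2,3)] pr[OF b(1,4)] by linarith
    then have rt: "\<bar>rate z\<bar> \<le> k * (\<bar>B\<bar> * \<bar>B\<bar> + \<bar>B\<bar> * \<bar>B\<bar>)"
      unfolding rate_def k_def[symmetric] abs_mult using k by (intro mult_mono) auto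
    have Lp: "\<bar>L * x * \<bar>y\<bar>\<bar> \<le> L * \<bar>B\<bar> * \<bar>B\<bar>" if "\<bar>x\<bar> \<le> \<bar>B\<bar>" "\<bar>y\<bar> \<le> \<bar>B\<bar>" for x y
      using mult_left_mono[OF pr[OF that] L_nonneg] L_nonneg by (simp add: abs_mult mult_ac)
    have g: "\<bar>exp (- V0 z) * (rate z - L * x * \<bar>y\<bar>)\<bar> \<le> C" if "\<bar>x\<bar> \<le> \<bar>B\<bar>" "\<bar>y\<bar> \<le> \<bar>B\<bar>" for x y
    proof -
      have "\<bar>rate z - L * x * \<bar>y\<bar>\<bar> \<le> k * (\<bar>B\<bar> * \<bar>B\<bar> + \<bar>B\<bar> * \<bar>B\<bar>) + L * \<bar>B\<bar> * \<bar>B\<bar>" using rt Lp[OF that] by linarith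
      then have "exp (- V0 z) * \<bar>rate z - L * x * \<bar>y\<bar>\<bar> \<le> c * (k * (\<bar>B\<bar> * \<bar>B\<bar> + \<bar>B\<bar> * \<bar>B\<bar>) + L * \<bar>B\<bar> * \<bar>B\<bar>)"
        using ex c0 by (intro mult_mono) auto
      then show ?thesis using C(3) by (simp add: abs_mult)
    qed
    have e: "\<bar>\<bar>x\<bar> * exp (- V0 z)\<bar> \<le> C" if "\<bar>x\<bar> \<le> \<bar>B\<bar>" for x
    proof -
      have "exp (- V0 z) * \<bar>x\<bar> \<le> c * \<bar>B\<bar>" using ex c0 that by (intro mult_mono) auto
      then show ?thesis using C(2) by (simp add: abs_mult mult.commute)
    qed
    show ?thesis using True g[OF b(2) j(1)] g[OF b(1) j(2)] e[OF j(1)] e[OF j(2)]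
      by (simp add: e1_def e2_def g1_def g2_def)
  qed (use C(1) in \<open>simp add: e1_def e2_def g1_def g2_def\<close>)
  then show ?thesis using C(1) by blast
qed

text \<open>Along \<open>X = const\<close> the densities \<open>Jm\<close> are continuous, so the
  breakpoints of \<psi> are merely a finite exceptional set for the derivative. A breakpoint of
  \<phi> would spoil the whole line and is excluded for \<open>X\<close>; excluding breakpoints as
  endpoints makes \<open>e1\<close> agree there with the density without cutoff.\<close>

lemma increment_X:
  assumes X: "X \<in> R.IX - (N \<union> M)" and Y: "Y1 \<le> Y2" "Y1 \<notin> N \<union> M" "Y2 \<notin> N \<union> M"
    and \<Omega>: "\<And>Y. Y \<in> {Y1..Y2} \<Longrightarrow> (X, Y) \<in> \<Omega>r"
  shows "(\<Sum>l = 1..n. e1 l (X, Y2)) - (\<Sum>l = 1..n. e1 l (X, Y1)) \<le> (LINT Y:{Y1..Y2}|lborel. \<Sum>l = 1..n. g1 l (X, Y))"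
proof -
  have O2: "(X, Y) \<in> O2" if "Y \<in> {Y1..Y2}" "Y \<notin> M" for Y
    using \<Omega>[OF that(1)] \<Omega>r_RIX(2)[OF \<Omega>[OF that(1)]] X that(2) \<Omega>r_Ur by (auto simp: O2_def good_def)
  have K: "compact ((\<lambda>Y. (X, Y)) ` {Y1..Y2})" by (intro compact_continuous_image continuous_intros) auto
  obtain B where B: "\<And>z l. z \<in> (\<lambda>Y. (X, Y)) ` {Y1..Y2} \<Longrightarrow> l \<in> {1..n} \<Longrightarrow> \<bar>g1 l z\<bar> \<le> B"
    using e_g_bounded[OF K] \<Omega> by blast
  have XN: "X \<notin> N" using X by simp
  have "(\<Sum>l = 1..n. \<bar>Jm l (X, Y2)\<bar> * exp (- V0 (X, Y2))) - (\<Sum>l = 1..n. \<bar>Jm l (X, Y1)\<bar> * exp (- V0 (X, Y1)))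
    \<le> (LINT Y:{Y1..Y2}|lborel. \<Sum>l = 1..n. g1 l (X, Y))"
  proof (rule sum_weighted_increment[OF Y(1) fin(2), where J = "\<lambda>l Y. Jm l (X, Y)" and V = "\<lambda>Y. V0 (X, Y)"
        and r = "\<lambda>Y. rate (X, Y)" and v = "\<lambda>Y. L * qr (X, Y)" and g = "\<lambda>l Y. g1 l (X, Y)"])
    show "continuous_on {Y1..Y2} (\<lambda>Y. Jm l (X, Y))" for l
      using isCont_Jm[OF _ XN] \<Omega> \<Omega>r_Ur by (blast intro: continuous_at_imp_continuous_on)
    show "continuous_on {Y1..Y2} (\<lambda>Y. V0 (X, Y))"
      using isCont_V0_line(1) \<Omega> by (blast intro: continuous_at_imp_continuous_on)
    show "set_integrable lborel {Y1..Y2} (\<lambda>Y. g1 l (X, Y))" if "l \<in> {1..n}" for l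
      proof (rule set_integrable_line[OF measurable_e_g(3), where B = B])
      show "continuous_on UNIV (\<lambda>Y. (X, Y))" by (intro continuous_on_Pair continuous_on_id continuous_on_const)
      show "\<bar>g1 l (X, Y)\<bar> \<le> B" if "Y \<in> {Y1..Y2}" for Y using that \<open>l \<in> {1..n}\<close> by (intro B imageI)
    qed
    fix Y assume Y: "Y \<in> {Y1<..<Y2} - M"
    then have Y': "Y \<in> {Y1..Y2}" "Y \<notin> M" by auto
    note \<Omega>Y = \<Omega>[OF Y'(1)]
    have "1 \<in> {1..n}" using n by auto
    note pos = good_derivatives(1,2)[OF \<Omega>Y XN Y'(2) n this]
    show "\<exists>D. ((\<lambda>Y. V0 (X, Y)) has_real_derivative D) (at Y) \<and> L * qr (X, Y) \<le> D" by (rule D_V0(1)[OF \<Omega>Y Y'(2)])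
    show "0 \<le> L * qr (X, Y)" using L_nonneg pos by simp
    fix l assume l: "l \<in> {1..n}"
    show "\<exists>D. ((\<lambda>Y. Jm l (X, Y)) has_real_derivative D) (at Y) \<and> \<bar>D\<bar> \<le> rate (X, Y)"
      using good_derivatives(3)[OF \<Omega>Y XN Y'(2) n l] by (simp only: rate_def E1_def E2_def)
    show "g1 l (X, Y) = exp (- V0 (X, Y)) * (rate (X, Y) - L * qr (X, Y) * \<bar>Jm l (X, Y)\<bar>)"
      using O2[OF Y'] by (simp add: g1_def)
  qed
  then show ?thesis using O2[of Y1] O2[of Y2] Y by (simp add: e1_def)
qed

lemma increment_Y:
  assumes Y: "Y \<in> R.IY - (N \<union> M)" and X: "X1 \<le> X2" "X1 \<notin> N \<union> M" "X2 \<notin> N \<union> M"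
    and \<Omega>: "\<And>X. X \<in> {X1..X2} \<Longrightarrow> (X, Y) \<in> \<Omega>r"
  shows "(\<Sum>l = 1..n. e2 l (X2, Y)) - (\<Sum>l = 1..n. e2 l (X1, Y)) \<le> (LINT X:{X1..X2}|lborel. \<Sum>l = 1..n. g2 l (X, Y))"
proof -
  have O2: "(X, Y) \<in> O2" if "X \<in> {X1..X2}" "X \<notin> N" for X
    using \<Omega>[OF that(1)] \<Omega>r_RIX(1)[OF \<Omega>[OF that(1)]] Y that(2) \<Omega>r_Ur by (auto simp: O2_def good_def)
  have K: "compact ((\<lambda>X. (X, Y)) ` {X1..X2})" by (intro compact_continuous_image continuous_intros) auto
  obtain B where B: "\<And>z l. z \<in> (\<lambda>X. (X, Y)) ` {X1..X2} \<Longrightarrow> l \<in> {1..n} \<Longrightarrow> \<bar>g2 l z\<bar> \<le> B"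
    using e_g_bounded[OF K] \<Omega> by blast
  have YM: "Y \<notin> M" using Y by simp
  have "(\<Sum>l = 1..n. \<bar>Jp l (X2, Y)\<bar> * exp (- V0 (X2, Y))) - (\<Sum>l = 1..n. \<bar>Jp l (X1, Y)\<bar> * exp (- V0 (X1, Y)))
    \<le> (LINT X:{X1..X2}|lborel. \<Sum>l = 1..n. g2 l (X, Y))"
  proof (rule sum_weighted_increment[OF X(1) fin(1), where J = "\<lambda>l X. Jp l (X, Y)" and V = "\<lambda>X. V0 (X, Y)"
        and r = "\<lambda>X. rate (X, Y)" and v = "\<lambda>X. L * pr (X, Y)" and g = "\<lambda>l X. g2 l (X, Y)"])
    show "continuous_on {X1..X2} (\<lambda>X. Jp l (X, Y))" for l
      using isCont_Jp[OF _ YM] \<Omega> \<Omega>r_Ur by (blast intro: continuous_at_imp_continuous_on)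
    show "continuous_on {X1..X2} (\<lambda>X. V0 (X, Y))"
      using isCont_V0_line(2) \<Omega> by (blast intro: continuous_at_imp_continuous_on)
    show "set_integrable lborel {X1..X2} (\<lambda>X. g2 l (X, Y))" if "l \<in> {1..n}" for l
      proof (rule set_integrable_line[OF measurable_e_g(4), where B = B])
      show "continuous_on UNIV (\<lambda>X. (X, Y))" by (intro continuous_on_Pair continuous_on_id continuous_on_const)
      show "\<bar>g2 l (X, Y)\<bar> \<le> B" if "X \<in> {X1..X2}" for X using that \<open>l \<in> {1..n}\<close> by (intro B imageI)
    qed
    fix X assume X: "X \<in> {X1<..<X2} - N"
    then have X': "X \<in> {X1..X2}" "X \<notin> N" by auto
    note \<Omega>X = \<Omega>[OF X'(1)]
    have "1 \<in> {1..n}" using n by auto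
    note pos = good_derivatives(1,2)[OF \<Omega>X X'(2) YM n this]
    show "\<exists>D. ((\<lambda>X. V0 (X, Y)) has_real_derivative D) (at X) \<and> L * pr (X, Y) \<le> D" by (rule D_V0(2)[OF \<Omega>X X'(2)])
    show "0 \<le> L * pr (X, Y)" using L_nonneg pos by simp
    fix l assume l: "l \<in> {1..n}"
    show "\<exists>D. ((\<lambda>X. Jp l (X, Y)) has_real_derivative D) (at X) \<and> \<bar>D\<bar> \<le> rate (X, Y)"
      using good_derivatives(4)[OF \<Omega>X X'(2) YM n l] by (simp only: rate_def E1_def E2_def)
    show "g2 l (X, Y) = exp (- V0 (X, Y)) * (rate (X, Y) - L * pr (X, Y) * \<bar>Jp l (X, Y)\<bar>)"
      using O2[OF X'] by (simp add: g2_def)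
  qed
  then show ?thesis using O2[of X1] O2[of X2] X by (simp add: e2_def)
qed

text \<open>Summing \<open>n\<close> equal rates in both families gives \<open>2 * n * rate\<close>,
  which by the choice of \<open>L\<close> is exactly the sum of the two gains
  \<open>L * qr * E1\<close> and \<open>L * pr * E2\<close>.\<close>

lemma flux_balance: "(\<Sum>l = 1..n. g1 l z) + (\<Sum>l = 1..n. g2 l z) = 0"
proof -
  have "(\<Sum>l = 1..n. g1 l z) = indicator O2 z * (exp (- V0 z) * (real n * rate z - L * qr z * E1 z))"
    by (simp add: g1_def E1_def sum_distrib_left[symmetric] sum_subtractf)
  moreover have "(\<Sum>l = 1..n. g2 l z) = indicator O2 z * (exp (- V0 z) * (real n * rate z - L * pr z * E2 z))"
    by (simp add: g2_def E2_def sum_distrib_left[symmetric] sum_subtractf)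
  moreover have "2 * real n * rate z = L * qr z * E1 z + L * pr z * E2 z"
    by (simp add: rate_def L algebra_simps)
  then have "(real n * rate z - L * qr z * E1 z) + (real n * rate z - L * pr z * E2 z) = 0" by simp
  ultimately show ?thesis by (simp flip: distrib_left)
qed

definition "flux t = (\<Sum>l = 1..n. (\<integral>\<^sup>+X. ennreal (if X \<in> R.IX then e1 l (X, R.yv t X) else 0) \<partial>lborel)
    + (\<integral>\<^sup>+Y. ennreal (if Y \<in> R.IY then e2 l (R.xv t Y, Y) else 0) \<partial>lborel))"

lemma e_nonneg: "0 \<le> e1 l z" "0 \<le> e2 l z" by (simp_all add: e1_def e2_def)

lemma measurable_e_graph:
  assumes t: "t \<in> {0..T}"
  shows "(\<lambda>X. if X \<in> R.IX then e1 l (X, R.yv t X) else 0) \<in> borel_measurable borel"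
    and "(\<lambda>Y. if Y \<in> R.IY then e2 l (R.xv t Y, Y) else 0) \<in> borel_measurable borel"
proof -
  show "(\<lambda>X. if X \<in> R.IX then e1 l (X, R.yv t X) else 0) \<in> borel_measurable borel"
    by (rule R.measurable_graph[OF t measurable_e_g(1)])
  have "prod.swap \<in> borel_measurable (borel :: (real \<times> real) measure)"
    by (intro borel_measurable_continuous_onI continuous_on_swap)
  from label_strip.measurable_graph[OF R.swap t measurable_compose[OF this measurable_e_g(2)]]
  show "(\<lambda>Y. if Y \<in> R.IY then e2 l (R.xv t Y, Y) else 0) \<in> borel_measurable borel"
    unfolding R.swap_simps swap_simp .
qed

lemma flux_eq:
  assumes t: "t \<in> {0..T}"
  shows "flux t = (\<integral>\<^sup>+X. ennreal (if X \<in> R.IX then \<Sum>l = 1..n. e1 l (X, R.yv t X) else 0) \<partial>lborel)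
    + (\<integral>\<^sup>+Y. ennreal (if Y \<in> R.IY then \<Sum>l = 1..n. e2 l (R.xv t Y, Y) else 0) \<partial>lborel)"
proof -
  have "(\<Sum>l = 1..n. \<integral>\<^sup>+X. ennreal (if X \<in> R.IX then e1 l (X, R.yv t X) else 0) \<partial>lborel)
      = (\<integral>\<^sup>+X. ennreal (if X \<in> R.IX then \<Sum>l = 1..n. e1 l (X, R.yv t X) else 0) \<partial>lborel)"
    by (subst nn_integral_sum[symmetric])
       (use measurable_e_graph(1)[OF t] in \<open>auto intro!: nn_integral_cong simp: sum_ennreal e_nonneg\<close>)
  moreover have "(\<Sum>l = 1..n. \<integral>\<^sup>+Y. ennreal (if Y \<in> R.IY then e2 l (R.xv t Y, Y) else 0) \<partial>lborel)
      = (\<integral>\<^sup>+Y. ennreal (if Y \<in> R.IY then \<Sum>l = 1..n. e2 l (R.xv t Y, Y) else 0) \<partial>lborel)"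
    by (subst nn_integral_sum[symmetric])
       (use measurable_e_graph(2)[OF t] in \<open>auto intro!: nn_integral_cong simp: sum_ennreal e_nonneg\<close>)
  ultimately show ?thesis by (simp add: flux_def sum.distrib)
qed

lemma flux_le:
  assumes t: "t \<in> {0..T}"
  shows "flux t \<le> flux 0"
proof -
  have 0: "(0::real) \<in> {0..T}" using T_pos by simp
  show ?thesis unfolding flux_eq[OF t] flux_eq[OF 0]
  proof (rule R.monotone_flux[OF t, where N = "N \<union> M" and ?g1.0 = "\<lambda>z. \<Sum>l = 1..n. g1 l z" and ?g2.0 = "\<lambda>z. \<Sum>l = 1..n. g2 l z"
      and ?e1.0 = "\<lambda>z. \<Sum>l = 1..n. e1 l z" and ?e2.0 = "\<lambda>z. \<Sum>l = 1..n. e2 l z"])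
    show "finite (N \<union> M)" using fin by simp
    show "(\<lambda>z. \<Sum>l = 1..n. e1 l z) \<in> borel_measurable borel" "(\<lambda>z. \<Sum>l = 1..n. e2 l z) \<in> borel_measurable borel"
      "(\<lambda>z. \<Sum>l = 1..n. g1 l z) \<in> borel_measurable borel" "(\<lambda>z. \<Sum>l = 1..n. g2 l z) \<in> borel_measurable borel"
      by (intro borel_measurable_sum measurable_e_g)+
    show "0 \<le> (\<Sum>l = 1..n. e1 l z)" "0 \<le> (\<Sum>l = 1..n. e2 l z)" for z by (simp_all add: sum_nonneg e_nonneg)
    show "(\<Sum>l = 1..n. g1 l z) + (\<Sum>l = 1..n. g2 l z) \<le> 0" for z by (rule eq_refl[OF flux_balance])
  next
    fix xa xb
    have "R.region t xa xb \<subseteq> \<Omega>r" using strip_image_\<Omega>r[of t] t by (auto simp: R.region_def)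
    from e_g_bounded[OF R.compact_region[OF t] this]
    obtain B where B: "0 \<le> B" "\<And>z l. z \<in> R.region t xa xb \<Longrightarrow> l \<in> {1..n} \<Longrightarrow> \<bar>e1 l z\<bar> \<le> B \<and> \<bar>e2 l z\<bar> \<le> B \<and> \<bar>g1 l z\<bar> \<le> B \<and> \<bar>g2 l z\<bar> \<le> B"
      by blast
    have s: "\<bar>\<Sum>l = 1..n. f l\<bar> \<le> real n * B" if "\<And>l. l \<in> {1..n} \<Longrightarrow> \<bar>f l\<bar> \<le> B" for f :: "nat \<Rightarrow> real"
    proof -
      have "\<bar>\<Sum>l = 1..n. f l\<bar> \<le> (\<Sum>l = 1..n. \<bar>f l\<bar>)" by (rule sum_abs)
      also have "\<dots> \<le> (\<Sum>l = 1..n. B)" using that by (rule sum_mono)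
      finally show ?thesis by simp
    qed
    show "\<exists>B. \<forall>z\<in>R.region t xa xb. \<bar>\<Sum>l = 1..n. e1 l z\<bar> \<le> B \<and> \<bar>\<Sum>l = 1..n. e2 l z\<bar> \<le> B \<and> \<bar>\<Sum>l = 1..n. g1 l z\<bar> \<le> B \<and> \<bar>\<Sum>l = 1..n. g2 l z\<bar> \<le> B"
      using B(2) by (intro exI[of _ "real n * B"] ballI conjI s) blast+
  next
    fix X Y1 Y2 assume "X \<in> R.IX - (N \<union> M)" "Y1 \<le> Y2" "Y1 \<notin> N \<union> M" "Y2 \<notin> N \<union> M" "R.yv 0 X \<le> Y1" "Y2 \<le> R.yv t X"
    then show "(\<Sum>l = 1..n. e1 l (X, Y2)) - (\<Sum>l = 1..n. e1 l (X, Y1)) \<le> (LINT Y:{Y1..Y2}|lborel. \<Sum>l = 1..n. g1 l (X, Y))"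
      using R_slice(1)[OF t, of X] by (intro increment_X) auto
  next
    fix Y X1 X2 assume "Y \<in> R.IY - (N \<union> M)" "X1 \<le> X2" "X1 \<notin> N \<union> M" "X2 \<notin> N \<union> M" "R.xv 0 Y \<le> X1" "X2 \<le> R.xv t Y"
    then show "(\<Sum>l = 1..n. e2 l (X2, Y)) - (\<Sum>l = 1..n. e2 l (X1, Y)) \<le> (LINT X:{X1..X2}|lborel. \<Sum>l = 1..n. g2 l (X, Y))"
      using R_slice(2)[OF t, of Y] by (intro increment_Y) auto
  qed
qed

text \<open>A level curve is a strictly monotone graph, so it meets each of the finitely many
  excluded labels at most once.\<close>

lemma AE_in_O2:
  assumes t: "t \<in> {0..T}"
  shows "AE X in lborel. X \<in> R.IX \<longrightarrow> (X, R.yv t X) \<in> O2 \<and> (X, R.yv t X) \<in> \<Omega>r \<and> (X, R.yv t X) \<in> level_curve \<Omega>r (Zr \<theta>) t"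
    and "AE Y in lborel. Y \<in> R.IY \<longrightarrow> (R.xv t Y, Y) \<in> O2 \<and> (R.xv t Y, Y) \<in> \<Omega>r \<and> (R.xv t Y, Y) \<in> level_curve \<Omega>r (Zr \<theta>) t"
proof -
  have fNM: "finite (N \<union> M)" using fin by simp
  have lc: "(X, R.yv t X) \<in> level_curve \<Omega>r (Zr \<theta>) t" if "X \<in> R.IX" for X
    unfolding level_curve_eq[OF t] using R.graph_point[OF t that] by force
  have lc': "(R.xv t Y, Y) \<in> level_curve \<Omega>r (Zr \<theta>) t" if "Y \<in> R.IY" for Y
    unfolding level_curve_eq[OF t] using R.graph_point'[OF t that] by force
  have \<Omega>: "z \<in> \<Omega>r" if "z \<in> level_curve \<Omega>r (Zr \<theta>) t" for z using that by (simp add: level_curve_def)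
  have O2: "(X, Y) \<in> O2" if "(X, Y) \<in> \<Omega>r" "X \<notin> N" "Y \<notin> M" for X Y
    using that \<Omega>r_RIX[OF that(1)] \<Omega>r_Ur by (auto simp: O2_def good_def)
  show "AE X in lborel. X \<in> R.IX \<longrightarrow> (X, R.yv t X) \<in> O2 \<and> (X, R.yv t X) \<in> \<Omega>r \<and> (X, R.yv t X) \<in> level_curve \<Omega>r (Zr \<theta>) t"
    using R.AE_yv_avoids[OF t fNM]
  proof eventually_elim
    case (elim X)
    show ?case
    proof
      assume X: "X \<in> R.IX"
      note m = lc[OF X] \<Omega>[OF lc[OF X]]
      have "X \<notin> N" "R.yv t X \<notin> M" using elim X by auto
      then show "(X, R.yv t X) \<in> O2 \<and> (X, R.yv t X) \<in> \<Omega>r \<and> (X, R.yv t X) \<in> level_curve \<Omega>r (Zr \<theta>) t"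
        using m O2[OF m(2)] by simp
    qed
  qed
  show "AE Y in lborel. Y \<in> R.IY \<longrightarrow> (R.xv t Y, Y) \<in> O2 \<and> (R.xv t Y, Y) \<in> \<Omega>r \<and> (R.xv t Y, Y) \<in> level_curve \<Omega>r (Zr \<theta>) t"
    using label_strip.AE_yv_avoids[OF R.swap t fNM, unfolded R.swap_simps]
  proof eventually_elim
    case (elim Y)
    show ?case
    proof
      assume Y: "Y \<in> R.IY"
      note m = lc'[OF Y] \<Omega>[OF lc'[OF Y]]
      have "Y \<notin> M" "R.xv t Y \<notin> N" using elim Y by auto
      then show "(R.xv t Y, Y) \<in> O2 \<and> (R.xv t Y, Y) \<in> \<Omega>r \<and> (R.xv t Y, Y) \<in> level_curve \<Omega>r (Zr \<theta>) t"
        using m O2[OF m(2)] by simp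
    qed
  qed
qed

lemma abs_Jp: "\<bar>Jp l z\<bar> = \<bar>J_plus \<gamma> l Zr \<theta> z\<bar>"
  by (simp add: Jp_def)

lemma tangent_norm_eq:
  assumes t: "t \<in> {0..T}" and \<Omega>s: "\<Omega>s \<theta> = \<Omega>r" and \<iota>: "n = num_terms \<iota>"
  shows "tangent_norm \<gamma> e \<iota> \<Omega>s Zr t \<theta> =
    (\<Sum>l = 1..n. (\<integral>\<^sup>+X. (if X \<in> R.IX then ennreal (\<bar>Jm l (X, R.yv t X)\<bar> * W_minus e \<Omega>r (Zr \<theta>) (ch_x (Zr \<theta>) (X, R.yv t X)) (ch_t (Zr \<theta>) (X, R.yv t X))) else 0) \<partial>lborel)
      + (\<integral>\<^sup>+Y. (if Y \<in> R.IY then ennreal (\<bar>Jp l (R.xv t Y, Y)\<bar> * W_plus e \<Omega>r (Zr \<theta>) (ch_x (Zr \<theta>) (R.xv t Y, Y)) (ch_t (Zr \<theta>) (R.xv t Y, Y))) else 0) \<partial>lborel))"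
  unfolding tangent_norm_def \<Omega>s \<iota>[symmetric] R.int_dX_graph[OF t level_curve_eq[OF t]] R.int_dY_graph[OF t level_curve_eq[OF t]] abs_Jp Jm_def ..

text \<open>The weights of the tangent norm lie in \<open>[\<eta>, 2\<eta>]\<close>, so they may be replaced by the weight \<open>exp(-V)\<close>
  for which the flux is monotone.\<close>

lemma tangent_norm_growth:
  assumes t: "t \<in> {0..T}" and \<Omega>s: "\<Omega>s \<theta> = \<Omega>r" and \<iota>: "n = num_terms \<iota>" and e: "0 < e"
    and W: "\<And>x. W_minus e \<Omega>r (Zr \<theta>) x t \<le> 2 * e" "\<And>x. W_plus e \<Omega>r (Zr \<theta>) x t \<le> 2 * e"
    and W0: "\<And>x. e \<le> W_minus e \<Omega>r (Zr \<theta>) x 0" "\<And>x. e \<le> W_plus e \<Omega>r (Zr \<theta>) x 0"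
  shows "tangent_norm \<gamma> e \<iota> \<Omega>s Zr t \<theta> \<le> ennreal (2 * exp (4 * L * \<eta> + 2 * m * L * t)) * tangent_norm \<gamma> e \<iota> \<Omega>s Zr 0 \<theta>"
proof -
  have 0: "(0::real) \<in> {0..T}" using T_pos by simp
  \<comment> \<open>The factor \<open>c\<close> combines the upper bounds of the metric weight and
    of \<open>exp V0\<close> at time \<open>t\<close>; \<open>d\<close> combines the lower bound of
    the metric weight and the upper bound of \<open>exp (- V0)\<close> at time 0. Their product no
    longer contains \<open>e\<close>.\<close>
  define c where "c = 2 * e * exp (2 * L * \<eta> + 2 * m * L * t)"
  define d where "d = exp (2 * L * \<eta>) / e"
  have cd: "0 < c" "0 < d" using e by (auto simp: c_def d_def)
  have up: "\<bar>j\<bar> * w \<le> c * (\<bar>j\<bar> * exp (- V0 z))" if z: "z \<in> level_curve \<Omega>r (Zr \<theta>) t" and w: "w \<le> 2 * e" for j w z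
  proof -
    have "z \<in> \<Omega>r" "ch_t (Zr \<theta>) z = t" using z by (auto simp: level_curve_def)
    then have "0 \<le> 2 * L * \<eta> + 2 * m * L * t - V0 z" using V0_bounds(2)[of z] by simp
    then have "1 \<le> exp (2 * L * \<eta> + 2 * m * L * t - V0 z)" by simp
    then have "2 * e \<le> 2 * e * exp (2 * L * \<eta> + 2 * m * L * t - V0 z)" using e by simp
    also have "\<dots> = c * exp (- V0 z)" by (simp add: c_def exp_diff exp_minus divide_inverse)
    finally have "w \<le> c * exp (- V0 z)" using w by linarith
    then have "\<bar>j\<bar> * w \<le> \<bar>j\<bar> * (c * exp (- V0 z))" by (intro mult_left_mono) auto
    then show ?thesis by (simp add: mult_ac)
  qed
  have down: "\<bar>j\<bar> * exp (- V0 z) \<le> d * (\<bar>j\<bar> * w)" if z: "z \<in> \<Omega>r" and w: "e \<le> w" for j w z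
  proof -
    have "exp (- V0 z) \<le> exp (2 * L * \<eta>)" using V0_bounds(1)[OF z] by simp
    also have "\<dots> \<le> d * w" using w e by (simp add: d_def field_simps)
    finally have "\<bar>j\<bar> * exp (- V0 z) \<le> \<bar>j\<bar> * (d * w)" by (intro mult_left_mono) auto
    then show ?thesis by (simp add: mult_ac)
  qed
  have tz: "ch_t (Zr \<theta>) z = t'" if "z \<in> level_curve \<Omega>r (Zr \<theta>) t'" for z t' using that by (simp add: level_curve_def)
  have "tangent_norm \<gamma> e \<iota> \<Omega>s Zr t \<theta> \<le> ennreal c * flux t"
    unfolding tangent_norm_eq[where \<Omega>s = \<Omega>s, OF t \<Omega>s \<iota>] flux_def sum_distrib_left distrib_left
  proof (intro sum_mono add_mono)
    fix l
    show "(\<integral>\<^sup>+X. (if X \<in> R.IX then ennreal (\<bar>Jm l (X, R.yv t X)\<bar> * W_minus e \<Omega>r (Zr \<theta>) (ch_x (Zr \<theta>) (X, R.yv t X)) (ch_t (Zr \<theta>) (X, R.yv t X))) else 0) \<partial>lborel)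
      \<le> ennreal c * (\<integral>\<^sup>+X. ennreal (if X \<in> R.IX then e1 l (X, R.yv t X) else 0) \<partial>lborel)"
    proof (subst nn_integral_cmult[symmetric])
      show "(\<integral>\<^sup>+X. (if X \<in> R.IX then ennreal (\<bar>Jm l (X, R.yv t X)\<bar> * W_minus e \<Omega>r (Zr \<theta>) (ch_x (Zr \<theta>) (X, R.yv t X)) (ch_t (Zr \<theta>) (X, R.yv t X))) else 0) \<partial>lborel)
        \<le> (\<integral>\<^sup>+X. ennreal c * ennreal (if X \<in> R.IX then e1 l (X, R.yv t X) else 0) \<partial>lborel)"
        using AE_in_O2(1)[OF t]
      proof (intro nn_integral_mono_AE, eventually_elim)
        case (elim X)
        show ?case
        proof (cases "X \<in> R.IX")
          case True
          then have z: "(X, R.yv t X) \<in> O2" "(X, R.yv t X) \<in> level_curve \<Omega>r (Zr \<theta>) t" using elim by simp_all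
          have "\<bar>Jm l (X, R.yv t X)\<bar> * W_minus e \<Omega>r (Zr \<theta>) (ch_x (Zr \<theta>) (X, R.yv t X)) (ch_t (Zr \<theta>) (X, R.yv t X)) \<le> c * e1 l (X, R.yv t X)"
            using up[OF z(2) W(1)] z(1) unfolding tz[OF z(2)] by (simp add: e1_def)
          then show ?thesis using True cd by (simp add: ennreal_leI ennreal_mult'[symmetric])
        qed simp
      qed
    qed (use measurable_e_graph(1)[OF t] in simp)
    show "(\<integral>\<^sup>+Y. (if Y \<in> R.IY then ennreal (\<bar>Jp l (R.xv t Y, Y)\<bar> * W_plus e \<Omega>r (Zr \<theta>) (ch_x (Zr \<theta>) (R.xv t Y, Y)) (ch_t (Zr \<theta>) (R.xv t Y, Y))) else 0) \<partial>lborel)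
      \<le> ennreal c * (\<integral>\<^sup>+Y. ennreal (if Y \<in> R.IY then e2 l (R.xv t Y, Y) else 0) \<partial>lborel)"
    proof (subst nn_integral_cmult[symmetric])
      show "(\<integral>\<^sup>+Y. (if Y \<in> R.IY then ennreal (\<bar>Jp l (R.xv t Y, Y)\<bar> * W_plus e \<Omega>r (Zr \<theta>) (ch_x (Zr \<theta>) (R.xv t Y, Y)) (ch_t (Zr \<theta>) (R.xv t Y, Y))) else 0) \<partial>lborel)
        \<le> (\<integral>\<^sup>+Y. ennreal c * ennreal (if Y \<in> R.IY then e2 l (R.xv t Y, Y) else 0) \<partial>lborel)"
        using AE_in_O2(2)[OF t]
      proof (intro nn_integral_mono_AE, eventually_elim)
        case (elim Y)
        show ?case
        proof (cases "Y \<in> R.IY")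
          case True
          then have z: "(R.xv t Y, Y) \<in> O2" "(R.xv t Y, Y) \<in> level_curve \<Omega>r (Zr \<theta>) t" using elim by simp_all
          have "\<bar>Jp l (R.xv t Y, Y)\<bar> * W_plus e \<Omega>r (Zr \<theta>) (ch_x (Zr \<theta>) (R.xv t Y, Y)) (ch_t (Zr \<theta>) (R.xv t Y, Y)) \<le> c * e2 l (R.xv t Y, Y)"
            using up[OF z(2) W(2)] z(1) unfolding tz[OF z(2)] by (simp add: e2_def)
          then show ?thesis using True cd by (simp add: ennreal_leI ennreal_mult'[symmetric])
        qed simp
      qed
    qed (use measurable_e_graph(2)[OF t] in simp)
  qed
  also have "\<dots> \<le> ennreal c * flux 0" by (intro mult_left_mono flux_le[OF t]) simp
  also have "flux 0 \<le> ennreal d * tangent_norm \<gamma> e \<iota> \<Omega>s Zr 0 \<theta>"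
    unfolding tangent_norm_eq[where \<Omega>s = \<Omega>s, OF 0 \<Omega>s \<iota>] flux_def sum_distrib_left distrib_left
  proof (intro sum_mono add_mono)
    fix l
    show "(\<integral>\<^sup>+X. ennreal (if X \<in> R.IX then e1 l (X, R.yv 0 X) else 0) \<partial>lborel) \<le>
      ennreal d * (\<integral>\<^sup>+X. (if X \<in> R.IX then ennreal (\<bar>Jm l (X, R.yv 0 X)\<bar> * W_minus e \<Omega>r (Zr \<theta>) (ch_x (Zr \<theta>) (X, R.yv 0 X)) (ch_t (Zr \<theta>) (X, R.yv 0 X))) else 0) \<partial>lborel)"
    proof (rule order_trans[OF nn_integral_mono_AE nn_integral_cmult_le[OF cd(2)]])
      show "AE X in lborel. ennreal (if X \<in> R.IX then e1 l (X, R.yv 0 X) else 0) \<le>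
        ennreal d * (if X \<in> R.IX then ennreal (\<bar>Jm l (X, R.yv 0 X)\<bar> * W_minus e \<Omega>r (Zr \<theta>) (ch_x (Zr \<theta>) (X, R.yv 0 X)) (ch_t (Zr \<theta>) (X, R.yv 0 X))) else 0)"
        using AE_in_O2(1)[OF 0]
      proof eventually_elim
        case (elim X)
        show ?case
        proof (cases "X \<in> R.IX")
          case True
          then have z: "(X, R.yv 0 X) \<in> O2" "(X, R.yv 0 X) \<in> \<Omega>r" "(X, R.yv 0 X) \<in> level_curve \<Omega>r (Zr \<theta>) 0" using elim by simp_all
          have "e1 l (X, R.yv 0 X) \<le> d * (\<bar>Jm l (X, R.yv 0 X)\<bar> * W_minus e \<Omega>r (Zr \<theta>) (ch_x (Zr \<theta>) (X, R.yv 0 X)) (ch_t (Zr \<theta>) (X, R.yv 0 X)))"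
            using down[OF z(2) W0(1)] z(1) unfolding tz[OF z(3)] by (simp add: e1_def)
          then show ?thesis using True cd by (simp add: ennreal_leI ennreal_mult'[symmetric])
        qed simp
      qed
    qed
    show "(\<integral>\<^sup>+Y. ennreal (if Y \<in> R.IY then e2 l (R.xv 0 Y, Y) else 0) \<partial>lborel) \<le>
      ennreal d * (\<integral>\<^sup>+Y. (if Y \<in> R.IY then ennreal (\<bar>Jp l (R.xv 0 Y, Y)\<bar> * W_plus e \<Omega>r (Zr \<theta>) (ch_x (Zr \<theta>) (R.xv 0 Y, Y)) (ch_t (Zr \<theta>) (R.xv 0 Y, Y))) else 0) \<partial>lborel)"
    proof (rule order_trans[OF nn_integral_mono_AE nn_integral_cmult_le[OF cd(2)]])
      show "AE Y in lborel. ennreal (if Y \<in> R.IY then e2 l (R.xv 0 Y, Y) else 0) \<le>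
        ennreal d * (if Y \<in> R.IY then ennreal (\<bar>Jp l (R.xv 0 Y, Y)\<bar> * W_plus e \<Omega>r (Zr \<theta>) (ch_x (Zr \<theta>) (R.xv 0 Y, Y)) (ch_t (Zr \<theta>) (R.xv 0 Y, Y))) else 0)"
        using AE_in_O2(2)[OF 0]
      proof eventually_elim
        case (elim Y)
        show ?case
        proof (cases "Y \<in> R.IY")
          case True
          then have z: "(R.xv 0 Y, Y) \<in> O2" "(R.xv 0 Y, Y) \<in> \<Omega>r" "(R.xv 0 Y, Y) \<in> level_curve \<Omega>r (Zr \<theta>) 0" using elim by simp_all
          have "e2 l (R.xv 0 Y, Y) \<le> d * (\<bar>Jp l (R.xv 0 Y, Y)\<bar> * W_plus e \<Omega>r (Zr \<theta>) (ch_x (Zr \<theta>) (R.xv 0 Y, Y)) (ch_t (Zr \<theta>) (R.xv 0 Y, Y)))"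
            using down[OF z(2) W0(2)] z(1) unfolding tz[OF z(3)] by (simp add: e2_def)
          then show ?thesis using True cd by (simp add: ennreal_leI ennreal_mult'[symmetric])
        qed simp
      qed
    qed
  qed
  finally have "tangent_norm \<gamma> e \<iota> \<Omega>s Zr t \<theta> \<le> ennreal c * (ennreal d * tangent_norm \<gamma> e \<iota> \<Omega>s Zr 0 \<theta>)"
    by (simp add: mult_left_mono)
  moreover have "ennreal c * ennreal d = ennreal (2 * exp (4 * L * \<eta> + 2 * m * L * t))"
  proof -
    have "c * d = 2 * exp (4 * L * \<eta> + 2 * m * L * t)" using e by (simp add: c_def d_def exp_add[symmetric])
    then show ?thesis using cd by (simp flip: ennreal_mult')
  qed
  ultimately show ?thesis by (simp add: mult.assoc[symmetric])
qed

end

section \<open>Bounds on the specific volume\<close>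

lemma Ck_on_strip_derivatives:
  fixes f :: "real \<times> real \<Rightarrow> real"
  assumes "Ck_on (Suc k) f (UNIV \<times> {0..<T})"
  shows "\<exists>fx ft. continuous_on (UNIV \<times> {0..<T}) fx \<and> continuous_on (UNIV \<times> {0..<T}) ft \<and>
    (\<forall>x. \<forall>t\<in>{0..<T}. ((\<lambda>y. f (y, t)) has_real_derivative fx (x, t)) (at x) \<and>
      ((\<lambda>t'. f (x, t')) has_real_derivative ft (x, t)) (at t within {0..<T}))"
proof -
  obtain g where g: "\<And>z. z \<in> UNIV \<times> {0..<T} \<Longrightarrow> (f has_derivative (\<lambda>h. g z \<bullet> h)) (at z within UNIV \<times> {0..<T})"
    and c: "\<And>b. b \<in> Basis \<Longrightarrow> Ck_on k (\<lambda>z. g z \<bullet> b) (UNIV \<times> {0..<T})"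
    using assms unfolding Ck_on.simps by blast
  have c1: "continuous_on (UNIV \<times> {0..<T}) (\<lambda>z. g z \<bullet> (1, 0))" by (rule Ck_on_continuous[OF c]) (simp add: Basis_prod_def)
  have c2: "continuous_on (UNIV \<times> {0..<T}) (\<lambda>z. g z \<bullet> (0, 1))" by (rule Ck_on_continuous[OF c]) (simp add: Basis_prod_def)
  have "((\<lambda>y. f (y, t)) has_real_derivative g (x, t) \<bullet> (1, 0)) (at x)" if "t \<in> {0..<T}" for x t
  proof -
    have "((\<lambda>y. (y, t)) has_derivative (\<lambda>h. (h, 0))) (at x)" by (auto intro!: derivative_eq_intros)
    from has_derivative_in_compose2[where t = "UNIV \<times> {0..<T}" and s = UNIV, OF g _ UNIV_I this]
    have "((\<lambda>y. f (y, t)) has_derivative (\<lambda>h. g (x, t) \<bullet> (h, 0))) (at x)" using that by (simp add: image_subset_iff)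
    then show ?thesis by (simp add: has_field_derivative_def inner_prod_def)
  qed
  moreover have "((\<lambda>t'. f (x, t')) has_real_derivative g (x, t) \<bullet> (0, 1)) (at t within {0..<T})" if "t \<in> {0..<T}" for x t
  proof -
    have "((\<lambda>t'. (x, t')) has_derivative (\<lambda>h. (0, h))) (at t within {0..<T})" by (auto intro!: derivative_eq_intros)
    from has_derivative_in_compose2[where t = "UNIV \<times> {0..<T}" and s = "{0..<T}", OF g _ that this]
    have "((\<lambda>t'. f (x, t')) has_derivative (\<lambda>h. g (x, t) \<bullet> (0, h))) (at t within {0..<T})" by auto
    then show ?thesis by (simp add: has_field_derivative_def inner_prod_def)
  qed
  ultimately show ?thesis using c1 c2 by blast
qed

lemma increment_le_nn_integral:
  fixes f f' :: "real \<Rightarrow> real"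
  assumes "a \<le> b" "\<And>x. x \<in> {a..b} \<Longrightarrow> (f has_real_derivative f' x) (at x within {a..b})" "continuous_on {a..b} f'"
  shows "ennreal \<bar>f b - f a\<bar> \<le> (\<integral>\<^sup>+x. ennreal (indicator {a..b} x * \<bar>f' x\<bar>) \<partial>lborel)"
proof -
  have "(\<integral>x. indicator {a..b} x *\<^sub>R f' x \<partial>lborel) = f b - f a"
    by (rule integral_FTC_Icc[OF assms(1)]) (use assms(2,3) in \<open>auto simp: has_real_derivative_iff_has_vector_derivative\<close>)
  moreover have "integrable lborel (\<lambda>x. indicator {a..b} x *\<^sub>R f' x)"
    using borel_integrable_atLeastAtMost'[OF assms(3)] by (simp add: set_integrable_def)
  ultimately show ?thesis using integral_norm_bound_ennreal[of lborel "\<lambda>x. indicator {a..b} x *\<^sub>R f' x"]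
    by (simp add: abs_mult)
qed

lemma integrable_takes_small_values:
  fixes f :: "real \<Rightarrow> real"
  assumes "(\<integral>\<^sup>+x. ennreal \<bar>f x\<bar> \<partial>lborel) < \<infinity>" "0 < e"
  shows "\<exists>x. \<bar>f x\<bar> < e"
proof (rule ccontr)
  assume "\<nexists>x. \<bar>f x\<bar> < e"
  then have "(\<integral>\<^sup>+x. ennreal e \<partial>(lborel :: real measure)) \<le> (\<integral>\<^sup>+x. ennreal \<bar>f x\<bar> \<partial>lborel)"
    by (intro nn_integral_mono ennreal_leI) (simp add: not_less)
  moreover have "(\<integral>\<^sup>+x. ennreal e \<partial>(lborel :: real measure)) = \<infinity>"
    using assms(2) by (simp add: ennreal_mult_top)
  ultimately show False using assms(1) by simp
qed

text \<open>An integrable deviation is arbitrarily small somewhere on the line, so the value at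
  infinity inherits the pointwise bounds of the data. The final constant can therefore be
  independent of it.\<close>

lemma mean_value_initial:
  assumes "v \<in> D_eta \<gamma> \<tau>bar cbar \<eta>"
  shows "1 / cbar \<le> \<tau>bar" "\<tau>bar \<le> cbar"
proof -
  have "integrable lborel (\<lambda>x. fst v x - \<tau>bar)" and b: "\<And>x. 1 / cbar \<le> fst v x \<and> fst v x \<le> cbar"
    using assms by (auto simp: D_eta_def perturbation_def Ck_W11_def)
  then have fin: "(\<integral>\<^sup>+x. ennreal \<bar>fst v x - \<tau>bar\<bar> \<partial>lborel) < \<infinity>"
    by (simp add: integrable_iff_bounded)
  have "1 / cbar \<le> \<tau>bar + e \<and> \<tau>bar \<le> cbar + e" if e: "0 < e" for e
  proof -
    obtain x where x: "\<bar>fst v x - \<tau>bar\<bar> < e" using integrable_takes_small_values[OF fin e] ..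
    from x b[of x] show ?thesis by linarith
  qed
  then show "1 / cbar \<le> \<tau>bar" "\<tau>bar \<le> cbar" by (auto intro: field_le_epsilon)
qed

text \<open>For this primitive \<open>H\<close> of the wave speed, \<open>R - S = 2 (H(\<tau>))\<^sub>x\<close>.\<close>

definition speed_primitive :: "real \<Rightarrow> real \<Rightarrow> real" where
  "speed_primitive \<gamma> \<tau> = - 2 / (\<gamma> - 1) * \<tau> powr (- (\<gamma> - 1) / 2)"

lemma DERIV_speed_primitive:
  assumes "1 < \<gamma>" "0 < \<tau>"
  shows "(speed_primitive \<gamma> has_real_derivative wave_speed \<gamma> \<tau>) (at \<tau>)"
proof -
  have e: "- (\<gamma> - 1) / 2 - 1 = - (\<gamma> + 1) / 2" by (simp add: field_simps)
  have "(speed_primitive \<gamma> has_real_derivative - 2 / (\<gamma> - 1) * (- (\<gamma> - 1) / 2 * \<tau> powr (- (\<gamma> - 1) / 2 - 1))) (at \<tau>)"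
    unfolding speed_primitive_def[abs_def] by (intro DERIV_cmult has_real_derivative_powr assms)
  moreover have "- 2 / (\<gamma> - 1) * (- (\<gamma> - 1) / 2 * y) = y" for y using assms(1) by (simp add: divide_simps) (simp add: algebra_simps)
  ultimately show ?thesis unfolding e wave_speed_def by simp
qed

lemma speed_primitive_less:
  assumes "1 < \<gamma>" "0 < a" "a < b"
  shows "speed_primitive \<gamma> a < speed_primitive \<gamma> b"
proof (rule DERIV_pos_imp_increasing[OF assms(3)])
  fix x assume "a \<le> x" "x \<le> b"
  then have "0 < x" using assms(2) by simp
  then show "\<exists>y. DERIV (speed_primitive \<gamma>) x :> y \<and> 0 < y"
    using DERIV_speed_primitive[OF assms(1)] wave_speed_pos by blast
qed

text \<open>The oscillation of the primitive in \<open>x\<close> is at most \<eta> because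
  \<open>c \<tau>_x = (R - S) / 2\<close>. The deviation of \<tau> from its value at infinity stays
  integrable because \<open>\<tau>_t = u_x = (R + S) / 2\<close> is integrable in space and time.
  Hence \<tau> comes arbitrarily close to that value at some position, from which the oscillation
  bound reaches every other.\<close>

lemma vol_near_mean:
  assumes \<gamma>: "1 < \<gamma>" and \<tau>: "0 < \<tau>bar" and T: "0 < T" and s: "euler_solution \<gamma> \<tau>bar 3 T s" and \<eta>: "0 \<le> \<eta>"
    and tv: "\<And>r. r \<in> {0..<T} \<Longrightarrow> (\<integral>\<^sup>+x. ennreal (\<bar>R_var \<gamma> s x r\<bar> + \<bar>S_var \<gamma> s x r\<bar>) \<partial>lborel) \<le> ennreal \<eta>"
    and r: "r \<in> {0..<T}"
  shows "\<bar>speed_primitive \<gamma> (vol s (x, r)) - speed_primitive \<gamma> \<tau>bar\<bar> \<le> \<eta>"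
proof -
  let ?S = "UNIV \<times> {0..<T} :: (real \<times> real) set"
  have "Ck_on (Suc 2) (vol s) ?S" "Ck_on (Suc 2) (vel s) ?S"
    using s by (simp_all add: euler_solution_def numeral_3_eq_3 numeral_2_eq_2 del: Ck_on.simps)
  from Ck_on_strip_derivatives[OF this(1)] Ck_on_strip_derivatives[OF this(2)]
  obtain vx vt ux ut where c: "continuous_on ?S vx" "continuous_on ?S vt"
    and D: "\<And>x t. t \<in> {0..<T} \<Longrightarrow> ((\<lambda>y. vol s (y, t)) has_real_derivative vx (x, t)) (at x)"
      "\<And>x t. t \<in> {0..<T} \<Longrightarrow> ((\<lambda>t'. vol s (x, t')) has_real_derivative vt (x, t)) (at t within {0..<T})"
      "\<And>x t. t \<in> {0..<T} \<Longrightarrow> ((\<lambda>y. vel s (y, t)) has_real_derivative ux (x, t)) (at x)"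
    by (elim exE conjE) blast
  have pos: "0 < vol s (x, t)" if "t \<in> {0..<T}" for x t using s that by (simp add: euler_solution_def)
  have RS: "R_var \<gamma> s x t = ux (x, t) + wave_speed \<gamma> (vol s (x, t)) * vx (x, t)"
    "S_var \<gamma> s x t = ux (x, t) - wave_speed \<gamma> (vol s (x, t)) * vx (x, t)" if "t \<in> {0..<T}" for x t
    unfolding R_var_def S_var_def using DERIV_imp_deriv[OF D(1)[OF that]] DERIV_imp_deriv[OF D(3)[OF that]] by simp_all
  have vtux: "vt (x, t) = ux (x, t)" if t: "t \<in> {0<..<T}" for x t
  proof -
    have "((\<lambda>t'. vol s (x, t')) has_real_derivative vt (x, t)) (at t)"
      using D(2)[of t x] t by (simp add: at_within_interior[of t "{0..<T}"])
    moreover have "deriv (\<lambda>t'. vol s (x, t')) t - deriv (\<lambda>y. vel s (y, t)) x = 0" using s t by (simp add: euler_solution_def)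
    ultimately show ?thesis using DERIV_imp_deriv DERIV_imp_deriv[OF D(3)[of t x]] t by force
  qed
  have osc: "\<bar>speed_primitive \<gamma> (vol s (b, r)) - speed_primitive \<gamma> (vol s (a, r))\<bar> \<le> \<eta>" if "a \<le> b" for a b
  proof -
    let ?h = "\<lambda>x. wave_speed \<gamma> (vol s (x, r)) * vx (x, r)"
    have D': "((\<lambda>x. speed_primitive \<gamma> (vol s (x, r))) has_real_derivative ?h x) (at x)" for x
      by (rule DERIV_chain2[OF DERIV_speed_primitive[OF \<gamma> pos[OF r]] D(1)[OF r]])
    have "continuous_on UNIV (\<lambda>x. vx (x, r))"
      by (rule continuous_on_compose2[OF c(1)]) (use r in \<open>auto intro!: continuous_intros\<close>)
    moreover have "continuous_on UNIV (\<lambda>x. vol s (x, r))" by (rule DERIV_continuous_on) (rule D(1)[OF r])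
    ultimately have "continuous_on UNIV ?h"
      using pos[OF r] by (intro continuous_on_mult continuous_on_wave_speed) auto
    then have "ennreal \<bar>speed_primitive \<gamma> (vol s (b, r)) - speed_primitive \<gamma> (vol s (a, r))\<bar>
        \<le> (\<integral>\<^sup>+x. ennreal (indicator {a..b} x * \<bar>?h x\<bar>) \<partial>lborel)"
      using D' that by (intro increment_le_nn_integral) (blast intro: has_field_derivative_at_within continuous_on_subset)+
    also have "\<dots> \<le> (\<integral>\<^sup>+x. ennreal (\<bar>R_var \<gamma> s x r\<bar> + \<bar>S_var \<gamma> s x r\<bar>) \<partial>lborel)"
      unfolding RS[OF r] by (intro nn_integral_mono ennreal_leI) (auto simp: indicator_def)
    finally show ?thesis using order_trans[OF _ tv[OF r]] \<eta> by (metis ennreal_le_iff)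
  qed
  have fin: "(\<integral>\<^sup>+x. ennreal \<bar>vol s (x, r) - \<tau>bar\<bar> \<partial>lborel) < \<infinity>"
  proof -
    have sub: "UNIV \<times> {0..r} \<subseteq> ?S" using r by auto
    have mI: "(\<lambda>z. indicator (UNIV \<times> {0..r}) z *\<^sub>R \<bar>vt z\<bar>) \<in> borel_measurable borel"
      by (intro borel_measurable_continuous_on_indicator continuous_on_rabs continuous_on_subset[OF c(2) sub])
        (auto intro: borel_closed closed_Times)
    then have meas: "(\<lambda>(x, t). ennreal (indicator {0..r} t * \<bar>vt (x, t)\<bar>)) \<in> borel_measurable (lborel \<Otimes>\<^sub>M lborel)"
      by (simp add: case_prod_beta' indicator_times borel_prod lborel_prod)
    have "(\<integral>\<^sup>+x. ennreal \<bar>vol s (x, r) - vol s (x, 0)\<bar> \<partial>lborel)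
      \<le> (\<integral>\<^sup>+x. \<integral>\<^sup>+t. ennreal (indicator {0..r} t * \<bar>vt (x, t)\<bar>) \<partial>lborel \<partial>lborel)"
    proof (intro nn_integral_mono increment_le_nn_integral)
      fix x t assume "t \<in> {0..r}"
      then show "((\<lambda>t'. vol s (x, t')) has_real_derivative vt (x, t)) (at t within {0..r})"
        by (intro DERIV_subset[OF D(2)]) (use r in auto)
    next
      fix x
      show "continuous_on {0..r} (\<lambda>t. vt (x, t))"
        by (rule continuous_on_compose2[OF c(2)]) (use r in \<open>auto intro!: continuous_intros\<close>)
    qed (use r in simp)
    also have "\<dots> = (\<integral>\<^sup>+t. \<integral>\<^sup>+x. ennreal (indicator {0..r} t * \<bar>vt (x, t)\<bar>) \<partial>lborel \<partial>lborel)"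
      by (rule lborel_pair.Fubini'[OF meas, symmetric])
    also have "\<dots> \<le> (\<integral>\<^sup>+t. ennreal \<eta> * indicator {0..r} t \<partial>lborel)"
    proof (rule nn_integral_mono_AE)
      show "AE t in lborel. (\<integral>\<^sup>+x. ennreal (indicator {0..r} t * \<bar>vt (x, t)\<bar>) \<partial>lborel) \<le> ennreal \<eta> * indicator {0..r} t"
        \<comment> \<open>The Euler equations hold in the open time interval, so
          \<open>vt = ux\<close> is available for positive \<open>t\<close> only.\<close>
        using AE_lborel_singleton[of 0]
      proof eventually_elim
        case (elim t)
        show ?case
        proof (cases "t \<in> {0..r}")
          case True
          then have t: "t \<in> {0<..<T}" "t \<in> {0..<T}" using elim r by auto
          have "(\<integral>\<^sup>+x. ennreal \<bar>vt (x, t)\<bar> \<partial>lborel) \<le> (\<integral>\<^sup>+x. ennreal (\<bar>R_var \<gamma> s x t\<bar> + \<bar>S_var \<gamma> s x t\<bar>) \<partial>lborel)"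
            unfolding RS[OF t(2)] vtux[OF t(1)] by (intro nn_integral_mono ennreal_leI) auto
          from order_trans[OF this tv[OF t(2)]] show ?thesis using True by simp
        qed simp
      qed
    qed
    also have "\<dots> < \<infinity>" using r by (simp add: nn_integral_cmult_indicator ennreal_mult_less_top)
    finally have A: "(\<integral>\<^sup>+x. ennreal \<bar>vol s (x, r) - vol s (x, 0)\<bar> \<partial>lborel) < \<infinity>" .
    have "integrable lborel (\<lambda>x. vol s (x, 0) - \<tau>bar)"
      using s by (auto simp: euler_solution_def perturbation_def initial_def Ck_W11_def)
    then have B: "(\<integral>\<^sup>+x. ennreal \<bar>vol s (x, 0) - \<tau>bar\<bar> \<partial>lborel) < \<infinity>" by (simp add: integrable_iff_bounded)
    have cv: "(\<lambda>x. vol s (x, t)) \<in> borel_measurable borel" if "t \<in> {0..<T}" for t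
      by (rule borel_measurable_continuous_onI, rule DERIV_continuous_on) (rule D(1)[OF that])
    have cv0 [measurable]: "(\<lambda>x. vol s (x, 0)) \<in> borel_measurable borel" using cv[of 0] T by simp
    note [measurable] = cv[OF r]
    have "(\<integral>\<^sup>+x. ennreal \<bar>vol s (x, r) - \<tau>bar\<bar> \<partial>lborel)
      \<le> (\<integral>\<^sup>+x. ennreal \<bar>vol s (x, r) - vol s (x, 0)\<bar> + ennreal \<bar>vol s (x, 0) - \<tau>bar\<bar> \<partial>lborel)"
      by (intro nn_integral_mono) (simp flip: ennreal_plus)
    also have "\<dots> = (\<integral>\<^sup>+x. ennreal \<bar>vol s (x, r) - vol s (x, 0)\<bar> \<partial>lborel) + (\<integral>\<^sup>+x. ennreal \<bar>vol s (x, 0) - \<tau>bar\<bar> \<partial>lborel)"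
      by (rule nn_integral_add) measurable
    also have "\<dots> < \<infinity>" using A B by simp
    finally show ?thesis .
  qed
  have "\<bar>speed_primitive \<gamma> (vol s (x, r)) - speed_primitive \<gamma> \<tau>bar\<bar> \<le> \<eta> + e" if e: "0 < e" for e
  proof -
    have "isCont (speed_primitive \<gamma>) \<tau>bar" using DERIV_isCont[OF DERIV_speed_primitive[OF \<gamma> \<tau>]] .
    then obtain d where d: "0 < d" "\<And>y. \<bar>y - \<tau>bar\<bar> < d \<Longrightarrow> \<bar>speed_primitive \<gamma> y - speed_primitive \<gamma> \<tau>bar\<bar> < e"
      using e unfolding continuous_at_eps_delta dist_real_def by meson
    obtain y where "\<bar>vol s (y, r) - \<tau>bar\<bar> < d" using integrable_takes_small_values[OF fin d(1)] ..
    from d(2)[OF this] osc[of x y] osc[of y x] show ?thesis by linarith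
  qed
  then show ?thesis by (rule field_le_epsilon)
qed

text \<open>Doubling the interval on both sides leaves a positive gap between the values of the
  strictly increasing primitive. The threshold is the smaller of the two gaps and depends on
  \<gamma> and \<open>cbar\<close> only.\<close>

lemma vol_bounds_threshold:
  assumes "1 < \<gamma>" "0 < cbar"
  shows "\<exists>e>0. \<forall>\<tau>bar \<tau>. 1 / cbar \<le> \<tau>bar \<longrightarrow> \<tau>bar \<le> cbar \<longrightarrow> 0 < \<tau> \<longrightarrow>
    \<bar>speed_primitive \<gamma> \<tau> - speed_primitive \<gamma> \<tau>bar\<bar> \<le> e \<longrightarrow> \<tau> \<in> {1 / (2 * cbar)..2 * cbar}"
proof -
  have l: "0 < 1 / (2 * cbar)" "1 / (2 * cbar) < 1 / cbar" using assms(2) by (auto simp: field_simps)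
  define e where "e = min (speed_primitive \<gamma> (2 * cbar) - speed_primitive \<gamma> cbar) (speed_primitive \<gamma> (1 / cbar) - speed_primitive \<gamma> (1 / (2 * cbar)))"
  have e0: "0 < e" unfolding e_def
    using speed_primitive_less[OF assms(1,2), of "2 * cbar"] speed_primitive_less[OF assms(1) l] assms(2) by simp
  have mono: "speed_primitive \<gamma> x \<le> speed_primitive \<gamma> y" if "0 < x" "x \<le> y" for x y
    using speed_primitive_less[OF assms(1) that(1), of y] that(2) by (cases "x = y") auto
  have "\<tau> \<in> {1 / (2 * cbar)..2 * cbar}"
    if b: "1 / cbar \<le> \<tau>bar" "\<tau>bar \<le> cbar" and \<tau>: "0 < \<tau>" and d: "\<bar>speed_primitive \<gamma> \<tau> - speed_primitive \<gamma> \<tau>bar\<bar> \<le> e" for \<tau>bar \<tau>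
  proof -
    have m: "speed_primitive \<gamma> (1 / cbar) \<le> speed_primitive \<gamma> \<tau>bar" "speed_primitive \<gamma> \<tau>bar \<le> speed_primitive \<gamma> cbar"
      using b l assms(2) by (auto intro!: mono intro: less_le_trans[of 0 "1 / cbar"])
    have E: "e \<le> speed_primitive \<gamma> (2 * cbar) - speed_primitive \<gamma> cbar" "e \<le> speed_primitive \<gamma> (1 / cbar) - speed_primitive \<gamma> (1 / (2 * cbar))"
      by (simp_all add: e_def)
    have "\<tau> \<le> 2 * cbar"
    proof (rule ccontr)
      assume "\<not> \<tau> \<le> 2 * cbar"
      then have "speed_primitive \<gamma> (2 * cbar) < speed_primitive \<gamma> \<tau>" using assms by (intro speed_primitive_less) auto
      then show False using d m E by linarith
    qed
    moreover have "1 / (2 * cbar) \<le> \<tau>"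
    proof (rule ccontr)
      assume "\<not> 1 / (2 * cbar) \<le> \<tau>"
      then have "speed_primitive \<gamma> \<tau> < speed_primitive \<gamma> (1 / (2 * cbar))" using assms \<tau> by (intro speed_primitive_less) auto
      then show False using d m E by linarith
    qed
    ultimately show ?thesis by simp
  qed
  then show ?thesis using e0 by blast
qed

section \<open>Charts of solutions\<close>

lemma has_derivative_partials:
  fixes f :: "real \<times> real \<Rightarrow> real"
  assumes "(f has_derivative (\<lambda>h. g \<bullet> h)) (at z)"
  shows "((\<lambda>X. f (X, snd z)) has_real_derivative DX f z) (at (fst z))"
    and "((\<lambda>Y. f (fst z, Y)) has_real_derivative DY f z) (at (snd z))"
    and "(f has_derivative (\<lambda>h. DX f z * fst h + DY f z * snd h)) (at z)"
proof -
  have z: "(fst z, snd z) = z" by simp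
  have "((\<lambda>X. (X, snd z)) has_derivative (\<lambda>h. (h, 0))) (at (fst z))" by (auto intro!: derivative_eq_intros)
  from has_derivative_compose[OF this, of f "\<lambda>h. g \<bullet> h"] assms
  have X: "((\<lambda>X. f (X, snd z)) has_real_derivative fst g) (at (fst z))"
    by (simp add: has_field_derivative_def inner_prod_def)
  have "((\<lambda>Y. (fst z, Y)) has_derivative (\<lambda>h. (0, h))) (at (snd z))" by (auto intro!: derivative_eq_intros)
  from has_derivative_compose[OF this, of f "\<lambda>h. g \<bullet> h"] assms
  have Y: "((\<lambda>Y. f (fst z, Y)) has_real_derivative snd g) (at (snd z))"
    by (simp add: has_field_derivative_def inner_prod_def)
  have e: "DX f z = fst g" "DY f z = snd g"
    unfolding DX_def DY_def using DERIV_imp_deriv[OF X] DERIV_imp_deriv[OF Y] by simp_all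
  show "((\<lambda>X. f (X, snd z)) has_real_derivative DX f z) (at (fst z))"
    "((\<lambda>Y. f (fst z, Y)) has_real_derivative DY f z) (at (snd z))"
    "(f has_derivative (\<lambda>h. DX f z * fst h + DY f z * snd h)) (at z)"
    using X Y assms unfolding e by (simp_all add: inner_prod_def)
qed

text \<open>The chart is tied to the flow only before time \<open>T\<close>; along a vertical line
  in \<open>(x,t)\<close> the bounds extend by continuity to the final time, where the chart defines
  the solution.\<close>

lemma char_chart_tau_bounds:
  assumes C: "char_chart \<gamma> s T U \<Omega> Z" and T: "0 < T"
    and b: "\<And>x t. t \<in> {0..<T} \<Longrightarrow> vol s (x, t) \<in> {l..h}" and z: "z \<in> \<Omega>"
  shows "ch_tau Z z \<in> {l..h}"
proof -
  obtain G where hom: "homeomorphism \<Omega> (UNIV \<times> {0..T}) (\<lambda>z. (ch_x Z z, ch_t Z z)) G"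
    using C by (auto simp: char_chart_def)
  have G: "G w \<in> \<Omega>" "ch_x Z (G w) = fst w" "ch_t Z (G w) = snd w" if "w \<in> UNIV \<times> {0..T}" for w
    using homeomorphism_image2[OF hom] homeomorphism_apply2[OF hom that] that by auto
  have "Ck_on 2 (ch_tau Z) U" "\<Omega> \<subseteq> U" using C by (auto simp: char_chart_def chart_fields_def simp del: Ck_on.simps)
  then have ct: "continuous_on \<Omega> (ch_tau Z)" using Ck_on_continuous continuous_on_subset by blast
  define x where "x = ch_x Z z"
  have tz: "ch_t Z z \<in> {0..T}" and Gz: "G (x, ch_t Z z) = z"
    using homeomorphism_apply1[OF hom z] imageI[OF z, of "\<lambda>z. (ch_x Z z, ch_t Z z)"]
    unfolding homeomorphism_image1[OF hom] by (simp_all add: x_def)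
  have cl: "closure {0..<T} = {0..T}" using T by (intro closure_atLeastLessThan)
  have "continuous_on {0..T} (\<lambda>t. G (x, t))"
    by (rule continuous_on_compose2[OF homeomorphism_cont2[OF hom]]) (auto intro!: continuous_intros)
  then have cont: "continuous_on (closure {0..<T}) (\<lambda>t. ch_tau Z (G (x, t)))"
    unfolding cl by (rule continuous_on_compose2[OF ct]) (use G in auto)
  have v: "ch_tau Z (G (x, t)) \<in> {l..h}" if t: "t \<in> {0..<T}" for t
  proof -
    have w: "(x, t) \<in> UNIV \<times> {0..T}" using t by auto
    have "ch_tau Z (G (x, t)) = vol s (ch_x Z (G (x, t)), ch_t Z (G (x, t)))"
      using C G[OF w] t by (auto simp: char_chart_def)
    then show ?thesis using G[OF w] b[OF t] by simp
  qed
  have m: "ch_t Z z \<in> closure {0..<T}" unfolding cl by (rule tz)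
  have "ch_tau Z (G (x, ch_t Z z)) \<le> h"
    by (rule continuous_le_on_closure[OF cont m]) (drule v, simp)
  moreover have "l \<le> ch_tau Z (G (x, ch_t Z z))"
    by (rule continuous_ge_on_closure[OF cont m]) (drule v, simp)
  ultimately show ?thesis by (simp add: Gz)
qed

text \<open>The open set may be shrunk to the part where \<tau> is positive, since only there can
  the \<open>deriv\<close> in the system be identified with the explicit derivative of the wave
  speed.\<close>

lemma char_chart_geometry:
  assumes C: "char_chart \<gamma> s T U0 \<Omega> Z" and T: "0 < T" and U: "open U" "\<Omega> \<subseteq> U" "U \<subseteq> U0"
    and pos: "\<And>z. z \<in> U \<Longrightarrow> 0 < ch_tau Z z" and co: "\<And>z. z \<in> \<Omega> \<Longrightarrow> coeff_bound \<gamma> m (ch_tau Z z)"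
    and \<eta>: "0 \<le> \<eta>"
    and tv: "\<And>r. r \<in> {0..<T} \<Longrightarrow> (\<integral>\<^sup>+x. ennreal (\<bar>R_var \<gamma> s x r\<bar> + \<bar>S_var \<gamma> s x r\<bar>) \<partial>lborel) \<le> ennreal \<eta>"
  shows "\<exists>G. char_geometry \<gamma> T m \<eta> U \<Omega> G (ch_tau Z) (ch_alpha Z) (ch_beta Z) (ch_p Z) (ch_q Z) (ch_x Z) (ch_t Z) \<and>
    (\<forall>r\<in>{0..<T}. (\<integral>\<^sup>+y. ennreal \<bar>tan (ch_alpha Z (G (y, r)) / 2)\<bar> \<partial>lborel) \<le> ennreal \<eta> \<and>
      (\<integral>\<^sup>+y. ennreal \<bar>tan (ch_beta Z (G (y, r)) / 2)\<bar> \<partial>lborel) \<le> ennreal \<eta>)"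
proof -
  obtain G where hom: "homeomorphism \<Omega> (UNIV \<times> {0..T}) (\<lambda>z. (ch_x Z z, ch_t Z z)) G"
    using C by (auto simp: char_chart_def)
  have G: "G w \<in> \<Omega>" "ch_x Z (G w) = fst w" "ch_t Z (G w) = snd w" if "w \<in> UNIV \<times> {0..T}" for w
    using homeomorphism_image2[OF hom] homeomorphism_apply2[OF hom that] that by auto
  have ck: "Ck_on 2 (f Z) U0" if "f \<in> chart_fields" for f using C that by (simp add: char_chart_def)
  have O0: "open U0" using C by (simp add: char_chart_def)
  have D: "((\<lambda>X. f Z (X, snd z)) has_real_derivative DX (f Z) z) (at (fst z)) \<and>
      ((\<lambda>Y. f Z (fst z, Y)) has_real_derivative DY (f Z) z) (at (snd z)) \<and>
      (f Z has_derivative (\<lambda>h. DX (f Z) z * fst h + DY (f Z) z * snd h)) (at z)"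
    if f: "f \<in> chart_fields" and z: "z \<in> U" for f z
  proof -
    obtain g where "\<And>z. z \<in> U0 \<Longrightarrow> (f Z has_derivative (\<lambda>h. g z \<bullet> h)) (at z)"
      using Ck_on_open_gradient[OF ck[OF f, unfolded numeral_2_eq_2] O0] by blast
    from has_derivative_partials[OF this[of z]] z U(3) show ?thesis by auto
  qed
  have F: "ch_tau \<in> chart_fields" "ch_u \<in> chart_fields" "ch_alpha \<in> chart_fields" "ch_beta \<in> chart_fields"
    "ch_p \<in> chart_fields" "ch_q \<in> chart_fields" "ch_x \<in> chart_fields" "ch_t \<in> chart_fields"
    by (simp_all add: chart_fields_def)
  have sl: "semilinear_at \<gamma> Z z" if "z \<in> U" for z using C U(3) that by (auto simp: char_chart_def)
  have k: "deriv (wave_speed \<gamma>) (ch_tau Z z) / (2 * (wave_speed \<gamma> (ch_tau Z z))\<^sup>2) = 2 * kap \<gamma> (ch_tau Z z)"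
    "deriv (wave_speed \<gamma>) (ch_tau Z z) / (4 * (wave_speed \<gamma> (ch_tau Z z))\<^sup>2) = kap \<gamma> (ch_tau Z z)" if "z \<in> U" for z
    by (simp_all add: kap_def deriv_wave_speed[OF pos[OF that]])
  have S: "DY (ch_alpha Z) z = 2 * kap \<gamma> (ch_tau Z z) * ch_q Z z * sin (ch_alpha Z z / 2) * sin ((ch_alpha Z z - ch_beta Z z) / 2)"
      "DX (ch_beta Z) z = 2 * kap \<gamma> (ch_tau Z z) * ch_p Z z * sin (ch_beta Z z / 2) * sin ((ch_beta Z z - ch_alpha Z z) / 2)"
      "DY (ch_p Z) z = kap \<gamma> (ch_tau Z z) * ch_p Z z * ch_q Z z * cos (ch_alpha Z z / 2) * sin ((ch_beta Z z - ch_alpha Z z) / 2)"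
      "DX (ch_q Z) z = kap \<gamma> (ch_tau Z z) * ch_q Z z * ch_p Z z * cos (ch_beta Z z / 2) * sin ((ch_alpha Z z - ch_beta Z z) / 2)"
      "DX (ch_t Z) z = 1 / (2 * wave_speed \<gamma> (ch_tau Z z)) * ch_p Z z * cos (ch_alpha Z z / 2)"
      "DY (ch_t Z) z = 1 / (2 * wave_speed \<gamma> (ch_tau Z z)) * ch_q Z z * cos (ch_beta Z z / 2)"
      "DX (ch_x Z) z = 1 / 2 * ch_p Z z * cos (ch_alpha Z z / 2)"
      "DY (ch_x Z) z = - 1 / 2 * ch_q Z z * cos (ch_beta Z z / 2)" if "z \<in> U" for z
    using sl[OF that] unfolding semilinear_at_def Let_def k[OF that] by simp_all
  have zp: "0 < ch_p Z z" "0 < ch_q Z z" "ch_alpha Z z \<in> {-pi..<pi}" "ch_beta Z z \<in> {-pi..<pi}" if "z \<in> \<Omega>" for z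
    using C that by (auto simp: char_chart_def)
  have tz: "ch_t Z z \<in> {0..T}" "G (ch_x Z z, ch_t Z z) = z" if "z \<in> \<Omega>" for z
    using homeomorphism_apply1[OF hom that] imageI[OF that, of "\<lambda>z. (ch_x Z z, ch_t Z z)"]
    unfolding homeomorphism_image1[OF hom] by simp_all
  have at: "ch_alpha Z z / 2 = arctan (R_var \<gamma> s (ch_x Z z) (ch_t Z z))" "ch_beta Z z / 2 = arctan (S_var \<gamma> s (ch_x Z z) (ch_t Z z))"
    if "z \<in> \<Omega>" "ch_t Z z < T" for z
    using C that by (auto simp: char_chart_def)
  have tv': "(\<integral>\<^sup>+y. ennreal \<bar>tan (ch_alpha Z (G (y, r)) / 2)\<bar> \<partial>lborel) \<le> ennreal \<eta>"
    "(\<integral>\<^sup>+y. ennreal \<bar>tan (ch_beta Z (G (y, r)) / 2)\<bar> \<partial>lborel) \<le> ennreal \<eta>" if r: "r \<in> {0..<T}" for r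
  proof -
    have w: "(y, r) \<in> UNIV \<times> {0..T}" for y using r by auto
    have e: "tan (ch_alpha Z (G (y, r)) / 2) = R_var \<gamma> s y r" "tan (ch_beta Z (G (y, r)) / 2) = S_var \<gamma> s y r" for y
      using at[OF G(1)[OF w]] G(2,3)[OF w] r by (simp_all add: tan_arctan)
    show "(\<integral>\<^sup>+y. ennreal \<bar>tan (ch_alpha Z (G (y, r)) / 2)\<bar> \<partial>lborel) \<le> ennreal \<eta>"
      "(\<integral>\<^sup>+y. ennreal \<bar>tan (ch_beta Z (G (y, r)) / 2)\<bar> \<partial>lborel) \<le> ennreal \<eta>"
      unfolding e by (rule order_trans[OF nn_integral_mono tv[OF r]], rule ennreal_leI, simp)+
  qed
  have "char_geometry \<gamma> T m \<eta> U \<Omega> G (ch_tau Z) (ch_alpha Z) (ch_beta Z) (ch_p Z) (ch_q Z) (ch_x Z) (ch_t Z)"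
  proof
    show "0 < T" "open U" "\<Omega> \<subseteq> U" "0 \<le> \<eta>" by (fact T U \<eta>)+
    fix z assume z: "z \<in> U"
    show "(ch_x Z has_derivative (\<lambda>h. (1 / 2 * ch_p Z z * cos (ch_alpha Z z / 2)) * fst h
        + (- 1 / 2 * ch_q Z z * cos (ch_beta Z z / 2)) * snd h)) (at z)"
      using D[OF F(7) z] unfolding S[OF z] by blast
    show "(ch_t Z has_derivative (\<lambda>h. (1 / (2 * wave_speed \<gamma> (ch_tau Z z)) * ch_p Z z * cos (ch_alpha Z z / 2)) * fst h
        + (1 / (2 * wave_speed \<gamma> (ch_tau Z z)) * ch_q Z z * cos (ch_beta Z z / 2)) * snd h)) (at z)"
      using D[OF F(8) z] unfolding S[OF z] by blast
  next
    fix X Y assume z: "(X, Y) \<in> U"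
    show "((\<lambda>Y. ch_alpha Z (X, Y)) has_real_derivative 2 * kap \<gamma> (ch_tau Z (X, Y)) * ch_q Z (X, Y) * sin (ch_alpha Z (X, Y) / 2) *
        sin ((ch_alpha Z (X, Y) - ch_beta Z (X, Y)) / 2)) (at Y)"
      using D[OF F(3) z] unfolding S[OF z] fst_conv snd_conv by blast
    show "((\<lambda>X. ch_beta Z (X, Y)) has_real_derivative 2 * kap \<gamma> (ch_tau Z (X, Y)) * ch_p Z (X, Y) * sin (ch_beta Z (X, Y) / 2) *
        sin ((ch_beta Z (X, Y) - ch_alpha Z (X, Y)) / 2)) (at X)"
      using D[OF F(4) z] unfolding S[OF z] fst_conv snd_conv by blast
    show "((\<lambda>Y. ch_p Z (X, Y)) has_real_derivative kap \<gamma> (ch_tau Z (X, Y)) * ch_p Z (X, Y) * ch_q Z (X, Y) * cos (ch_alpha Z (X, Y) / 2) *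
        sin ((ch_beta Z (X, Y) - ch_alpha Z (X, Y)) / 2)) (at Y)"
      using D[OF F(5) z] unfolding S[OF z] fst_conv snd_conv by blast
    show "((\<lambda>X. ch_q Z (X, Y)) has_real_derivative kap \<gamma> (ch_tau Z (X, Y)) * ch_q Z (X, Y) * ch_p Z (X, Y) * cos (ch_beta Z (X, Y) / 2) *
        sin ((ch_alpha Z (X, Y) - ch_beta Z (X, Y)) / 2)) (at X)"
      using D[OF F(6) z] unfolding S[OF z] fst_conv snd_conv by blast
  next
    show "continuous_on U (ch_alpha Z)" "continuous_on U (ch_beta Z)"
      using Ck_on_continuous[OF ck] U(3) F(3,4) by (meson continuous_on_subset)+
    show "continuous_on (UNIV \<times> {0..T}) G" by (rule homeomorphism_cont2[OF hom])
    fix w :: "real \<times> real" assume w: "w \<in> UNIV \<times> {0..T}"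
    show "G w \<in> \<Omega>" "ch_x Z (G w) = fst w" "ch_t Z (G w) = snd w" by (fact G[OF w])+
  next
    fix z assume z: "z \<in> \<Omega>"
    show "G (ch_x Z z, ch_t Z z) = z" "ch_t Z z \<in> {0..T}" "0 < ch_p Z z" "0 < ch_q Z z" "coeff_bound \<gamma> m (ch_tau Z z)"
      by (fact tz[OF z] zp[OF z] co[OF z])+
    show "0 \<le> cos (ch_alpha Z z / 2)" "0 \<le> cos (ch_beta Z z / 2)" using zp[OF z] by (auto intro!: cos_ge_zero)
    assume "ch_t Z z < T"
    then show "0 < cos (ch_alpha Z z / 2)" "0 < cos (ch_beta Z z / 2)"
      unfolding at[OF z \<open>ch_t Z z < T\<close>] by (intro cos_gt_zero_pi arctan_lbound arctan_ubound)+
  next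
    have "T / 2 \<in> {0..<T}" using T by simp
    then show "(\<integral>\<^sup>+y. ennreal \<bar>tan (ch_alpha Z (G (y, T / 2)) / 2)\<bar> \<partial>lborel) \<le> ennreal \<eta>"
      "(\<integral>\<^sup>+y. ennreal \<bar>tan (ch_beta Z (G (y, T / 2)) / 2)\<bar> \<partial>lborel) \<le> ennreal \<eta>"
      by (fact tv')+
  qed
  then show ?thesis using tv' by blast
qed

text \<open>At the final time \<open>tan\<close> takes the junk value \<open>0\<close> where the angle reaches \<open>-\<pi>/2\<close>, which is harmless
  for an upper bound.\<close>

lemma (in char_geometry) variation_closed:
  fixes f :: "real \<times> real \<Rightarrow> real"
  assumes f: "continuous_on U f" and range: "\<And>z. z \<in> \<Omega> \<Longrightarrow> 0 \<le> cos (f z / 2)"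
    and pos: "\<And>z. z \<in> \<Omega> \<Longrightarrow> tc z < T \<Longrightarrow> 0 < cos (f z / 2)"
    and tv: "\<And>r. r \<in> {0..<T} \<Longrightarrow> (\<integral>\<^sup>+y. ennreal \<bar>tan (f (G (y, r)) / 2)\<bar> \<partial>lborel) \<le> ennreal \<eta>"
    and t: "t \<in> {0..T}"
  shows "(\<integral>\<^sup>+y. ennreal \<bar>tan (f (G (y, t)) / 2)\<bar> \<partial>lborel) \<le> ennreal \<eta>"
proof (cases "t < T")
  case True
  then show ?thesis using t by (intro tv) simp
next
  case False
  then have tT: "t = T" using t by simp
  have fG: "continuous_on (UNIV \<times> {0..T}) (\<lambda>w. f (G w))"
    by (rule continuous_on_compose2[OF f cont_G]) (use G_in \<Omega>_U in blast)
  define r where "r k = T * (1 - inverse (real (Suc k)))" for k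
  have "inverse (real (Suc k)) \<le> 1" "0 < inverse (real (Suc k))" for k by (simp_all add: inverse_eq_divide)
  then have rk: "r k \<in> {0..<T}" for k unfolding r_def using T_pos by (auto simp del: of_nat_Suc)
  have rl: "r \<longlonglongrightarrow> T"
    unfolding r_def using tendsto_mult[OF tendsto_const[of T] tendsto_diff[OF tendsto_const[of 1] LIMSEQ_inverse_real_of_nat]] by simp
  \<comment> \<open>The times \<open>r k\<close> tend to the final time from below. At time
    \<open>T\<close> the integrand is at most the lower limit of those at \<open>r k\<close>, so
    Fatou's lemma carries the bound over.\<close>
  let ?g = "\<lambda>k y. ennreal \<bar>tan (f (G (y, r k)) / 2)\<bar>"
  have "(\<integral>\<^sup>+y. ennreal \<bar>tan (f (G (y, T)) / 2)\<bar> \<partial>lborel) \<le> (\<integral>\<^sup>+y. liminf (\<lambda>k. ?g k y) \<partial>lborel)"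
  proof (rule nn_integral_mono)
    fix y
    show "ennreal \<bar>tan (f (G (y, T)) / 2)\<bar> \<le> liminf (\<lambda>k. ?g k y)"
    proof (cases "cos (f (G (y, T)) / 2) = 0")
      case True
      then show ?thesis by (simp add: tan_def)
    next
      case False
      have "(\<lambda>k. f (G (y, r k))) \<longlonglongrightarrow> f (G (y, T))"
        by (rule continuous_on_tendsto_compose[OF fG]) (use rk T_pos in \<open>auto intro!: tendsto_intros rl simp: less_imp_le\<close>)
      then have "(\<lambda>k. ?g k y) \<longlonglongrightarrow> ennreal \<bar>tan (f (G (y, T)) / 2)\<bar>"
        using False by (intro tendsto_ennrealI tendsto_rabs isCont_tendsto_compose[OF isCont_tan] tendsto_divide tendsto_const) auto
      then show ?thesis using lim_imp_Liminf[OF sequentially_bot] by fastforce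
    qed
  qed
  also have "\<dots> \<le> liminf (\<lambda>k. \<integral>\<^sup>+y. ?g k y \<partial>lborel)"
  proof (rule nn_integral_liminf)
    fix k
    have w: "(y, r k) \<in> UNIV \<times> {0..T}" for y using rk[of k] by simp
    have "continuous_on UNIV (\<lambda>y. f (G (y, r k)))"
      by (rule continuous_on_compose2[OF fG]) (use w in \<open>auto intro!: continuous_intros\<close>)
    moreover have "cos (f (G (y, r k)) / 2) \<noteq> 0" for y
      using pos[OF G_in[OF w[of y]]] t_G[OF w[of y]] rk[of k] by simp
    ultimately have "continuous_on UNIV (\<lambda>y. \<bar>tan (f (G (y, r k)) / 2)\<bar>)" by (intro continuous_intros) auto
    then show "(\<lambda>y. ?g k y) \<in> borel_measurable lborel"
      by (intro measurable_compose[OF _ measurable_ennreal]) (simp add: borel_measurable_continuous_onI)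
  qed
  also have "\<dots> \<le> ennreal \<eta>"
    using Liminf_mono[of "\<lambda>k. \<integral>\<^sup>+y. ?g k y \<partial>lborel" "\<lambda>k. ennreal \<eta>" sequentially] tv[OF rk] by (simp add: Liminf_const)
  finally show ?thesis unfolding tT .
qed

text \<open>The integrand is dominated by \<open>|S|\<close>, since
  \<open>x^2 / sqrt (1 + x^2)\<close> is at most \<open>|x|\<close>. If it fails to be integrable,
  its integral is 0 by convention and the bounds remain true.\<close>

lemma weight_integral_bounds:
  fixes S :: "real \<Rightarrow> real"
  assumes "(\<integral>\<^sup>+y. ennreal \<bar>S y\<bar> \<partial>lborel) \<le> ennreal \<eta>" "0 \<le> \<eta>"
  shows "0 \<le> (LINT y:A|lborel. (S y)\<^sup>2 / sqrt (1 + (S y)\<^sup>2))" "(LINT y:A|lborel. (S y)\<^sup>2 / sqrt (1 + (S y)\<^sup>2)) \<le> \<eta>"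
proof -
  let ?f = "\<lambda>y. indicator A y *\<^sub>R ((S y)\<^sup>2 / sqrt (1 + (S y)\<^sup>2)) :: real"
  have f0: "0 \<le> ?f y" for y by simp
  have le: "x\<^sup>2 / sqrt (1 + x\<^sup>2) \<le> \<bar>x\<bar>" for x :: real
  proof -
    have "\<bar>x\<bar> \<le> sqrt (1 + x\<^sup>2)" by (rule real_le_rsqrt) simp
    then have "\<bar>x\<bar> * \<bar>x\<bar> \<le> \<bar>x\<bar> * sqrt (1 + x\<^sup>2)" by (rule mult_left_mono) simp
    moreover have "0 < sqrt (1 + x\<^sup>2)" by (simp add: add_pos_nonneg)
    ultimately show ?thesis by (simp add: pos_divide_le_eq power2_eq_square)
  qed
  show "0 \<le> (LINT y:A|lborel. (S y)\<^sup>2 / sqrt (1 + (S y)\<^sup>2))"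
    unfolding set_lebesgue_integral_def by (rule integral_nonneg_AE) simp
  show "(LINT y:A|lborel. (S y)\<^sup>2 / sqrt (1 + (S y)\<^sup>2)) \<le> \<eta>"
    unfolding set_lebesgue_integral_def
  proof (cases "integrable lborel ?f")
    case True
    then have "ennreal (integral\<^sup>L lborel ?f) = (\<integral>\<^sup>+y. ennreal (?f y) \<partial>lborel)"
      by (simp add: nn_integral_eq_integral)
    also have "\<dots> \<le> (\<integral>\<^sup>+y. ennreal \<bar>S y\<bar> \<partial>lborel)"
      by (intro nn_integral_mono ennreal_leI) (simp add: le indicator_def)
    finally have "ennreal (integral\<^sup>L lborel ?f) \<le> ennreal \<eta>" using assms(1) by (rule order_trans)
    then show "integral\<^sup>L lborel ?f \<le> \<eta>" using assms(2) by simp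
  qed (simp add: not_integrable_integral_eq assms(2))
qed

context relabelled_path
begin

text \<open>A relabeling does not change the angles, and the point of the relabelled chart above
  \<open>(y, t)\<close> is carried by \<phi> and \<psi> to \<open>G (y, t)\<close>.\<close>

lemma chart_RS:
  assumes t: "t \<in> {0..T}"
  shows "chart_R \<Omega>r (Zr \<theta>) (y, t) = tan (ch_alpha (Z \<theta>) (G (y, t)) / 2)"
    and "chart_S \<Omega>r (Zr \<theta>) (y, t) = tan (ch_beta (Z \<theta>) (G (y, t)) / 2)"
proof -
  have inj: "inj_on (\<lambda>z. (ch_x (Zr \<theta>) z, ch_t (Zr \<theta>) z)) \<Omega>r"
  proof (rule inj_onI)
    fix z z' assume z: "z \<in> \<Omega>r" "z' \<in> \<Omega>r" and e: "(ch_x (Zr \<theta>) z, ch_t (Zr \<theta>) z) = (ch_x (Zr \<theta>) z', ch_t (Zr \<theta>) z')"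
    obtain X Y X' Y' where XY: "z = (X, Y)" "z' = (X', Y')" by (cases z, cases z')
    have "(\<phi> \<theta> X, \<psi> \<theta> Y) \<in> \<Omega>" "(\<phi> \<theta> X', \<psi> \<theta> Y') \<in> \<Omega>" using z by (simp_all add: XY \<Omega>r_iff)
    note g = G_xt[OF this(1)] G_xt[OF this(2)]
    have e': "ch_x (Z \<theta>) (\<phi> \<theta> X, \<psi> \<theta> Y) = ch_x (Z \<theta>) (\<phi> \<theta> X', \<psi> \<theta> Y')"
      "ch_t (Z \<theta>) (\<phi> \<theta> X, \<psi> \<theta> Y) = ch_t (Z \<theta>) (\<phi> \<theta> X', \<psi> \<theta> Y')"
      using e by (simp_all only: XY Zr_def relabel_def chart.simps prod.case prod.inject)
    have "(\<phi> \<theta> X, \<psi> \<theta> Y) = (\<phi> \<theta> X', \<psi> \<theta> Y')" by (rule trans[OF sym g(2)], rule g(1)[unfolded e'])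
    then show "z = z'" using strict_mono_eq[OF \<phi>(1)] strict_mono_eq[OF \<psi>(1)] by (simp add: XY)
  qed
  have "chart_point \<Omega>r (Zr \<theta>) (y, t) = (Xr y t, Yr y t)"
    unfolding chart_point_def
    by (rule the_inv_into_f_eq[OF inj])
       (use graph_in_\<Omega>r[OF t, of y] x_G[of "(y, t)"] t_G[of "(y, t)"] t in \<open>simp_all add: Zr_def relabel_def \<phi>_Xr flip: G_eq\<close>)
  then show "chart_R \<Omega>r (Zr \<theta>) (y, t) = tan (ch_alpha (Z \<theta>) (G (y, t)) / 2)"
    "chart_S \<Omega>r (Zr \<theta>) (y, t) = tan (ch_beta (Z \<theta>) (G (y, t)) / 2)"
    by (simp_all add: chart_R_def chart_S_def Zr_def relabel_def \<phi>_Xr flip: G_eq)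
qed

lemma weight_bounds:
  assumes tv: "\<And>r. r \<in> {0..<T} \<Longrightarrow> (\<integral>\<^sup>+y. ennreal \<bar>tan (ch_alpha (Z \<theta>) (G (y, r)) / 2)\<bar> \<partial>lborel) \<le> ennreal \<eta>"
      "\<And>r. r \<in> {0..<T} \<Longrightarrow> (\<integral>\<^sup>+y. ennreal \<bar>tan (ch_beta (Z \<theta>) (G (y, r)) / 2)\<bar> \<partial>lborel) \<le> ennreal \<eta>"
    and t: "t \<in> {0..T}"
  shows "\<eta> \<le> W_minus \<eta> \<Omega>r (Zr \<theta>) x t" "W_minus \<eta> \<Omega>r (Zr \<theta>) x t \<le> 2 * \<eta>"
    and "\<eta> \<le> W_plus \<eta> \<Omega>r (Zr \<theta>) x t" "W_plus \<eta> \<Omega>r (Zr \<theta>) x t \<le> 2 * \<eta>"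
proof -
  note a = weight_integral_bounds[OF variation_closed[OF cont_al cos_nonneg(1) cos_pos(1) tv(1) t] \<eta>_nonneg]
  note b = weight_integral_bounds[OF variation_closed[OF cont_be cos_nonneg(2) cos_pos(2) tv(2) t] \<eta>_nonneg]
  show "\<eta> \<le> W_minus \<eta> \<Omega>r (Zr \<theta>) x t" "W_minus \<eta> \<Omega>r (Zr \<theta>) x t \<le> 2 * \<eta>"
    unfolding W_minus_def chart_RS[OF t] using b[of "{..x}"] by linarith+
  show "\<eta> \<le> W_plus \<eta> \<Omega>r (Zr \<theta>) x t" "W_plus \<eta> \<Omega>r (Zr \<theta>) x t \<le> 2 * \<eta>"
    unfolding W_plus_def chart_RS[OF t] using a[of "{x..}"] by linarith+
qed

end

section \<open>Length of paths and geodesic distance\<close>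

definition growth_rate :: "real \<Rightarrow> nat \<Rightarrow> real" where
  "growth_rate m n = 2 * real n * (500 * m ^ 4)"

text \<open>The exceptional parameters of the charts and of the two relabelings form a finite set.
  Off it the parameters form an open set on which everything is differentiable in \<theta>, and the
  finite set does not affect the length.\<close>

lemma tangent_norm_along_path:
  assumes T: "0 < T" and rep: "represents \<gamma> T \<Upsilon> \<Omega> Z" and \<phi>: "pw_relabeling \<phi>" and \<psi>: "pw_relabeling \<psi>"
    and l: "0 < l" and vol: "\<And>\<theta> x t. \<theta> \<in> {0..1} \<Longrightarrow> t \<in> {0..<T} \<Longrightarrow> vol (\<Upsilon> \<theta>) (x, t) \<in> {l..h}"
    and co: "\<And>\<tau>. \<tau> \<in> {l..h} \<Longrightarrow> coeff_bound \<gamma> m \<tau>" and \<eta>: "0 < \<eta>"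
    and tv: "\<And>\<theta> r. \<theta> \<in> {0..1} \<Longrightarrow> r \<in> {0..<T} \<Longrightarrow>
      (\<integral>\<^sup>+x. ennreal (\<bar>R_var \<gamma> (\<Upsilon> \<theta>) x r\<bar> + \<bar>S_var \<gamma> (\<Upsilon> \<theta>) x r\<bar>) \<partial>lborel) \<le> ennreal \<eta>"
  shows "\<exists>E. finite E \<and> (\<forall>\<theta>\<in>{0<..<1} - E. \<forall>t\<in>{0..T}.
    tangent_norm \<gamma> \<eta> \<iota> (\<lambda>\<theta>. relabel_domain (\<phi> \<theta>) (\<psi> \<theta>) (\<Omega> \<theta>)) (\<lambda>\<theta>. relabel (\<phi> \<theta>) (\<psi> \<theta>) (Z \<theta>)) t \<theta> \<le>
    ennreal (2 * exp (4 * growth_rate m (num_terms \<iota>) * \<eta> + 2 * m * growth_rate m (num_terms \<iota>) * t)) *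
    tangent_norm \<gamma> \<eta> \<iota> (\<lambda>\<theta>. relabel_domain (\<phi> \<theta>) (\<psi> \<theta>) (\<Omega> \<theta>)) (\<lambda>\<theta>. relabel (\<phi> \<theta>) (\<psi> \<theta>) (Z \<theta>)) 0 \<theta>)"
proof -
  obtain F V where F: "finite F" and V: "open V" and ck: "\<And>f. f \<in> chart_fields \<Longrightarrow> Ck_on 2 (\<lambda>(\<theta>, z). f (Z \<theta>) z) V"
    and ch: "\<And>\<theta>. \<theta> \<in> {0<..<1} - F \<Longrightarrow> char_chart \<gamma> (\<Upsilon> \<theta>) T {z. (\<theta>, z) \<in> V} (\<Omega> \<theta>) (Z \<theta>)"
    using rep unfolding represents_def by (elim exE conjE) blast
  obtain F1 N where F1: "finite F1" "finite N" and c1: "\<And>A. open A \<Longrightarrow> A \<subseteq> {0<..<1} - F1 \<Longrightarrow> smooth_cells A N \<phi>"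
    using pw_relabeling_cells[OF \<phi>] by (elim exE conjE) blast
  obtain F2 M where F2: "finite F2" "finite M" and c2: "\<And>A. open A \<Longrightarrow> A \<subseteq> {0<..<1} - F2 \<Longrightarrow> smooth_cells A M \<psi>"
    using pw_relabeling_cells[OF \<psi>] by (elim exE conjE) blast
  define E where "E = F \<union> F1 \<union> F2"
  define A where "A = {0<..<1} - E"
  have fE: "finite E" using F F1 F2 by (simp add: E_def)
  then have oA: "open A" unfolding A_def by (intro open_Diff open_greaterThanLessThan finite_imp_closed)
  have cells: "smooth_cells A N \<phi>" "smooth_cells A M \<psi>"
    by (rule c1[OF oA], simp add: A_def E_def, blast) (rule c2[OF oA], simp add: A_def E_def, blast)
  have chA: "char_chart \<gamma> (\<Upsilon> \<theta>) T {z. (\<theta>, z) \<in> V} (\<Omega> \<theta>) (Z \<theta>)" if "\<theta> \<in> A" for \<theta>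
    using that by (intro ch) (simp add: A_def E_def)
  have "\<forall>f. \<exists>g. f \<in> chart_fields \<longrightarrow> (\<forall>w\<in>V. ((\<lambda>(\<theta>, z). f (Z \<theta>) z) has_derivative (\<lambda>d. g w \<bullet> d)) (at w)) \<and> continuous_on V g"
    using Ck_on_open_gradient[OF ck[unfolded numeral_2_eq_2] V] by meson
  from choice[OF this] obtain grad where grad: "\<And>f. f \<in> chart_fields \<Longrightarrow>
      (\<forall>w\<in>V. ((\<lambda>(\<theta>, z). f (Z \<theta>) z) has_derivative (\<lambda>d. grad f w \<bullet> d)) (at w)) \<and> continuous_on V (grad f)" by auto
  \<comment> \<open>The common domain \<open>V\<close> of the charts may contain points outside the
    images where \<tau> is not positive; the restriction removes them and stays open.\<close>
  define V' where "V' = V \<inter> (\<lambda>(\<theta>, z). ch_tau (Z \<theta>) z) -` {0<..}"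
  have "ch_tau \<in> chart_fields" by (simp add: chart_fields_def)
  then have oV': "open V'" unfolding V'_def
    by (intro continuous_open_preimage Ck_on_continuous[OF ck] V open_greaterThan)
  have "tangent_norm \<gamma> \<eta> \<iota> (\<lambda>\<theta>. relabel_domain (\<phi> \<theta>) (\<psi> \<theta>) (\<Omega> \<theta>)) (\<lambda>\<theta>. relabel (\<phi> \<theta>) (\<psi> \<theta>) (Z \<theta>)) t \<theta> \<le>
      ennreal (2 * exp (4 * growth_rate m (num_terms \<iota>) * \<eta> + 2 * m * growth_rate m (num_terms \<iota>) * t)) *
      tangent_norm \<gamma> \<eta> \<iota> (\<lambda>\<theta>. relabel_domain (\<phi> \<theta>) (\<psi> \<theta>) (\<Omega> \<theta>)) (\<lambda>\<theta>. relabel (\<phi> \<theta>) (\<psi> \<theta>) (Z \<theta>)) 0 \<theta>"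
    if \<theta>: "\<theta> \<in> A" and t: "t \<in> {0..T}" for \<theta> t
  proof -
    have \<theta>01: "\<theta> \<in> {0..1}" using \<theta> by (simp add: A_def)
    have tb: "ch_tau (Z \<theta>) z \<in> {l..h}" if "z \<in> \<Omega> \<theta>" for z
      by (rule char_chart_tau_bounds[OF chA[OF \<theta>] T vol[OF \<theta>01] that])
    have U: "open {z. (\<theta>, z) \<in> V'}" "\<Omega> \<theta> \<subseteq> {z. (\<theta>, z) \<in> V'}" "{z. (\<theta>, z) \<in> V'} \<subseteq> {z. (\<theta>, z) \<in> V}"
    proof -
      have "{z. (\<theta>, z) \<in> V'} = Pair \<theta> -` V'" by auto
      then show "open {z. (\<theta>, z) \<in> V'}" using open_vimage[OF oV', of "Pair \<theta>"] by (simp add: continuous_on_Pair)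
      have "\<Omega> \<theta> \<subseteq> {z. (\<theta>, z) \<in> V}" using chA[OF \<theta>] by (simp add: char_chart_def)
      moreover have "0 < ch_tau (Z \<theta>) z" if "z \<in> \<Omega> \<theta>" for z using tb[OF that] l by simp
      ultimately show "\<Omega> \<theta> \<subseteq> {z. (\<theta>, z) \<in> V'}" unfolding V'_def by auto
      show "{z. (\<theta>, z) \<in> V'} \<subseteq> {z. (\<theta>, z) \<in> V}" by (auto simp: V'_def)
    qed
    have pos: "0 < ch_tau (Z \<theta>) z" if "z \<in> {z. (\<theta>, z) \<in> V'}" for z using that by (simp add: V'_def)
    have ex: "\<exists>G. char_geometry \<gamma> T m \<eta> {z. (\<theta>, z) \<in> V'} (\<Omega> \<theta>) G (ch_tau (Z \<theta>)) (ch_alpha (Z \<theta>)) (ch_beta (Z \<theta>))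
        (ch_p (Z \<theta>)) (ch_q (Z \<theta>)) (ch_x (Z \<theta>)) (ch_t (Z \<theta>)) \<and>
      (\<forall>r\<in>{0..<T}. (\<integral>\<^sup>+y. ennreal \<bar>tan (ch_alpha (Z \<theta>) (G (y, r)) / 2)\<bar> \<partial>lborel) \<le> ennreal \<eta> \<and>
        (\<integral>\<^sup>+y. ennreal \<bar>tan (ch_beta (Z \<theta>) (G (y, r)) / 2)\<bar> \<partial>lborel) \<le> ennreal \<eta>)"
      by (rule char_chart_geometry[OF chA[OF \<theta>] T U pos co[OF tb] less_imp_le[OF \<eta>] tv[OF \<theta>01]])
    obtain G where geo: "char_geometry \<gamma> T m \<eta> {z. (\<theta>, z) \<in> V'} (\<Omega> \<theta>) G (ch_tau (Z \<theta>)) (ch_alpha (Z \<theta>)) (ch_beta (Z \<theta>))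
        (ch_p (Z \<theta>)) (ch_q (Z \<theta>)) (ch_x (Z \<theta>)) (ch_t (Z \<theta>))"
      and tvG: "\<And>r. r \<in> {0..<T} \<Longrightarrow> (\<integral>\<^sup>+y. ennreal \<bar>tan (ch_alpha (Z \<theta>) (G (y, r)) / 2)\<bar> \<partial>lborel) \<le> ennreal \<eta>"
        "\<And>r. r \<in> {0..<T} \<Longrightarrow> (\<integral>\<^sup>+y. ennreal \<bar>tan (ch_beta (Z \<theta>) (G (y, r)) / 2)\<bar> \<partial>lborel) \<le> ennreal \<eta>"
      using ex by (elim exE conjE) blast
    obtain b where b: "\<And>X. \<bar>b X\<bar> \<le> \<eta>"
      "\<And>X Y. (X, Y) \<in> \<Omega> \<theta> \<Longrightarrow> (b has_real_derivative ch_p (Z \<theta>) (X, Y) * \<bar>sin (ch_alpha (Z \<theta>) (X, Y) / 2)\<bar>) (at X)"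
      using char_geometry.variation_potential[OF geo] by (elim exE conjE) blast
    obtain a where a: "\<And>Y. \<bar>a Y\<bar> \<le> \<eta>"
      "\<And>Y X. (Y, X) \<in> prod.swap ` \<Omega> \<theta> \<Longrightarrow> (a has_real_derivative ch_q (Z \<theta>) (prod.swap (Y, X)) *
        \<bar>sin (ch_beta (Z \<theta>) (prod.swap (Y, X)) / 2)\<bar>) (at Y)"
      using char_geometry.variation_potential[OF char_geometry.swap_geometry[OF geo]] by (elim exE conjE) blast
    have a': "(a has_real_derivative ch_q (Z \<theta>) (X, Y) * \<bar>sin (ch_beta (Z \<theta>) (X, Y) / 2)\<bar>) (at Y)" if "(X, Y) \<in> \<Omega> \<theta>" for X Y
      using a(2)[of Y X] imageI[OF that, of prod.swap] by simp
    have r: "strict_mono (\<phi> \<theta>)" "continuous_on UNIV (\<phi> \<theta>)" "surj (\<phi> \<theta>)" "strict_mono (\<psi> \<theta>)" "continuous_on UNIV (\<psi> \<theta>)" "surj (\<psi> \<theta>)"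
      using \<phi> \<psi> \<theta>01 by (simp_all add: pw_relabeling_def)
    have V'V: "w \<in> V" if "w \<in> V'" for w using that by (simp add: V'_def)
    interpret rp: relabelled_path \<gamma> T m \<eta> \<theta> V' "\<Omega> \<theta>" G Z A N M \<phi> \<psi> grad
    proof (rule relabelled_path.intro, rule geo, rule relabelled_path_axioms.intro)
      show "open V'" "open A" "\<theta> \<in> A" "finite N" "finite M" by (fact oV' oA \<theta> F1 F2)+
      show "((\<lambda>(\<theta>, z). f (Z \<theta>) z) has_derivative (\<lambda>d. grad f z \<bullet> d)) (at z)" if "f \<in> chart_fields" "z \<in> V'" for f z
        using grad[OF that(1)] V'V[OF that(2)] by (elim conjE) (rule bspec)
      show "continuous_on V' (grad f)" if "f \<in> chart_fields" for f
        by (rule continuous_on_subset[OF conjunct2[OF grad[OF that]]]) (use V'V in blast)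
      show "semilinear_at \<gamma> (Z \<theta>') z" if "\<theta>' \<in> A" "(\<theta>', z) \<in> V'" for \<theta>' z
        using chA[OF that(1)] V'V[OF that(2)] by (cases z) (simp add: char_chart_def)
    qed (fact cells r)+
    interpret wp: weighted_path \<gamma> T m \<eta> \<theta> V' "\<Omega> \<theta>" G Z A N M \<phi> \<psi> grad "growth_rate m (num_terms \<iota>)" a b "num_terms \<iota>"
      by unfold_locales (use b(1) a(1) in \<open>cases \<iota>; simp\<close>, simp add: growth_rate_def, fact b, fact b, fact a, fact a')
    have \<Omega>r: "relabel_domain (\<phi> \<theta>) (\<psi> \<theta>) (\<Omega> \<theta>) = rp.\<Omega>r" by (simp only: rp.\<Omega>r_def)
    have 0: "(0::real) \<in> {0..T}" using T by simp
    show ?thesis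
      using wp.tangent_norm_growth[where \<Omega>s = "\<lambda>\<theta>. relabel_domain (\<phi> \<theta>) (\<psi> \<theta>) (\<Omega> \<theta>)", OF t \<Omega>r refl \<eta>
        rp.weight_bounds(2)[OF tvG t] rp.weight_bounds(4)[OF tvG t] rp.weight_bounds(1)[OF tvG 0] rp.weight_bounds(3)[OF tvG 0]]
      by (simp only: rp.Zr_def)
  qed
  then show ?thesis using fE unfolding A_def by blast
qed

text \<open>A finite positive factor is invertible in \<open>ennreal\<close> and so passes through
  the infimum, including that of the empty set, where both the infimum and the bound are
  infinite.\<close>

lemma ennreal_le_mult_Inf:
  assumes "0 < c" "\<And>v. v \<in> A \<Longrightarrow> X \<le> ennreal c * v"
  shows "X \<le> ennreal c * Inf A"
proof -
  have cc: "ennreal (1 / c) * ennreal c = 1" using assms(1) by (simp flip: ennreal_mult' add: ennreal_1)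
  have "ennreal (1 / c) * X \<le> v" if "v \<in> A" for v
  proof -
    have "ennreal (1 / c) * X \<le> ennreal (1 / c) * (ennreal c * v)" by (intro mult_left_mono assms(2) that) simp
    then show ?thesis by (simp add: mult.assoc[symmetric] cc)
  qed
  then have "ennreal (1 / c) * X \<le> Inf A" by (rule Inf_greatest)
  then have "ennreal c * (ennreal (1 / c) * X) \<le> ennreal c * Inf A" by (rule mult_left_mono) simp
  moreover have "ennreal c * (ennreal (1 / c) * X) = X" using cc by (metis mult.assoc mult.commute mult_1)
  ultimately show ?thesis by simp
qed

text \<open>The admissible charts and relabelings do not depend on the time. A competitor for the
  length at time 0 is therefore also one at time \<open>t\<close>, and the bound for each competitor
  passes to the infimum.\<close>

lemma path_length_growth:
  assumes T: "0 < T" and l: "0 < l" and vol: "\<And>\<theta> x t. \<theta> \<in> {0..1} \<Longrightarrow> t \<in> {0..<T} \<Longrightarrow> vol (\<Upsilon> \<theta>) (x, t) \<in> {l..h}"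
    and co: "\<And>\<tau>. \<tau> \<in> {l..h} \<Longrightarrow> coeff_bound \<gamma> m \<tau>" and \<eta>: "0 < \<eta>"
    and tv: "\<And>\<theta> r. \<theta> \<in> {0..1} \<Longrightarrow> r \<in> {0..<T} \<Longrightarrow>
      (\<integral>\<^sup>+x. ennreal (\<bar>R_var \<gamma> (\<Upsilon> \<theta>) x r\<bar> + \<bar>S_var \<gamma> (\<Upsilon> \<theta>) x r\<bar>) \<partial>lborel) \<le> ennreal \<eta>"
    and t: "t \<in> {0..T}"
    and K: "2 * exp (4 * growth_rate m (num_terms \<iota>) * \<eta> + 2 * m * growth_rate m (num_terms \<iota>) * t) \<le> K"
  shows "path_length \<gamma> \<eta> \<iota> T \<Upsilon> t \<le> ennreal K * path_length \<gamma> \<eta> \<iota> T \<Upsilon> 0"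
proof -
  have K0: "0 < K" using less_le_trans[OF _ K] by simp
  show ?thesis unfolding path_length_def[of _ _ _ _ _ 0]
  proof (rule ennreal_le_mult_Inf[OF K0], elim CollectE exE conjE)
    fix v \<Omega> Z \<phi> \<psi>
    assume rep: "represents \<gamma> T \<Upsilon> \<Omega> Z" "pw_relabeling \<phi>" "pw_relabeling \<psi>"
    define n where "n r \<theta> = tangent_norm \<gamma> \<eta> \<iota> (\<lambda>\<theta>. relabel_domain (\<phi> \<theta>) (\<psi> \<theta>) (\<Omega> \<theta>)) (\<lambda>\<theta>. relabel (\<phi> \<theta>) (\<psi> \<theta>) (Z \<theta>)) r \<theta>" for r \<theta>
    assume "v = (\<integral>\<^sup>+\<theta>\<in>{0..1}. tangent_norm \<gamma> \<eta> \<iota> (\<lambda>\<theta>. relabel_domain (\<phi> \<theta>) (\<psi> \<theta>) (\<Omega> \<theta>)) (\<lambda>\<theta>. relabel (\<phi> \<theta>) (\<psi> \<theta>) (Z \<theta>)) 0 \<theta> \<partial>lborel)"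
    then have v: "v = (\<integral>\<^sup>+\<theta>\<in>{0..1}. n 0 \<theta> \<partial>lborel)" by (simp only: n_def)
    have ex: "\<exists>E. finite E \<and> (\<forall>\<theta>\<in>{0<..<1} - E. \<forall>t\<in>{0..T}. n t \<theta> \<le>
        ennreal (2 * exp (4 * growth_rate m (num_terms \<iota>) * \<eta> + 2 * m * growth_rate m (num_terms \<iota>) * t)) * n 0 \<theta>)"
      unfolding n_def by (rule tangent_norm_along_path[where \<Upsilon> = \<Upsilon> and \<iota> = \<iota>, OF T rep l vol co \<eta> tv])
    obtain E where E: "finite E" "\<And>\<theta>. \<theta> \<in> {0<..<1} - E \<Longrightarrow> n t \<theta> \<le>
        ennreal (2 * exp (4 * growth_rate m (num_terms \<iota>) * \<eta> + 2 * m * growth_rate m (num_terms \<iota>) * t)) * n 0 \<theta>"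
      using ex t by (elim exE conjE) blast
    have "path_length \<gamma> \<eta> \<iota> T \<Upsilon> t \<le> (\<integral>\<^sup>+\<theta>\<in>{0..1}. n t \<theta> \<partial>lborel)"
      unfolding path_length_def n_def by (rule Inf_lower) (use rep in blast)
    also have "\<dots> \<le> (\<integral>\<^sup>+\<theta>. ennreal K * (n 0 \<theta> * indicator {0..1} \<theta>) \<partial>lborel)"
    proof (rule nn_integral_mono_AE)
      have "AE \<theta> in lborel. \<theta> \<notin> E \<union> {0, 1}" by (rule AE_not_in[OF finite_imp_null_set_lborel]) (use E(1) in simp)
      then show "AE \<theta> in lborel. n t \<theta> * indicator {0..1} \<theta> \<le> ennreal K * (n 0 \<theta> * indicator {0..1} \<theta>)"
      proof eventually_elim
        case (elim \<theta>)
        show ?case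
        proof (cases "\<theta> \<in> {0..1}")
          case True
          then have "n t \<theta> \<le> ennreal (2 * exp (4 * growth_rate m (num_terms \<iota>) * \<eta> + 2 * m * growth_rate m (num_terms \<iota>) * t)) * n 0 \<theta>"
            using elim by (intro E(2)) auto
          also have "\<dots> \<le> ennreal K * n 0 \<theta>" by (intro mult_right_mono ennreal_leI K) simp
          finally show ?thesis using True by simp
        qed simp
      qed
    qed
    also have "\<dots> \<le> ennreal K * v" unfolding v by (rule nn_integral_cmult_le[OF K0])
    finally show "path_length \<gamma> \<eta> \<iota> T \<Upsilon> t \<le> ennreal K * v" .
  qed
qed

section \<open>Uniqueness of singularity times, constants and the final estimate\<close>

lemma first_singularity_unique:
  assumes "first_singularity \<gamma> \<tau>bar s ts" "first_singularity \<gamma> \<tau>bar s ts'"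
  shows "ts = ts'"
proof -
  \<comment> \<open>A solution whose singularity comes later has bounded \<open>R\<close>,
    \<open>S\<close> on the closed time interval up to the smaller time, which contradicts the
    blow-up there.\<close>
  have "\<not> ts1 < ts2" if s: "first_singularity \<gamma> \<tau>bar s ts1" "first_singularity \<gamma> \<tau>bar s ts2" for ts1 ts2
  proof
    assume lt: "ts1 < ts2"
    have "0 < ts1" using s by (simp add: first_singularity_def)
    with lt obtain T1 where T1: "ts1 = ereal T1" "0 < T1" by (cases ts1) auto
    obtain T2 where T2: "ereal T1 < ereal T2" "ereal T2 < ts2" using ereal_dense2[OF lt] T1(1) by blast
    have "0 < T2" "ereal T2 \<le> ts2" using T1 T2 by auto
    then have "euler_solution \<gamma> \<tau>bar 1 T2 s" using s(2) unfolding first_singularity_def by (elim conjE) blast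
    then have "\<forall>T'\<in>{0..<T2}. \<exists>M. \<forall>x. \<forall>t\<in>{0..T'}. \<bar>R_var \<gamma> s x t\<bar> \<le> M \<and> \<bar>S_var \<gamma> s x t\<bar> \<le> M"
      unfolding euler_solution_def by (elim conjE)
    then obtain M where "\<forall>x. \<forall>t\<in>{0..T1}. \<bar>R_var \<gamma> s x t\<bar> \<le> M \<and> \<bar>S_var \<gamma> s x t\<bar> \<le> M" using T1 T2 by (elim ballE[of _ _ T1]) auto
    then have "\<exists>M. \<forall>x. \<forall>t\<in>{0..<T1}. \<bar>R_var \<gamma> s x t\<bar> \<le> M \<and> \<bar>S_var \<gamma> s x t\<bar> \<le> M" by (intro exI[of _ M]) simp
    then show False using s(1) T1(1) unfolding first_singularity_def by (elim conjE) blast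
  qed
  from this[OF assms] this[OF assms(2,1)] show ?thesis by simp
qed

lemma common_time_unique:
  "common_time \<gamma> \<tau>bar s s' T \<Longrightarrow> common_time \<gamma> \<tau>bar s s' T' \<Longrightarrow> T = T'"
  unfolding common_time_def using first_singularity_unique by (metis ereal.inject)

lemma common_time_pos: "common_time \<gamma> \<tau>bar s s' T \<Longrightarrow> 0 < T"
  unfolding common_time_def first_singularity_def by (metis ereal_less(2) min_less_iff_conj)

text \<open>Chosen from \<gamma> and \<open>cbar\<close> alone, before the value at infinity, \<eta>
  and the solutions are known, so that the final constant can depend on nothing but these and the
  time.\<close>

definition coeff_const :: "real \<Rightarrow> real \<Rightarrow> real" where
  "coeff_const \<gamma> cbar = (SOME m. \<forall>\<tau>\<in>{1 / (2 * cbar)..2 * cbar}. coeff_bound \<gamma> m \<tau>)"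

text \<open>The growth factor for six densities and \<eta> equal to 1. It dominates both metrics and
  all smaller \<eta>, while \<open>|td|\<close> dominates all nonnegative times up to
  \<open>td\<close>.\<close>

definition growth_const :: "real \<Rightarrow> real \<Rightarrow> real \<Rightarrow> real" where
  "growth_const \<gamma> cbar td = 2 * exp (4 * growth_rate (coeff_const \<gamma> cbar) 6 + 2 * coeff_const \<gamma> cbar * growth_rate (coeff_const \<gamma> cbar) 6 * \<bar>td\<bar>)"

lemma path_distance_growth:
  assumes \<gamma>: "1 < \<gamma>" and cbar: "0 < cbar"
  shows "\<exists>\<eta>\<^sub>0>0. \<forall>\<eta>. 0 < \<eta> \<and> \<eta> \<le> \<eta>\<^sub>0 \<longrightarrow>
    (\<forall>\<tau>bar \<iota> T t td s s'. initial s \<in> D_eta \<gamma> \<tau>bar cbar \<eta> \<and> 0 < T \<and> 0 \<le> t \<and> t \<le> T \<and> t \<le> td \<longrightarrow>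
      path_distance \<gamma> \<tau>bar \<eta> \<iota> T t s s' \<le> ennreal (growth_const \<gamma> cbar td) * path_distance \<gamma> \<tau>bar \<eta> \<iota> T 0 s s')"
proof -
  obtain e where e: "0 < e" and thr: "\<And>\<tau>bar \<tau>. 1 / cbar \<le> \<tau>bar \<Longrightarrow> \<tau>bar \<le> cbar \<Longrightarrow> 0 < \<tau> \<Longrightarrow>
      \<bar>speed_primitive \<gamma> \<tau> - speed_primitive \<gamma> \<tau>bar\<bar> \<le> e \<Longrightarrow> \<tau> \<in> {1 / (2 * cbar)..2 * cbar}"
    using vol_bounds_threshold[OF \<gamma> cbar] by (elim exE conjE) blast
  define m where "m = coeff_const \<gamma> cbar"
  have l: "0 < 1 / (2 * cbar)" using cbar by simp
  have "\<forall>\<tau>\<in>{1 / (2 * cbar)..2 * cbar}. coeff_bound \<gamma> m \<tau>"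
    unfolding m_def coeff_const_def by (rule someI_ex[OF coeff_bound_exists[OF l]])
  then have co: "coeff_bound \<gamma> m \<tau>" if "\<tau> \<in> {1 / (2 * cbar)..2 * cbar}" for \<tau> using that by (rule bspec)
  have main: "path_distance \<gamma> \<tau>bar \<eta> \<iota> T t s s' \<le> ennreal (growth_const \<gamma> cbar td) * path_distance \<gamma> \<tau>bar \<eta> \<iota> T 0 s s'"
    if \<eta>: "0 < \<eta>" "\<eta> \<le> min 1 e" and s: "initial s \<in> D_eta \<gamma> \<tau>bar cbar \<eta>" and T: "0 < T" and t: "0 \<le> t" "t \<le> T" "t \<le> td"
    for \<tau>bar \<eta> \<iota> T t td s s'
    unfolding path_distance_def[of _ _ _ _ _ 0]
  proof (rule ennreal_le_mult_Inf)
    show "0 < growth_const \<gamma> cbar td" by (simp add: growth_const_def)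
    fix v assume "v \<in> {path_length \<gamma> \<eta> \<iota> T \<Upsilon> 0 |\<Upsilon>. piecewise_regular \<gamma> \<tau>bar T \<Upsilon> \<and> same_flow T (\<Upsilon> 0) s \<and> same_flow T (\<Upsilon> 1) s' \<and>
      (\<forall>\<theta>\<in>{0..1}. \<forall>r\<in>{0..<T}. (\<integral>\<^sup>+x. ennreal (\<bar>R_var \<gamma> (\<Upsilon> \<theta>) x r\<bar> + \<bar>S_var \<gamma> (\<Upsilon> \<theta>) x r\<bar>) \<partial>lborel) \<le> ennreal \<eta>)}"
    then obtain \<Upsilon> where v: "v = path_length \<gamma> \<eta> \<iota> T \<Upsilon> 0"
      and \<Upsilon>: "piecewise_regular \<gamma> \<tau>bar T \<Upsilon>" "same_flow T (\<Upsilon> 0) s" "same_flow T (\<Upsilon> 1) s'"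
      and tvs: "\<forall>\<theta>\<in>{0..1}. \<forall>r\<in>{0..<T}. (\<integral>\<^sup>+x. ennreal (\<bar>R_var \<gamma> (\<Upsilon> \<theta>) x r\<bar> + \<bar>S_var \<gamma> (\<Upsilon> \<theta>) x r\<bar>) \<partial>lborel) \<le> ennreal \<eta>"
      by (elim CollectE exE conjE)
    note tv = bspec[OF bspec[OF tvs]]
    note mean = mean_value_initial[OF s]
    have mean_pos: "0 < \<tau>bar" using mean(1) less_le_trans[of 0 "1 / cbar" \<tau>bar] cbar by simp
    have eu: "euler_solution \<gamma> \<tau>bar 3 T (\<Upsilon> \<theta>)" if "\<theta> \<in> {0..1}" for \<theta>
      using \<Upsilon>(1) that unfolding piecewise_regular_def by (elim conjE) (erule bspec)
    have vol: "vol (\<Upsilon> \<theta>) (x, r) \<in> {1 / (2 * cbar)..2 * cbar}" if \<theta>: "\<theta> \<in> {0..1}" and r: "r \<in> {0..<T}" for \<theta> x r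
    proof (rule thr[OF mean])
      show "0 < vol (\<Upsilon> \<theta>) (x, r)" using eu[OF \<theta>] r by (simp add: euler_solution_def)
      have "\<bar>speed_primitive \<gamma> (vol (\<Upsilon> \<theta>) (x, r)) - speed_primitive \<gamma> \<tau>bar\<bar> \<le> \<eta>"
        by (rule vol_near_mean[OF \<gamma> mean_pos T eu[OF \<theta>] less_imp_le[OF \<eta>(1)] tv[OF \<theta>] r])
      then show "\<bar>speed_primitive \<gamma> (vol (\<Upsilon> \<theta>) (x, r)) - speed_primitive \<gamma> \<tau>bar\<bar> \<le> e" using \<eta>(2) by simp
    qed
    have m1: "1 \<le> m"
    proof -
      have "(0::real) \<in> {0..1}" "0 \<in> {0..<T}" using T by simp_all
      from co[OF vol[OF this]] show ?thesis by (simp add: coeff_bound_def)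
    qed
    have K: "2 * exp (4 * growth_rate m (num_terms \<iota>) * \<eta> + 2 * m * growth_rate m (num_terms \<iota>) * t) \<le> growth_const \<gamma> cbar td"
    proof -
      have g: "0 \<le> growth_rate m (num_terms \<iota>)" "growth_rate m (num_terms \<iota>) \<le> growth_rate m 6"
        using m1 by (cases \<iota>; simp add: growth_rate_def)+
      have "growth_rate m (num_terms \<iota>) * \<eta> \<le> growth_rate m 6 * 1" using g \<eta> by (intro mult_mono) auto
      moreover have "2 * m * growth_rate m (num_terms \<iota>) * t \<le> 2 * m * growth_rate m 6 * \<bar>td\<bar>"
        using g t m1 by (intro mult_mono) auto
      ultimately show ?thesis by (simp add: growth_const_def m_def[symmetric])
    qed
    have "path_distance \<gamma> \<tau>bar \<eta> \<iota> T t s s' \<le> path_length \<gamma> \<eta> \<iota> T \<Upsilon> t"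
      unfolding path_distance_def by (rule Inf_lower) (use \<Upsilon> tvs in blast)
    also have "\<dots> \<le> ennreal (growth_const \<gamma> cbar td) * v"
      unfolding v by (rule path_length_growth[OF T l vol co \<eta>(1) tv _ K]) (use t in auto)
    finally show "path_distance \<gamma> \<tau>bar \<eta> \<iota> T t s s' \<le> ennreal (growth_const \<gamma> cbar td) * v" .
  qed
  \<comment> \<open>The bound 1 lets \<eta> disappear from the exponent, and \<open>e\<close> keeps
    \<tau> in the doubled interval on which the coefficients are bounded.\<close>
  show ?thesis
    by (rule exI[of _ "min 1 e"]) (use e in \<open>auto intro!: main\<close>)
qed

text \<open>Which case of the definition of the distance applies depends on the initial data and not
  on the time. Hence \<open>d\<close> and \<open>d\<^sub>0\<close> are either both path distances or
  both limits, and in the latter case one approximating sequence can serve for both.\<close>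

theorem theorem3:
  fixes \<gamma> :: real
  assumes "1 < \<gamma>"
  shows "\<exists>C :: real \<Rightarrow> real \<Rightarrow> real. (\<forall>cbar td. 0 < C cbar td) \<and>
    (\<forall>\<tau>bar cbar D. 0 < \<tau>bar \<and> 0 < cbar \<and> generic_data_set \<gamma> \<tau>bar D \<longrightarrow>
      (\<exists>\<eta>\<^sub>0>0. \<forall>\<eta>. 0 < \<eta> \<and> \<eta> \<le> \<eta>\<^sub>0 \<longrightarrow>
        (\<forall>s s' ts ts' td.
           initial s \<in> D_eta \<gamma> \<tau>bar cbar \<eta> \<and> initial s' \<in> D_eta \<gamma> \<tau>bar cbar \<eta> \<and>
           first_singularity \<gamma> \<tau>bar s ts \<and> first_singularity \<gamma> \<tau>bar s' ts' \<and>
           ereal td = min ts ts' \<longrightarrow>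
           (\<forall>\<iota>. \<forall>t\<in>{0..td}. \<forall>d d\<^sub>0.
              geodesic_distance \<gamma> \<tau>bar cbar \<eta> D \<iota> t s s' d \<and>
              geodesic_distance \<gamma> \<tau>bar cbar \<eta> D \<iota> 0 s s' d\<^sub>0 \<longrightarrow>
              d \<le> ennreal (C cbar td) * d\<^sub>0))))"
proof (intro exI[of _ "growth_const \<gamma>"] conjI allI impI)
  show "0 < growth_const \<gamma> cbar td" for cbar td by (simp add: growth_const_def)
  fix \<tau>bar cbar :: real and D :: "data set"
  assume h: "0 < \<tau>bar \<and> 0 < cbar \<and> generic_data_set \<gamma> \<tau>bar D"
  then have "0 < cbar" by simp
  from path_distance_growth[OF assms this] obtain \<eta>0 where e: "0 < \<eta>0 \<and> (\<forall>\<eta>. 0 < \<eta> \<and> \<eta> \<le> \<eta>0 \<longrightarrow>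
    (\<forall>\<tau>bar \<iota> T t td s s'. initial s \<in> D_eta \<gamma> \<tau>bar cbar \<eta> \<and> 0 < T \<and> 0 \<le> t \<and> t \<le> T \<and> t \<le> td \<longrightarrow>
      path_distance \<gamma> \<tau>bar \<eta> \<iota> T t s s' \<le> ennreal (growth_const \<gamma> cbar td) * path_distance \<gamma> \<tau>bar \<eta> \<iota> T 0 s s'))" ..
  note \<eta>0 = conjunct1[OF e]
  have grow: "path_distance \<gamma> \<tau>bar \<eta> \<iota> T t s s' \<le> ennreal (growth_const \<gamma> cbar td) * path_distance \<gamma> \<tau>bar \<eta> \<iota> T 0 s s'"
    if "0 < \<eta>" "\<eta> \<le> \<eta>0" "initial s \<in> D_eta \<gamma> \<tau>bar cbar \<eta>" "0 < T" "0 \<le> t" "t \<le> T" "t \<le> td" for \<eta> \<iota> T t td s s'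
    by (rule conjunct2[OF e, rule_format]) (use that in simp_all)
  show "\<exists>\<eta>\<^sub>0>0. \<forall>\<eta>. 0 < \<eta> \<and> \<eta> \<le> \<eta>\<^sub>0 \<longrightarrow>
        (\<forall>s s' ts ts' td.
           initial s \<in> D_eta \<gamma> \<tau>bar cbar \<eta> \<and> initial s' \<in> D_eta \<gamma> \<tau>bar cbar \<eta> \<and>
           first_singularity \<gamma> \<tau>bar s ts \<and> first_singularity \<gamma> \<tau>bar s' ts' \<and>
           ereal td = min ts ts' \<longrightarrow>
           (\<forall>\<iota>. \<forall>t\<in>{0..td}. \<forall>d d\<^sub>0.
              geodesic_distance \<gamma> \<tau>bar cbar \<eta> D \<iota> t s s' d \<and>
              geodesic_distance \<gamma> \<tau>bar cbar \<eta> D \<iota> 0 s s' d\<^sub>0 \<longrightarrow>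
              d \<le> ennreal (growth_const \<gamma> cbar td) * d\<^sub>0))"
  proof (intro exI[of _ \<eta>0] conjI allI impI ballI, fact \<eta>0, elim conjE)
    fix \<eta> s s' ts ts' td \<iota> t d d0
    assume \<eta>: "0 < \<eta>" "\<eta> \<le> \<eta>0" and s: "initial s \<in> D_eta \<gamma> \<tau>bar cbar \<eta>" and t: "t \<in> {0..td}"
      and d: "geodesic_distance \<gamma> \<tau>bar cbar \<eta> D \<iota> t s s' d" and d0: "geodesic_distance \<gamma> \<tau>bar cbar \<eta> D \<iota> 0 s s' d0"
    have t': "0 \<le> t" "t \<le> td" using t by simp_all
    show "d \<le> ennreal (growth_const \<gamma> cbar td) * d0"
    proof (cases "smooth_class \<gamma> \<tau>bar cbar \<eta> D s \<and> smooth_class \<gamma> \<tau>bar cbar \<eta> D s'")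
      case True
      obtain T where T: "common_time \<gamma> \<tau>bar s s' T" "t \<le> T" "d = path_distance \<gamma> \<tau>bar \<eta> \<iota> T t s s'"
        using d True unfolding geodesic_distance_def by auto
      obtain T' where T': "common_time \<gamma> \<tau>bar s s' T'" "d0 = path_distance \<gamma> \<tau>bar \<eta> \<iota> T' 0 s s'"
        using d0 True unfolding geodesic_distance_def by auto
      show ?thesis unfolding T(3) T'(2) common_time_unique[OF T'(1) T(1)]
        by (rule grow[OF \<eta> s common_time_pos[OF T(1)] t'(1) T(2) t'(2)])
    next
      case False
      then have ex: "\<exists>\<sigma> \<sigma>' T. approximates \<gamma> \<tau>bar cbar \<eta> D t s s' \<sigma> \<sigma>' T"
        and lim: "\<And>\<sigma> \<sigma>' T. approximates \<gamma> \<tau>bar cbar \<eta> D t s s' \<sigma> \<sigma>' T \<Longrightarrow>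
              (\<lambda>n. path_distance \<gamma> \<tau>bar \<eta> \<iota> (T n) t (\<sigma> n) (\<sigma>' n)) \<longlonglongrightarrow> d"
        and lim0: "\<And>\<sigma> \<sigma>' T. approximates \<gamma> \<tau>bar cbar \<eta> D 0 s s' \<sigma> \<sigma>' T \<Longrightarrow>
              (\<lambda>n. path_distance \<gamma> \<tau>bar \<eta> \<iota> (T n) 0 (\<sigma> n) (\<sigma>' n)) \<longlonglongrightarrow> d0"
        using d d0 unfolding geodesic_distance_def by simp_all
      obtain \<sigma> \<sigma>' T where a: "approximates \<gamma> \<tau>bar cbar \<eta> D t s s' \<sigma> \<sigma>' T" using ex by (elim exE)
      have n: "initial (\<sigma> n) \<in> D_eta \<gamma> \<tau>bar cbar \<eta>" "common_time \<gamma> \<tau>bar (\<sigma> n) (\<sigma>' n) (T n)" "t \<le> T n" for n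
        using a by (simp_all add: approximates_def smooth_class_def)
      \<comment> \<open>Approximants admissible at time \<open>t\<close> are admissible at time 0,
        because their common existence times are positive; the approximation of the data is the same
        condition.\<close>
      have a0: "approximates \<gamma> \<tau>bar cbar \<eta> D 0 s s' \<sigma> \<sigma>' T"
        using a common_time_pos[OF n(2)] by (simp add: approximates_def less_imp_le)
      show ?thesis
      proof (rule LIMSEQ_le[OF lim[OF a] ennreal_tendsto_cmult[OF _ lim0[OF a0]]])
        show "\<exists>N. \<forall>n\<ge>N. path_distance \<gamma> \<tau>bar \<eta> \<iota> (T n) t (\<sigma> n) (\<sigma>' n) \<le>
            ennreal (growth_const \<gamma> cbar td) * path_distance \<gamma> \<tau>bar \<eta> \<iota> (T n) 0 (\<sigma> n) (\<sigma>' n)"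
          \<comment> \<open>The factor involves \<open>td\<close> and not the existence times
            \<open>T n\<close> of the approximants, so it is uniform in \<open>n\<close> and
            survives the limit.\<close>
          using grow[OF \<eta> n(1) common_time_pos[OF n(2)] t'(1) n(3) t'(2)] by blast
      qed simp
    qed
  qed
qed

end
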